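(* Let $\mathbb{D}$ be a double category and $\mathbb{E}$ an equipment with local coequalizers. Then the functor $$\epsilon\circ(-):\mathrm{Lax}_{\ell,u}(\mathbb{D},\mathrm{Mod}(\mathbb{E}))\to\mathrm{Lax}_\ell(\mathbb{D},\mathbb{E}),\qquad H\mapsto\epsilon H,\quad\alpha\mapsto\epsilon*\alpha,$$ has the functor $F\mapsto\mathrm{Mod}(F)\eta$, $\alpha\mapsto\bar\alpha$ as its inverse, and hence is an isomorphism of categories $$\mathrm{Lax}_{\ell,u}(\mathbb{D},\mathrm{Mod}(\mathbb{E}))\xrightarrow{\ \cong\ }\mathrm{Lax}_\ell(\mathbb{D},\mathbb{E})$$ extending the bijection $H\mapsto\epsilon H$, $F\mapsto\mathrm{Mod}(F)\eta$ between unitary lax functors $\mathbb{D}\to\mathrm{Mod}(\mathbb{E})$ and lax functors $\mathbb{D}\to\mathbb{E}$.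
   Context: Double categories are pseudo: strict in the direction of arrows, weak in the direction of proarrows. A double category $\mathbb{D}$ has underlying categories $\mathbb{D}_0$ (objects and arrows) and $\mathbb{D}_1$ (proarrows, written $m: x \nrightarrow y$, and cells). A cell $\alpha: m \to n$ from $m: x \nrightarrow y$ to $n: w \nrightarrow z$ over $(f,g)$ has source arrow $f: x\to w$ and target arrow $g: y \to z$; it is globular if $f,g$ are identities. Composition in $\mathbb{D}_0,\mathbb{D}_1$ is written $\cdot$ in diagrammatic order; external composition of proarrows and cells is written $\odot$ in diagrammatic order, with external identities $\mathrm{id}_x,\mathrm{id}_f$. Coherence isomorphisms for $\odot$ are suppressed in formulas. An equipment is a double category for which $\langle s,t\rangle:\mathbb{D}_1\to\mathbb{D}_0\times\mathbb{D}_0$ is a fibration. Local coequalizers: each hom-category $\mathbb{D}(x,y)$ (proarrows $x\nrightarrow y$, globular cells) has coequalizers, preserved by external composition in each argument. Lax double functor $F:\mathbb{D}\to\mathbb{E}$: functors $F_0,F_1$ compatible with source and target, with globular laxators $F_{m,n}:Fm\odot Fn\to F(m\odot n)$ and unitors $F_x:\mathrm{id}_{Fx}\to F\mathrm{id}_x$, natural ($(F\alpha\odot F\beta)\cdot F_{m',n'}=F_{m,n}\cdot F(\alpha\odot\beta)$, $\mathrm{id}_{Ff}\cdot F_y=F_x\cdot F\mathrm{id}_f$), associative and unital. $F_{x,m}:F\mathrm{id}_x\odot Fm\to Fm$, $F_{m,y}:Fm\odot F\mathrm{id}_y\to Fm$, $F_{x,x}$ denote laxators at identity proarrows (composed with $F$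 of the unit isomorphisms). $F$ is unitary if its unitors are identities. Lax natural transformation $\alpha:F\Rightarrow G$ of lax functors $\mathbb{D}\to\mathbb{E}$: arrows $\alpha_x:Fx\to Gx$; cells $\alpha_m:Fm\to Gm$ over $(\alpha_x,\alpha_y)$ for $m:x\nrightarrow y$; for each arrow $f:x\to y$ a cell $\alpha_f:\mathrm{id}_{Fx}\to G\mathrm{id}_y$ over $(\alpha_x\cdot Gf,\ Ff\cdot\alpha_y)$; such that (1) for each cell $\gamma:m\to n$ over $(f,g)$, $m:x\nrightarrow y$, $n:w\nrightarrow z$: $(\alpha_f\odot(F\gamma\cdot\alpha_n))\cdot G_{w,n}=((\alpha_m\cdot G\gamma)\odot\alpha_g)\cdot G_{n,z}$; (2) $F_{m,n}\cdot\alpha_{m\odot n}=(\alpha_m\odot\alpha_n)\cdot G_{m,n}$ and $F_x\cdot\alpha_{\mathrm{id}_x}=\mathrm{id}_{\alpha_x}\cdot G_x$; (3) for $x\xrightarrow{f}y\xrightarrow{g}z$, $\alpha_{f\cdot g}=((\alpha_f\cdot G\mathrm{id}_g)\odot(\mathrm{id}_{Ff}\cdot\alpha_g))\cdot G_{z,z}$ and $\alpha_{1_x}=\mathrm{id}_{\alpha_x}\cdot G_x$. Composition: $(\alpha\beta)_x=\alpha_x\cdot\beta_x$, $(\alpha\beta)_m=\alpha_m\cdot\beta_m$, $(\alpha\beta)_f=((\mathrm{id}_{\alpha_x}\cdot\beta_f)\odot(\alpha_f\cdot\beta_{\mathrm{id}_y}))\cdot H_{y,y}$ for $\beta:G\Rightarrow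 H$; the identity on $F$ has $(1_F)_x=1_{Fx}$, $(1_F)_m=1_{Fm}$, $(1_F)_f=\mathrm{id}_{Ff}\cdot F_y$. $\mathrm{Lax}_\ell(\mathbb{D},\mathbb{E})$ is the category of lax functors and lax natural transformations; $\mathrm{Lax}_{\ell,u}$ is its full subcategory on unitary lax functors. Bimodules. A category object in $\mathbb{E}$ is $(x,r,\mu,\upsilon)$ with $r:x\nrightarrow x$ and globular cells $\mu:r\odot r\to r$, $\upsilon:\mathrm{id}_x\to r$, associative and unital. A functor $(f,\phi):(x,r,\mu,\upsilon)\to(y,s,\nu,\theta)$ is an arrow $f:x\to y$ and a cell $\phi:r\to s$ over $(f,f)$ with $(\phi\odot\phi)\cdot\nu=\mu\cdot\phi$, $\mathrm{id}_f\cdot\theta=\upsilon\cdot\phi$. A bimodule $(m,\lambda,\rho)$ from $(x,r)$ to $(y,s)$ is $m:x\nrightarrow y$ with globular $\lambda:r\odot m\to m$, $\rho:m\odot s\to m$ satisfying associativity, unitality and compatibility. A cell of bimodules $m\to n$ over functors $(f,\phi),(g,\psi)$ is a cell $\alpha:m\to n$ over $(f,g)$ with $(\phi\odot\alpha)\cdot\lambda^n=\lambda^m\cdot\alpha$ and $(\alpha\odot\psi)\cdot\rho^n=\rho^m\cdot\alpha$. For $\mathbb{E}$ an equipment with local coequalizers these form a double category $\mathrm{Mod}(\mathbb{E})$: the composite $m\otimes n$ is the coequalizer $q:m\odot n\to m\otimes n$ of $\rho\odot1,1\odot\lambda:m\odot s\odot n\rightrightarrows m\odot n$; $\alpha\otimes\beta$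 is determined by $q\cdot(\alpha\otimes\beta)=(\alpha\odot\beta)\cdot q$; the chosen unit on $(x,r,\mu,\upsilon)$ is $(r,\mu,\mu)$, and the external identity on $(f,\phi)$ is $\phi$. Units are chosen this way throughout, and unitarity refers to this choice. $\epsilon:\mathrm{Mod}(\mathbb{E})\to\mathbb{E}$ is the lax functor taking underlying objects, arrows, proarrows and cells, with laxators the coequalizer cells $q$ and unitors the units $\upsilon$. For unitary $H:\mathbb{D}\to\mathrm{Mod}(\mathbb{E})$ write $\upsilon_{Hx}$ for the unit of the category object $Hx$. For $\alpha:H\Rightarrow K$ lax, $(\epsilon*\alpha)_x$ is the underlying arrow of $\alpha_x$, $(\epsilon*\alpha)_m=\alpha_m$, and $(\epsilon*\alpha)_f=\upsilon_{Hx}\cdot\alpha_f$. $\mathrm{Mod}(F)\eta:\mathbb{D}\to\mathrm{Mod}(\mathbb{E})$ is the unitary lax functor sending $x\mapsto(Fx,F\mathrm{id}_x,F_{x,x},F_x)$, $f\mapsto(Ff,F\mathrm{id}_f)$, $m\mapsto(Fm,F_{x,m},F_{m,y})$, $\theta\mapsto F\theta$, with laxator at $(m,n)$ the unique cell $Fm\otimes Fn\to F(m\odot n)$ through which $F_{m,n}$ factors along $q$. For lax $\alpha:F\Rightarrow G$, $\bar\alpha:\mathrm{Mod}(F)\eta\Rightarrow\mathrm{Mod}(G)\eta$ has $\bar\alpha_x=(\alpha_x,\alpha_{\mathrm{id}_x})$, $\bar\alpha_m=\alpha_m$, $\bar\alpha_f=(\alpha_f\odot(F\mathrm{id}_f\cdot\alpha_{\mathrm{id}_y}))\cdot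 G_{y,y}=((\alpha_{\mathrm{id}_x}\cdot G\mathrm{id}_f)\odot\alpha_f)\cdot G_{y,y}$. *)

theory Defs
  imports Main "HOL-Library.FuncSet"
begin

section \<open>Categories\<close>

text \<open>
  Composition is written in diagrammatic order throughout. The operations of a category, and of a
  double category below, are total functions that are only meaningful on composable arguments in
  the carriers.
\<close>

record ('o, 'a) cat =
  Obj :: "'o set"
  Arr :: "'a set"
  Dom :: "'a \<Rightarrow> 'o"
  Cod :: "'a \<Rightarrow> 'o"
  Id :: "'o \<Rightarrow> 'a"
  Comp :: "'a \<Rightarrow> 'a \<Rightarrow> 'a" (infixl "\<cdot>\<index>" 70)

definition Hom :: "('o, 'a) cat \<Rightarrow> 'o \<Rightarrow> 'o \<Rightarrow> 'a set" where
  "Hom C x y = {f \<in> Arr C. Dom C f = x \<and> Cod C f = y}"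

locale category =
  fixes C :: "('o, 'a) cat" (structure)
  assumes dom_closed: "f \<in> Arr C \<Longrightarrow> Dom C f \<in> Obj C"
    and cod_closed: "f \<in> Arr C \<Longrightarrow> Cod C f \<in> Obj C"
    and id_closed: "x \<in> Obj C \<Longrightarrow> Id C x \<in> Hom C x x"
    and comp_closed: "\<lbrakk>f \<in> Hom C x y; g \<in> Hom C y z\<rbrakk> \<Longrightarrow> f \<cdot> g \<in> Hom C x z"
    and id_left: "f \<in> Hom C x y \<Longrightarrow> Id C x \<cdot> f = f"
    and id_right: "f \<in> Hom C x y \<Longrightarrow> f \<cdot> Id C y = f"
    and comp_assoc: "\<lbrakk>f \<in> Hom C w x; g \<in> Hom C x y; h \<in> Hom C y z\<rbrakk>
                       \<Longrightarrow> (f \<cdot> g) \<cdot> h = f \<cdot> (g \<cdot> h)"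

locale cat_functor = A: category A + B: category B
  for A :: "('o, 'a) cat" and B :: "('p, 'b) cat" +
  fixes Fo :: "'o \<Rightarrow> 'p" and Fa :: "'a \<Rightarrow> 'b"
  assumes obj_closed: "x \<in> Obj A \<Longrightarrow> Fo x \<in> Obj B"
    and arr_closed: "f \<in> Hom A x y \<Longrightarrow> Fa f \<in> Hom B (Fo x) (Fo y)"
    and pres_id: "x \<in> Obj A \<Longrightarrow> Fa (Id A x) = Id B (Fo x)"
    and pres_comp: "\<lbrakk>f \<in> Hom A x y; g \<in> Hom A y z\<rbrakk>
                      \<Longrightarrow> Fa (f \<cdot>\<^bsub>A\<^esub> g) = Fa f \<cdot>\<^bsub>B\<^esub> Fa g"

locale inverse_functors = F: cat_functor A B Fo Fa + G: cat_functor B A Go Ga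
  for A :: "('o, 'a) cat" and B :: "('p, 'b) cat" and Fo Fa Go Ga +
  assumes inv_obj_left: "x \<in> Obj A \<Longrightarrow> Go (Fo x) = x"
    and inv_arr_left: "f \<in> Arr A \<Longrightarrow> Ga (Fa f) = f"
    and inv_obj_right: "y \<in> Obj B \<Longrightarrow> Fo (Go y) = y"
    and inv_arr_right: "g \<in> Arr B \<Longrightarrow> Fa (Ga g) = g"

definition iso_of_categories ::
  "('o, 'a) cat \<Rightarrow> ('p, 'b) cat \<Rightarrow> ('o \<Rightarrow> 'p) \<Rightarrow> ('a \<Rightarrow> 'b) \<Rightarrow> bool" where
  "iso_of_categories A B Fo Fa \<longleftrightarrow> (\<exists>Go Ga. inverse_functors A B Fo Fa Go Ga)"

definition full_subcat :: "('o, 'a) cat \<Rightarrow> ('o \<Rightarrow> bool) \<Rightarrow> ('o, 'a) cat" where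
  "full_subcat C P =
     C\<lparr>Obj := {x \<in> Obj C. P x}, Arr := {f \<in> Arr C. P (Dom C f) \<and> P (Cod C f)}\<rparr>"

definition prod_cat :: "('o, 'a) cat \<Rightarrow> ('p, 'b) cat \<Rightarrow> ('o \<times> 'p, 'a \<times> 'b) cat" where
  "prod_cat A B = \<lparr>Obj = Obj A \<times> Obj B, Arr = Arr A \<times> Arr B,
     Dom = (\<lambda>(f, g). (Dom A f, Dom B g)), Cod = (\<lambda>(f, g). (Cod A f, Cod B g)),
     Id = (\<lambda>(x, y). (Id A x, Id B y)),
     Comp = (\<lambda>(f, g) (f', g'). (f \<cdot>\<^bsub>A\<^esub> f', g \<cdot>\<^bsub>B\<^esub> g'))\<rparr>"

definition inverse_arrows :: "('o, 'a) cat \<Rightarrow> 'a \<Rightarrow> 'a \<Rightarrow> bool" where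
  "inverse_arrows C f g \<longleftrightarrow> f \<in> Arr C \<and> g \<in> Hom C (Cod C f) (Dom C f)
     \<and> f \<cdot>\<^bsub>C\<^esub> g = Id C (Dom C f) \<and> g \<cdot>\<^bsub>C\<^esub> f = Id C (Cod C f)"

definition iso_arrow :: "('o, 'a) cat \<Rightarrow> 'a \<Rightarrow> bool" where
  "iso_arrow C f \<longleftrightarrow> (\<exists>g. inverse_arrows C f g)"

definition inv_arrow :: "('o, 'a) cat \<Rightarrow> 'a \<Rightarrow> 'a" where
  "inv_arrow C f = (THE g. inverse_arrows C f g)"

definition parallel_pair :: "('o, 'a) cat \<Rightarrow> 'a \<Rightarrow> 'a \<Rightarrow> bool" where
  "parallel_pair C f g \<longleftrightarrow> f \<in> Arr C \<and> g \<in> Hom C (Dom C f) (Cod C f)"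

definition coequalizer :: "('o, 'a) cat \<Rightarrow> 'a \<Rightarrow> 'a \<Rightarrow> 'a \<Rightarrow> bool" where
  "coequalizer C f g q \<longleftrightarrow> parallel_pair C f g \<and> q \<in> Arr C \<and> Dom C q = Cod C f
     \<and> f \<cdot>\<^bsub>C\<^esub> q = g \<cdot>\<^bsub>C\<^esub> q
     \<and> (\<forall>d. \<forall>h \<in> Hom C (Cod C f) d. f \<cdot>\<^bsub>C\<^esub> h = g \<cdot>\<^bsub>C\<^esub> h
            \<longrightarrow> (\<exists>!u. u \<in> Hom C (Cod C q) d \<and> q \<cdot>\<^bsub>C\<^esub> u = h))"

definition cartesian_arrow ::
  "('o, 'a) cat \<Rightarrow> ('p, 'b) cat \<Rightarrow> ('o \<Rightarrow> 'p) \<Rightarrow> ('a \<Rightarrow> 'b) \<Rightarrow> 'a \<Rightarrow> bool" where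
  "cartesian_arrow A B Po Pa \<phi> \<longleftrightarrow> \<phi> \<in> Arr A
     \<and> (\<forall>\<psi> \<in> Arr A. \<forall>h \<in> Hom B (Po (Dom A \<psi>)) (Po (Dom A \<phi>)).
          Cod A \<psi> = Cod A \<phi> \<and> Pa \<psi> = h \<cdot>\<^bsub>B\<^esub> Pa \<phi>
          \<longrightarrow> (\<exists>!\<chi>. \<chi> \<in> Hom A (Dom A \<psi>) (Dom A \<phi>) \<and> Pa \<chi> = h \<and> \<chi> \<cdot>\<^bsub>A\<^esub> \<phi> = \<psi>))"

locale fibration = cat_functor A B Po Pa
  for A :: "('o, 'a) cat" and B :: "('p, 'b) cat" and Po Pa +
  assumes cartesian_lift: "\<lbrakk>e \<in> Obj A; f \<in> Arr B; Cod B f = Po e\<rbrakk>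
    \<Longrightarrow> \<exists>\<phi>. cartesian_arrow A B Po Pa \<phi> \<and> Cod A \<phi> = e \<and> Pa \<phi> = f"


section \<open>Double categories\<close>

text \<open>
  The category \<open>cat0 D\<close> consists of objects and arrows, \<open>cat1 D\<close> of proarrows and cells.
  The structure isomorphisms are
  \<open>assoc D m n p : (m \<odot> n) \<odot> p \<rightarrow> m \<odot> (n \<odot> p)\<close>,
  \<open>lunit D m : id \<odot> m \<rightarrow> m\<close> and \<open>runit D m : m \<odot> id \<rightarrow> m\<close>.
\<close>

record ('o, 'a, 'p, 'c) dbl =
  cat0 :: "('o, 'a) cat"
  cat1 :: "('p, 'c) cat"
  psrc :: "'p \<Rightarrow> 'o"
  ptgt :: "'p \<Rightarrow> 'o"
  csrc :: "'c \<Rightarrow> 'a"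
  ctgt :: "'c \<Rightarrow> 'a"
  pid :: "'o \<Rightarrow> 'p"
  cid :: "'a \<Rightarrow> 'c"
  pcomp :: "'p \<Rightarrow> 'p \<Rightarrow> 'p" (infixl "\<odot>\<^sub>p\<index>" 75)
  hcomp :: "'c \<Rightarrow> 'c \<Rightarrow> 'c" (infixl "\<odot>\<index>" 75)
  assoc :: "'p \<Rightarrow> 'p \<Rightarrow> 'p \<Rightarrow> 'c"
  lunit :: "'p \<Rightarrow> 'c"
  runit :: "'p \<Rightarrow> 'c"

abbreviation acomp (infixl "\<cdot>\<^sub>0\<index>" 70) where
  "f \<cdot>\<^sub>0\<^bsub>D\<^esub> g \<equiv> Comp (cat0 D) f g"

abbreviation vcomp (infixl "\<cdot>\<^sub>1\<index>" 70) where
  "\<alpha> \<cdot>\<^sub>1\<^bsub>D\<^esub> \<beta> \<equiv> Comp (cat1 D) \<alpha> \<beta>"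

abbreviation aid ("\<one>\<^sub>0\<index>") where
  "\<one>\<^sub>0\<^bsub>D\<^esub> \<equiv> Id (cat0 D)"

abbreviation vid ("\<one>\<^sub>1\<index>") where
  "\<one>\<^sub>1\<^bsub>D\<^esub> \<equiv> Id (cat1 D)"

abbreviation cinv ("inv\<^sub>1\<index>") where
  "inv\<^sub>1\<^bsub>D\<^esub> \<equiv> inv_arrow (cat1 D)"

definition Pro :: "('o, 'a, 'p, 'c) dbl \<Rightarrow> 'o \<Rightarrow> 'o \<Rightarrow> 'p set" where
  "Pro D x y = {m \<in> Obj (cat1 D). psrc D m = x \<and> ptgt D m = y}"

definition Cells :: "('o, 'a, 'p, 'c) dbl \<Rightarrow> 'p \<Rightarrow> 'p \<Rightarrow> 'a \<Rightarrow> 'a \<Rightarrow> 'c set" where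
  "Cells D m n f g = {\<alpha> \<in> Hom (cat1 D) m n. csrc D \<alpha> = f \<and> ctgt D \<alpha> = g}"

definition Glob :: "('o, 'a, 'p, 'c) dbl \<Rightarrow> 'p \<Rightarrow> 'p \<Rightarrow> 'c set" where
  "Glob D m n = Cells D m n (\<one>\<^sub>0\<^bsub>D\<^esub> (psrc D m)) (\<one>\<^sub>0\<^bsub>D\<^esub> (ptgt D m))"

locale double_category =
  source: cat_functor "cat1 D" "cat0 D" "psrc D" "csrc D" +
  target: cat_functor "cat1 D" "cat0 D" "ptgt D" "ctgt D" +
  unit: cat_functor "cat0 D" "cat1 D" "pid D" "cid D"
  for D :: "('o, 'a, 'p, 'c) dbl" (structure) +
  assumes pid_closed: "x \<in> Obj (cat0 D) \<Longrightarrow> pid D x \<in> Pro D x x"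
    and cid_closed: "f \<in> Hom (cat0 D) x y \<Longrightarrow> cid D f \<in> Cells D (pid D x) (pid D y) f f"
    and pcomp_closed: "\<lbrakk>m \<in> Pro D x y; n \<in> Pro D y z\<rbrakk> \<Longrightarrow> m \<odot>\<^sub>p n \<in> Pro D x z"
    and hcomp_closed: "\<lbrakk>\<alpha> \<in> Cells D m m' f g; \<beta> \<in> Cells D n n' g h\<rbrakk>
      \<Longrightarrow> \<alpha> \<odot> \<beta> \<in> Cells D (m \<odot>\<^sub>p n) (m' \<odot>\<^sub>p n') f h"
    and hcomp_id: "\<lbrakk>m \<in> Pro D x y; n \<in> Pro D y z\<rbrakk> \<Longrightarrow> \<one>\<^sub>1 m \<odot> \<one>\<^sub>1 n = \<one>\<^sub>1 (m \<odot>\<^sub>p n)"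
    and interchange:
      "\<lbrakk>\<alpha> \<in> Cells D m m' f g; \<beta> \<in> Cells D n n' g h;
        \<alpha>' \<in> Cells D m' m'' f' g'; \<beta>' \<in> Cells D n' n'' g' h'\<rbrakk>
      \<Longrightarrow> (\<alpha> \<cdot>\<^sub>1 \<alpha>') \<odot> (\<beta> \<cdot>\<^sub>1 \<beta>') = (\<alpha> \<odot> \<beta>) \<cdot>\<^sub>1 (\<alpha>' \<odot> \<beta>')"
    and assoc_closed: "\<lbrakk>m \<in> Pro D w x; n \<in> Pro D x y; p \<in> Pro D y z\<rbrakk>
      \<Longrightarrow> assoc D m n p \<in> Glob D ((m \<odot>\<^sub>p n) \<odot>\<^sub>p p) (m \<odot>\<^sub>p (n \<odot>\<^sub>p p))"
    and assoc_iso: "\<lbrakk>m \<in> Pro D w x; n \<in> Pro D x y; p \<in> Pro D y z\<rbrakk>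
      \<Longrightarrow> iso_arrow (cat1 D) (assoc D m n p)"
    and assoc_natural:
      "\<lbrakk>\<alpha> \<in> Cells D m m' e f; \<beta> \<in> Cells D n n' f g; \<gamma> \<in> Cells D p p' g h\<rbrakk>
      \<Longrightarrow> ((\<alpha> \<odot> \<beta>) \<odot> \<gamma>) \<cdot>\<^sub>1 assoc D m' n' p' = assoc D m n p \<cdot>\<^sub>1 (\<alpha> \<odot> (\<beta> \<odot> \<gamma>))"
    and lunit_closed: "m \<in> Pro D x y \<Longrightarrow> lunit D m \<in> Glob D (pid D x \<odot>\<^sub>p m) m"
    and lunit_iso: "m \<in> Pro D x y \<Longrightarrow> iso_arrow (cat1 D) (lunit D m)"
    and lunit_natural: "\<alpha> \<in> Cells D m n f g
      \<Longrightarrow> (cid D f \<odot> \<alpha>) \<cdot>\<^sub>1 lunit D n = lunit D m \<cdot>\<^sub>1 \<alpha>"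
    and runit_closed: "m \<in> Pro D x y \<Longrightarrow> runit D m \<in> Glob D (m \<odot>\<^sub>p pid D y) m"
    and runit_iso: "m \<in> Pro D x y \<Longrightarrow> iso_arrow (cat1 D) (runit D m)"
    and runit_natural: "\<alpha> \<in> Cells D m n f g
      \<Longrightarrow> (\<alpha> \<odot> cid D g) \<cdot>\<^sub>1 runit D n = runit D m \<cdot>\<^sub>1 \<alpha>"
    and pentagon:
      "\<lbrakk>m \<in> Pro D v w; n \<in> Pro D w x; p \<in> Pro D x y; r \<in> Pro D y z\<rbrakk>
      \<Longrightarrow> assoc D (m \<odot>\<^sub>p n) p r \<cdot>\<^sub>1 assoc D m n (p \<odot>\<^sub>p r)
        = (assoc D m n p \<odot> \<one>\<^sub>1 r) \<cdot>\<^sub>1 assoc D m (n \<odot>\<^sub>p p) r \<cdot>\<^sub>1 (\<one>\<^sub>1 m \<odot> assoc D n p r)"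
    and triangle: "\<lbrakk>m \<in> Pro D x y; n \<in> Pro D y z\<rbrakk>
      \<Longrightarrow> assoc D m (pid D y) n \<cdot>\<^sub>1 (\<one>\<^sub>1 m \<odot> lunit D n) = runit D m \<odot> \<one>\<^sub>1 n"

locale equipment = double_category E +
  fibration "cat1 E" "prod_cat (cat0 E) (cat0 E)"
    "\<lambda>m. (psrc E m, ptgt E m)" "\<lambda>\<alpha>. (csrc E \<alpha>, ctgt E \<alpha>)"
  for E :: "('o, 'a, 'p, 'c) dbl"

definition hom_cat :: "('o, 'a, 'p, 'c) dbl \<Rightarrow> 'o \<Rightarrow> 'o \<Rightarrow> ('p, 'c) cat" where
  "hom_cat D x y = (cat1 D)\<lparr>Obj := Pro D x y,
     Arr := {\<alpha>. \<exists>m \<in> Pro D x y. \<exists>n \<in> Pro D x y. \<alpha> \<in> Glob D m n}\<rparr>"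

definition local_coequalizers :: "('o, 'a, 'p, 'c) dbl \<Rightarrow> bool" where
  "local_coequalizers D \<longleftrightarrow>
     (\<forall>x \<in> Obj (cat0 D). \<forall>y \<in> Obj (cat0 D). \<forall>\<alpha> \<beta>. parallel_pair (hom_cat D x y) \<alpha> \<beta>
        \<longrightarrow> (\<exists>q. coequalizer (hom_cat D x y) \<alpha> \<beta> q))
     \<and> (\<forall>x y z \<alpha> \<beta> q. \<forall>m \<in> Pro D x y. coequalizer (hom_cat D y z) \<alpha> \<beta> q
        \<longrightarrow> coequalizer (hom_cat D x z) (\<one>\<^sub>1\<^bsub>D\<^esub> m \<odot>\<^bsub>D\<^esub> \<alpha>) (\<one>\<^sub>1\<^bsub>D\<^esub> m \<odot>\<^bsub>D\<^esub> \<beta>) (\<one>\<^sub>1\<^bsub>D\<^esub> m \<odot>\<^bsub>D\<^esub> q))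
     \<and> (\<forall>x y z \<alpha> \<beta> q. \<forall>n \<in> Pro D y z. coequalizer (hom_cat D x y) \<alpha> \<beta> q
        \<longrightarrow> coequalizer (hom_cat D x z) (\<alpha> \<odot>\<^bsub>D\<^esub> \<one>\<^sub>1\<^bsub>D\<^esub> n) (\<beta> \<odot>\<^bsub>D\<^esub> \<one>\<^sub>1\<^bsub>D\<^esub> n) (q \<odot>\<^bsub>D\<^esub> \<one>\<^sub>1\<^bsub>D\<^esub> n))"


section \<open>Lax double functors\<close>

text \<open>
  So that equality of lax functors and of transformations is equality of their data, all
  components take the value \<^term>\<open>undefined\<close> outside the carriers of the domain.
\<close>

record ('o, 'a, 'p, 'c, 'o2, 'a2, 'p2, 'c2) laxfun =
  fo :: "'o \<Rightarrow> 'o2"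
  fa :: "'a \<Rightarrow> 'a2"
  fp :: "'p \<Rightarrow> 'p2"
  fc :: "'c \<Rightarrow> 'c2"
  lax :: "'p \<Rightarrow> 'p \<Rightarrow> 'c2"
  un :: "'o \<Rightarrow> 'c2"

definition composable :: "('o, 'a, 'p, 'c) dbl \<Rightarrow> 'p \<Rightarrow> 'p \<Rightarrow> bool" where
  "composable D m n \<longleftrightarrow> m \<in> Obj (cat1 D) \<and> n \<in> Obj (cat1 D) \<and> ptgt D m = psrc D n"

definition restrict_laxfun ::
  "('o, 'a, 'p, 'c) dbl \<Rightarrow> ('o, 'a, 'p, 'c, 'o2, 'a2, 'p2, 'c2) laxfun
   \<Rightarrow> ('o, 'a, 'p, 'c, 'o2, 'a2, 'p2, 'c2) laxfun" where
  "restrict_laxfun D F = \<lparr>fo = restrict (fo F) (Obj (cat0 D)), fa = restrict (fa F) (Arr (cat0 D)),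
     fp = restrict (fp F) (Obj (cat1 D)), fc = restrict (fc F) (Arr (cat1 D)),
     lax = (\<lambda>m n. if composable D m n then lax F m n else undefined),
     un = restrict (un F) (Obj (cat0 D))\<rparr>"

text \<open>In the next locale, operations without a subscript are those of the codomain \<open>E\<close>.\<close>

locale lax_functor =
  zero: cat_functor "cat0 D" "cat0 E" "fo F" "fa F" +
  one: cat_functor "cat1 D" "cat1 E" "fp F" "fc F"
  for D :: "('o, 'a, 'p, 'c) dbl" and E :: "('o2, 'a2, 'p2, 'c2) dbl" (structure)
    and F :: "('o, 'a, 'p, 'c, 'o2, 'a2, 'p2, 'c2) laxfun" +
  assumes extensional: "restrict_laxfun D F = F"
    and fp_closed: "m \<in> Pro D x y \<Longrightarrow> fp F m \<in> Pro E (fo F x) (fo F y)"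
    and fc_closed: "\<alpha> \<in> Cells D m n f g
      \<Longrightarrow> fc F \<alpha> \<in> Cells E (fp F m) (fp F n) (fa F f) (fa F g)"
    and lax_closed: "\<lbrakk>m \<in> Pro D x y; n \<in> Pro D y z\<rbrakk>
      \<Longrightarrow> lax F m n \<in> Glob E (fp F m \<odot>\<^sub>p fp F n) (fp F (m \<odot>\<^sub>p\<^bsub>D\<^esub> n))"
    and un_closed: "x \<in> Obj (cat0 D) \<Longrightarrow> un F x \<in> Glob E (pid E (fo F x)) (fp F (pid D x))"
    and lax_natural: "\<lbrakk>\<alpha> \<in> Cells D m m' f g; \<beta> \<in> Cells D n n' g h\<rbrakk>
      \<Longrightarrow> (fc F \<alpha> \<odot> fc F \<beta>) \<cdot>\<^sub>1 lax F m' n' = lax F m n \<cdot>\<^sub>1 fc F (\<alpha> \<odot>\<^bsub>D\<^esub> \<beta>)"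
    and un_natural: "f \<in> Hom (cat0 D) x y
      \<Longrightarrow> cid E (fa F f) \<cdot>\<^sub>1 un F y = un F x \<cdot>\<^sub>1 fc F (cid D f)"
    and lax_assoc: "\<lbrakk>m \<in> Pro D w x; n \<in> Pro D x y; p \<in> Pro D y z\<rbrakk>
      \<Longrightarrow> (lax F m n \<odot> \<one>\<^sub>1 (fp F p)) \<cdot>\<^sub>1 lax F (m \<odot>\<^sub>p\<^bsub>D\<^esub> n) p \<cdot>\<^sub>1 fc F (assoc D m n p)
        = assoc E (fp F m) (fp F n) (fp F p) \<cdot>\<^sub>1 (\<one>\<^sub>1 (fp F m) \<odot> lax F n p)
            \<cdot>\<^sub>1 lax F m (n \<odot>\<^sub>p\<^bsub>D\<^esub> p)"
    and lax_lunit: "m \<in> Pro D x y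
      \<Longrightarrow> (un F x \<odot> \<one>\<^sub>1 (fp F m)) \<cdot>\<^sub>1 lax F (pid D x) m \<cdot>\<^sub>1 fc F (lunit D m) = lunit E (fp F m)"
    and lax_runit: "m \<in> Pro D x y
      \<Longrightarrow> (\<one>\<^sub>1 (fp F m) \<odot> un F y) \<cdot>\<^sub>1 lax F m (pid D y) \<cdot>\<^sub>1 fc F (runit D m) = runit E (fp F m)"

definition unitary ::
  "('o, 'a, 'p, 'c) dbl \<Rightarrow> ('o2, 'a2, 'p2, 'c2) dbl
   \<Rightarrow> ('o, 'a, 'p, 'c, 'o2, 'a2, 'p2, 'c2) laxfun \<Rightarrow> bool" where
  "unitary D E F \<longleftrightarrow> (\<forall>x \<in> Obj (cat0 D).
     fp F (pid D x) = pid E (fo F x) \<and> un F x = \<one>\<^sub>1\<^bsub>E\<^esub> (pid E (fo F x)))"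

text \<open>
  The cells \<open>F\<^sub>x\<^sub>,\<^sub>m\<close> and \<open>F\<^sub>m\<^sub>,\<^sub>y\<close>: laxators at an identity proarrow, followed by the image of a
  unit isomorphism. Since the two unit isomorphisms agree at an identity proarrow, \<open>F\<^sub>x\<^sub>,\<^sub>x\<close> is
  either of them at \<open>pid D x\<close>.
\<close>

definition lax_id_left ::
  "('o, 'a, 'p, 'c) dbl \<Rightarrow> ('o2, 'a2, 'p2, 'c2) dbl
   \<Rightarrow> ('o, 'a, 'p, 'c, 'o2, 'a2, 'p2, 'c2) laxfun \<Rightarrow> 'p \<Rightarrow> 'c2" where
  "lax_id_left D E F m = lax F (pid D (psrc D m)) m \<cdot>\<^sub>1\<^bsub>E\<^esub> fc F (lunit D m)"

definition lax_id_right ::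
  "('o, 'a, 'p, 'c) dbl \<Rightarrow> ('o2, 'a2, 'p2, 'c2) dbl
   \<Rightarrow> ('o, 'a, 'p, 'c, 'o2, 'a2, 'p2, 'c2) laxfun \<Rightarrow> 'p \<Rightarrow> 'c2" where
  "lax_id_right D E F m = lax F m (pid D (ptgt D m)) \<cdot>\<^sub>1\<^bsub>E\<^esub> fc F (runit D m)"

definition lax_id_id ::
  "('o, 'a, 'p, 'c) dbl \<Rightarrow> ('o2, 'a2, 'p2, 'c2) dbl
   \<Rightarrow> ('o, 'a, 'p, 'c, 'o2, 'a2, 'p2, 'c2) laxfun \<Rightarrow> 'o \<Rightarrow> 'c2" where
  "lax_id_id D E F x = lax_id_left D E F (pid D x)"

text \<open>The composite of \<open>H : D \<rightarrow> M\<close> and \<open>K : M \<rightarrow> E\<close>; of \<open>M\<close> no structure is needed.\<close>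

definition lax_comp ::
  "('o, 'a, 'p, 'c) dbl \<Rightarrow> ('o3, 'a3, 'p3, 'c3) dbl
   \<Rightarrow> ('o, 'a, 'p, 'c, 'o2, 'a2, 'p2, 'c2) laxfun
   \<Rightarrow> ('o2, 'a2, 'p2, 'c2, 'o3, 'a3, 'p3, 'c3) laxfun
   \<Rightarrow> ('o, 'a, 'p, 'c, 'o3, 'a3, 'p3, 'c3) laxfun" where
  "lax_comp D E H K = restrict_laxfun D
     \<lparr>fo = fo K \<circ> fo H, fa = fa K \<circ> fa H, fp = fp K \<circ> fp H, fc = fc K \<circ> fc H,
      lax = (\<lambda>m n. lax K (fp H m) (fp H n) \<cdot>\<^sub>1\<^bsub>E\<^esub> fc K (lax H m n)),
      un = (\<lambda>x. un K (fo H x) \<cdot>\<^sub>1\<^bsub>E\<^esub> fc K (un H x))\<rparr>"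


section \<open>Lax natural transformations\<close>

record ('o, 'a, 'p, 'c, 'o2, 'a2, 'p2, 'c2) laxtrans =
  tdom :: "('o, 'a, 'p, 'c, 'o2, 'a2, 'p2, 'c2) laxfun"
  tcod :: "('o, 'a, 'p, 'c, 'o2, 'a2, 'p2, 'c2) laxfun"
  tob :: "'o \<Rightarrow> 'a2"
  tpro :: "'p \<Rightarrow> 'c2"
  tarr :: "'a \<Rightarrow> 'c2"

definition restrict_laxtrans ::
  "('o, 'a, 'p, 'c) dbl \<Rightarrow> ('o, 'a, 'p, 'c, 'o2, 'a2, 'p2, 'c2) laxtrans
   \<Rightarrow> ('o, 'a, 'p, 'c, 'o2, 'a2, 'p2, 'c2) laxtrans" where
  "restrict_laxtrans D \<alpha> = \<lparr>tdom = tdom \<alpha>, tcod = tcod \<alpha>,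
     tob = restrict (tob \<alpha>) (Obj (cat0 D)), tpro = restrict (tpro \<alpha>) (Obj (cat1 D)),
     tarr = restrict (tarr \<alpha>) (Arr (cat0 D))\<rparr>"

text \<open>
  Operations without a subscript are those of the codomain \<open>E\<close>. The coherence cells that are
  usually suppressed are the inverses of unit isomorphisms of \<open>E\<close> in \<open>cell_condition\<close> and
  \<open>arr_comp\<close>, where the two sides would otherwise start at \<open>id \<odot> F m\<close> and \<open>F m \<odot> id\<close>, respectively
  at \<open>id\<close> and \<open>id \<odot> id\<close>.
\<close>

locale lax_trans =
  fixes D :: "('o, 'a, 'p, 'c) dbl" and E :: "('o2, 'a2, 'p2, 'c2) dbl" (structure)
    and \<alpha> :: "('o, 'a, 'p, 'c, 'o2, 'a2, 'p2, 'c2) laxtrans"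
    and F G :: "('o, 'a, 'p, 'c, 'o2, 'a2, 'p2, 'c2) laxfun"
  defines "F \<equiv> tdom \<alpha>" and "G \<equiv> tcod \<alpha>"
  assumes lax_dom: "lax_functor D E F"
    and lax_cod: "lax_functor D E G"
    and extensional: "restrict_laxtrans D \<alpha> = \<alpha>"
    and tob_closed: "x \<in> Obj (cat0 D) \<Longrightarrow> tob \<alpha> x \<in> Hom (cat0 E) (fo F x) (fo G x)"
    and tpro_closed: "m \<in> Pro D x y
      \<Longrightarrow> tpro \<alpha> m \<in> Cells E (fp F m) (fp G m) (tob \<alpha> x) (tob \<alpha> y)"
    and tarr_closed: "f \<in> Hom (cat0 D) x y
      \<Longrightarrow> tarr \<alpha> f \<in> Cells E (pid E (fo F x)) (fp G (pid D y))
                     (tob \<alpha> x \<cdot>\<^sub>0 fa G f) (fa F f \<cdot>\<^sub>0 tob \<alpha> y)"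
    and cell_condition: "\<gamma> \<in> Cells D m n f g
      \<Longrightarrow> inv\<^sub>1 (lunit E (fp F m)) \<cdot>\<^sub>1 (tarr \<alpha> f \<odot> (fc F \<gamma> \<cdot>\<^sub>1 tpro \<alpha> n)) \<cdot>\<^sub>1 lax_id_left D E G n
        = inv\<^sub>1 (runit E (fp F m)) \<cdot>\<^sub>1 ((tpro \<alpha> m \<cdot>\<^sub>1 fc G \<gamma>) \<odot> tarr \<alpha> g) \<cdot>\<^sub>1 lax_id_right D E G n"
    and pro_comp: "\<lbrakk>m \<in> Pro D x y; n \<in> Pro D y z\<rbrakk>
      \<Longrightarrow> lax F m n \<cdot>\<^sub>1 tpro \<alpha> (m \<odot>\<^sub>p\<^bsub>D\<^esub> n) = (tpro \<alpha> m \<odot> tpro \<alpha> n) \<cdot>\<^sub>1 lax G m n"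
    and pro_id: "x \<in> Obj (cat0 D)
      \<Longrightarrow> un F x \<cdot>\<^sub>1 tpro \<alpha> (pid D x) = cid E (tob \<alpha> x) \<cdot>\<^sub>1 un G x"
    and arr_comp: "\<lbrakk>f \<in> Hom (cat0 D) x y; g \<in> Hom (cat0 D) y z\<rbrakk>
      \<Longrightarrow> tarr \<alpha> (f \<cdot>\<^sub>0\<^bsub>D\<^esub> g)
        = inv\<^sub>1 (lunit E (pid E (fo F x)))
            \<cdot>\<^sub>1 ((tarr \<alpha> f \<cdot>\<^sub>1 fc G (cid D g)) \<odot> (cid E (fa F f) \<cdot>\<^sub>1 tarr \<alpha> g)) \<cdot>\<^sub>1 lax_id_id D E G z"
    and arr_id: "x \<in> Obj (cat0 D) \<Longrightarrow> tarr \<alpha> (\<one>\<^sub>0\<^bsub>D\<^esub> x) = cid E (tob \<alpha> x) \<cdot>\<^sub>1 un G x"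

definition trans_id ::
  "('o, 'a, 'p, 'c) dbl \<Rightarrow> ('o2, 'a2, 'p2, 'c2) dbl
   \<Rightarrow> ('o, 'a, 'p, 'c, 'o2, 'a2, 'p2, 'c2) laxfun
   \<Rightarrow> ('o, 'a, 'p, 'c, 'o2, 'a2, 'p2, 'c2) laxtrans" where
  "trans_id D E F = restrict_laxtrans D
     \<lparr>tdom = F, tcod = F, tob = (\<lambda>x. \<one>\<^sub>0\<^bsub>E\<^esub> (fo F x)), tpro = (\<lambda>m. \<one>\<^sub>1\<^bsub>E\<^esub> (fp F m)),
      tarr = (\<lambda>f. cid E (fa F f) \<cdot>\<^sub>1\<^bsub>E\<^esub> un F (Cod (cat0 D) f))\<rparr>"

definition trans_comp ::
  "('o, 'a, 'p, 'c) dbl \<Rightarrow> ('o2, 'a2, 'p2, 'c2) dbl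
   \<Rightarrow> ('o, 'a, 'p, 'c, 'o2, 'a2, 'p2, 'c2) laxtrans
   \<Rightarrow> ('o, 'a, 'p, 'c, 'o2, 'a2, 'p2, 'c2) laxtrans
   \<Rightarrow> ('o, 'a, 'p, 'c, 'o2, 'a2, 'p2, 'c2) laxtrans" where
  "trans_comp D E \<alpha> \<beta> = restrict_laxtrans D
     \<lparr>tdom = tdom \<alpha>, tcod = tcod \<beta>,
      tob = (\<lambda>x. tob \<alpha> x \<cdot>\<^sub>0\<^bsub>E\<^esub> tob \<beta> x),
      tpro = (\<lambda>m. tpro \<alpha> m \<cdot>\<^sub>1\<^bsub>E\<^esub> tpro \<beta> m),
      tarr = (\<lambda>f. let x = Dom (cat0 D) f; y = Cod (cat0 D) f in
        inv\<^sub>1\<^bsub>E\<^esub> (lunit E (pid E (fo (tdom \<alpha>) x)))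
          \<cdot>\<^sub>1\<^bsub>E\<^esub> ((cid E (tob \<alpha> x) \<cdot>\<^sub>1\<^bsub>E\<^esub> tarr \<beta> f) \<odot>\<^bsub>E\<^esub> (tarr \<alpha> f \<cdot>\<^sub>1\<^bsub>E\<^esub> tpro \<beta> (pid D y)))
          \<cdot>\<^sub>1\<^bsub>E\<^esub> lax_id_id D E (tcod \<beta>) y)\<rparr>"

definition Lax ::
  "('o, 'a, 'p, 'c) dbl \<Rightarrow> ('o2, 'a2, 'p2, 'c2) dbl
   \<Rightarrow> (('o, 'a, 'p, 'c, 'o2, 'a2, 'p2, 'c2) laxfun,
       ('o, 'a, 'p, 'c, 'o2, 'a2, 'p2, 'c2) laxtrans) cat" where
  "Lax D E = \<lparr>Obj = {F. lax_functor D E F}, Arr = {\<alpha>. lax_trans D E \<alpha>},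
     Dom = tdom, Cod = tcod, Id = trans_id D E, Comp = trans_comp D E\<rparr>"

definition Lax_unitary ::
  "('o, 'a, 'p, 'c) dbl \<Rightarrow> ('o2, 'a2, 'p2, 'c2) dbl
   \<Rightarrow> (('o, 'a, 'p, 'c, 'o2, 'a2, 'p2, 'c2) laxfun,
       ('o, 'a, 'p, 'c, 'o2, 'a2, 'p2, 'c2) laxtrans) cat" where
  "Lax_unitary D E = full_subcat (Lax D E) (unitary D E)"


section \<open>Category objects and bimodules\<close>

record ('o, 'p, 'c) catobj =
  co_ob :: 'o
  co_pro :: 'p
  co_mult :: 'c
  co_unit :: 'c

record ('o, 'a, 'p, 'c) cofun =
  cf_dom :: "('o, 'p, 'c) catobj"
  cf_cod :: "('o, 'p, 'c) catobj"
  cf_arr :: 'a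
  cf_cell :: 'c

record ('o, 'p, 'c) bimod =
  bm_src :: "('o, 'p, 'c) catobj"
  bm_tgt :: "('o, 'p, 'c) catobj"
  bm_pro :: 'p
  bm_lact :: 'c
  bm_ract :: 'c

record ('o, 'a, 'p, 'c) bicell =
  bc_dom :: "('o, 'p, 'c) bimod"
  bc_cod :: "('o, 'p, 'c) bimod"
  bc_src :: "('o, 'a, 'p, 'c) cofun"
  bc_tgt :: "('o, 'a, 'p, 'c) cofun"
  bc_cell :: 'c

context
  fixes E :: "('o, 'a, 'p, 'c) dbl" (structure)
begin

definition is_catobj :: "('o, 'p, 'c) catobj \<Rightarrow> bool" where
  "is_catobj X \<longleftrightarrow> (let x = co_ob X; r = co_pro X; \<mu> = co_mult X; \<upsilon> = co_unit X in
     x \<in> Obj (cat0 E) \<and> r \<in> Pro E x x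
     \<and> \<mu> \<in> Glob E (r \<odot>\<^sub>p r) r \<and> \<upsilon> \<in> Glob E (pid E x) r
     \<and> (\<mu> \<odot> \<one>\<^sub>1 r) \<cdot>\<^sub>1 \<mu> = assoc E r r r \<cdot>\<^sub>1 (\<one>\<^sub>1 r \<odot> \<mu>) \<cdot>\<^sub>1 \<mu>
     \<and> (\<upsilon> \<odot> \<one>\<^sub>1 r) \<cdot>\<^sub>1 \<mu> = lunit E r
     \<and> (\<one>\<^sub>1 r \<odot> \<upsilon>) \<cdot>\<^sub>1 \<mu> = runit E r)"

definition is_cofun :: "('o, 'a, 'p, 'c) cofun \<Rightarrow> bool" where
  "is_cofun \<Phi> \<longleftrightarrow> (let X = cf_dom \<Phi>; Y = cf_cod \<Phi>; f = cf_arr \<Phi>; \<phi> = cf_cell \<Phi> in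
     is_catobj X \<and> is_catobj Y
     \<and> f \<in> Hom (cat0 E) (co_ob X) (co_ob Y) \<and> \<phi> \<in> Cells E (co_pro X) (co_pro Y) f f
     \<and> (\<phi> \<odot> \<phi>) \<cdot>\<^sub>1 co_mult Y = co_mult X \<cdot>\<^sub>1 \<phi>
     \<and> cid E f \<cdot>\<^sub>1 co_unit Y = co_unit X \<cdot>\<^sub>1 \<phi>)"

definition is_bimod :: "('o, 'p, 'c) bimod \<Rightarrow> bool" where
  "is_bimod M \<longleftrightarrow>
    (let X = bm_src M; Y = bm_tgt M; r = co_pro X; s = co_pro Y;
         m = bm_pro M; l = bm_lact M; \<rho> = bm_ract M in
     is_catobj X \<and> is_catobj Y
     \<and> m \<in> Pro E (co_ob X) (co_ob Y)
     \<and> l \<in> Glob E (r \<odot>\<^sub>p m) m \<and> \<rho> \<in> Glob E (m \<odot>\<^sub>p s) m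
     \<and> (co_mult X \<odot> \<one>\<^sub>1 m) \<cdot>\<^sub>1 l = assoc E r r m \<cdot>\<^sub>1 (\<one>\<^sub>1 r \<odot> l) \<cdot>\<^sub>1 l
     \<and> (co_unit X \<odot> \<one>\<^sub>1 m) \<cdot>\<^sub>1 l = lunit E m
     \<and> (\<rho> \<odot> \<one>\<^sub>1 s) \<cdot>\<^sub>1 \<rho> = assoc E m s s \<cdot>\<^sub>1 (\<one>\<^sub>1 m \<odot> co_mult Y) \<cdot>\<^sub>1 \<rho>
     \<and> (\<one>\<^sub>1 m \<odot> co_unit Y) \<cdot>\<^sub>1 \<rho> = runit E m
     \<and> (l \<odot> \<one>\<^sub>1 s) \<cdot>\<^sub>1 \<rho> = assoc E r m s \<cdot>\<^sub>1 (\<one>\<^sub>1 r \<odot> \<rho>) \<cdot>\<^sub>1 l)"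

definition is_bicell :: "('o, 'a, 'p, 'c) bicell \<Rightarrow> bool" where
  "is_bicell A \<longleftrightarrow>
    (let M = bc_dom A; N = bc_cod A; \<Phi> = bc_src A; \<Psi> = bc_tgt A; \<alpha> = bc_cell A in
     is_bimod M \<and> is_bimod N \<and> is_cofun \<Phi> \<and> is_cofun \<Psi>
     \<and> cf_dom \<Phi> = bm_src M \<and> cf_cod \<Phi> = bm_src N
     \<and> cf_dom \<Psi> = bm_tgt M \<and> cf_cod \<Psi> = bm_tgt N
     \<and> \<alpha> \<in> Cells E (bm_pro M) (bm_pro N) (cf_arr \<Phi>) (cf_arr \<Psi>)
     \<and> (cf_cell \<Phi> \<odot> \<alpha>) \<cdot>\<^sub>1 bm_lact N = bm_lact M \<cdot>\<^sub>1 \<alpha>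
     \<and> (\<alpha> \<odot> cf_cell \<Psi>) \<cdot>\<^sub>1 bm_ract N = bm_ract M \<cdot>\<^sub>1 \<alpha>)"

definition cofun_id :: "('o, 'p, 'c) catobj \<Rightarrow> ('o, 'a, 'p, 'c) cofun" where
  "cofun_id X = \<lparr>cf_dom = X, cf_cod = X, cf_arr = \<one>\<^sub>0 (co_ob X), cf_cell = \<one>\<^sub>1 (co_pro X)\<rparr>"

definition cofun_comp ::
  "('o, 'a, 'p, 'c) cofun \<Rightarrow> ('o, 'a, 'p, 'c) cofun \<Rightarrow> ('o, 'a, 'p, 'c) cofun" where
  "cofun_comp \<Phi> \<Psi> = \<lparr>cf_dom = cf_dom \<Phi>, cf_cod = cf_cod \<Psi>,
     cf_arr = cf_arr \<Phi> \<cdot>\<^sub>0 cf_arr \<Psi>, cf_cell = cf_cell \<Phi> \<cdot>\<^sub>1 cf_cell \<Psi>\<rparr>"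

definition glob_bicell ::
  "('o, 'p, 'c) bimod \<Rightarrow> ('o, 'p, 'c) bimod \<Rightarrow> 'c \<Rightarrow> ('o, 'a, 'p, 'c) bicell" where
  "glob_bicell M N \<alpha> = \<lparr>bc_dom = M, bc_cod = N,
     bc_src = cofun_id (bm_src M), bc_tgt = cofun_id (bm_tgt M), bc_cell = \<alpha>\<rparr>"

definition bicell_id :: "('o, 'p, 'c) bimod \<Rightarrow> ('o, 'a, 'p, 'c) bicell" where
  "bicell_id M = glob_bicell M M (\<one>\<^sub>1 (bm_pro M))"

definition bicell_comp ::
  "('o, 'a, 'p, 'c) bicell \<Rightarrow> ('o, 'a, 'p, 'c) bicell \<Rightarrow> ('o, 'a, 'p, 'c) bicell" where
  "bicell_comp A B = \<lparr>bc_dom = bc_dom A, bc_cod = bc_cod B,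
     bc_src = cofun_comp (bc_src A) (bc_src B), bc_tgt = cofun_comp (bc_tgt A) (bc_tgt B),
     bc_cell = bc_cell A \<cdot>\<^sub>1 bc_cell B\<rparr>"

definition unit_bimod :: "('o, 'p, 'c) catobj \<Rightarrow> ('o, 'p, 'c) bimod" where
  "unit_bimod X = \<lparr>bm_src = X, bm_tgt = X, bm_pro = co_pro X,
     bm_lact = co_mult X, bm_ract = co_mult X\<rparr>"

definition unit_bicell :: "('o, 'a, 'p, 'c) cofun \<Rightarrow> ('o, 'a, 'p, 'c) bicell" where
  "unit_bicell \<Phi> = \<lparr>bc_dom = unit_bimod (cf_dom \<Phi>), bc_cod = unit_bimod (cf_cod \<Phi>),
     bc_src = \<Phi>, bc_tgt = \<Phi>, bc_cell = cf_cell \<Phi>\<rparr>"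

text \<open>
  Coequalizers are determined only up to isomorphism, so \<open>Mod(E)\<close> depends on a choice: \<open>q M N\<close> is
  the chosen coequalizer of \<open>\<rho> \<odot> 1\<close> and \<open>1 \<odot> \<lambda>\<close>, the former being the one that starts at
  \<open>(m \<odot> s) \<odot> n\<close> and the latter being precomposed with the associator.
\<close>

definition tensor_choice ::
  "(('o, 'p, 'c) bimod \<Rightarrow> ('o, 'p, 'c) bimod \<Rightarrow> 'c) \<Rightarrow> bool" where
  "tensor_choice q \<longleftrightarrow> (\<forall>M N. is_bimod M \<and> is_bimod N \<and> bm_tgt M = bm_src N \<longrightarrow>
     coequalizer (hom_cat E (co_ob (bm_src M)) (co_ob (bm_tgt N)))
       (bm_ract M \<odot> \<one>\<^sub>1 (bm_pro N))
       (assoc E (bm_pro M) (co_pro (bm_tgt M)) (bm_pro N) \<cdot>\<^sub>1 (\<one>\<^sub>1 (bm_pro M) \<odot> bm_lact N))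
       (q M N))"

context
  fixes q :: "('o, 'p, 'c) bimod \<Rightarrow> ('o, 'p, 'c) bimod \<Rightarrow> 'c"
begin

definition tensor_pro :: "('o, 'p, 'c) bimod \<Rightarrow> ('o, 'p, 'c) bimod \<Rightarrow> 'p" where
  "tensor_pro M N = Cod (cat1 E) (q M N)"

text \<open>
  The actions on \<open>m \<otimes> n\<close> are those induced on the coequalizer by the left action on \<open>m\<close> and the
  right action on \<open>n\<close>; the descriptions determine them because \<open>r \<odot> (-)\<close> and \<open>(-) \<odot> t\<close> preserve
  coequalizers. Likewise for the associator and the unitors below.
\<close>

definition tensor :: "('o, 'p, 'c) bimod \<Rightarrow> ('o, 'p, 'c) bimod \<Rightarrow> ('o, 'p, 'c) bimod" where
  "tensor M N =
    (let m = bm_pro M; n = bm_pro N; k = tensor_pro M N;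
         r = co_pro (bm_src M); t = co_pro (bm_tgt N) in
     \<lparr>bm_src = bm_src M, bm_tgt = bm_tgt N, bm_pro = k,
      bm_lact = (THE l. l \<in> Glob E (r \<odot>\<^sub>p k) k
        \<and> assoc E r m n \<cdot>\<^sub>1 (\<one>\<^sub>1 r \<odot> q M N) \<cdot>\<^sub>1 l = (bm_lact M \<odot> \<one>\<^sub>1 n) \<cdot>\<^sub>1 q M N),
      bm_ract = (THE \<rho>. \<rho> \<in> Glob E (k \<odot>\<^sub>p t) k
        \<and> (q M N \<odot> \<one>\<^sub>1 t) \<cdot>\<^sub>1 \<rho> = assoc E m n t \<cdot>\<^sub>1 (\<one>\<^sub>1 m \<odot> bm_ract N) \<cdot>\<^sub>1 q M N)\<rparr>)"

definition tensor_cell ::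
  "('o, 'a, 'p, 'c) bicell \<Rightarrow> ('o, 'a, 'p, 'c) bicell \<Rightarrow> ('o, 'a, 'p, 'c) bicell" where
  "tensor_cell A B =
    \<lparr>bc_dom = tensor (bc_dom A) (bc_dom B), bc_cod = tensor (bc_cod A) (bc_cod B),
     bc_src = bc_src A, bc_tgt = bc_tgt B,
     bc_cell = (THE \<gamma>. \<gamma> \<in> Cells E (tensor_pro (bc_dom A) (bc_dom B)) (tensor_pro (bc_cod A) (bc_cod B))
                          (cf_arr (bc_src A)) (cf_arr (bc_tgt B))
       \<and> q (bc_dom A) (bc_dom B) \<cdot>\<^sub>1 \<gamma> = (bc_cell A \<odot> bc_cell B) \<cdot>\<^sub>1 q (bc_cod A) (bc_cod B))\<rparr>"

definition tensor_assoc ::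
  "('o, 'p, 'c) bimod \<Rightarrow> ('o, 'p, 'c) bimod \<Rightarrow> ('o, 'p, 'c) bimod \<Rightarrow> ('o, 'a, 'p, 'c) bicell" where
  "tensor_assoc M N P = glob_bicell (tensor (tensor M N) P) (tensor M (tensor N P))
    (THE \<gamma>. \<gamma> \<in> Glob E (tensor_pro (tensor M N) P) (tensor_pro M (tensor N P))
       \<and> (q M N \<odot> \<one>\<^sub>1 (bm_pro P)) \<cdot>\<^sub>1 q (tensor M N) P \<cdot>\<^sub>1 \<gamma>
         = assoc E (bm_pro M) (bm_pro N) (bm_pro P)
             \<cdot>\<^sub>1 (\<one>\<^sub>1 (bm_pro M) \<odot> q N P) \<cdot>\<^sub>1 q M (tensor N P))"

definition tensor_lunit :: "('o, 'p, 'c) bimod \<Rightarrow> ('o, 'a, 'p, 'c) bicell" where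
  "tensor_lunit M = (let U = unit_bimod (bm_src M) in glob_bicell (tensor U M) M
    (THE \<gamma>. \<gamma> \<in> Glob E (tensor_pro U M) (bm_pro M) \<and> q U M \<cdot>\<^sub>1 \<gamma> = bm_lact M))"

definition tensor_runit :: "('o, 'p, 'c) bimod \<Rightarrow> ('o, 'a, 'p, 'c) bicell" where
  "tensor_runit M = (let U = unit_bimod (bm_tgt M) in glob_bicell (tensor M U) M
    (THE \<gamma>. \<gamma> \<in> Glob E (tensor_pro M U) (bm_pro M) \<and> q M U \<cdot>\<^sub>1 \<gamma> = bm_ract M))"

definition Mod ::
  "(('o, 'p, 'c) catobj, ('o, 'a, 'p, 'c) cofun, ('o, 'p, 'c) bimod, ('o, 'a, 'p, 'c) bicell) dbl"
  where
  "Mod =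
    \<lparr>cat0 = \<lparr>Obj = {X. is_catobj X}, Arr = {\<Phi>. is_cofun \<Phi>},
             Dom = cf_dom, Cod = cf_cod, Id = cofun_id, Comp = cofun_comp\<rparr>,
     cat1 = \<lparr>Obj = {M. is_bimod M}, Arr = {A. is_bicell A},
             Dom = bc_dom, Cod = bc_cod, Id = bicell_id, Comp = bicell_comp\<rparr>,
     psrc = bm_src, ptgt = bm_tgt, csrc = bc_src, ctgt = bc_tgt,
     pid = unit_bimod, cid = unit_bicell, pcomp = tensor, hcomp = tensor_cell,
     assoc = tensor_assoc, lunit = tensor_lunit, runit = tensor_runit\<rparr>"

definition epsilon ::
  "(('o, 'p, 'c) catobj, ('o, 'a, 'p, 'c) cofun, ('o, 'p, 'c) bimod, ('o, 'a, 'p, 'c) bicell,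
    'o, 'a, 'p, 'c) laxfun" where
  "epsilon = restrict_laxfun Mod
     \<lparr>fo = co_ob, fa = cf_arr, fp = bm_pro, fc = bc_cell, lax = q, un = co_unit\<rparr>"

end

end


section \<open>The two functors\<close>

definition eps_fun ::
  "('o, 'a, 'p, 'c) dbl \<Rightarrow> ('o2, 'a2, 'p2, 'c2) dbl
   \<Rightarrow> (('o2, 'p2, 'c2) bimod \<Rightarrow> ('o2, 'p2, 'c2) bimod \<Rightarrow> 'c2)
   \<Rightarrow> ('o, 'a, 'p, 'c, ('o2, 'p2, 'c2) catobj, ('o2, 'a2, 'p2, 'c2) cofun,
       ('o2, 'p2, 'c2) bimod, ('o2, 'a2, 'p2, 'c2) bicell) laxfun
   \<Rightarrow> ('o, 'a, 'p, 'c, 'o2, 'a2, 'p2, 'c2) laxfun" where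
  "eps_fun D E q H = lax_comp D E H (epsilon E q)"

definition eps_trans ::
  "('o, 'a, 'p, 'c) dbl \<Rightarrow> ('o2, 'a2, 'p2, 'c2) dbl
   \<Rightarrow> (('o2, 'p2, 'c2) bimod \<Rightarrow> ('o2, 'p2, 'c2) bimod \<Rightarrow> 'c2)
   \<Rightarrow> ('o, 'a, 'p, 'c, ('o2, 'p2, 'c2) catobj, ('o2, 'a2, 'p2, 'c2) cofun,
       ('o2, 'p2, 'c2) bimod, ('o2, 'a2, 'p2, 'c2) bicell) laxtrans
   \<Rightarrow> ('o, 'a, 'p, 'c, 'o2, 'a2, 'p2, 'c2) laxtrans" where
  "eps_trans D E q \<alpha> = restrict_laxtrans D
     \<lparr>tdom = eps_fun D E q (tdom \<alpha>), tcod = eps_fun D E q (tcod \<alpha>),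
      tob = (\<lambda>x. cf_arr (tob \<alpha> x)), tpro = (\<lambda>m. bc_cell (tpro \<alpha> m)),
      tarr = (\<lambda>f. co_unit (fo (tdom \<alpha>) (Dom (cat0 D) f)) \<cdot>\<^sub>1\<^bsub>E\<^esub> bc_cell (tarr \<alpha> f))\<rparr>"

context
  fixes D :: "('o, 'a, 'p, 'c) dbl" and E :: "('o2, 'a2, 'p2, 'c2) dbl" (structure)
    and q :: "('o2, 'p2, 'c2) bimod \<Rightarrow> ('o2, 'p2, 'c2) bimod \<Rightarrow> 'c2"
begin

context
  fixes F :: "('o, 'a, 'p, 'c, 'o2, 'a2, 'p2, 'c2) laxfun"
begin

definition bar_ob :: "'o \<Rightarrow> ('o2, 'p2, 'c2) catobj" where
  "bar_ob x = \<lparr>co_ob = fo F x, co_pro = fp F (pid D x),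
     co_mult = lax_id_id D E F x, co_unit = un F x\<rparr>"

definition bar_arr :: "'a \<Rightarrow> ('o2, 'a2, 'p2, 'c2) cofun" where
  "bar_arr f = \<lparr>cf_dom = bar_ob (Dom (cat0 D) f), cf_cod = bar_ob (Cod (cat0 D) f),
     cf_arr = fa F f, cf_cell = fc F (cid D f)\<rparr>"

definition bar_pro :: "'p \<Rightarrow> ('o2, 'p2, 'c2) bimod" where
  "bar_pro m = \<lparr>bm_src = bar_ob (psrc D m), bm_tgt = bar_ob (ptgt D m), bm_pro = fp F m,
     bm_lact = lax_id_left D E F m, bm_ract = lax_id_right D E F m\<rparr>"

definition bar_cell :: "'c \<Rightarrow> ('o2, 'a2, 'p2, 'c2) bicell" where
  "bar_cell \<theta> = \<lparr>bc_dom = bar_pro (Dom (cat1 D) \<theta>), bc_cod = bar_pro (Cod (cat1 D) \<theta>),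
     bc_src = bar_arr (csrc D \<theta>), bc_tgt = bar_arr (ctgt D \<theta>), bc_cell = fc F \<theta>\<rparr>"

definition bar_lax :: "'p \<Rightarrow> 'p \<Rightarrow> ('o2, 'a2, 'p2, 'c2) bicell" where
  "bar_lax m n =
     glob_bicell E (tensor E q (bar_pro m) (bar_pro n)) (bar_pro (m \<odot>\<^sub>p\<^bsub>D\<^esub> n))
       (THE \<kappa>. \<kappa> \<in> Glob E (tensor_pro E q (bar_pro m) (bar_pro n)) (fp F (m \<odot>\<^sub>p\<^bsub>D\<^esub> n))
          \<and> q (bar_pro m) (bar_pro n) \<cdot>\<^sub>1 \<kappa> = lax F m n)"

text \<open>This is \<open>Mod(F)\<eta>\<close>.\<close>

definition bar_fun ::
  "('o, 'a, 'p, 'c, ('o2, 'p2, 'c2) catobj, ('o2, 'a2, 'p2, 'c2) cofun,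
    ('o2, 'p2, 'c2) bimod, ('o2, 'a2, 'p2, 'c2) bicell) laxfun" where
  "bar_fun = restrict_laxfun D
     \<lparr>fo = bar_ob, fa = bar_arr, fp = bar_pro, fc = bar_cell, lax = bar_lax,
      un = (\<lambda>x. bicell_id E (unit_bimod (bar_ob x)))\<rparr>"

end

definition bar_tob ::
  "('o, 'a, 'p, 'c, 'o2, 'a2, 'p2, 'c2) laxtrans \<Rightarrow> 'o \<Rightarrow> ('o2, 'a2, 'p2, 'c2) cofun" where
  "bar_tob \<alpha> x = \<lparr>cf_dom = bar_ob (tdom \<alpha>) x, cf_cod = bar_ob (tcod \<alpha>) x,
     cf_arr = tob \<alpha> x, cf_cell = tpro \<alpha> (pid D x)\<rparr>"

definition bar_tpro ::
  "('o, 'a, 'p, 'c, 'o2, 'a2, 'p2, 'c2) laxtrans \<Rightarrow> 'p \<Rightarrow> ('o2, 'a2, 'p2, 'c2) bicell" where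
  "bar_tpro \<alpha> m = \<lparr>bc_dom = bar_pro (tdom \<alpha>) m, bc_cod = bar_pro (tcod \<alpha>) m,
     bc_src = bar_tob \<alpha> (psrc D m), bc_tgt = bar_tob \<alpha> (ptgt D m), bc_cell = tpro \<alpha> m\<rparr>"

definition bar_tarr ::
  "('o, 'a, 'p, 'c, 'o2, 'a2, 'p2, 'c2) laxtrans \<Rightarrow> 'a \<Rightarrow> ('o2, 'a2, 'p2, 'c2) bicell" where
  "bar_tarr \<alpha> f =
    (let F = tdom \<alpha>; G = tcod \<alpha>; x = Dom (cat0 D) f; y = Cod (cat0 D) f in
     \<lparr>bc_dom = unit_bimod (bar_ob F x), bc_cod = bar_pro G (pid D y),
      bc_src = cofun_comp E (bar_tob \<alpha> x) (bar_arr G f),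
      bc_tgt = cofun_comp E (bar_arr F f) (bar_tob \<alpha> y),
      bc_cell = inv\<^sub>1 (lunit E (fp F (pid D x)))
        \<cdot>\<^sub>1 (tarr \<alpha> f \<odot> (fc F (cid D f) \<cdot>\<^sub>1 tpro \<alpha> (pid D y))) \<cdot>\<^sub>1 lax_id_id D E G y\<rparr>)"

definition bar_trans ::
  "('o, 'a, 'p, 'c, 'o2, 'a2, 'p2, 'c2) laxtrans
   \<Rightarrow> ('o, 'a, 'p, 'c, ('o2, 'p2, 'c2) catobj, ('o2, 'a2, 'p2, 'c2) cofun,
       ('o2, 'p2, 'c2) bimod, ('o2, 'a2, 'p2, 'c2) bicell) laxtrans" where
  "bar_trans \<alpha> = restrict_laxtrans D
     \<lparr>tdom = bar_fun (tdom \<alpha>), tcod = bar_fun (tcod \<alpha>),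
      tob = bar_tob \<alpha>, tpro = bar_tpro \<alpha>, tarr = bar_tarr \<alpha>\<rparr>"

end

end

(*
  A transformation between unitary lax functors H, K into Mod(E) is determined by its underlying
  cells. This is clear for its components at objects and proarrows, since unitarity forces the
  functor part of alpha_x to be alpha at the identity proarrow of x. The component alpha_f is a cell
  out of a unit bimodule, that is, out of a category object acting on itself, so equivariance
  recovers it from its restriction along the unit upsilon, which is the component of the image of
  alpha in Lax(D, E). Conversely, a cell into a bimodule extends along upsilon by acting with it on
  one side, and the extension is equivariant as soon as acting on the left and on the right agree;
  for a lax transformation F => G the two sides are the two formulas for the bar of alpha at f, and
  they agree by the naturality axiom (1).

  The associativity laws of category objects, bimodules, tensor products and laxators all have the
  shape of a square on the associator. Five such squares are the edges of a pentagon, and four of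
  them imply the fifth up to whiskering by a cell that can be cancelled (an epimorphic coequalizer
  cell, or nothing at all).
*)
theory Submission
  imports Defs
begin


section \<open>Rewriting and cancellation of isomorphisms in categories\<close>

section \<open>Categories\<close>

text \<open>The structure of Mod(E) in the axioms of lax functors and transformations (tensor
  products, associator, unit isomorphisms) is defined by definite description through coequalizers.
  Each piece gets a characterizing equation after precomposition with coequalizer cells, and
  equations in Mod(E) are compared with equations in E by cancelling these cells. Cancellation must
  work against cells over arbitrary arrows, while local coequalizers are universal only among
  globular cells; cartesian lifts in the equipment close this gap.

  Unit isomorphisms that informal formulas suppress are absorbed into \<open>lcomp\<close> and
  \<open>rcomp\<close>, the left and right action of a cell out of a unit. Their associativity, unit
  and naturality laws serve both the category of lax functors and the extension of cells along
  units.

  Comparing axioms one by one shows that suitably typed data form a transformation into Mod(E)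
  exactly when their image is one into E. Identities, composites and the functoriality of the
  inverse are read off from images, by injectivity.\<close>

context category
begin

lemma arr_id [simp]: "x \<in> Obj C \<Longrightarrow> Id C x \<in> Arr C"
  and dom_id [simp]: "x \<in> Obj C \<Longrightarrow> Dom C (Id C x) = x"
  and cod_id [simp]: "x \<in> Obj C \<Longrightarrow> Cod C (Id C x) = x"
  using id_closed[of x] by (auto simp: Hom_def)

lemma
  assumes "f \<in> Arr C" "g \<in> Arr C" "Cod C f = Dom C g"
  shows arr_comp [simp]: "f \<cdot> g \<in> Arr C"
    and dom_comp [simp]: "Dom C (f \<cdot> g) = Dom C f"
    and cod_comp [simp]: "Cod C (f \<cdot> g) = Cod C g"
  using assms comp_closed[of f "Dom C f" "Cod C f" g "Cod C g"] by (auto simp: Hom_def)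

lemma comp_id_left [simp]: "\<lbrakk>f \<in> Arr C; Dom C f = x\<rbrakk> \<Longrightarrow> Id C x \<cdot> f = f"
  using id_left[of f x "Cod C f"] by (auto simp: Hom_def)

lemma comp_id_right [simp]: "\<lbrakk>f \<in> Arr C; Cod C f = x\<rbrakk> \<Longrightarrow> f \<cdot> Id C x = f"
  using id_right[of f "Dom C f" x] by (auto simp: Hom_def)

lemma assoc [simp]:
  "\<lbrakk>f \<in> Arr C; g \<in> Arr C; h \<in> Arr C; Cod C f = Dom C g; Cod C g = Dom C h\<rbrakk>
    \<Longrightarrow> (f \<cdot> g) \<cdot> h = f \<cdot> (g \<cdot> h)"
  using comp_assoc[of f "Dom C f" "Dom C g" g "Dom C h" h "Cod C h"] by (auto simp: Hom_def)

declare dom_closed [simp] cod_closed [simp]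

lemma inverse_arrows_unique:
  assumes "inverse_arrows C f g" "inverse_arrows C f h"
  shows "g = h"
proof -
  have *: "f \<in> Arr C" "g \<in> Arr C" "h \<in> Arr C" "Dom C g = Cod C f" "Cod C g = Dom C f"
    "Dom C h = Cod C f" "Cod C h = Dom C f" "h \<cdot> f = Id C (Cod C f)" "f \<cdot> g = Id C (Dom C f)"
    using assms by (auto simp: inverse_arrows_def Hom_def)
  then have "h \<cdot> (f \<cdot> g) = (h \<cdot> f) \<cdot> g"
    by (subst assoc) simp_all
  with * show ?thesis by simp
qed

text \<open>\<open>inv_arrow\<close> is a definite description, so it is evaluated by exhibiting
  some inverse. For the unit isomorphisms of \<open>Mod E q\<close> this is how an explicit inverse
  replaces the abstract one.\<close>

lemma inv_arrow_eq: "inverse_arrows C f g \<Longrightarrow> inv_arrow C f = g"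
  unfolding inv_arrow_def using inverse_arrows_unique by blast

lemma inverse_arrows_inv: "iso_arrow C f \<Longrightarrow> inverse_arrows C f (inv_arrow C f)"
  unfolding iso_arrow_def using inv_arrow_eq by auto

lemma
  assumes "iso_arrow C f"
  shows arr_inv [simp]: "inv_arrow C f \<in> Arr C"
    and dom_inv [simp]: "Dom C (inv_arrow C f) = Cod C f"
    and cod_inv [simp]: "Cod C (inv_arrow C f) = Dom C f"
    and comp_inv [simp]: "f \<cdot> inv_arrow C f = Id C (Dom C f)"
    and inv_comp [simp]: "inv_arrow C f \<cdot> f = Id C (Cod C f)"
    and iso_arr: "f \<in> Arr C"
  using inverse_arrows_inv[OF assms] by (auto simp: inverse_arrows_def Hom_def)

lemma comp_inv' [simp]:
  assumes "iso_arrow C f" "g \<in> Arr C" "Dom C g = Dom C f"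
  shows "f \<cdot> (inv_arrow C f \<cdot> g) = g"
  using assms assoc[of f "inv_arrow C f" g] iso_arr by simp

lemma inv_comp' [simp]:
  assumes "iso_arrow C f" "g \<in> Arr C" "Dom C g = Cod C f"
  shows "inv_arrow C f \<cdot> (f \<cdot> g) = g"
  using assms assoc[of "inv_arrow C f" f g] iso_arr by simp

lemma iso_cancel:
  assumes "iso_arrow C f" "g \<in> Arr C" "Dom C g = Cod C f" "h \<in> Arr C" "Dom C h = Cod C f"
    and "f \<cdot> g = f \<cdot> h"
  shows "g = h"
  using assms by (metis inv_comp')

lemma iso_cancel_right:
  assumes "iso_arrow C f" "g \<in> Arr C" "Cod C g = Dom C f" "h \<in> Arr C" "Cod C h = Dom C f"
    and "g \<cdot> f = h \<cdot> f"
  shows "g = h"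
proof -
  have "(g \<cdot> f) \<cdot> inv_arrow C f = (h \<cdot> f) \<cdot> inv_arrow C f"
    using assms(6) by (rule arg_cong)
  with assms(1-5) show ?thesis by (simp add: iso_arr)
qed

end

context cat_functor
begin

lemma [simp]: "x \<in> Obj A \<Longrightarrow> Fo x \<in> Obj B"
  by (rule obj_closed)

lemma
  assumes "f \<in> Arr A"
  shows arr_map [simp]: "Fa f \<in> Arr B"
    and dom_map [simp]: "Dom B (Fa f) = Fo (Dom A f)"
    and cod_map [simp]: "Cod B (Fa f) = Fo (Cod A f)"
  using assms arr_closed[of f "Dom A f" "Cod A f"] by (auto simp: Hom_def)

lemma map_id [simp]: "x \<in> Obj A \<Longrightarrow> Fa (Id A x) = Id B (Fo x)"
  by (rule pres_id)

lemma map_comp: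
  "\<lbrakk>f \<in> Arr A; g \<in> Arr A; Cod A f = Dom A g\<rbrakk> \<Longrightarrow> Fa (f \<cdot>\<^bsub>A\<^esub> g) = Fa f \<cdot>\<^bsub>B\<^esub> Fa g"
  using pres_comp[of f "Dom A f" "Cod A f" g "Cod A g"] by (auto simp: Hom_def)

end


section \<open>Boundaries, interchange and naturality in a double category\<close>

section \<open>Double categories\<close>

context double_category
begin

declare source.map_comp [simp] target.map_comp [simp] unit.map_comp [simp]

lemma CellsI:
  "\<lbrakk>\<alpha> \<in> Arr (cat1 D); Dom (cat1 D) \<alpha> = m; Cod (cat1 D) \<alpha> = n; csrc D \<alpha> = f; ctgt D \<alpha> = g\<rbrakk>
    \<Longrightarrow> \<alpha> \<in> Cells D m n f g"
  by (simp add: Cells_def Hom_def)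

lemma
  assumes "x \<in> Obj (cat0 D)"
  shows pid_pro [simp]: "pid D x \<in> Obj (cat1 D)"
    and psrc_pid [simp]: "psrc D (pid D x) = x"
    and ptgt_pid [simp]: "ptgt D (pid D x) = x"
  using pid_closed[OF assms] by (auto simp: Pro_def)

lemma
  assumes "f \<in> Arr (cat0 D)"
  shows csrc_cid [simp]: "csrc D (cid D f) = f"
    and ctgt_cid [simp]: "ctgt D (cid D f) = f"
  using assms cid_closed[of f "Dom (cat0 D) f" "Cod (cat0 D) f"]
  by (auto simp: Cells_def Hom_def)

lemma
  assumes "m \<in> Obj (cat1 D)" "n \<in> Obj (cat1 D)" "ptgt D m = psrc D n"
  shows pcomp_pro [simp]: "m \<odot>\<^sub>p n \<in> Obj (cat1 D)"
    and psrc_pcomp [simp]: "psrc D (m \<odot>\<^sub>p n) = psrc D m"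
    and ptgt_pcomp [simp]: "ptgt D (m \<odot>\<^sub>p n) = ptgt D n"
    and hcomp_vid: "\<one>\<^sub>1 m \<odot> \<one>\<^sub>1 n = \<one>\<^sub>1 (m \<odot>\<^sub>p n)"
  using assms pcomp_closed[of m "psrc D m" "ptgt D m" n "ptgt D n"]
    hcomp_id[of m "psrc D m" "ptgt D m" n "ptgt D n"]
  by (auto simp: Pro_def)

lemma
  assumes "\<alpha> \<in> Arr (cat1 D)" "\<beta> \<in> Arr (cat1 D)" "ctgt D \<alpha> = csrc D \<beta>"
  shows hcomp_cell [simp]: "\<alpha> \<odot> \<beta> \<in> Arr (cat1 D)"
    and dom_hcomp [simp]: "Dom (cat1 D) (\<alpha> \<odot> \<beta>) = Dom (cat1 D) \<alpha> \<odot>\<^sub>p Dom (cat1 D) \<beta>"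
    and cod_hcomp [simp]: "Cod (cat1 D) (\<alpha> \<odot> \<beta>) = Cod (cat1 D) \<alpha> \<odot>\<^sub>p Cod (cat1 D) \<beta>"
    and csrc_hcomp [simp]: "csrc D (\<alpha> \<odot> \<beta>) = csrc D \<alpha>"
    and ctgt_hcomp [simp]: "ctgt D (\<alpha> \<odot> \<beta>) = ctgt D \<beta>"
  using assms hcomp_closed[OF CellsI[OF assms(1) refl refl refl refl]
      CellsI[OF assms(2) refl refl assms(3)[symmetric] refl]]
  by (auto simp: Cells_def Hom_def)

text \<open>Interchange is oriented towards fewer external composites, so that as a rewrite rule it
  merges neighbouring whiskerings into one.\<close>

lemma hcomp_vcomp:
  assumes "\<alpha> \<in> Arr (cat1 D)" "\<beta> \<in> Arr (cat1 D)" "ctgt D \<alpha> = csrc D \<beta>"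
    and "\<alpha>' \<in> Arr (cat1 D)" "\<beta>' \<in> Arr (cat1 D)" "ctgt D \<alpha>' = csrc D \<beta>'"
    and "Cod (cat1 D) \<alpha> = Dom (cat1 D) \<alpha>'" "Cod (cat1 D) \<beta> = Dom (cat1 D) \<beta>'"
  shows "(\<alpha> \<odot> \<beta>) \<cdot>\<^sub>1 (\<alpha>' \<odot> \<beta>') = (\<alpha> \<cdot>\<^sub>1 \<alpha>') \<odot> (\<beta> \<cdot>\<^sub>1 \<beta>')"
  using assms interchange[OF CellsI[OF assms(1) refl refl refl refl]
      CellsI[OF assms(2) refl refl assms(3)[symmetric] refl]
      CellsI[OF assms(4) assms(7)[symmetric] refl refl refl]
      CellsI[OF assms(5) assms(8)[symmetric] refl assms(6)[symmetric] refl]]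
  by simp

text \<open>Vertical chains are normalized to bracket to the right, so interchange must also be
  available at the head of a longer chain.\<close>

lemma hcomp_vcomp':
  assumes "\<alpha> \<in> Arr (cat1 D)" "\<beta> \<in> Arr (cat1 D)" "ctgt D \<alpha> = csrc D \<beta>"
    and "\<alpha>' \<in> Arr (cat1 D)" "\<beta>' \<in> Arr (cat1 D)" "ctgt D \<alpha>' = csrc D \<beta>'"
    and "Cod (cat1 D) \<alpha> = Dom (cat1 D) \<alpha>'" "Cod (cat1 D) \<beta> = Dom (cat1 D) \<beta>'"
    and "\<gamma> \<in> Arr (cat1 D)" "Dom (cat1 D) \<gamma> = Cod (cat1 D) \<alpha>' \<odot>\<^sub>p Cod (cat1 D) \<beta>'"
  shows "(\<alpha> \<odot> \<beta>) \<cdot>\<^sub>1 ((\<alpha>' \<odot> \<beta>') \<cdot>\<^sub>1 \<gamma>) = ((\<alpha> \<cdot>\<^sub>1 \<alpha>') \<odot> (\<beta> \<cdot>\<^sub>1 \<beta>')) \<cdot>\<^sub>1 \<gamma>"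
  using assms by (simp add: hcomp_vcomp flip: source.A.assoc)

lemma
  assumes "m \<in> Obj (cat1 D)" "n \<in> Obj (cat1 D)" "p \<in> Obj (cat1 D)"
    and "ptgt D m = psrc D n" "ptgt D n = psrc D p"
  shows assoc_cell [simp]: "assoc D m n p \<in> Arr (cat1 D)"
    and dom_assoc [simp]: "Dom (cat1 D) (assoc D m n p) = (m \<odot>\<^sub>p n) \<odot>\<^sub>p p"
    and cod_assoc [simp]: "Cod (cat1 D) (assoc D m n p) = m \<odot>\<^sub>p (n \<odot>\<^sub>p p)"
    and csrc_assoc [simp]: "csrc D (assoc D m n p) = \<one>\<^sub>0 (psrc D m)"
    and ctgt_assoc [simp]: "ctgt D (assoc D m n p) = \<one>\<^sub>0 (ptgt D p)"
    and iso_assoc [simp]: "iso_arrow (cat1 D) (assoc D m n p)"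
  using assms assoc_closed[of m "psrc D m" "ptgt D m" n "ptgt D n" p "ptgt D p"]
    assoc_iso[of m "psrc D m" "ptgt D m" n "ptgt D n" p "ptgt D p"]
  by (auto simp: Pro_def Cells_def Glob_def Hom_def)

lemma
  assumes "m \<in> Obj (cat1 D)"
  shows lunit_cell [simp]: "lunit D m \<in> Arr (cat1 D)"
    and dom_lunit [simp]: "Dom (cat1 D) (lunit D m) = pid D (psrc D m) \<odot>\<^sub>p m"
    and cod_lunit [simp]: "Cod (cat1 D) (lunit D m) = m"
    and csrc_lunit [simp]: "csrc D (lunit D m) = \<one>\<^sub>0 (psrc D m)"
    and ctgt_lunit [simp]: "ctgt D (lunit D m) = \<one>\<^sub>0 (ptgt D m)"
    and iso_lunit [simp]: "iso_arrow (cat1 D) (lunit D m)"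
    and runit_cell [simp]: "runit D m \<in> Arr (cat1 D)"
    and dom_runit [simp]: "Dom (cat1 D) (runit D m) = m \<odot>\<^sub>p pid D (ptgt D m)"
    and cod_runit [simp]: "Cod (cat1 D) (runit D m) = m"
    and csrc_runit [simp]: "csrc D (runit D m) = \<one>\<^sub>0 (psrc D m)"
    and ctgt_runit [simp]: "ctgt D (runit D m) = \<one>\<^sub>0 (ptgt D m)"
    and iso_runit [simp]: "iso_arrow (cat1 D) (runit D m)"
  using assms lunit_closed[of m "psrc D m" "ptgt D m"] lunit_iso[of m "psrc D m" "ptgt D m"]
    runit_closed[of m "psrc D m" "ptgt D m"] runit_iso[of m "psrc D m" "ptgt D m"]
  by (auto simp: Pro_def Cells_def Glob_def Hom_def)

text \<open>Being inverse in \<open>cat1 D\<close> says nothing directly about boundary arrows.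
  Applying the source functor to \<alpha> followed by its inverse gives an identity, and the factor
  \<open>csrc D \<alpha>\<close> drops out because it is itself an identity; likewise for
  targets.\<close>

lemma
  assumes "iso_arrow (cat1 D) \<alpha>"
  shows csrc_inv_glob: "csrc D \<alpha> = \<one>\<^sub>0 x \<Longrightarrow> x \<in> Obj (cat0 D) \<Longrightarrow> csrc D (inv\<^sub>1 \<alpha>) = \<one>\<^sub>0 x"
    and ctgt_inv_glob: "ctgt D \<alpha> = \<one>\<^sub>0 x \<Longrightarrow> x \<in> Obj (cat0 D) \<Longrightarrow> ctgt D (inv\<^sub>1 \<alpha>) = \<one>\<^sub>0 x"
proof -
  note \<alpha> = assms source.A.iso_arr[OF assms]
  show "csrc D (inv\<^sub>1 \<alpha>) = \<one>\<^sub>0 x" if x: "csrc D \<alpha> = \<one>\<^sub>0 x" "x \<in> Obj (cat0 D)"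
  proof -
    have 1: "psrc D (Dom (cat1 D) \<alpha>) = x" "psrc D (Cod (cat1 D) \<alpha>) = x"
      using source.dom_map[of \<alpha>] source.cod_map[of \<alpha>] \<alpha> x by simp_all
    have "csrc D (\<alpha> \<cdot>\<^sub>1 inv\<^sub>1 \<alpha>) = \<one>\<^sub>0 x \<cdot>\<^sub>0 csrc D (inv\<^sub>1 \<alpha>)"
      using \<alpha> x by (subst source.map_comp) simp_all
    then show ?thesis
      using \<alpha> 1 x by simp
  qed
  show "ctgt D (inv\<^sub>1 \<alpha>) = \<one>\<^sub>0 x" if x: "ctgt D \<alpha> = \<one>\<^sub>0 x" "x \<in> Obj (cat0 D)"
  proof -
    have 1: "ptgt D (Dom (cat1 D) \<alpha>) = x" "ptgt D (Cod (cat1 D) \<alpha>) = x"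
      using target.dom_map[of \<alpha>] target.cod_map[of \<alpha>] \<alpha> x by simp_all
    have "ctgt D (\<alpha> \<cdot>\<^sub>1 inv\<^sub>1 \<alpha>) = \<one>\<^sub>0 x \<cdot>\<^sub>0 ctgt D (inv\<^sub>1 \<alpha>)"
      using \<alpha> x by (subst target.map_comp) simp_all
    then show ?thesis
      using \<alpha> 1 x by simp
  qed
qed

lemma
  assumes "m \<in> Obj (cat1 D)"
  shows csrc_lunit_inv [simp]: "csrc D (inv\<^sub>1 (lunit D m)) = \<one>\<^sub>0 (psrc D m)"
    and ctgt_lunit_inv [simp]: "ctgt D (inv\<^sub>1 (lunit D m)) = \<one>\<^sub>0 (ptgt D m)"
    and csrc_runit_inv [simp]: "csrc D (inv\<^sub>1 (runit D m)) = \<one>\<^sub>0 (psrc D m)"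
    and ctgt_runit_inv [simp]: "ctgt D (inv\<^sub>1 (runit D m)) = \<one>\<^sub>0 (ptgt D m)"
  using assms by (simp_all add: csrc_inv_glob ctgt_inv_glob)

lemma
  assumes "m \<in> Obj (cat1 D)" "n \<in> Obj (cat1 D)" "p \<in> Obj (cat1 D)"
    and "ptgt D m = psrc D n" "ptgt D n = psrc D p"
  shows csrc_assoc_inv [simp]: "csrc D (inv\<^sub>1 (assoc D m n p)) = \<one>\<^sub>0 (psrc D m)"
    and ctgt_assoc_inv [simp]: "ctgt D (inv\<^sub>1 (assoc D m n p)) = \<one>\<^sub>0 (ptgt D p)"
  using assms by (simp_all add: csrc_inv_glob ctgt_inv_glob)

lemma assoc_nat:
  assumes "\<alpha> \<in> Arr (cat1 D)" "\<beta> \<in> Arr (cat1 D)" "\<gamma> \<in> Arr (cat1 D)"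
    and "ctgt D \<alpha> = csrc D \<beta>" "ctgt D \<beta> = csrc D \<gamma>"
    and "Cod (cat1 D) \<alpha> = m" "Cod (cat1 D) \<beta> = n" "Cod (cat1 D) \<gamma> = p"
  shows "((\<alpha> \<odot> \<beta>) \<odot> \<gamma>) \<cdot>\<^sub>1 assoc D m n p
    = assoc D (Dom (cat1 D) \<alpha>) (Dom (cat1 D) \<beta>) (Dom (cat1 D) \<gamma>) \<cdot>\<^sub>1 (\<alpha> \<odot> (\<beta> \<odot> \<gamma>))"
  using assoc_natural[OF CellsI[OF assms(1) refl assms(6) refl refl]
      CellsI[OF assms(2) refl assms(7) assms(4)[symmetric] refl]
      CellsI[OF assms(3) refl assms(8) assms(5)[symmetric] refl]] .

lemma psrc_cod_eq: "\<lbrakk>\<alpha> \<in> Arr (cat1 D); \<beta> \<in> Arr (cat1 D); ctgt D \<alpha> = csrc D \<beta>\<rbrakk>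
    \<Longrightarrow> ptgt D (Dom (cat1 D) \<alpha>) = psrc D (Dom (cat1 D) \<beta>)
      \<and> ptgt D (Cod (cat1 D) \<alpha>) = psrc D (Cod (cat1 D) \<beta>)"
  by (metis source.cod_map source.dom_map target.cod_map target.dom_map)

text \<open>Stated as an equivalence with \<open>True\<close> so that simp settles matching
  conditions of this shape instead of rewriting one side of the equation into the other.\<close>

lemma ptgt_dom [simp]: "\<lbrakk>\<alpha> \<in> Arr (cat1 D); \<beta> \<in> Arr (cat1 D); ctgt D \<alpha> = csrc D \<beta>\<rbrakk>
    \<Longrightarrow> ptgt D (Dom (cat1 D) \<alpha>) = psrc D (Dom (cat1 D) \<beta>) \<longleftrightarrow> True"
  by (simp add: psrc_cod_eq)

lemma lunit_nat:
  assumes "\<alpha> \<in> Arr (cat1 D)" "csrc D \<alpha> = f" "Cod (cat1 D) \<alpha> = n"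
  shows "(cid D f \<odot> \<alpha>) \<cdot>\<^sub>1 lunit D n = lunit D (Dom (cat1 D) \<alpha>) \<cdot>\<^sub>1 \<alpha>"
  using lunit_natural[OF CellsI[OF assms(1) refl assms(3,2) refl]] .

lemma runit_nat:
  assumes "\<alpha> \<in> Arr (cat1 D)" "ctgt D \<alpha> = f" "Cod (cat1 D) \<alpha> = n"
  shows "(\<alpha> \<odot> cid D f) \<cdot>\<^sub>1 runit D n = runit D (Dom (cat1 D) \<alpha>) \<cdot>\<^sub>1 \<alpha>"
  using runit_natural[OF CellsI[OF assms(1) refl assms(3) refl assms(2)]] .

lemma pent:
  assumes "m \<in> Obj (cat1 D)" "n \<in> Obj (cat1 D)" "p \<in> Obj (cat1 D)" "r \<in> Obj (cat1 D)"
    and "ptgt D m = psrc D n" "ptgt D n = psrc D p" "ptgt D p = psrc D r"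
  shows "assoc D (m \<odot>\<^sub>p n) p r \<cdot>\<^sub>1 assoc D m n (p \<odot>\<^sub>p r)
        = (assoc D m n p \<odot> \<one>\<^sub>1 r) \<cdot>\<^sub>1 (assoc D m (n \<odot>\<^sub>p p) r \<cdot>\<^sub>1 (\<one>\<^sub>1 m \<odot> assoc D n p r))"
  using assms pentagon[of m "psrc D m" "ptgt D m" n "ptgt D n" p "ptgt D p" r "ptgt D r"]
  by (simp add: Pro_def)

lemma tri:
  assumes "m \<in> Obj (cat1 D)" "n \<in> Obj (cat1 D)" "ptgt D m = x" "psrc D n = x"
  shows "assoc D m (pid D x) n \<cdot>\<^sub>1 (\<one>\<^sub>1 m \<odot> lunit D n) = runit D m \<odot> \<one>\<^sub>1 n"
  using assms triangle[of m "psrc D m" x n "ptgt D n"] by (simp add: Pro_def)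

end


section \<open>Unit coherence derived from pentagon and triangle\<close>

context double_category
begin

subsection \<open>Coherence\<close>

lemma assoc_nat':
  assumes "\<alpha> \<in> Arr (cat1 D)" "\<beta> \<in> Arr (cat1 D)" "\<gamma> \<in> Arr (cat1 D)"
    and "ctgt D \<alpha> = csrc D \<beta>" "ctgt D \<beta> = csrc D \<gamma>"
    and "Cod (cat1 D) \<alpha> = m" "Cod (cat1 D) \<beta> = n" "Cod (cat1 D) \<gamma> = p"
    and "\<delta> \<in> Arr (cat1 D)" "Dom (cat1 D) \<delta> = m \<odot>\<^sub>p (n \<odot>\<^sub>p p)"
  shows "((\<alpha> \<odot> \<beta>) \<odot> \<gamma>) \<cdot>\<^sub>1 (assoc D m n p \<cdot>\<^sub>1 \<delta>)
    = assoc D (Dom (cat1 D) \<alpha>) (Dom (cat1 D) \<beta>) (Dom (cat1 D) \<gamma>) \<cdot>\<^sub>1 ((\<alpha> \<odot> (\<beta> \<odot> \<gamma>)) \<cdot>\<^sub>1 \<delta>)"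
proof -
  have "ptgt D m = psrc D n" "ptgt D n = psrc D p" "m \<in> Obj (cat1 D)" "n \<in> Obj (cat1 D)"
    "p \<in> Obj (cat1 D)"
    using assms psrc_cod_eq[of \<alpha> \<beta>] psrc_cod_eq[of \<beta> \<gamma>] by auto
  with assms show ?thesis
    using arg_cong[OF assoc_nat[OF assms(1-8)], of "\<lambda>t. t \<cdot>\<^sub>1 \<delta>"] by simp
qed

lemma Glob_D:
  assumes "\<alpha> \<in> Glob D m n"
  shows "\<alpha> \<in> Arr (cat1 D)" "Dom (cat1 D) \<alpha> = m" "Cod (cat1 D) \<alpha> = n"
    "csrc D \<alpha> = \<one>\<^sub>0 (psrc D m)" "ctgt D \<alpha> = \<one>\<^sub>0 (ptgt D m)"
    "m \<in> Obj (cat1 D)" "n \<in> Obj (cat1 D)" "psrc D n = psrc D m" "ptgt D n = ptgt D m"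
proof -
  show *: "\<alpha> \<in> Arr (cat1 D)" "Dom (cat1 D) \<alpha> = m" "Cod (cat1 D) \<alpha> = n"
    "csrc D \<alpha> = \<one>\<^sub>0 (psrc D m)" "ctgt D \<alpha> = \<one>\<^sub>0 (ptgt D m)"
    using assms by (auto simp: Glob_def Cells_def Hom_def)
  show **: "m \<in> Obj (cat1 D)" "n \<in> Obj (cat1 D)"
    using * source.A.dom_closed source.A.cod_closed by auto
  show "psrc D n = psrc D m" "ptgt D n = ptgt D m"
    using source.cod_map[of \<alpha>] target.cod_map[of \<alpha>] * ** by simp_all
qed

lemma GlobI:
  assumes "\<alpha> \<in> Arr (cat1 D)" "Dom (cat1 D) \<alpha> = m" "Cod (cat1 D) \<alpha> = n"
    "csrc D \<alpha> = \<one>\<^sub>0 (psrc D m)" "ctgt D \<alpha> = \<one>\<^sub>0 (ptgt D m)"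
  shows "\<alpha> \<in> Glob D m n"
  using assms by (auto simp: Glob_def Cells_def Hom_def)

lemma iso_hcomp_vid:
  assumes "iso_arrow (cat1 D) \<alpha>" "p \<in> Obj (cat1 D)" "ctgt D \<alpha> = \<one>\<^sub>0 (psrc D p)"
  shows "iso_arrow (cat1 D) (\<alpha> \<odot> \<one>\<^sub>1 p)"
proof -
  have [simp]: "\<alpha> \<in> Arr (cat1 D)" "ctgt D (inv\<^sub>1 \<alpha>) = \<one>\<^sub>0 (psrc D p)"
    "ptgt D (Dom (cat1 D) \<alpha>) = psrc D p" "ptgt D (Cod (cat1 D) \<alpha>) = psrc D p"
    using assms source.A.iso_arr ctgt_inv_glob psrc_cod_eq[of \<alpha> "\<one>\<^sub>1 p"] by simp_all
  have "inverse_arrows (cat1 D) (\<alpha> \<odot> \<one>\<^sub>1 p) (inv\<^sub>1 \<alpha> \<odot> \<one>\<^sub>1 p)"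
    using assms by (simp add: inverse_arrows_def Hom_def hcomp_vcomp hcomp_vid)
  then show ?thesis unfolding iso_arrow_def by blast
qed

text \<open>Naturality of the left unit isomorphism expresses \<open>lunit D m\<close> followed by
  \<alpha> through the whiskered cell, and the isomorphism cancels. Coherence equations that are
  first obtained under a whiskering by a unit are brought down in this way.\<close>

lemma pid_hcomp_faithful:
  assumes "\<alpha> \<in> Glob D m n" "\<beta> \<in> Glob D m n" "psrc D m = x" "\<one>\<^sub>1 (pid D x) \<odot> \<alpha> = \<one>\<^sub>1 (pid D x) \<odot> \<beta>"
  shows "\<alpha> = \<beta>"
proof -
  note [simp] = Glob_D[OF assms(1)] Glob_D[OF assms(2)] assms(3)
  have [simp]: "x \<in> Obj (cat0 D)" using source.obj_closed[of m] by simp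
  have "lunit D m \<cdot>\<^sub>1 \<alpha> = (\<one>\<^sub>1 (pid D x) \<odot> \<alpha>) \<cdot>\<^sub>1 lunit D n"
    using lunit_nat[of \<alpha> "\<one>\<^sub>0 x" n] by simp
  also have "\<dots> = lunit D m \<cdot>\<^sub>1 \<beta>"
    using lunit_nat[of \<beta> "\<one>\<^sub>0 x" n] assms(4) by simp
  finally show ?thesis
    by (rule source.A.iso_cancel[rotated -1]) simp_all
qed

lemma hcomp_pid_faithful:
  assumes "\<alpha> \<in> Glob D m n" "\<beta> \<in> Glob D m n" "ptgt D m = x" "\<alpha> \<odot> \<one>\<^sub>1 (pid D x) = \<beta> \<odot> \<one>\<^sub>1 (pid D x)"
  shows "\<alpha> = \<beta>"
proof -
  note [simp] = Glob_D[OF assms(1)] Glob_D[OF assms(2)] assms(3)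
  have [simp]: "x \<in> Obj (cat0 D)" using target.obj_closed[of m] by simp
  have "runit D m \<cdot>\<^sub>1 \<alpha> = (\<alpha> \<odot> \<one>\<^sub>1 (pid D x)) \<cdot>\<^sub>1 runit D n"
    using runit_nat[of \<alpha> "\<one>\<^sub>0 x" n] by simp
  also have "\<dots> = runit D m \<cdot>\<^sub>1 \<beta>"
    using runit_nat[of \<beta> "\<one>\<^sub>0 x" n] assms(4) by simp
  finally show ?thesis
    by (rule source.A.iso_cancel[rotated -1]) simp_all
qed

text \<open>Kelly's argument: the triangle at \<open>(id, m)\<close> inside the pentagon at \<open>(id, id, m, n)\<close>.\<close>

lemma assoc_lunit:
  assumes [simp]: "m \<in> Obj (cat1 D)" "n \<in> Obj (cat1 D)" "ptgt D m = psrc D n" "psrc D m = x"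
  shows "assoc D (pid D x) m n \<cdot>\<^sub>1 lunit D (m \<odot>\<^sub>p n) = lunit D m \<odot> \<one>\<^sub>1 n"
proof -
  let ?i = "pid D x"
  have [simp]: "x \<in> Obj (cat0 D)" using source.obj_closed[of m] by simp
  let ?P = "(assoc D ?i ?i m \<odot> \<one>\<^sub>1 n) \<cdot>\<^sub>1 assoc D ?i (?i \<odot>\<^sub>p m) n"
  have "?P \<cdot>\<^sub>1 (\<one>\<^sub>1 ?i \<odot> (assoc D ?i m n \<cdot>\<^sub>1 lunit D (m \<odot>\<^sub>p n)))
      = ((assoc D ?i ?i m \<odot> \<one>\<^sub>1 n) \<cdot>\<^sub>1 (assoc D ?i (?i \<odot>\<^sub>p m) n \<cdot>\<^sub>1 (\<one>\<^sub>1 ?i \<odot> assoc D ?i m n)))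
         \<cdot>\<^sub>1 (\<one>\<^sub>1 ?i \<odot> lunit D (m \<odot>\<^sub>p n))"
    by (simp add: hcomp_vcomp)
  also have "\<dots> = assoc D (?i \<odot>\<^sub>p ?i) m n \<cdot>\<^sub>1 (assoc D ?i ?i (m \<odot>\<^sub>p n) \<cdot>\<^sub>1 (\<one>\<^sub>1 ?i \<odot> lunit D (m \<odot>\<^sub>p n)))"
    by (subst pent[symmetric]) simp_all
  also have "\<dots> = assoc D (?i \<odot>\<^sub>p ?i) m n \<cdot>\<^sub>1 (runit D ?i \<odot> (\<one>\<^sub>1 m \<odot> \<one>\<^sub>1 n))"
    by (simp add: tri hcomp_vid)
  also have "\<dots> = ((runit D ?i \<odot> \<one>\<^sub>1 m) \<odot> \<one>\<^sub>1 n) \<cdot>\<^sub>1 assoc D ?i m n"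
    by (simp add: assoc_nat)
  also have "\<dots> = ((assoc D ?i ?i m \<cdot>\<^sub>1 (\<one>\<^sub>1 ?i \<odot> lunit D m)) \<odot> (\<one>\<^sub>1 n \<cdot>\<^sub>1 \<one>\<^sub>1 n)) \<cdot>\<^sub>1 assoc D ?i m n"
    by (simp add: tri)
  also have "\<dots> = (assoc D ?i ?i m \<odot> \<one>\<^sub>1 n) \<cdot>\<^sub>1 (((\<one>\<^sub>1 ?i \<odot> lunit D m) \<odot> \<one>\<^sub>1 n) \<cdot>\<^sub>1 assoc D ?i m n)"
    by (subst hcomp_vcomp[symmetric]) simp_all
  also have "\<dots> = ?P \<cdot>\<^sub>1 (\<one>\<^sub>1 ?i \<odot> (lunit D m \<odot> \<one>\<^sub>1 n))"
    by (simp add: assoc_nat)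
  finally have *: "(assoc D ?i ?i m \<odot> \<one>\<^sub>1 n)
        \<cdot>\<^sub>1 (assoc D ?i (?i \<odot>\<^sub>p m) n \<cdot>\<^sub>1 (\<one>\<^sub>1 ?i \<odot> (assoc D ?i m n \<cdot>\<^sub>1 lunit D (m \<odot>\<^sub>p n))))
      = (assoc D ?i ?i m \<odot> \<one>\<^sub>1 n)
        \<cdot>\<^sub>1 (assoc D ?i (?i \<odot>\<^sub>p m) n \<cdot>\<^sub>1 (\<one>\<^sub>1 ?i \<odot> (lunit D m \<odot> \<one>\<^sub>1 n)))"
    by simp
  have "assoc D ?i (?i \<odot>\<^sub>p m) n \<cdot>\<^sub>1 (\<one>\<^sub>1 ?i \<odot> (assoc D ?i m n \<cdot>\<^sub>1 lunit D (m \<odot>\<^sub>p n)))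
      = assoc D ?i (?i \<odot>\<^sub>p m) n \<cdot>\<^sub>1 (\<one>\<^sub>1 ?i \<odot> (lunit D m \<odot> \<one>\<^sub>1 n))"
    by (rule source.A.iso_cancel[OF iso_hcomp_vid _ _ _ _ *]) simp_all
  then have "\<one>\<^sub>1 ?i \<odot> (assoc D ?i m n \<cdot>\<^sub>1 lunit D (m \<odot>\<^sub>p n)) = \<one>\<^sub>1 ?i \<odot> (lunit D m \<odot> \<one>\<^sub>1 n)"
    by (rule source.A.iso_cancel[rotated -1]) simp_all
  then show ?thesis
    by (rule pid_hcomp_faithful[rotated -1]) (auto intro!: GlobI)
qed

text \<open>The mirror image of \<open>assoc_lunit\<close>: the pentagon at (m, n, id, id), with
  triangles at (n, id) and at the composite of m and n with id, yields the equation whiskered by the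
  unit on the right.\<close>

lemma assoc_runit:
  assumes [simp]: "m \<in> Obj (cat1 D)" "n \<in> Obj (cat1 D)" "ptgt D m = psrc D n" "ptgt D n = x"
  shows "assoc D m n (pid D x) \<cdot>\<^sub>1 (\<one>\<^sub>1 m \<odot> runit D n) = runit D (m \<odot>\<^sub>p n)"
proof -
  let ?i = "pid D x"
  have [simp]: "x \<in> Obj (cat0 D)" using target.obj_closed[of n] by simp
  have "((assoc D m n ?i \<cdot>\<^sub>1 (\<one>\<^sub>1 m \<odot> runit D n)) \<odot> \<one>\<^sub>1 ?i) \<cdot>\<^sub>1 assoc D m n ?i
      = (assoc D m n ?i \<odot> \<one>\<^sub>1 ?i) \<cdot>\<^sub>1 (((\<one>\<^sub>1 m \<odot> runit D n) \<odot> \<one>\<^sub>1 ?i) \<cdot>\<^sub>1 assoc D m n ?i)"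
    by (simp add: hcomp_vcomp')
  also have "\<dots> = (assoc D m n ?i \<odot> \<one>\<^sub>1 ?i) \<cdot>\<^sub>1 (assoc D m (n \<odot>\<^sub>p ?i) ?i \<cdot>\<^sub>1 (\<one>\<^sub>1 m \<odot> (runit D n \<odot> \<one>\<^sub>1 ?i)))"
    by (simp add: assoc_nat)
  also have "\<dots> = ((assoc D m n ?i \<odot> \<one>\<^sub>1 ?i) \<cdot>\<^sub>1 (assoc D m (n \<odot>\<^sub>p ?i) ?i \<cdot>\<^sub>1 (\<one>\<^sub>1 m \<odot> assoc D n ?i ?i)))
      \<cdot>\<^sub>1 (\<one>\<^sub>1 m \<odot> (\<one>\<^sub>1 n \<odot> lunit D ?i))"
    by (simp add: hcomp_vcomp tri)
  also have "\<dots> = assoc D (m \<odot>\<^sub>p n) ?i ?i \<cdot>\<^sub>1 (assoc D m n (?i \<odot>\<^sub>p ?i) \<cdot>\<^sub>1 (\<one>\<^sub>1 m \<odot> (\<one>\<^sub>1 n \<odot> lunit D ?i)))"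
    by (subst pent[symmetric]) simp_all
  also have "\<dots> = assoc D (m \<odot>\<^sub>p n) ?i ?i \<cdot>\<^sub>1 (((\<one>\<^sub>1 m \<odot> \<one>\<^sub>1 n) \<odot> lunit D ?i) \<cdot>\<^sub>1 assoc D m n ?i)"
    by (simp add: assoc_nat)
  also have "\<dots> = (assoc D (m \<odot>\<^sub>p n) ?i ?i \<cdot>\<^sub>1 (\<one>\<^sub>1 (m \<odot>\<^sub>p n) \<odot> lunit D ?i)) \<cdot>\<^sub>1 assoc D m n ?i"
    by (simp add: hcomp_vid)
  also have "\<dots> = (runit D (m \<odot>\<^sub>p n) \<odot> \<one>\<^sub>1 ?i) \<cdot>\<^sub>1 assoc D m n ?i"
    by (subst tri) simp_all
  finally have "(assoc D m n ?i \<cdot>\<^sub>1 (\<one>\<^sub>1 m \<odot> runit D n)) \<odot> \<one>\<^sub>1 ?i = runit D (m \<odot>\<^sub>p n) \<odot> \<one>\<^sub>1 ?i"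
    by (rule source.A.iso_cancel_right[rotated -1]) simp_all
  then show ?thesis
    by (rule hcomp_pid_faithful[rotated -1]) (auto intro!: GlobI)
qed

text \<open>Naturality of \<open>lunit\<close> at itself shows that whiskering \<open>lunit\<close>
  at the unit on the left gives \<open>lunit\<close> at the composite of two units. Triangle and
  \<open>assoc_lunit\<close> then make the two unit isomorphisms agree after whiskering on the
  right, hence agree. Left and right products of cells out of units coincide for this
  reason.\<close>

lemma lunit_pid:
  assumes [simp]: "x \<in> Obj (cat0 D)"
  shows "runit D (pid D x) = lunit D (pid D x)"
proof -
  let ?i = "pid D x"
  have "(\<one>\<^sub>1 ?i \<odot> lunit D ?i) \<cdot>\<^sub>1 lunit D ?i = lunit D (?i \<odot>\<^sub>p ?i) \<cdot>\<^sub>1 lunit D ?i"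
    using lunit_nat[of "lunit D ?i" "\<one>\<^sub>0 x" ?i] by simp
  then have "\<one>\<^sub>1 ?i \<odot> lunit D ?i = lunit D (?i \<odot>\<^sub>p ?i)"
    by (rule source.A.iso_cancel_right[rotated -1]) simp_all
  then have "runit D ?i \<odot> \<one>\<^sub>1 ?i = lunit D ?i \<odot> \<one>\<^sub>1 ?i"
    using tri[of ?i ?i x] assoc_lunit[of ?i ?i x] by simp
  then show ?thesis
    by (rule hcomp_pid_faithful[rotated -1]) (auto intro!: GlobI)
qed


section \<open>Squares over the associator and the pentagon they span\<close>

subsection \<open>Associative squares\<close>

text \<open>
  The associativity laws for category objects, bimodules, coequalizers and laxators all have the
  following shape, where \<open>l1\<close>, \<open>l2\<close>, \<open>l3\<close>, \<open>l4\<close> multiply \<open>(m, n)\<close>, \<open>(mn, p)\<close>, \<open>(n, p)\<close> and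
  \<open>(m, np)\<close>.
\<close>

definition assoc_square :: "'c \<times> 'c \<Rightarrow> 'c \<times> 'c \<Rightarrow> 'p \<Rightarrow> 'p \<Rightarrow> 'p \<Rightarrow> bool" where
  "assoc_square l r m n p \<longleftrightarrow> (case l of (l1, l2) \<Rightarrow> case r of (l3, l4) \<Rightarrow>
     m \<in> Obj (cat1 D) \<and> n \<in> Obj (cat1 D) \<and> p \<in> Obj (cat1 D)
     \<and> ptgt D m = psrc D n \<and> ptgt D n = psrc D p
     \<and> l1 \<in> Glob D (m \<odot>\<^sub>p n) (Cod (cat1 D) l1) \<and> l3 \<in> Glob D (n \<odot>\<^sub>p p) (Cod (cat1 D) l3)
     \<and> l2 \<in> Glob D (Cod (cat1 D) l1 \<odot>\<^sub>p p) (Cod (cat1 D) l4)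
     \<and> l4 \<in> Glob D (m \<odot>\<^sub>p Cod (cat1 D) l3) (Cod (cat1 D) l4)
     \<and> (l1 \<odot> \<one>\<^sub>1 p) \<cdot>\<^sub>1 l2 = assoc D m n p \<cdot>\<^sub>1 ((\<one>\<^sub>1 m \<odot> l3) \<cdot>\<^sub>1 l4))"

lemma
  assumes "assoc_square (l1, l2) (l3, l4) m n p"
  shows assoc_squareD: "m \<in> Obj (cat1 D)" "n \<in> Obj (cat1 D)" "p \<in> Obj (cat1 D)"
    "ptgt D m = psrc D n" "ptgt D n = psrc D p"
    "l1 \<in> Arr (cat1 D)" "Dom (cat1 D) l1 = m \<odot>\<^sub>p n"
    "csrc D l1 = \<one>\<^sub>0 (psrc D m)" "ctgt D l1 = \<one>\<^sub>0 (psrc D p)"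
    "psrc D (Cod (cat1 D) l1) = psrc D m" "ptgt D (Cod (cat1 D) l1) = psrc D p"
    "l3 \<in> Arr (cat1 D)" "Dom (cat1 D) l3 = n \<odot>\<^sub>p p"
    "csrc D l3 = \<one>\<^sub>0 (psrc D n)" "ctgt D l3 = \<one>\<^sub>0 (ptgt D p)"
    "psrc D (Cod (cat1 D) l3) = psrc D n" "ptgt D (Cod (cat1 D) l3) = ptgt D p"
    "l2 \<in> Arr (cat1 D)" "Dom (cat1 D) l2 = Cod (cat1 D) l1 \<odot>\<^sub>p p"
    "Cod (cat1 D) l2 = Cod (cat1 D) l4"
    "csrc D l2 = \<one>\<^sub>0 (psrc D m)" "ctgt D l2 = \<one>\<^sub>0 (ptgt D p)"
    "l4 \<in> Arr (cat1 D)" "Dom (cat1 D) l4 = m \<odot>\<^sub>p Cod (cat1 D) l3"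
    "csrc D l4 = \<one>\<^sub>0 (psrc D m)" "ctgt D l4 = \<one>\<^sub>0 (ptgt D p)"
    "psrc D (Cod (cat1 D) l4) = psrc D m" "ptgt D (Cod (cat1 D) l4) = ptgt D p"
  and assoc_square_eq: "(l1 \<odot> \<one>\<^sub>1 p) \<cdot>\<^sub>1 l2 = assoc D m n p \<cdot>\<^sub>1 ((\<one>\<^sub>1 m \<odot> l3) \<cdot>\<^sub>1 l4)"
proof -
  show *: "m \<in> Obj (cat1 D)" "n \<in> Obj (cat1 D)" "p \<in> Obj (cat1 D)"
    "ptgt D m = psrc D n" "ptgt D n = psrc D p"
    "(l1 \<odot> \<one>\<^sub>1 p) \<cdot>\<^sub>1 l2 = assoc D m n p \<cdot>\<^sub>1 ((\<one>\<^sub>1 m \<odot> l3) \<cdot>\<^sub>1 l4)"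
    using assms by (simp_all add: assoc_square_def)
  have l1: "l1 \<in> Glob D (m \<odot>\<^sub>p n) (Cod (cat1 D) l1)"
    and l2: "l2 \<in> Glob D (Cod (cat1 D) l1 \<odot>\<^sub>p p) (Cod (cat1 D) l4)"
    and l3: "l3 \<in> Glob D (n \<odot>\<^sub>p p) (Cod (cat1 D) l3)"
    and l4: "l4 \<in> Glob D (m \<odot>\<^sub>p Cod (cat1 D) l3) (Cod (cat1 D) l4)"
    using assms by (simp_all add: assoc_square_def)
  note ** = * Glob_D[OF l1] Glob_D[OF l3]
  show "l1 \<in> Arr (cat1 D)" "Dom (cat1 D) l1 = m \<odot>\<^sub>p n"
    "csrc D l1 = \<one>\<^sub>0 (psrc D m)" "ctgt D l1 = \<one>\<^sub>0 (psrc D p)"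
    "psrc D (Cod (cat1 D) l1) = psrc D m" "ptgt D (Cod (cat1 D) l1) = psrc D p"
    "l3 \<in> Arr (cat1 D)" "Dom (cat1 D) l3 = n \<odot>\<^sub>p p"
    "csrc D l3 = \<one>\<^sub>0 (psrc D n)" "ctgt D l3 = \<one>\<^sub>0 (ptgt D p)"
    "psrc D (Cod (cat1 D) l3) = psrc D n" "ptgt D (Cod (cat1 D) l3) = ptgt D p"
    using ** by simp_all
  show "l2 \<in> Arr (cat1 D)" "Dom (cat1 D) l2 = Cod (cat1 D) l1 \<odot>\<^sub>p p"
    "Cod (cat1 D) l2 = Cod (cat1 D) l4"
    "csrc D l2 = \<one>\<^sub>0 (psrc D m)" "ctgt D l2 = \<one>\<^sub>0 (ptgt D p)"
    "l4 \<in> Arr (cat1 D)" "Dom (cat1 D) l4 = m \<odot>\<^sub>p Cod (cat1 D) l3"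
    "csrc D l4 = \<one>\<^sub>0 (psrc D m)" "ctgt D l4 = \<one>\<^sub>0 (ptgt D p)"
    "psrc D (Cod (cat1 D) l4) = psrc D m" "ptgt D (Cod (cat1 D) l4) = ptgt D p"
    using ** Glob_D[OF l2] Glob_D[OF l4] by simp_all
qed

text \<open>Naturality of the associator lets arbitrary cells \<open>a\<close>, \<open>b\<close>,
  \<open>c\<close> enter the three slots of the square. A law stated with identities thereby becomes
  a law for generalized elements, which is the form used in most computations.\<close>

lemma assoc_square_gen:
  assumes sq: "assoc_square (l1, l2) (l3, l4) m n p"
    and [simp]: "a \<in> Arr (cat1 D)" "b \<in> Arr (cat1 D)" "c \<in> Arr (cat1 D)"
      "Cod (cat1 D) a = m" "Cod (cat1 D) b = n" "Cod (cat1 D) c = p"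
      "ctgt D a = csrc D b" "ctgt D b = csrc D c"
  shows "(((a \<odot> b) \<cdot>\<^sub>1 l1) \<odot> c) \<cdot>\<^sub>1 l2
    = assoc D (Dom (cat1 D) a) (Dom (cat1 D) b) (Dom (cat1 D) c) \<cdot>\<^sub>1 ((a \<odot> ((b \<odot> c) \<cdot>\<^sub>1 l3)) \<cdot>\<^sub>1 l4)"
proof -
  note [simp] = assoc_squareD[OF sq]
  have "(((a \<odot> b) \<cdot>\<^sub>1 l1) \<odot> c) \<cdot>\<^sub>1 l2 = ((a \<odot> b) \<odot> c) \<cdot>\<^sub>1 ((l1 \<odot> \<one>\<^sub>1 p) \<cdot>\<^sub>1 l2)"
    by (simp add: hcomp_vcomp')
  also have "\<dots> = (((a \<odot> b) \<odot> c) \<cdot>\<^sub>1 assoc D m n p) \<cdot>\<^sub>1 ((\<one>\<^sub>1 m \<odot> l3) \<cdot>\<^sub>1 l4)"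
    using assoc_square_eq[OF sq] by simp
  also have "\<dots> = assoc D (Dom (cat1 D) a) (Dom (cat1 D) b) (Dom (cat1 D) c)
      \<cdot>\<^sub>1 ((a \<odot> (b \<odot> c)) \<cdot>\<^sub>1 ((\<one>\<^sub>1 m \<odot> l3) \<cdot>\<^sub>1 l4))"
    by (simp add: assoc_nat')
  finally show ?thesis
    by (simp add: hcomp_vcomp')
qed

end


text \<open>Taken in \<open>cat1\<close>, this allows cancellation against cells over arbitrary
  arrows, not only globular ones. For an arrow \<open>c\<close> the codomains of \<open>u\<close>
  and \<open>v\<close> agree as soon as the composites do.\<close>

definition epi_arrow :: "('o, 'a) cat \<Rightarrow> 'a \<Rightarrow> bool" where
  "epi_arrow C c \<longleftrightarrow> (\<forall>u \<in> Arr C. \<forall>v \<in> Arr C.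
     Dom C u = Cod C c \<and> Dom C v = Cod C c \<and> c \<cdot>\<^bsub>C\<^esub> u = c \<cdot>\<^bsub>C\<^esub> v \<longrightarrow> u = v)"

lemma epi_arrowD:
  "\<lbrakk>epi_arrow C c; c \<cdot>\<^bsub>C\<^esub> u = c \<cdot>\<^bsub>C\<^esub> v; u \<in> Arr C; v \<in> Arr C; Dom C u = Cod C c; Dom C v = Cod C c\<rbrakk>
    \<Longrightarrow> u = v"
  unfolding epi_arrow_def by blast

context double_category
begin

lemma assoc_squareI':
  assumes "m \<in> Obj (cat1 D)" "n \<in> Obj (cat1 D)" "p \<in> Obj (cat1 D)"
    "ptgt D m = psrc D n" "ptgt D n = psrc D p"
    "l1 \<in> Arr (cat1 D)" "Dom (cat1 D) l1 = m \<odot>\<^sub>p n"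
    "csrc D l1 = \<one>\<^sub>0 (psrc D m)" "ctgt D l1 = \<one>\<^sub>0 (psrc D p)"
    "l3 \<in> Arr (cat1 D)" "Dom (cat1 D) l3 = n \<odot>\<^sub>p p"
    "csrc D l3 = \<one>\<^sub>0 (psrc D n)" "ctgt D l3 = \<one>\<^sub>0 (ptgt D p)"
    "l2 \<in> Arr (cat1 D)" "Dom (cat1 D) l2 = Cod (cat1 D) l1 \<odot>\<^sub>p p"
    "csrc D l2 = \<one>\<^sub>0 (psrc D m)" "ctgt D l2 = \<one>\<^sub>0 (ptgt D p)"
    "l4 \<in> Arr (cat1 D)" "Dom (cat1 D) l4 = m \<odot>\<^sub>p Cod (cat1 D) l3"
    "csrc D l4 = \<one>\<^sub>0 (psrc D m)" "ctgt D l4 = \<one>\<^sub>0 (ptgt D p)"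
    "Cod (cat1 D) l2 = Cod (cat1 D) l4"
    "(l1 \<odot> \<one>\<^sub>1 p) \<cdot>\<^sub>1 l2 = assoc D m n p \<cdot>\<^sub>1 ((\<one>\<^sub>1 m \<odot> l3) \<cdot>\<^sub>1 l4)"
  shows "assoc_square (l1, l2) (l3, l4) m n p"
proof -
  have l1: "l1 \<in> Glob D (m \<odot>\<^sub>p n) (Cod (cat1 D) l1)"
    and l3: "l3 \<in> Glob D (n \<odot>\<^sub>p p) (Cod (cat1 D) l3)"
    using assms(1-13) by (auto intro!: GlobI)
  have "l2 \<in> Glob D (Cod (cat1 D) l1 \<odot>\<^sub>p p) (Cod (cat1 D) l4)"
    "l4 \<in> Glob D (m \<odot>\<^sub>p Cod (cat1 D) l3) (Cod (cat1 D) l4)"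
    using assms(1-22) Glob_D[OF l1] Glob_D[OF l3] by (auto intro!: GlobI)
  with l1 l3 assms show ?thesis
    by (simp add: assoc_square_def)
qed

text \<open>
  The squares at the five edges of the pentagon of bracketings of \<open>m, n, p, t\<close>; each of the
  following lemmas derives one of them, whiskered by the cells that are left over, from the other
  four.
\<close>

context
  fixes m n p t :: 'p and ab bc cd abc_l abc_r bcd_l bcd_r La Lb Lc :: 'c
begin

abbreviation (input) "sq1 \<equiv> assoc_square (ab, abc_l) (bc, abc_r) m n p"
abbreviation (input) "sq2 \<equiv> assoc_square (bc, bcd_l) (cd, bcd_r) n p t"
abbreviation (input) "sq3 \<equiv> assoc_square (abc_r, La) (bcd_l, Lb) m (Cod (cat1 D) bc) t"
abbreviation (input) "sq4 \<equiv> assoc_square (abc_l, La) (cd, Lc) (Cod (cat1 D) ab) p t"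
abbreviation (input) "sq5 \<equiv> assoc_square (ab, Lc) (bcd_r, Lb) m n (Cod (cat1 D) cd)"
abbreviation (input) "right_bracketed \<equiv> (\<one>\<^sub>1 m \<odot> ((\<one>\<^sub>1 n \<odot> cd) \<cdot>\<^sub>1 bcd_r)) \<cdot>\<^sub>1 Lb"

text \<open>Squares 4 and 5 cover the side of the pentagon with two associators, from the fully
  left-bracketed product to the right-bracketed one.\<close>

lemma pentagon_path_45:
  assumes s4: sq4 and s5: sq5
  shows "(((ab \<odot> \<one>\<^sub>1 p) \<cdot>\<^sub>1 abc_l) \<odot> \<one>\<^sub>1 t) \<cdot>\<^sub>1 La
    = assoc D (m \<odot>\<^sub>p n) p t \<cdot>\<^sub>1 (assoc D m n (p \<odot>\<^sub>p t) \<cdot>\<^sub>1 right_bracketed)"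
    and "(ab \<odot> cd) \<cdot>\<^sub>1 Lc = assoc D m n (p \<odot>\<^sub>p t) \<cdot>\<^sub>1 right_bracketed"
proof -
  note [simp] = assoc_squareD[OF s4] assoc_squareD[OF s5]
  show *: "(ab \<odot> cd) \<cdot>\<^sub>1 Lc = assoc D m n (p \<odot>\<^sub>p t) \<cdot>\<^sub>1 right_bracketed"
    using assoc_square_gen[OF s5, of "\<one>\<^sub>1 m" "\<one>\<^sub>1 n" cd] by (simp add: hcomp_vid)
  show "(((ab \<odot> \<one>\<^sub>1 p) \<cdot>\<^sub>1 abc_l) \<odot> \<one>\<^sub>1 t) \<cdot>\<^sub>1 La
    = assoc D (m \<odot>\<^sub>p n) p t \<cdot>\<^sub>1 (assoc D m n (p \<odot>\<^sub>p t) \<cdot>\<^sub>1 right_bracketed)"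
    using assoc_square_gen[OF s4, of ab "\<one>\<^sub>1 p" "\<one>\<^sub>1 t"] * by (simp add: hcomp_vid)
qed

text \<open>Squares 2 and 3 cover the side with three associators, except for its first edge: that
  edge is square 1.\<close>

lemma pentagon_path_23:
  assumes s2: sq2 and s3: sq3
  shows "(((\<one>\<^sub>1 m \<odot> bc) \<cdot>\<^sub>1 abc_r) \<odot> \<one>\<^sub>1 t) \<cdot>\<^sub>1 La
    = assoc D m (n \<odot>\<^sub>p p) t \<cdot>\<^sub>1 ((\<one>\<^sub>1 m \<odot> assoc D n p t) \<cdot>\<^sub>1 right_bracketed)"
proof -
  note [simp] = assoc_squareD[OF s2] assoc_squareD[OF s3]
  show ?thesis
    using assoc_square_gen[OF s3, of "\<one>\<^sub>1 m" bc "\<one>\<^sub>1 t"] assoc_square_eq[OF s2]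
    by (simp add: hcomp_vcomp')
qed

text \<open>Nothing is cancelled here: the whiskering by \<open>t\<close> and the tail
  \<open>La\<close> stay. With \<open>abc_l\<close> and \<open>abc_r\<close> identities and
  \<open>ab\<close>, \<open>bc\<close> the two actions at a middle category object, the conclusion
  says that \<open>La\<close> coequalizes the pair defining a tensor product, whiskered on the
  right.\<close>

lemma pentagon_sq1:
  assumes s2: sq2 and s3: sq3 and s4: sq4 and s5: sq5
  shows "(((ab \<odot> \<one>\<^sub>1 p) \<cdot>\<^sub>1 abc_l) \<odot> \<one>\<^sub>1 t) \<cdot>\<^sub>1 La
    = ((assoc D m n p \<cdot>\<^sub>1 ((\<one>\<^sub>1 m \<odot> bc) \<cdot>\<^sub>1 abc_r)) \<odot> \<one>\<^sub>1 t) \<cdot>\<^sub>1 La"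
proof -
  note [simp] = assoc_squareD[OF s2] assoc_squareD[OF s3] assoc_squareD[OF s4] assoc_squareD[OF s5]
  have "((assoc D m n p \<cdot>\<^sub>1 ((\<one>\<^sub>1 m \<odot> bc) \<cdot>\<^sub>1 abc_r)) \<odot> \<one>\<^sub>1 t) \<cdot>\<^sub>1 La
      = (assoc D m n p \<odot> \<one>\<^sub>1 t) \<cdot>\<^sub>1 ((((\<one>\<^sub>1 m \<odot> bc) \<cdot>\<^sub>1 abc_r) \<odot> \<one>\<^sub>1 t) \<cdot>\<^sub>1 La)"
    by (simp add: hcomp_vcomp')
  also have "\<dots> = ((assoc D m n p \<odot> \<one>\<^sub>1 t) \<cdot>\<^sub>1 (assoc D m (n \<odot>\<^sub>p p) t \<cdot>\<^sub>1 (\<one>\<^sub>1 m \<odot> assoc D n p t)))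
      \<cdot>\<^sub>1 right_bracketed"
    by (simp add: pentagon_path_23[OF s2 s3])
  also have "\<dots> = (assoc D (m \<odot>\<^sub>p n) p t \<cdot>\<^sub>1 assoc D m n (p \<odot>\<^sub>p t)) \<cdot>\<^sub>1 right_bracketed"
    by (subst pent) simp_all
  also have "\<dots> = (((ab \<odot> \<one>\<^sub>1 p) \<cdot>\<^sub>1 abc_l) \<odot> \<one>\<^sub>1 t) \<cdot>\<^sub>1 La"
    by (simp add: pentagon_path_45[OF s4 s5])
  finally show ?thesis by simp
qed

text \<open>In the application \<open>bc\<close> is a coequalizer cell standing between a left and a
  right action, whence the whiskering on both sides; the resulting square is the compatibility of
  the two actions on a tensor product.\<close>

lemma pentagon_sq3:
  assumes s1: sq1 and s2: sq2 and s4: sq4 and s5: sq5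
    and epi: "epi_arrow (cat1 D) ((\<one>\<^sub>1 m \<odot> bc) \<odot> \<one>\<^sub>1 t)"
  shows sq3
proof -
  note [simp] = assoc_squareD[OF s1] assoc_squareD[OF s2] assoc_squareD[OF s4] assoc_squareD[OF s5]
  have [simp]: "Cod (cat1 D) abc_l = Cod (cat1 D) abc_r" "Cod (cat1 D) bcd_l = Cod (cat1 D) bcd_r"
    "Cod (cat1 D) La = Cod (cat1 D) Lc" "Cod (cat1 D) Lc = Cod (cat1 D) Lb"
    by simp_all
  have "(assoc D m n p \<odot> \<one>\<^sub>1 t) \<cdot>\<^sub>1 (((\<one>\<^sub>1 m \<odot> bc) \<odot> \<one>\<^sub>1 t) \<cdot>\<^sub>1 ((abc_r \<odot> \<one>\<^sub>1 t) \<cdot>\<^sub>1 La))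
      = (((ab \<odot> \<one>\<^sub>1 p) \<cdot>\<^sub>1 abc_l) \<odot> \<one>\<^sub>1 t) \<cdot>\<^sub>1 La"
    by (simp add: hcomp_vcomp' assoc_square_eq[OF s1])
  also have "\<dots> = (assoc D (m \<odot>\<^sub>p n) p t \<cdot>\<^sub>1 assoc D m n (p \<odot>\<^sub>p t)) \<cdot>\<^sub>1 right_bracketed"
    by (simp add: pentagon_path_45[OF s4 s5])
  also have "\<dots> = ((assoc D m n p \<odot> \<one>\<^sub>1 t) \<cdot>\<^sub>1 (assoc D m (n \<odot>\<^sub>p p) t \<cdot>\<^sub>1 (\<one>\<^sub>1 m \<odot> assoc D n p t)))
      \<cdot>\<^sub>1 right_bracketed"
    by (subst pent) simp_all
  also have "\<dots> = (assoc D m n p \<odot> \<one>\<^sub>1 t) \<cdot>\<^sub>1 (assoc D m (n \<odot>\<^sub>p p) t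
      \<cdot>\<^sub>1 ((\<one>\<^sub>1 m \<odot> ((bc \<odot> \<one>\<^sub>1 t) \<cdot>\<^sub>1 bcd_l)) \<cdot>\<^sub>1 Lb))"
    by (simp add: hcomp_vcomp' assoc_square_eq[OF s2])
  also have "\<dots> = (assoc D m n p \<odot> \<one>\<^sub>1 t) \<cdot>\<^sub>1 (((\<one>\<^sub>1 m \<odot> bc) \<odot> \<one>\<^sub>1 t)
      \<cdot>\<^sub>1 (assoc D m (Cod (cat1 D) bc) t \<cdot>\<^sub>1 ((\<one>\<^sub>1 m \<odot> bcd_l) \<cdot>\<^sub>1 Lb)))"
    by (simp add: assoc_nat' hcomp_vcomp')
  finally have "((\<one>\<^sub>1 m \<odot> bc) \<odot> \<one>\<^sub>1 t) \<cdot>\<^sub>1 ((abc_r \<odot> \<one>\<^sub>1 t) \<cdot>\<^sub>1 La)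
      = ((\<one>\<^sub>1 m \<odot> bc) \<odot> \<one>\<^sub>1 t) \<cdot>\<^sub>1 (assoc D m (Cod (cat1 D) bc) t \<cdot>\<^sub>1 ((\<one>\<^sub>1 m \<odot> bcd_l) \<cdot>\<^sub>1 Lb))"
    by (rule source.A.iso_cancel[rotated -1]) (simp_all add: iso_hcomp_vid)
  then have "(abc_r \<odot> \<one>\<^sub>1 t) \<cdot>\<^sub>1 La
      = assoc D m (Cod (cat1 D) bc) t \<cdot>\<^sub>1 ((\<one>\<^sub>1 m \<odot> bcd_l) \<cdot>\<^sub>1 Lb)"
    by (rule epi_arrowD[OF epi]) simp_all
  then show ?thesis
    by (intro assoc_squareI') simp_all
qed

text \<open>In the applications \<open>ab\<close> is a coequalizer cell. The resulting square is
  associativity of the right action on a tensor product, or the balance of a cell that is to be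
  factored through a second tensor product.\<close>

lemma pentagon_sq4:
  assumes s1: sq1 and s2: sq2 and s3: sq3 and s5: sq5
    and epi: "epi_arrow (cat1 D) ((ab \<odot> \<one>\<^sub>1 p) \<odot> \<one>\<^sub>1 t)"
  shows sq4
proof -
  note [simp] = assoc_squareD[OF s1] assoc_squareD[OF s2] assoc_squareD[OF s3] assoc_squareD[OF s5]
  have [simp]: "Cod (cat1 D) abc_l = Cod (cat1 D) abc_r" "Cod (cat1 D) bcd_l = Cod (cat1 D) bcd_r"
    "Cod (cat1 D) La = Cod (cat1 D) Lb" "Cod (cat1 D) Lc = Cod (cat1 D) Lb"
    by simp_all
  have "((ab \<odot> \<one>\<^sub>1 p) \<odot> \<one>\<^sub>1 t) \<cdot>\<^sub>1 ((abc_l \<odot> \<one>\<^sub>1 t) \<cdot>\<^sub>1 La)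
      = (assoc D m n p \<odot> \<one>\<^sub>1 t) \<cdot>\<^sub>1 ((((\<one>\<^sub>1 m \<odot> bc) \<cdot>\<^sub>1 abc_r) \<odot> \<one>\<^sub>1 t) \<cdot>\<^sub>1 La)"
    by (simp add: hcomp_vcomp' assoc_square_eq[OF s1])
  also have "\<dots> = ((assoc D m n p \<odot> \<one>\<^sub>1 t) \<cdot>\<^sub>1 (assoc D m (n \<odot>\<^sub>p p) t \<cdot>\<^sub>1 (\<one>\<^sub>1 m \<odot> assoc D n p t)))
      \<cdot>\<^sub>1 right_bracketed"
    by (simp add: pentagon_path_23[OF s2 s3])
  also have "\<dots> = (assoc D (m \<odot>\<^sub>p n) p t \<cdot>\<^sub>1 assoc D m n (p \<odot>\<^sub>p t)) \<cdot>\<^sub>1 right_bracketed"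
    by (subst pent) simp_all
  also have "\<dots> = assoc D (m \<odot>\<^sub>p n) p t \<cdot>\<^sub>1 ((ab \<odot> cd) \<cdot>\<^sub>1 Lc)"
    using assoc_square_gen[OF s5, of "\<one>\<^sub>1 m" "\<one>\<^sub>1 n" cd] by (simp add: hcomp_vid)
  also have "\<dots> = ((ab \<odot> \<one>\<^sub>1 p) \<odot> \<one>\<^sub>1 t) \<cdot>\<^sub>1 (assoc D (Cod (cat1 D) ab) p t
      \<cdot>\<^sub>1 ((\<one>\<^sub>1 (Cod (cat1 D) ab) \<odot> cd) \<cdot>\<^sub>1 Lc))"
    by (simp add: assoc_nat' hcomp_vcomp' hcomp_vid)
  finally have "(abc_l \<odot> \<one>\<^sub>1 t) \<cdot>\<^sub>1 La = assoc D (Cod (cat1 D) ab) p t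
      \<cdot>\<^sub>1 ((\<one>\<^sub>1 (Cod (cat1 D) ab) \<odot> cd) \<cdot>\<^sub>1 Lc)"
    by (rule epi_arrowD[OF epi]) simp_all
  then show ?thesis
    by (intro assoc_squareI') simp_all
qed

text \<open>In the application \<open>cd\<close> is a coequalizer cell and the square is
  associativity of the left action on a tensor product. The associator in front is an isomorphism,
  so only the whiskered \<open>cd\<close> has to be epic.\<close>

lemma pentagon_sq5:
  assumes s1: sq1 and s2: sq2 and s3: sq3 and s4: sq4
    and epi: "epi_arrow (cat1 D) (\<one>\<^sub>1 (m \<odot>\<^sub>p n) \<odot> cd)"
  shows sq5
proof -
  note [simp] = assoc_squareD[OF s1] assoc_squareD[OF s2] assoc_squareD[OF s3] assoc_squareD[OF s4]
  have [simp]: "Cod (cat1 D) abc_l = Cod (cat1 D) abc_r" "Cod (cat1 D) bcd_l = Cod (cat1 D) bcd_r"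
    "Cod (cat1 D) La = Cod (cat1 D) Lb" "Cod (cat1 D) Lc = Cod (cat1 D) Lb"
    using assoc_squareD(20)[OF s3] assoc_squareD(20)[OF s4] by simp_all
  have "assoc D (m \<odot>\<^sub>p n) p t \<cdot>\<^sub>1 ((\<one>\<^sub>1 (m \<odot>\<^sub>p n) \<odot> cd) \<cdot>\<^sub>1 ((ab \<odot> \<one>\<^sub>1 (Cod (cat1 D) cd)) \<cdot>\<^sub>1 Lc))
      = (((ab \<odot> \<one>\<^sub>1 p) \<cdot>\<^sub>1 abc_l) \<odot> \<one>\<^sub>1 t) \<cdot>\<^sub>1 La"
    using assoc_square_gen[OF s4, of ab "\<one>\<^sub>1 p" "\<one>\<^sub>1 t"] by (simp add: hcomp_vcomp' hcomp_vid)
  also have "\<dots> = (assoc D m n p \<odot> \<one>\<^sub>1 t) \<cdot>\<^sub>1 ((((\<one>\<^sub>1 m \<odot> bc) \<cdot>\<^sub>1 abc_r) \<odot> \<one>\<^sub>1 t) \<cdot>\<^sub>1 La)"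
    by (simp add: hcomp_vcomp' assoc_square_eq[OF s1])
  also have "\<dots> = ((assoc D m n p \<odot> \<one>\<^sub>1 t) \<cdot>\<^sub>1 (assoc D m (n \<odot>\<^sub>p p) t \<cdot>\<^sub>1 (\<one>\<^sub>1 m \<odot> assoc D n p t)))
      \<cdot>\<^sub>1 right_bracketed"
    by (simp add: pentagon_path_23[OF s2 s3])
  also have "\<dots> = (assoc D (m \<odot>\<^sub>p n) p t \<cdot>\<^sub>1 assoc D m n (p \<odot>\<^sub>p t)) \<cdot>\<^sub>1 right_bracketed"
    by (subst pent) simp_all
  also have "\<dots> = assoc D (m \<odot>\<^sub>p n) p t \<cdot>\<^sub>1 ((((\<one>\<^sub>1 m \<odot> \<one>\<^sub>1 n) \<odot> cd)
      \<cdot>\<^sub>1 (assoc D m n (Cod (cat1 D) cd) \<cdot>\<^sub>1 ((\<one>\<^sub>1 m \<odot> bcd_r) \<cdot>\<^sub>1 Lb))))"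
    by (simp add: assoc_nat' hcomp_vcomp')
  also have "\<one>\<^sub>1 m \<odot> \<one>\<^sub>1 n = \<one>\<^sub>1 (m \<odot>\<^sub>p n)"
    by (simp add: hcomp_vid)
  finally have "(\<one>\<^sub>1 (m \<odot>\<^sub>p n) \<odot> cd) \<cdot>\<^sub>1 ((ab \<odot> \<one>\<^sub>1 (Cod (cat1 D) cd)) \<cdot>\<^sub>1 Lc)
      = (\<one>\<^sub>1 (m \<odot>\<^sub>p n) \<odot> cd) \<cdot>\<^sub>1 (assoc D m n (Cod (cat1 D) cd) \<cdot>\<^sub>1 ((\<one>\<^sub>1 m \<odot> bcd_r) \<cdot>\<^sub>1 Lb))"
    by (rule source.A.iso_cancel[rotated -1]) simp_all
  then have "(ab \<odot> \<one>\<^sub>1 (Cod (cat1 D) cd)) \<cdot>\<^sub>1 Lc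
      = assoc D m n (Cod (cat1 D) cd) \<cdot>\<^sub>1 ((\<one>\<^sub>1 m \<odot> bcd_r) \<cdot>\<^sub>1 Lb)"
    by (rule epi_arrowD[OF epi]) simp_all
  then show ?thesis
    by (intro assoc_squareI') simp_all
qed

text \<open>The left-handed companion of \<open>pentagon_sq1\<close>: with \<open>bcd_l\<close> and
  \<open>bcd_r\<close> identities, it says that \<open>Lb\<close> coequalizes the pair defining a
  tensor product, whiskered on the left by \<open>m\<close>.\<close>

lemma pentagon_sq2:
  assumes s1: sq1 and s3: sq3 and s4: sq4 and s5: sq5
    and [simp]: "Cod (cat1 D) bcd_l = Cod (cat1 D) bcd_r"
  shows "(\<one>\<^sub>1 m \<odot> ((bc \<odot> \<one>\<^sub>1 t) \<cdot>\<^sub>1 bcd_l)) \<cdot>\<^sub>1 Lb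
    = (\<one>\<^sub>1 m \<odot> (assoc D n p t \<cdot>\<^sub>1 ((\<one>\<^sub>1 n \<odot> cd) \<cdot>\<^sub>1 bcd_r))) \<cdot>\<^sub>1 Lb"
proof -
  note [simp] = assoc_squareD[OF s1] assoc_squareD[OF s3] assoc_squareD[OF s4] assoc_squareD[OF s5]
  have "(assoc D m n p \<odot> \<one>\<^sub>1 t) \<cdot>\<^sub>1 (assoc D m (n \<odot>\<^sub>p p) t
      \<cdot>\<^sub>1 ((\<one>\<^sub>1 m \<odot> ((bc \<odot> \<one>\<^sub>1 t) \<cdot>\<^sub>1 bcd_l)) \<cdot>\<^sub>1 Lb))
      = (assoc D m n p \<odot> \<one>\<^sub>1 t) \<cdot>\<^sub>1 ((((\<one>\<^sub>1 m \<odot> bc) \<cdot>\<^sub>1 abc_r) \<odot> \<one>\<^sub>1 t) \<cdot>\<^sub>1 La)"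
    using assoc_square_gen[OF s3, of "\<one>\<^sub>1 m" bc "\<one>\<^sub>1 t"] by simp
  also have "\<dots> = (((ab \<odot> \<one>\<^sub>1 p) \<cdot>\<^sub>1 abc_l) \<odot> \<one>\<^sub>1 t) \<cdot>\<^sub>1 La"
    by (simp add: hcomp_vcomp' assoc_square_eq[OF s1])
  also have "\<dots> = (assoc D (m \<odot>\<^sub>p n) p t \<cdot>\<^sub>1 assoc D m n (p \<odot>\<^sub>p t)) \<cdot>\<^sub>1 right_bracketed"
    by (simp add: pentagon_path_45[OF s4 s5])
  also have "\<dots> = ((assoc D m n p \<odot> \<one>\<^sub>1 t) \<cdot>\<^sub>1 (assoc D m (n \<odot>\<^sub>p p) t \<cdot>\<^sub>1 (\<one>\<^sub>1 m \<odot> assoc D n p t)))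
      \<cdot>\<^sub>1 right_bracketed"
    by (subst pent) simp_all
  also have "\<dots> = (assoc D m n p \<odot> \<one>\<^sub>1 t) \<cdot>\<^sub>1 (assoc D m (n \<odot>\<^sub>p p) t
      \<cdot>\<^sub>1 ((\<one>\<^sub>1 m \<odot> (assoc D n p t \<cdot>\<^sub>1 ((\<one>\<^sub>1 n \<odot> cd) \<cdot>\<^sub>1 bcd_r))) \<cdot>\<^sub>1 Lb))"
    by (simp add: hcomp_vcomp')
  finally have "assoc D m (n \<odot>\<^sub>p p) t \<cdot>\<^sub>1 ((\<one>\<^sub>1 m \<odot> ((bc \<odot> \<one>\<^sub>1 t) \<cdot>\<^sub>1 bcd_l)) \<cdot>\<^sub>1 Lb)
    = assoc D m (n \<odot>\<^sub>p p) t
      \<cdot>\<^sub>1 ((\<one>\<^sub>1 m \<odot> (assoc D n p t \<cdot>\<^sub>1 ((\<one>\<^sub>1 n \<odot> cd) \<cdot>\<^sub>1 bcd_r))) \<cdot>\<^sub>1 Lb)"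
    by (rule source.A.iso_cancel[rotated -1]) (simp_all add: iso_hcomp_vid)
  then show ?thesis
    by (rule source.A.iso_cancel[rotated -1]) simp_all
qed

end


section \<open>The calculus of cells out of units acting on other cells\<close>

subsection \<open>Actions on cells out of units\<close>

text \<open>
  For \<open>a\<close> with domain a unit, \<open>lcomp l a b\<close> is the paper's \<open>(a \<odot> b) \<cdot> l\<close> with the suppressed
  coherence isomorphism made explicit, so that it has the same domain as \<open>b\<close>; dually \<open>rcomp\<close>.
\<close>

definition lcomp :: "'c \<Rightarrow> 'c \<Rightarrow> 'c \<Rightarrow> 'c" where
  "lcomp l a b = inv\<^sub>1 (lunit D (Dom (cat1 D) b)) \<cdot>\<^sub>1 ((a \<odot> b) \<cdot>\<^sub>1 l)"

definition rcomp :: "'c \<Rightarrow> 'c \<Rightarrow> 'c \<Rightarrow> 'c" where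
  "rcomp r b a = inv\<^sub>1 (runit D (Dom (cat1 D) b)) \<cdot>\<^sub>1 ((b \<odot> a) \<cdot>\<^sub>1 r)"

lemma psrc_dom: "\<alpha> \<in> Arr (cat1 D) \<Longrightarrow> csrc D \<alpha> = f \<Longrightarrow> psrc D (Dom (cat1 D) \<alpha>) = Dom (cat0 D) f"
  and psrc_cod: "\<alpha> \<in> Arr (cat1 D) \<Longrightarrow> csrc D \<alpha> = f \<Longrightarrow> psrc D (Cod (cat1 D) \<alpha>) = Cod (cat0 D) f"
  and ptgt_dom': "\<alpha> \<in> Arr (cat1 D) \<Longrightarrow> ctgt D \<alpha> = f \<Longrightarrow> ptgt D (Dom (cat1 D) \<alpha>) = Dom (cat0 D) f"
  and ptgt_cod: "\<alpha> \<in> Arr (cat1 D) \<Longrightarrow> ctgt D \<alpha> = f \<Longrightarrow> ptgt D (Cod (cat1 D) \<alpha>) = Cod (cat0 D) f"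
  by auto

lemma
  assumes "a \<in> Arr (cat1 D)" "b \<in> Arr (cat1 D)" "ctgt D a = csrc D b"
    "Dom (cat1 D) a = pid D (psrc D (Dom (cat1 D) b))"
    "l \<in> Arr (cat1 D)" "Dom (cat1 D) l = Cod (cat1 D) a \<odot>\<^sub>p Cod (cat1 D) b"
  shows lcomp_cell [simp]: "lcomp l a b \<in> Arr (cat1 D)"
    and dom_lcomp [simp]: "Dom (cat1 D) (lcomp l a b) = Dom (cat1 D) b"
    and cod_lcomp [simp]: "Cod (cat1 D) (lcomp l a b) = Cod (cat1 D) l"
    and csrc_lcomp [simp]: "csrc D l = \<one>\<^sub>0 (psrc D (Cod (cat1 D) a))
      \<Longrightarrow> csrc D (lcomp l a b) = csrc D a"
    and ctgt_lcomp [simp]: "ctgt D l = \<one>\<^sub>0 (ptgt D (Cod (cat1 D) b))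
      \<Longrightarrow> ctgt D (lcomp l a b) = ctgt D b"
  using assms psrc_dom[OF assms(1) refl] by (simp_all add: lcomp_def)

lemma
  assumes "b \<in> Arr (cat1 D)" "a \<in> Arr (cat1 D)" "ctgt D b = csrc D a"
    "Dom (cat1 D) a = pid D (ptgt D (Dom (cat1 D) b))"
    "r \<in> Arr (cat1 D)" "Dom (cat1 D) r = Cod (cat1 D) b \<odot>\<^sub>p Cod (cat1 D) a"
  shows rcomp_cell [simp]: "rcomp r b a \<in> Arr (cat1 D)"
    and dom_rcomp [simp]: "Dom (cat1 D) (rcomp r b a) = Dom (cat1 D) b"
    and cod_rcomp [simp]: "Cod (cat1 D) (rcomp r b a) = Cod (cat1 D) r"
    and csrc_rcomp [simp]: "csrc D r = \<one>\<^sub>0 (psrc D (Cod (cat1 D) b))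
      \<Longrightarrow> csrc D (rcomp r b a) = csrc D b"
    and ctgt_rcomp [simp]: "ctgt D r = \<one>\<^sub>0 (ptgt D (Cod (cat1 D) a))
      \<Longrightarrow> ctgt D (rcomp r b a) = ctgt D a"
  using assms ptgt_dom'[OF assms(2) refl] by (simp_all add: rcomp_def)

text \<open>The triangle at the unit and \<open>u\<close>, read with inverse unit isomorphisms. The
  right unit isomorphism at the unit that occurs in it is replaced by the left one through
  \<open>lunit_pid\<close>.\<close>

lemma lunit_inv_assoc:
  assumes [simp]: "u \<in> Obj (cat1 D)" and x: "psrc D u = x"
  shows "(inv\<^sub>1 (lunit D (pid D x)) \<odot> \<one>\<^sub>1 u) \<cdot>\<^sub>1 assoc D (pid D x) (pid D x) u
    = \<one>\<^sub>1 (pid D x) \<odot> inv\<^sub>1 (lunit D u)"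
proof -
  note [simp] = x
  have [simp]: "x \<in> Obj (cat0 D)" using source.obj_closed[of u] by simp
  have "(\<one>\<^sub>1 (pid D x) \<odot> inv\<^sub>1 (lunit D u))
      = (((inv\<^sub>1 (lunit D (pid D x)) \<odot> \<one>\<^sub>1 u) \<cdot>\<^sub>1 (lunit D (pid D x) \<odot> \<one>\<^sub>1 u)))
        \<cdot>\<^sub>1 (\<one>\<^sub>1 (pid D x) \<odot> inv\<^sub>1 (lunit D u))"
    by (simp add: hcomp_vcomp hcomp_vid)
  also have "lunit D (pid D x) \<odot> \<one>\<^sub>1 u = assoc D (pid D x) (pid D x) u \<cdot>\<^sub>1 (\<one>\<^sub>1 (pid D x) \<odot> lunit D u)"
    by (simp add: tri lunit_pid)
  finally show ?thesis
    by (simp add: hcomp_vcomp hcomp_vid)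
qed

lemma runit_inv_assoc:
  assumes [simp]: "u \<in> Obj (cat1 D)" and x: "ptgt D u = x"
  shows "(inv\<^sub>1 (runit D u) \<odot> \<one>\<^sub>1 (pid D x)) \<cdot>\<^sub>1 assoc D u (pid D x) (pid D x)
    = \<one>\<^sub>1 u \<odot> inv\<^sub>1 (lunit D (pid D x))"
proof -
  note [simp] = x
  have [simp]: "x \<in> Obj (cat0 D)" using target.obj_closed[of u] by simp
  have "(\<one>\<^sub>1 u \<odot> inv\<^sub>1 (lunit D (pid D x)))
      = (((inv\<^sub>1 (runit D u) \<odot> \<one>\<^sub>1 (pid D x)) \<cdot>\<^sub>1 (runit D u \<odot> \<one>\<^sub>1 (pid D x))))
        \<cdot>\<^sub>1 (\<one>\<^sub>1 u \<odot> inv\<^sub>1 (lunit D (pid D x)))"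
    by (simp add: hcomp_vcomp hcomp_vid)
  also have "runit D u \<odot> \<one>\<^sub>1 (pid D x) = assoc D u (pid D x) (pid D x) \<cdot>\<^sub>1 (\<one>\<^sub>1 u \<odot> lunit D (pid D x))"
    by (simp add: tri)
  finally show ?thesis
    by (simp add: hcomp_vcomp hcomp_vid)
qed

text \<open>Inserting a unit on the left and one on the right of \<open>u\<close> can be done in
  either order: \<open>assoc_runit\<close> and naturality of \<open>runit\<close> at
  \<open>lunit\<close> compare the two orders.\<close>

lemma lunit_inv_runit_inv:
  assumes [simp]: "u \<in> Obj (cat1 D)" and x: "psrc D u = x" "ptgt D u = y"
  shows "inv\<^sub>1 (runit D u) \<cdot>\<^sub>1 ((inv\<^sub>1 (lunit D u) \<odot> \<one>\<^sub>1 (pid D y)) \<cdot>\<^sub>1 assoc D (pid D x) u (pid D y))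
    = inv\<^sub>1 (lunit D u) \<cdot>\<^sub>1 (\<one>\<^sub>1 (pid D x) \<odot> inv\<^sub>1 (runit D u))"
proof -
  note [simp] = x
  have [simp]: "x \<in> Obj (cat0 D)" "y \<in> Obj (cat0 D)"
    using source.obj_closed[of u] target.obj_closed[of u] by simp_all
  let ?L = "lunit D u" and ?R = "runit D u" and ?i = "\<one>\<^sub>1 (pid D x)" and ?j = "\<one>\<^sub>1 (pid D y)"
    and ?a = "assoc D (pid D x) u (pid D y)"
  have key: "?a \<cdot>\<^sub>1 ((?i \<odot> ?R) \<cdot>\<^sub>1 ?L) = (?L \<odot> ?j) \<cdot>\<^sub>1 ?R"
    using arg_cong[OF assoc_runit[of "pid D x" u y], of "\<lambda>t. t \<cdot>\<^sub>1 ?L"]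
      runit_nat[of ?L "\<one>\<^sub>0 y" u] by simp
  have "inv\<^sub>1 ?R \<cdot>\<^sub>1 ((inv\<^sub>1 ?L \<odot> ?j) \<cdot>\<^sub>1 ?a)
      = (inv\<^sub>1 ?R \<cdot>\<^sub>1 ((inv\<^sub>1 ?L \<odot> ?j) \<cdot>\<^sub>1 (?a \<cdot>\<^sub>1 ((?i \<odot> ?R) \<cdot>\<^sub>1 ?L)))) \<cdot>\<^sub>1 (inv\<^sub>1 ?L \<cdot>\<^sub>1 (?i \<odot> inv\<^sub>1 ?R))"
    by (simp add: hcomp_vcomp hcomp_vid)
  also have "\<dots> = inv\<^sub>1 ?L \<cdot>\<^sub>1 (?i \<odot> inv\<^sub>1 ?R)"
    unfolding key by (simp add: hcomp_vcomp' hcomp_vid)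
  finally show ?thesis .
qed

text \<open>Associativity of the left action. The associator produced by
  \<open>assoc_square_gen\<close> disappears into the inserted units by
  \<open>lunit_inv_assoc\<close>.\<close>

lemma lcomp_lcomp:
  assumes sq: "assoc_square (l1, l2) (l3, l4) m n p"
    and [simp]: "a \<in> Arr (cat1 D)" "b \<in> Arr (cat1 D)" "c \<in> Arr (cat1 D)"
      "Cod (cat1 D) a = m" "Cod (cat1 D) b = n" "Cod (cat1 D) c = p"
      "ctgt D a = csrc D b" "ctgt D b = csrc D c"
      "Dom (cat1 D) a = pid D x" "Dom (cat1 D) b = pid D x"
    and x: "psrc D (Dom (cat1 D) c) = x"
  shows "lcomp l2 (lcomp l1 a b) c = lcomp l4 a (lcomp l3 b c)"
proof -
  note [simp] = assoc_squareD[OF sq]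
  note x' [simp] = x
  have [simp]: "x \<in> Obj (cat0 D)" using source.obj_closed[of "Dom (cat1 D) c"] by simp
  let ?u = "Dom (cat1 D) c"
  have *: "(inv\<^sub>1 (lunit D (pid D x)) \<odot> \<one>\<^sub>1 ?u) \<cdot>\<^sub>1 (assoc D (pid D x) (pid D x) ?u \<cdot>\<^sub>1 X)
      = (\<one>\<^sub>1 (pid D x) \<odot> inv\<^sub>1 (lunit D ?u)) \<cdot>\<^sub>1 X"
    if "X \<in> Arr (cat1 D)" "Dom (cat1 D) X = pid D x \<odot>\<^sub>p (pid D x \<odot>\<^sub>p ?u)" for X
    using arg_cong[OF lunit_inv_assoc[of ?u x], of "\<lambda>t. t \<cdot>\<^sub>1 X"] that by simp
  have "lcomp l2 (lcomp l1 a b) c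
      = inv\<^sub>1 (lunit D ?u) \<cdot>\<^sub>1 ((inv\<^sub>1 (lunit D (pid D x)) \<odot> \<one>\<^sub>1 ?u) \<cdot>\<^sub>1 ((((a \<odot> b) \<cdot>\<^sub>1 l1) \<odot> c) \<cdot>\<^sub>1 l2))"
    by (simp add: lcomp_def hcomp_vcomp')
  also have "\<dots> = inv\<^sub>1 (lunit D ?u) \<cdot>\<^sub>1 ((\<one>\<^sub>1 (pid D x) \<odot> inv\<^sub>1 (lunit D ?u))
      \<cdot>\<^sub>1 ((a \<odot> ((b \<odot> c) \<cdot>\<^sub>1 l3)) \<cdot>\<^sub>1 l4))"
    using assoc_square_gen[OF sq, of a b c] by (simp add: *)
  also have "\<dots> = lcomp l4 a (lcomp l3 b c)"
    by (simp add: lcomp_def hcomp_vcomp')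
  finally show ?thesis .
qed

text \<open>A left action commutes with a right action; the associator is absorbed by
  \<open>lunit_inv_runit_inv\<close>. Applied to a bimodule, the square is the compatibility of its
  two actions.\<close>

lemma rcomp_lcomp:
  assumes sq: "assoc_square (l1, l2) (l3, l4) m n p"
    and [simp]: "a \<in> Arr (cat1 D)" "b \<in> Arr (cat1 D)" "c \<in> Arr (cat1 D)"
      "Cod (cat1 D) a = m" "Cod (cat1 D) b = n" "Cod (cat1 D) c = p"
      "ctgt D a = csrc D b" "ctgt D b = csrc D c"
      "Dom (cat1 D) a = pid D x" "Dom (cat1 D) c = pid D y"
    and x: "psrc D (Dom (cat1 D) b) = x" "ptgt D (Dom (cat1 D) b) = y"
  shows "rcomp l2 (lcomp l1 a b) c = lcomp l4 a (rcomp l3 b c)"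
proof -
  note [simp] = assoc_squareD[OF sq]
  note x' [simp] = x
  have [simp]: "x \<in> Obj (cat0 D)" "y \<in> Obj (cat0 D)"
    using source.obj_closed[of "Dom (cat1 D) b"] target.obj_closed[of "Dom (cat1 D) b"] by simp_all
  let ?u = "Dom (cat1 D) b"
  have *: "inv\<^sub>1 (runit D ?u) \<cdot>\<^sub>1 ((inv\<^sub>1 (lunit D ?u) \<odot> \<one>\<^sub>1 (pid D y)) \<cdot>\<^sub>1 (assoc D (pid D x) ?u (pid D y) \<cdot>\<^sub>1 X))
      = inv\<^sub>1 (lunit D ?u) \<cdot>\<^sub>1 ((\<one>\<^sub>1 (pid D x) \<odot> inv\<^sub>1 (runit D ?u)) \<cdot>\<^sub>1 X)"
    if "X \<in> Arr (cat1 D)" "Dom (cat1 D) X = pid D x \<odot>\<^sub>p (?u \<odot>\<^sub>p pid D y)" for X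
    using arg_cong[OF lunit_inv_runit_inv[of ?u x y], of "\<lambda>t. t \<cdot>\<^sub>1 X"] that by simp
  have "rcomp l2 (lcomp l1 a b) c
      = inv\<^sub>1 (runit D ?u) \<cdot>\<^sub>1 ((inv\<^sub>1 (lunit D ?u) \<odot> \<one>\<^sub>1 (pid D y)) \<cdot>\<^sub>1 ((((a \<odot> b) \<cdot>\<^sub>1 l1) \<odot> c) \<cdot>\<^sub>1 l2))"
    by (simp add: lcomp_def rcomp_def hcomp_vcomp')
  also have "\<dots> = inv\<^sub>1 (lunit D ?u) \<cdot>\<^sub>1 ((\<one>\<^sub>1 (pid D x) \<odot> inv\<^sub>1 (runit D ?u))
      \<cdot>\<^sub>1 ((a \<odot> ((b \<odot> c) \<cdot>\<^sub>1 l3)) \<cdot>\<^sub>1 l4))"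
    using assoc_square_gen[OF sq, of a b c] by (simp add: *)
  also have "\<dots> = lcomp l4 a (rcomp l3 b c)"
    by (simp add: lcomp_def rcomp_def hcomp_vcomp')
  finally show ?thesis .
qed

text \<open>Acting on the right by two cells out of units is acting by their product. That product
  is written with \<open>lcomp\<close>, the form in which composite arrow components are
  defined.\<close>

lemma rcomp_rcomp:
  assumes sq: "assoc_square (l1, l2) (l3, l4) m n p"
    and [simp]: "a \<in> Arr (cat1 D)" "b \<in> Arr (cat1 D)" "c \<in> Arr (cat1 D)"
      "Cod (cat1 D) a = m" "Cod (cat1 D) b = n" "Cod (cat1 D) c = p"
      "ctgt D a = csrc D b" "ctgt D b = csrc D c"
      "Dom (cat1 D) b = pid D x" "Dom (cat1 D) c = pid D x"
    and x: "ptgt D (Dom (cat1 D) a) = x"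
  shows "rcomp l2 (rcomp l1 a b) c = rcomp l4 a (lcomp l3 b c)"
proof -
  note [simp] = assoc_squareD[OF sq]
  note x' [simp] = x
  have [simp]: "x \<in> Obj (cat0 D)" using target.obj_closed[of "Dom (cat1 D) a"] by simp
  let ?u = "Dom (cat1 D) a"
  have *: "(inv\<^sub>1 (runit D ?u) \<odot> \<one>\<^sub>1 (pid D x)) \<cdot>\<^sub>1 (assoc D ?u (pid D x) (pid D x) \<cdot>\<^sub>1 X)
      = (\<one>\<^sub>1 ?u \<odot> inv\<^sub>1 (lunit D (pid D x))) \<cdot>\<^sub>1 X"
    if "X \<in> Arr (cat1 D)" "Dom (cat1 D) X = ?u \<odot>\<^sub>p (pid D x \<odot>\<^sub>p pid D x)" for X
    using arg_cong[OF runit_inv_assoc[of ?u x], of "\<lambda>t. t \<cdot>\<^sub>1 X"] that by simp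
  have "rcomp l2 (rcomp l1 a b) c
      = inv\<^sub>1 (runit D ?u) \<cdot>\<^sub>1 ((inv\<^sub>1 (runit D ?u) \<odot> \<one>\<^sub>1 (pid D x)) \<cdot>\<^sub>1 ((((a \<odot> b) \<cdot>\<^sub>1 l1) \<odot> c) \<cdot>\<^sub>1 l2))"
    by (simp add: rcomp_def hcomp_vcomp')
  also have "\<dots> = inv\<^sub>1 (runit D ?u) \<cdot>\<^sub>1 ((\<one>\<^sub>1 ?u \<odot> inv\<^sub>1 (lunit D (pid D x)))
      \<cdot>\<^sub>1 ((a \<odot> ((b \<odot> c) \<cdot>\<^sub>1 l3)) \<cdot>\<^sub>1 l4))"
    using assoc_square_gen[OF sq, of a b c] by (simp add: *)
  also have "\<dots> = rcomp l4 a (lcomp l3 b c)"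
    by (simp add: lcomp_def rcomp_def hcomp_vcomp')
  finally show ?thesis .
qed

text \<open>When both cells start at a unit, the two inserted isomorphisms coincide by
  \<open>lunit_pid\<close>. A product can thus be read from the side whose unit law or equivariance
  is at hand.\<close>

lemma lcomp_eq_rcomp:
  "\<lbrakk>Dom (cat1 D) a = pid D x; Dom (cat1 D) b = pid D x; x \<in> Obj (cat0 D)\<rbrakk>
    \<Longrightarrow> lcomp l a b = rcomp l a b"
  by (simp add: lcomp_def rcomp_def lunit_pid)

text \<open>Naturality of \<open>lunit\<close> at \<gamma> splits a precomposed cell into \<gamma>
  on the factor acted upon and the external identity on its source arrow on the acting
  factor.\<close>

lemma vcomp_lcomp:
  assumes [simp]: "\<gamma> \<in> Arr (cat1 D)" "a \<in> Arr (cat1 D)" "b \<in> Arr (cat1 D)" "ctgt D a = csrc D b"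
    "Dom (cat1 D) a = pid D (psrc D (Cod (cat1 D) \<gamma>))" "Dom (cat1 D) b = Cod (cat1 D) \<gamma>"
    "l \<in> Arr (cat1 D)" "Dom (cat1 D) l = Cod (cat1 D) a \<odot>\<^sub>p Cod (cat1 D) b"
  shows "\<gamma> \<cdot>\<^sub>1 lcomp l a b = lcomp l (cid D (csrc D \<gamma>) \<cdot>\<^sub>1 a) (\<gamma> \<cdot>\<^sub>1 b)"
proof -
  let ?u = "Dom (cat1 D) \<gamma>" and ?v = "Cod (cat1 D) \<gamma>" and ?f = "cid D (csrc D \<gamma>)"
  have "\<gamma> \<cdot>\<^sub>1 inv\<^sub>1 (lunit D ?v) = inv\<^sub>1 (lunit D ?u) \<cdot>\<^sub>1 ((lunit D ?u \<cdot>\<^sub>1 \<gamma>) \<cdot>\<^sub>1 inv\<^sub>1 (lunit D ?v))"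
    by simp
  also have "lunit D ?u \<cdot>\<^sub>1 \<gamma> = (?f \<odot> \<gamma>) \<cdot>\<^sub>1 lunit D ?v"
    by (simp add: lunit_nat)
  finally have *: "\<gamma> \<cdot>\<^sub>1 inv\<^sub>1 (lunit D ?v) = inv\<^sub>1 (lunit D ?u) \<cdot>\<^sub>1 (?f \<odot> \<gamma>)"
    by simp
  have "\<gamma> \<cdot>\<^sub>1 lcomp l a b = (\<gamma> \<cdot>\<^sub>1 inv\<^sub>1 (lunit D ?v)) \<cdot>\<^sub>1 ((a \<odot> b) \<cdot>\<^sub>1 l)"
    by (simp add: lcomp_def)
  also have "\<dots> = lcomp l (?f \<cdot>\<^sub>1 a) (\<gamma> \<cdot>\<^sub>1 b)"
    unfolding * by (simp add: lcomp_def hcomp_vcomp')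
  finally show ?thesis .
qed

lemma vcomp_rcomp:
  assumes [simp]: "\<gamma> \<in> Arr (cat1 D)" "a \<in> Arr (cat1 D)" "b \<in> Arr (cat1 D)" "ctgt D b = csrc D a"
    "Dom (cat1 D) a = pid D (ptgt D (Cod (cat1 D) \<gamma>))" "Dom (cat1 D) b = Cod (cat1 D) \<gamma>"
    "r \<in> Arr (cat1 D)" "Dom (cat1 D) r = Cod (cat1 D) b \<odot>\<^sub>p Cod (cat1 D) a"
  shows "\<gamma> \<cdot>\<^sub>1 rcomp r b a = rcomp r (\<gamma> \<cdot>\<^sub>1 b) (cid D (ctgt D \<gamma>) \<cdot>\<^sub>1 a)"
proof -
  let ?u = "Dom (cat1 D) \<gamma>" and ?v = "Cod (cat1 D) \<gamma>" and ?f = "cid D (ctgt D \<gamma>)"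
  have "\<gamma> \<cdot>\<^sub>1 inv\<^sub>1 (runit D ?v) = inv\<^sub>1 (runit D ?u) \<cdot>\<^sub>1 ((runit D ?u \<cdot>\<^sub>1 \<gamma>) \<cdot>\<^sub>1 inv\<^sub>1 (runit D ?v))"
    by simp
  also have "runit D ?u \<cdot>\<^sub>1 \<gamma> = (\<gamma> \<odot> ?f) \<cdot>\<^sub>1 runit D ?v"
    by (simp add: runit_nat)
  finally have *: "\<gamma> \<cdot>\<^sub>1 inv\<^sub>1 (runit D ?v) = inv\<^sub>1 (runit D ?u) \<cdot>\<^sub>1 (\<gamma> \<odot> ?f)"
    by simp
  have "\<gamma> \<cdot>\<^sub>1 rcomp r b a = (\<gamma> \<cdot>\<^sub>1 inv\<^sub>1 (runit D ?v)) \<cdot>\<^sub>1 ((b \<odot> a) \<cdot>\<^sub>1 r)"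
    by (simp add: rcomp_def)
  also have "\<dots> = rcomp r (\<gamma> \<cdot>\<^sub>1 b) (?f \<cdot>\<^sub>1 a)"
    unfolding * by (simp add: rcomp_def hcomp_vcomp')
  finally show ?thesis .
qed

text \<open>The hypothesis \<open>eq\<close> says that \<beta> is equivariant along \<phi>, so a
  postcomposed \<beta> distributes over the action.\<close>

lemma lcomp_vcomp:
  assumes eq: "(\<phi> \<odot> \<beta>) \<cdot>\<^sub>1 l' = l \<cdot>\<^sub>1 \<beta>"
    and [simp]: "a \<in> Arr (cat1 D)" "b \<in> Arr (cat1 D)" "ctgt D a = csrc D b"
    "Dom (cat1 D) a = pid D (psrc D (Dom (cat1 D) b))"
    "l \<in> Arr (cat1 D)" "Dom (cat1 D) l = Cod (cat1 D) a \<odot>\<^sub>p Cod (cat1 D) b"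
    "Cod (cat1 D) l = Cod (cat1 D) b"
    "\<phi> \<in> Arr (cat1 D)" "\<beta> \<in> Arr (cat1 D)" "ctgt D \<phi> = csrc D \<beta>"
    "Dom (cat1 D) \<phi> = Cod (cat1 D) a" "Dom (cat1 D) \<beta> = Cod (cat1 D) b"
    "l' \<in> Arr (cat1 D)" "Dom (cat1 D) l' = Cod (cat1 D) \<phi> \<odot>\<^sub>p Cod (cat1 D) \<beta>"
  shows "lcomp l a b \<cdot>\<^sub>1 \<beta> = lcomp l' (a \<cdot>\<^sub>1 \<phi>) (b \<cdot>\<^sub>1 \<beta>)"
proof -
  have "lcomp l a b \<cdot>\<^sub>1 \<beta> = inv\<^sub>1 (lunit D (Dom (cat1 D) b)) \<cdot>\<^sub>1 ((a \<odot> b) \<cdot>\<^sub>1 (l \<cdot>\<^sub>1 \<beta>))"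
    by (simp add: lcomp_def)
  also have "\<dots> = lcomp l' (a \<cdot>\<^sub>1 \<phi>) (b \<cdot>\<^sub>1 \<beta>)"
    unfolding eq[symmetric] by (simp add: lcomp_def hcomp_vcomp')
  finally show ?thesis .
qed

lemma rcomp_vcomp:
  assumes eq: "(\<beta> \<odot> \<psi>) \<cdot>\<^sub>1 r' = r \<cdot>\<^sub>1 \<beta>"
    and [simp]: "a \<in> Arr (cat1 D)" "b \<in> Arr (cat1 D)" "ctgt D b = csrc D a"
    "Dom (cat1 D) a = pid D (ptgt D (Dom (cat1 D) b))"
    "r \<in> Arr (cat1 D)" "Dom (cat1 D) r = Cod (cat1 D) b \<odot>\<^sub>p Cod (cat1 D) a"
    "Cod (cat1 D) r = Cod (cat1 D) b"
    "\<psi> \<in> Arr (cat1 D)" "\<beta> \<in> Arr (cat1 D)" "ctgt D \<beta> = csrc D \<psi>"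
    "Dom (cat1 D) \<psi> = Cod (cat1 D) a" "Dom (cat1 D) \<beta> = Cod (cat1 D) b"
    "r' \<in> Arr (cat1 D)" "Dom (cat1 D) r' = Cod (cat1 D) \<beta> \<odot>\<^sub>p Cod (cat1 D) \<psi>"
  shows "rcomp r b a \<cdot>\<^sub>1 \<beta> = rcomp r' (b \<cdot>\<^sub>1 \<beta>) (a \<cdot>\<^sub>1 \<psi>)"
proof -
  have "rcomp r b a \<cdot>\<^sub>1 \<beta> = inv\<^sub>1 (runit D (Dom (cat1 D) b)) \<cdot>\<^sub>1 ((b \<odot> a) \<cdot>\<^sub>1 (r \<cdot>\<^sub>1 \<beta>))"
    by (simp add: rcomp_def)
  also have "\<dots> = rcomp r' (b \<cdot>\<^sub>1 \<beta>) (a \<cdot>\<^sub>1 \<psi>)"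
    unfolding eq[symmetric] by (simp add: rcomp_def hcomp_vcomp')
  finally show ?thesis .
qed

text \<open>A unit \<upsilon> acts trivially. It appears behind \<open>cid D f\<close> because
  \<open>b\<close> may have an arbitrary source arrow \<open>f\<close>, which the acting cell has to
  match.\<close>

lemma lcomp_unit:
  assumes eq: "(\<upsilon> \<odot> \<one>\<^sub>1 n) \<cdot>\<^sub>1 l = lunit D n"
    and [simp]: "b \<in> Arr (cat1 D)" "Cod (cat1 D) b = n" "csrc D b = f"
    "\<upsilon> \<in> Glob D (pid D (psrc D n)) s" "l \<in> Glob D (s \<odot>\<^sub>p n) n"
  shows "lcomp l (cid D f \<cdot>\<^sub>1 \<upsilon>) b = b"
proof -
  have n: "n \<in> Obj (cat1 D)" using Glob_D(7)[OF assms(6)] .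
  then have "psrc D n \<in> Obj (cat0 D)" "ptgt D n \<in> Obj (cat0 D)"
    using source.obj_closed target.obj_closed by simp_all
  note [simp] = n this Glob_D(1-5)[OF assms(5)] Glob_D(1-5)[OF assms(6)] Glob_D(7-9)[OF assms(5), simplified]
  have [simp]: "f \<in> Arr (cat0 D)" "Dom (cat0 D) f = psrc D (Dom (cat1 D) b)" "Cod (cat0 D) f = psrc D n"
    using source.dom_map[of b] source.cod_map[of b] source.arr_map[of b] by simp_all
  have "((cid D f \<cdot>\<^sub>1 \<upsilon>) \<odot> b) \<cdot>\<^sub>1 l = (cid D f \<odot> b) \<cdot>\<^sub>1 ((\<upsilon> \<odot> \<one>\<^sub>1 n) \<cdot>\<^sub>1 l)"
    by (simp add: hcomp_vcomp')
  also have "\<dots> = lunit D (Dom (cat1 D) b) \<cdot>\<^sub>1 b"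
    unfolding eq by (simp add: lunit_nat)
  finally show ?thesis
    by (simp add: lcomp_def)
qed

lemma rcomp_unit:
  assumes eq: "(\<one>\<^sub>1 n \<odot> \<upsilon>) \<cdot>\<^sub>1 r = runit D n"
    and [simp]: "b \<in> Arr (cat1 D)" "Cod (cat1 D) b = n" "ctgt D b = f"
    "\<upsilon> \<in> Glob D (pid D (ptgt D n)) s" "r \<in> Glob D (n \<odot>\<^sub>p s) n"
  shows "rcomp r b (cid D f \<cdot>\<^sub>1 \<upsilon>) = b"
proof -
  have n: "n \<in> Obj (cat1 D)" using Glob_D(7)[OF assms(6)] .
  then have "psrc D n \<in> Obj (cat0 D)" "ptgt D n \<in> Obj (cat0 D)"
    using source.obj_closed target.obj_closed by simp_all
  note [simp] = n this Glob_D(1-5)[OF assms(5)] Glob_D(1-5)[OF assms(6)] Glob_D(7-9)[OF assms(5), simplified]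
  have [simp]: "f \<in> Arr (cat0 D)" "Dom (cat0 D) f = ptgt D (Dom (cat1 D) b)" "Cod (cat0 D) f = ptgt D n"
    using target.dom_map[of b] target.cod_map[of b] target.arr_map[of b] by simp_all
  have "(b \<odot> (cid D f \<cdot>\<^sub>1 \<upsilon>)) \<cdot>\<^sub>1 r = (b \<odot> cid D f) \<cdot>\<^sub>1 ((\<one>\<^sub>1 n \<odot> \<upsilon>) \<cdot>\<^sub>1 r)"
    by (simp add: hcomp_vcomp')
  also have "\<dots> = runit D (Dom (cat1 D) b) \<cdot>\<^sub>1 b"
    unfolding eq by (simp add: runit_nat)
  finally show ?thesis
    by (simp add: rcomp_def)
qed

end


section \<open>Lax functors as a source of bimodule laws\<close>

section \<open>Lax functors\<close>

context double_category
begin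

lemma Cells_D:
  assumes "\<gamma> \<in> Cells D m n f g"
  shows "\<gamma> \<in> Arr (cat1 D)" "Dom (cat1 D) \<gamma> = m" "Cod (cat1 D) \<gamma> = n" "csrc D \<gamma> = f" "ctgt D \<gamma> = g"
    "m \<in> Obj (cat1 D)" "n \<in> Obj (cat1 D)" "f \<in> Arr (cat0 D)" "g \<in> Arr (cat0 D)"
    "Dom (cat0 D) f = psrc D m" "Cod (cat0 D) f = psrc D n"
    "Dom (cat0 D) g = ptgt D m" "Cod (cat0 D) g = ptgt D n"
proof -
  show *: "\<gamma> \<in> Arr (cat1 D)" "Dom (cat1 D) \<gamma> = m" "Cod (cat1 D) \<gamma> = n" "csrc D \<gamma> = f" "ctgt D \<gamma> = g"
    using assms by (auto simp: Cells_def Hom_def)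
  then show "m \<in> Obj (cat1 D)" "n \<in> Obj (cat1 D)" "f \<in> Arr (cat0 D)" "g \<in> Arr (cat0 D)"
    "Dom (cat0 D) f = psrc D m" "Cod (cat0 D) f = psrc D n"
    "Dom (cat0 D) g = ptgt D m" "Cod (cat0 D) g = ptgt D n"
    by auto
qed

text \<open>Every proarrow is a bimodule over identity proarrows with the unit isomorphisms as
  actions. A lax functor carries these three squares to the bimodule laws of \<open>fp F m\<close>
  and, at an identity proarrow, to the associativity of a category object.\<close>

lemma
  assumes "m \<in> Obj (cat1 D)" "psrc D m = x" "ptgt D m = y"
  shows unit_square_left: "assoc_square (lunit D (pid D x), lunit D m) (lunit D m, lunit D m) (pid D x) (pid D x) m"
    and unit_square_right: "assoc_square (runit D m, runit D m) (lunit D (pid D y), runit D m) m (pid D y) (pid D y)"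
    and unit_square_mid: "assoc_square (lunit D m, runit D m) (runit D m, lunit D m) (pid D x) m (pid D y)"
proof -
  note [simp] = assms
  have [simp]: "x \<in> Obj (cat0 D)" "y \<in> Obj (cat0 D)"
    using source.obj_closed[of m] target.obj_closed[of m] by simp_all
  have 1: "assoc D (pid D x) (pid D x) m \<cdot>\<^sub>1 ((\<one>\<^sub>1 (pid D x) \<odot> lunit D m) \<cdot>\<^sub>1 lunit D m)
    = (lunit D (pid D x) \<odot> \<one>\<^sub>1 m) \<cdot>\<^sub>1 lunit D m"
    using arg_cong[OF tri[of "pid D x" m x], of "\<lambda>t. t \<cdot>\<^sub>1 lunit D m"] by (simp add: lunit_pid)
  have 2: "assoc D m (pid D y) (pid D y) \<cdot>\<^sub>1 ((\<one>\<^sub>1 m \<odot> lunit D (pid D y)) \<cdot>\<^sub>1 runit D m)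
    = (runit D m \<odot> \<one>\<^sub>1 (pid D y)) \<cdot>\<^sub>1 runit D m"
    using arg_cong[OF tri[of m "pid D y" y], of "\<lambda>t. t \<cdot>\<^sub>1 runit D m"] by simp
  have 3: "assoc D (pid D x) m (pid D y) \<cdot>\<^sub>1 ((\<one>\<^sub>1 (pid D x) \<odot> runit D m) \<cdot>\<^sub>1 lunit D m)
    = (lunit D m \<odot> \<one>\<^sub>1 (pid D y)) \<cdot>\<^sub>1 runit D m"
    using arg_cong[OF assoc_runit[of "pid D x" m y], of "\<lambda>t. t \<cdot>\<^sub>1 lunit D m"]
      runit_nat[of "lunit D m" "\<one>\<^sub>0 y" m] by simp
  show "assoc_square (lunit D (pid D x), lunit D m) (lunit D m, lunit D m) (pid D x) (pid D x) m"
    "assoc_square (runit D m, runit D m) (lunit D (pid D y), runit D m) m (pid D y) (pid D y)"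
    "assoc_square (lunit D m, runit D m) (runit D m, lunit D m) (pid D x) m (pid D y)"
    by (rule assoc_squareI'; simp add: 1 2 3)+
qed

text \<open>Triangle, \<open>assoc_lunit\<close> and \<open>assoc_runit\<close> rewritten as squares
  by filling with identities. Their images under a lax functor say that the laxator is balanced in
  the middle and equivariant on both sides.\<close>

lemma
  assumes "m \<in> Obj (cat1 D)" "n \<in> Obj (cat1 D)" "psrc D m = x" "ptgt D m = y" "psrc D n = y" "ptgt D n = z"
  shows triangle_square:
      "assoc_square (runit D m, \<one>\<^sub>1 (m \<odot>\<^sub>p n)) (lunit D n, \<one>\<^sub>1 (m \<odot>\<^sub>p n)) m (pid D y) n"
    and lunit_square: "assoc_square (lunit D m, \<one>\<^sub>1 (m \<odot>\<^sub>p n)) (\<one>\<^sub>1 (m \<odot>\<^sub>p n), lunit D (m \<odot>\<^sub>p n)) (pid D x) m n"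
    and runit_square: "assoc_square (\<one>\<^sub>1 (m \<odot>\<^sub>p n), runit D (m \<odot>\<^sub>p n)) (runit D n, \<one>\<^sub>1 (m \<odot>\<^sub>p n)) m n (pid D z)"
proof -
  note [simp] = assms
  have [simp]: "x \<in> Obj (cat0 D)" "y \<in> Obj (cat0 D)" "z \<in> Obj (cat0 D)"
    using source.obj_closed[of m] target.obj_closed[of m] target.obj_closed[of n] by simp_all
  show "assoc_square (runit D m, \<one>\<^sub>1 (m \<odot>\<^sub>p n)) (lunit D n, \<one>\<^sub>1 (m \<odot>\<^sub>p n)) m (pid D y) n"
    "assoc_square (lunit D m, \<one>\<^sub>1 (m \<odot>\<^sub>p n)) (\<one>\<^sub>1 (m \<odot>\<^sub>p n), lunit D (m \<odot>\<^sub>p n)) (pid D x) m n"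
    "assoc_square (\<one>\<^sub>1 (m \<odot>\<^sub>p n), runit D (m \<odot>\<^sub>p n)) (runit D n, \<one>\<^sub>1 (m \<odot>\<^sub>p n)) m n (pid D z)"
    by (rule assoc_squareI'; simp add: tri assoc_lunit assoc_runit hcomp_vid)+
qed

end

locale lax_fun = D: double_category D + E: double_category E + lax_functor D E F
  for D :: "('o, 'a, 'p, 'c) dbl" and E :: "('o2, 'a2, 'p2, 'c2) dbl" (structure)
    and F :: "('o, 'a, 'p, 'c, 'o2, 'a2, 'p2, 'c2) laxfun"
begin

declare zero.map_comp [simp] one.map_comp [simp]

lemma
  assumes "m \<in> Obj (cat1 D)"
  shows psrc_fp [simp]: "psrc E (fp F m) = fo F (psrc D m)"
    and ptgt_fp [simp]: "ptgt E (fp F m) = fo F (ptgt D m)"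
  using fp_closed[of m "psrc D m" "ptgt D m"] assms by (auto simp: Pro_def)

lemma
  assumes "\<alpha> \<in> Arr (cat1 D)"
  shows csrc_fc [simp]: "csrc E (fc F \<alpha>) = fa F (csrc D \<alpha>)"
    and ctgt_fc [simp]: "ctgt E (fc F \<alpha>) = fa F (ctgt D \<alpha>)"
  using E.Cells_D[OF fc_closed[OF D.CellsI[OF assms refl refl refl refl]]] by auto

lemma
  assumes "m \<in> Obj (cat1 D)" "n \<in> Obj (cat1 D)" "ptgt D m = psrc D n"
  shows lax_cell [simp]: "lax F m n \<in> Arr (cat1 E)"
    and dom_lax [simp]: "Dom (cat1 E) (lax F m n) = fp F m \<odot>\<^sub>p fp F n"
    and cod_lax [simp]: "Cod (cat1 E) (lax F m n) = fp F (m \<odot>\<^sub>p\<^bsub>D\<^esub> n)"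
    and csrc_lax [simp]: "csrc E (lax F m n) = \<one>\<^sub>0 (fo F (psrc D m))"
    and ctgt_lax [simp]: "ctgt E (lax F m n) = \<one>\<^sub>0 (fo F (ptgt D n))"
  using E.Glob_D[OF lax_closed[of m "psrc D m" "ptgt D m" n "ptgt D n"]] assms
  by (auto simp: Pro_def)

lemma
  assumes "x \<in> Obj (cat0 D)"
  shows un_cell [simp]: "un F x \<in> Arr (cat1 E)"
    and dom_un [simp]: "Dom (cat1 E) (un F x) = pid E (fo F x)"
    and cod_un [simp]: "Cod (cat1 E) (un F x) = fp F (pid D x)"
    and csrc_un [simp]: "csrc E (un F x) = \<one>\<^sub>0 (fo F x)"
    and ctgt_un [simp]: "ctgt E (un F x) = \<one>\<^sub>0 (fo F x)"
  using E.Glob_D(1-5)[OF un_closed[OF assms]] assms by auto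

lemma lax_nat:
  assumes "\<alpha> \<in> Arr (cat1 D)" "\<beta> \<in> Arr (cat1 D)" "ctgt D \<alpha> = csrc D \<beta>"
    "Cod (cat1 D) \<alpha> = m" "Cod (cat1 D) \<beta> = n"
  shows "(fc F \<alpha> \<odot> fc F \<beta>) \<cdot>\<^sub>1 lax F m n
    = lax F (Dom (cat1 D) \<alpha>) (Dom (cat1 D) \<beta>) \<cdot>\<^sub>1 fc F (\<alpha> \<odot>\<^bsub>D\<^esub> \<beta>)"
  using lax_natural[OF D.CellsI[OF assms(1) refl assms(4) refl refl]
      D.CellsI[OF assms(2) refl assms(5) assms(3)[symmetric] refl]] .

lemma lax_nat':
  assumes "\<alpha> \<in> Arr (cat1 D)" "\<beta> \<in> Arr (cat1 D)" "ctgt D \<alpha> = csrc D \<beta>"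
    "Cod (cat1 D) \<alpha> = m" "Cod (cat1 D) \<beta> = n"
    "\<delta> \<in> Arr (cat1 E)" "Dom (cat1 E) \<delta> = fp F (m \<odot>\<^sub>p\<^bsub>D\<^esub> n)"
  shows "(fc F \<alpha> \<odot> fc F \<beta>) \<cdot>\<^sub>1 (lax F m n \<cdot>\<^sub>1 \<delta>)
    = lax F (Dom (cat1 D) \<alpha>) (Dom (cat1 D) \<beta>) \<cdot>\<^sub>1 (fc F (\<alpha> \<odot>\<^bsub>D\<^esub> \<beta>) \<cdot>\<^sub>1 \<delta>)"
proof -
  have "ptgt D m = psrc D n"
    using D.psrc_cod_eq[OF assms(1-3)] assms(4,5) by simp
  with assms show ?thesis
    using arg_cong[OF lax_nat[OF assms(1-5)], of "\<lambda>t. t \<cdot>\<^sub>1 \<delta>"] by auto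
qed

text \<open>Naturality of the laxators moves the images of \<open>l1\<close> and \<open>l3\<close>
  through, after which associativity of the laxators compares the two sides. All action laws for the
  image of a lax functor are instances.\<close>

lemma lax_assoc_square:
  assumes sq: "D.assoc_square (l1, l2) (l3, l4) m n p"
    and k: "Cod (cat1 D) l1 = k" "Cod (cat1 D) l3 = j"
  shows "E.assoc_square (lax F m n \<cdot>\<^sub>1 fc F l1, lax F k p \<cdot>\<^sub>1 fc F l2)
    (lax F n p \<cdot>\<^sub>1 fc F l3, lax F m j \<cdot>\<^sub>1 fc F l4) (fp F m) (fp F n) (fp F p)"
proof -
  note [simp] = D.assoc_squareD[OF sq] k[symmetric]
  have "((lax F m n \<cdot>\<^sub>1 fc F l1) \<odot> \<one>\<^sub>1 (fp F p)) \<cdot>\<^sub>1 (lax F k p \<cdot>\<^sub>1 fc F l2)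
      = (lax F m n \<odot> \<one>\<^sub>1 (fp F p)) \<cdot>\<^sub>1 ((fc F l1 \<odot> fc F (\<one>\<^sub>1\<^bsub>D\<^esub> p)) \<cdot>\<^sub>1 (lax F k p \<cdot>\<^sub>1 fc F l2))"
    by (simp add: E.hcomp_vcomp')
  also have "\<dots> = (lax F m n \<odot> \<one>\<^sub>1 (fp F p)) \<cdot>\<^sub>1 (lax F (m \<odot>\<^sub>p\<^bsub>D\<^esub> n) p \<cdot>\<^sub>1 fc F ((l1 \<odot>\<^bsub>D\<^esub> \<one>\<^sub>1\<^bsub>D\<^esub> p) \<cdot>\<^sub>1\<^bsub>D\<^esub> l2))"
    by (subst lax_nat') simp_all
  also have "\<dots> = ((lax F m n \<odot> \<one>\<^sub>1 (fp F p)) \<cdot>\<^sub>1 lax F (m \<odot>\<^sub>p\<^bsub>D\<^esub> n) p \<cdot>\<^sub>1 fc F (assoc D m n p))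
      \<cdot>\<^sub>1 fc F ((\<one>\<^sub>1\<^bsub>D\<^esub> m \<odot>\<^bsub>D\<^esub> l3) \<cdot>\<^sub>1\<^bsub>D\<^esub> l4)"
    by (simp add: D.assoc_square_eq[OF sq])
  also have "\<dots> = (assoc E (fp F m) (fp F n) (fp F p) \<cdot>\<^sub>1 (\<one>\<^sub>1 (fp F m) \<odot> lax F n p)
            \<cdot>\<^sub>1 lax F m (n \<odot>\<^sub>p\<^bsub>D\<^esub> p)) \<cdot>\<^sub>1 fc F ((\<one>\<^sub>1\<^bsub>D\<^esub> m \<odot>\<^bsub>D\<^esub> l3) \<cdot>\<^sub>1\<^bsub>D\<^esub> l4)"
    by (subst lax_assoc[of m "psrc D m" "ptgt D m" n "ptgt D n" p "ptgt D p"]) (simp_all add: Pro_def)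
  also have "\<dots> = assoc E (fp F m) (fp F n) (fp F p) \<cdot>\<^sub>1 ((\<one>\<^sub>1 (fp F m) \<odot> lax F n p)
            \<cdot>\<^sub>1 ((fc F (\<one>\<^sub>1\<^bsub>D\<^esub> m) \<odot> fc F l3) \<cdot>\<^sub>1 (lax F m j \<cdot>\<^sub>1 fc F l4)))"
    by (subst lax_nat') simp_all
  finally show ?thesis
    by (intro E.assoc_squareI') (simp_all add: E.hcomp_vcomp')
qed

abbreviation "L m \<equiv> lax_id_left D E F m"
abbreviation "R m \<equiv> lax_id_right D E F m"
abbreviation "M x \<equiv> lax_id_id D E F x"

lemma
  assumes "m \<in> Obj (cat1 D)"
  shows L_cell [simp]: "L m \<in> Arr (cat1 E)"
    and dom_L [simp]: "Dom (cat1 E) (L m) = fp F (pid D (psrc D m)) \<odot>\<^sub>p fp F m"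
    and cod_L [simp]: "Cod (cat1 E) (L m) = fp F m"
    and csrc_L [simp]: "csrc E (L m) = \<one>\<^sub>0 (fo F (psrc D m))"
    and ctgt_L [simp]: "ctgt E (L m) = \<one>\<^sub>0 (fo F (ptgt D m))"
    and R_cell [simp]: "R m \<in> Arr (cat1 E)"
    and dom_R [simp]: "Dom (cat1 E) (R m) = fp F m \<odot>\<^sub>p fp F (pid D (ptgt D m))"
    and cod_R [simp]: "Cod (cat1 E) (R m) = fp F m"
    and csrc_R [simp]: "csrc E (R m) = \<one>\<^sub>0 (fo F (psrc D m))"
    and ctgt_R [simp]: "ctgt E (R m) = \<one>\<^sub>0 (fo F (ptgt D m))"
  using assms by (simp_all add: lax_id_left_def lax_id_right_def)

lemma
  assumes "x \<in> Obj (cat0 D)"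
  shows L_pid: "L (pid D x) = M x"
    and R_pid: "R (pid D x) = M x"
    and M_cell [simp]: "M x \<in> Arr (cat1 E)"
    and dom_M [simp]: "Dom (cat1 E) (M x) = fp F (pid D x) \<odot>\<^sub>p fp F (pid D x)"
    and cod_M [simp]: "Cod (cat1 E) (M x) = fp F (pid D x)"
    and csrc_M [simp]: "csrc E (M x) = \<one>\<^sub>0 (fo F x)"
    and ctgt_M [simp]: "ctgt E (M x) = \<one>\<^sub>0 (fo F x)"
  using assms by (simp_all add: lax_id_id_def lax_id_left_def lax_id_right_def D.lunit_pid)

lemma
  assumes "m \<in> Obj (cat1 D)" "psrc D m = x" "ptgt D m = y"
  shows square_left: "E.assoc_square (M x, L m) (L m, L m) (fp F (pid D x)) (fp F (pid D x)) (fp F m)"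
    and square_right: "E.assoc_square (R m, R m) (M y, R m) (fp F m) (fp F (pid D y)) (fp F (pid D y))"
    and square_mid: "E.assoc_square (L m, R m) (R m, L m) (fp F (pid D x)) (fp F m) (fp F (pid D y))"
proof -
  note [simp] = assms
  have [simp]: "x \<in> Obj (cat0 D)" "y \<in> Obj (cat0 D)"
    using D.source.obj_closed[of m] D.target.obj_closed[of m] by simp_all
  show "E.assoc_square (M x, L m) (L m, L m) (fp F (pid D x)) (fp F (pid D x)) (fp F m)"
    using lax_assoc_square[OF D.unit_square_left[OF assms] refl refl]
    by (simp add: lax_id_id_def lax_id_left_def)
  show "E.assoc_square (R m, R m) (M y, R m) (fp F m) (fp F (pid D y)) (fp F (pid D y))"
    using lax_assoc_square[OF D.unit_square_right[OF assms] refl refl]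
    by (simp add: lax_id_id_def lax_id_left_def lax_id_right_def)
  show "E.assoc_square (L m, R m) (R m, L m) (fp F (pid D x)) (fp F m) (fp F (pid D y))"
    using lax_assoc_square[OF D.unit_square_mid[OF assms] refl refl]
    by (simp add: lax_id_left_def lax_id_right_def)
qed

text \<open>\<open>square_balanced\<close> will let the laxator factor through the tensor product of
  bimodules; the other two squares will make the factor equivariant.\<close>

lemma
  assumes "m \<in> Obj (cat1 D)" "n \<in> Obj (cat1 D)" "psrc D m = x" "ptgt D m = y" "psrc D n = y" "ptgt D n = z"
  shows square_balanced: "E.assoc_square (R m, lax F m n) (L n, lax F m n) (fp F m) (fp F (pid D y)) (fp F n)"
    and square_left_lax: "E.assoc_square (L m, lax F m n) (lax F m n, L (m \<odot>\<^sub>p\<^bsub>D\<^esub> n)) (fp F (pid D x)) (fp F m) (fp F n)"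
    and square_lax_right: "E.assoc_square (lax F m n, R (m \<odot>\<^sub>p\<^bsub>D\<^esub> n)) (R n, lax F m n) (fp F m) (fp F n) (fp F (pid D z))"
proof -
  note [simp] = assms
  have [simp]: "x \<in> Obj (cat0 D)" "y \<in> Obj (cat0 D)" "z \<in> Obj (cat0 D)"
    using D.source.obj_closed[of m] D.target.obj_closed[of m] D.target.obj_closed[of n] by simp_all
  show "E.assoc_square (R m, lax F m n) (L n, lax F m n) (fp F m) (fp F (pid D y)) (fp F n)"
    using lax_assoc_square[OF D.triangle_square[OF assms] refl refl]
    by (simp add: lax_id_left_def lax_id_right_def)
  show "E.assoc_square (L m, lax F m n) (lax F m n, L (m \<odot>\<^sub>p\<^bsub>D\<^esub> n)) (fp F (pid D x)) (fp F m) (fp F n)"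
    using lax_assoc_square[OF D.lunit_square[OF assms] refl refl]
    by (simp add: lax_id_left_def)
  show "E.assoc_square (lax F m n, R (m \<odot>\<^sub>p\<^bsub>D\<^esub> n)) (R n, lax F m n) (fp F m) (fp F n) (fp F (pid D z))"
    using lax_assoc_square[OF D.runit_square[OF assms] refl refl]
    by (simp add: lax_id_right_def)
qed

lemma un_nat:
  assumes "f \<in> Arr (cat0 D)" "Cod (cat0 D) f = y"
  shows "cid E (fa F f) \<cdot>\<^sub>1 un F y = un F (Dom (cat0 D) f) \<cdot>\<^sub>1 fc F (cid D f)"
  using un_natural[of f "Dom (cat0 D) f" y] assms by (simp add: Hom_def)

lemma
  assumes "m \<in> Obj (cat1 D)"
  shows un_L: "psrc D m = x \<Longrightarrow> (un F x \<odot> \<one>\<^sub>1 (fp F m)) \<cdot>\<^sub>1 L m = lunit E (fp F m)"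
    and un_R: "ptgt D m = y \<Longrightarrow> (\<one>\<^sub>1 (fp F m) \<odot> un F y) \<cdot>\<^sub>1 R m = runit E (fp F m)"
  using assms lax_lunit[of m "psrc D m" "ptgt D m"] lax_runit[of m "psrc D m" "ptgt D m"]
  by (auto simp: Pro_def lax_id_left_def lax_id_right_def)

text \<open>Equivariance of the image of a cell under the induced actions: naturality of the
  laxators brings the external identity together with \<gamma>, and naturality of the unit
  isomorphisms in the domain finishes.\<close>

lemma
  assumes "\<gamma> \<in> Cells D m n f g"
  shows L_nat: "(fc F (cid D f) \<odot> fc F \<gamma>) \<cdot>\<^sub>1 L n = L m \<cdot>\<^sub>1 fc F \<gamma>"
    and R_nat: "(fc F \<gamma> \<odot> fc F (cid D g)) \<cdot>\<^sub>1 R n = R m \<cdot>\<^sub>1 fc F \<gamma>"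
proof -
  note [simp] = D.Cells_D[OF assms]
  have "(fc F (cid D f) \<odot> fc F \<gamma>) \<cdot>\<^sub>1 L n
      = lax F (pid D (psrc D m)) m \<cdot>\<^sub>1 fc F ((cid D f \<odot>\<^bsub>D\<^esub> \<gamma>) \<cdot>\<^sub>1\<^bsub>D\<^esub> lunit D n)"
    by (simp add: lax_id_left_def lax_nat')
  then show "(fc F (cid D f) \<odot> fc F \<gamma>) \<cdot>\<^sub>1 L n = L m \<cdot>\<^sub>1 fc F \<gamma>"
    by (subst (asm) D.lunit_nat) (simp_all add: lax_id_left_def)
  have "(fc F \<gamma> \<odot> fc F (cid D g)) \<cdot>\<^sub>1 R n
      = lax F m (pid D (ptgt D m)) \<cdot>\<^sub>1 fc F ((\<gamma> \<odot>\<^bsub>D\<^esub> cid D g) \<cdot>\<^sub>1\<^bsub>D\<^esub> runit D n)"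
    by (simp add: lax_id_right_def lax_nat')
  then show "(fc F \<gamma> \<odot> fc F (cid D g)) \<cdot>\<^sub>1 R n = R m \<cdot>\<^sub>1 fc F \<gamma>"
    by (subst (asm) D.runit_nat) (simp_all add: lax_id_right_def)
qed

end


section \<open>Lax transformations: composites, identities and the category they form\<close>

section \<open>The category of lax functors\<close>

locale lax_nat = D: double_category D + E: double_category E
  + F: lax_fun D E F + G: lax_fun D E G
  for D :: "('o, 'a, 'p, 'c) dbl" and E :: "('o2, 'a2, 'p2, 'c2) dbl" (structure)
    and F G :: "('o, 'a, 'p, 'c, 'o2, 'a2, 'p2, 'c2) laxfun"
    and \<alpha> :: "('o, 'a, 'p, 'c, 'o2, 'a2, 'p2, 'c2) laxtrans" +
  assumes trans: "lax_trans D E \<alpha>" and tdom [simp]: "tdom \<alpha> = F" and tcod [simp]: "tcod \<alpha> = G"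
begin

lemma
  assumes "x \<in> Obj (cat0 D)"
  shows tob_arr [simp]: "tob \<alpha> x \<in> Arr (cat0 E)"
    and dom_tob [simp]: "Dom (cat0 E) (tob \<alpha> x) = fo F x"
    and cod_tob [simp]: "Cod (cat0 E) (tob \<alpha> x) = fo G x"
  using lax_trans.tob_closed[OF trans assms] by (auto simp: Hom_def)

lemma
  assumes "m \<in> Obj (cat1 D)"
  shows tpro_cell [simp]: "tpro \<alpha> m \<in> Arr (cat1 E)"
    and dom_tpro [simp]: "Dom (cat1 E) (tpro \<alpha> m) = fp F m"
    and cod_tpro [simp]: "Cod (cat1 E) (tpro \<alpha> m) = fp G m"
    and csrc_tpro [simp]: "csrc E (tpro \<alpha> m) = tob \<alpha> (psrc D m)"
    and ctgt_tpro [simp]: "ctgt E (tpro \<alpha> m) = tob \<alpha> (ptgt D m)"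
  using E.Cells_D[OF lax_trans.tpro_closed[OF trans, of m "psrc D m" "ptgt D m"]] assms
  by (auto simp: Pro_def)

lemma
  assumes "f \<in> Arr (cat0 D)"
  shows tarr_cell [simp]: "tarr \<alpha> f \<in> Arr (cat1 E)"
    and dom_tarr [simp]: "Dom (cat1 E) (tarr \<alpha> f) = pid E (fo F (Dom (cat0 D) f))"
    and cod_tarr [simp]: "Cod (cat1 E) (tarr \<alpha> f) = fp G (pid D (Cod (cat0 D) f))"
    and csrc_tarr [simp]: "csrc E (tarr \<alpha> f) = tob \<alpha> (Dom (cat0 D) f) \<cdot>\<^sub>0 fa G f"
    and ctgt_tarr [simp]: "ctgt E (tarr \<alpha> f) = fa F f \<cdot>\<^sub>0 tob \<alpha> (Cod (cat0 D) f)"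
  using E.Cells_D(1-5)[OF lax_trans.tarr_closed[OF trans, of f "Dom (cat0 D) f" "Cod (cat0 D) f"]] assms
  by (auto simp: Hom_def)

text \<open>The inverse unit isomorphisms of the naturality axiom are those built into
  \<open>lcomp\<close> and \<open>rcomp\<close>, so the laws of these operations become available
  for it.\<close>

lemma cell_cond:
  assumes "\<gamma> \<in> Cells D m n f g"
  shows "E.lcomp (G.L n) (tarr \<alpha> f) (fc F \<gamma> \<cdot>\<^sub>1 tpro \<alpha> n)
    = E.rcomp (G.R n) (tpro \<alpha> m \<cdot>\<^sub>1 fc G \<gamma>) (tarr \<alpha> g)"
  using lax_trans.cell_condition[OF trans assms] D.Cells_D[OF assms]
  by (simp add: E.lcomp_def E.rcomp_def)

lemma tpro_lax:
  assumes "m \<in> Obj (cat1 D)" "n \<in> Obj (cat1 D)" "ptgt D m = psrc D n"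
  shows "(tpro \<alpha> m \<odot> tpro \<alpha> n) \<cdot>\<^sub>1 lax G m n = lax F m n \<cdot>\<^sub>1 tpro \<alpha> (m \<odot>\<^sub>p\<^bsub>D\<^esub> n)"
  using lax_trans.pro_comp[OF trans, of m "psrc D m" "ptgt D m" n "ptgt D n"] assms
  by (simp add: Pro_def)

lemma tpro_un:
  "x \<in> Obj (cat0 D) \<Longrightarrow> un F x \<cdot>\<^sub>1 tpro \<alpha> (pid D x) = cid E (tob \<alpha> x) \<cdot>\<^sub>1 un G x"
  using lax_trans.pro_id[OF trans] by simp

lemma tarr_comp:
  assumes "f \<in> Arr (cat0 D)" "g \<in> Arr (cat0 D)" "Cod (cat0 D) f = Dom (cat0 D) g"
  shows "tarr \<alpha> (f \<cdot>\<^sub>0\<^bsub>D\<^esub> g) = E.lcomp (G.M (Cod (cat0 D) g))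
    (tarr \<alpha> f \<cdot>\<^sub>1 fc G (cid D g)) (cid E (fa F f) \<cdot>\<^sub>1 tarr \<alpha> g)"
  using lax_trans.arr_comp[OF trans, of f "Dom (cat0 D) f" "Cod (cat0 D) f" g "Cod (cat0 D) g"] assms
  by (simp add: Hom_def E.lcomp_def)

lemma tarr_id:
  "x \<in> Obj (cat0 D) \<Longrightarrow> tarr \<alpha> (\<one>\<^sub>0\<^bsub>D\<^esub> x) = cid E (tob \<alpha> x) \<cdot>\<^sub>1 un G x"
  using lax_trans.arr_id[OF trans] by simp

text \<open>At a globular cell the arrow components in the naturality axiom belong to identities. By
  \<open>tarr_id\<close> they are units, and units act trivially, which leaves ordinary
  naturality.\<close>

lemma tpro_nat:
  assumes "\<gamma> \<in> Glob D m n"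
  shows "fc F \<gamma> \<cdot>\<^sub>1 tpro \<alpha> n = tpro \<alpha> m \<cdot>\<^sub>1 fc G \<gamma>"
proof -
  note [simp] = D.Glob_D[OF assms]
  define x y where "x = psrc D m" and "y = ptgt D m"
  note xy [simp] = x_def[symmetric] y_def[symmetric]
  have [simp]: "x \<in> Obj (cat0 D)" "y \<in> Obj (cat0 D)"
    using D.source.obj_closed[of m] D.target.obj_closed[of m] by simp_all
  have "E.lcomp (G.L n) (cid E (tob \<alpha> x) \<cdot>\<^sub>1 un G x) (fc F \<gamma> \<cdot>\<^sub>1 tpro \<alpha> n)
      = E.rcomp (G.R n) (tpro \<alpha> m \<cdot>\<^sub>1 fc G \<gamma>) (cid E (tob \<alpha> y) \<cdot>\<^sub>1 un G y)"
    using cell_cond[of \<gamma> m n "\<one>\<^sub>0\<^bsub>D\<^esub> x" "\<one>\<^sub>0\<^bsub>D\<^esub> y"] assms by (simp add: Glob_def tarr_id)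
  moreover have "E.lcomp (G.L n) (cid E (tob \<alpha> x) \<cdot>\<^sub>1 un G x) (fc F \<gamma> \<cdot>\<^sub>1 tpro \<alpha> n) = fc F \<gamma> \<cdot>\<^sub>1 tpro \<alpha> n"
    by (rule E.lcomp_unit[OF G.un_L]) (auto intro!: E.GlobI)
  moreover have "E.rcomp (G.R n) (tpro \<alpha> m \<cdot>\<^sub>1 fc G \<gamma>) (cid E (tob \<alpha> y) \<cdot>\<^sub>1 un G y) = tpro \<alpha> m \<cdot>\<^sub>1 fc G \<gamma>"
    by (rule E.rcomp_unit[OF G.un_R]) (auto intro!: E.GlobI)
  ultimately show ?thesis by simp
qed

text \<open>Compatibility with the laxator at an identity proarrow, followed by
  \<open>tpro_nat\<close> at the unit isomorphism. These equations make
  \<open>tpro \<alpha> m\<close> equivariant for the induced actions.\<close>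

lemma
  assumes "m \<in> Obj (cat1 D)"
  shows tpro_L: "psrc D m = x \<Longrightarrow> (tpro \<alpha> (pid D x) \<odot> tpro \<alpha> m) \<cdot>\<^sub>1 G.L m = F.L m \<cdot>\<^sub>1 tpro \<alpha> m"
    and tpro_R: "ptgt D m = y \<Longrightarrow> (tpro \<alpha> m \<odot> tpro \<alpha> (pid D y)) \<cdot>\<^sub>1 G.R m = F.R m \<cdot>\<^sub>1 tpro \<alpha> m"
proof -
  note [simp] = assms
  show "(tpro \<alpha> (pid D x) \<odot> tpro \<alpha> m) \<cdot>\<^sub>1 G.L m = F.L m \<cdot>\<^sub>1 tpro \<alpha> m" if "psrc D m = x"
  proof -
    have x: "psrc D m = x" "x \<in> Obj (cat0 D)"
      using that D.source.obj_closed[of m] by simp_all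
    have "(tpro \<alpha> (pid D x) \<odot> tpro \<alpha> m) \<cdot>\<^sub>1 G.L m
        = ((tpro \<alpha> (pid D x) \<odot> tpro \<alpha> m) \<cdot>\<^sub>1 lax G (pid D x) m) \<cdot>\<^sub>1 fc G (lunit D m)"
      using x by (simp add: lax_id_left_def)
    also have "\<dots> = lax F (pid D x) m \<cdot>\<^sub>1 (tpro \<alpha> (pid D x \<odot>\<^sub>p\<^bsub>D\<^esub> m) \<cdot>\<^sub>1 fc G (lunit D m))"
      using x by (simp add: tpro_lax)
    also have "\<dots> = F.L m \<cdot>\<^sub>1 tpro \<alpha> m"
      using x by (subst tpro_nat[symmetric, where n = m]) (auto intro!: D.GlobI simp: lax_id_left_def)
    finally show ?thesis .
  qed
  show "(tpro \<alpha> m \<odot> tpro \<alpha> (pid D y)) \<cdot>\<^sub>1 G.R m = F.R m \<cdot>\<^sub>1 tpro \<alpha> m" if "ptgt D m = y"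
  proof -
    have x: "ptgt D m = y" "y \<in> Obj (cat0 D)"
      using that D.target.obj_closed[of m] by simp_all
    have "(tpro \<alpha> m \<odot> tpro \<alpha> (pid D y)) \<cdot>\<^sub>1 G.R m
        = ((tpro \<alpha> m \<odot> tpro \<alpha> (pid D y)) \<cdot>\<^sub>1 lax G m (pid D y)) \<cdot>\<^sub>1 fc G (runit D m)"
      using x by (simp add: lax_id_right_def)
    also have "\<dots> = lax F m (pid D y) \<cdot>\<^sub>1 (tpro \<alpha> (m \<odot>\<^sub>p\<^bsub>D\<^esub> pid D y) \<cdot>\<^sub>1 fc G (runit D m))"
      using x by (simp add: tpro_lax)
    also have "\<dots> = F.R m \<cdot>\<^sub>1 tpro \<alpha> m"
      using x by (subst tpro_nat[symmetric, where n = m]) (auto intro!: D.GlobI simp: lax_id_right_def)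
    finally show ?thesis .
  qed
qed

lemma tpro_M:
  "x \<in> Obj (cat0 D) \<Longrightarrow>
    (tpro \<alpha> (pid D x) \<odot> tpro \<alpha> (pid D x)) \<cdot>\<^sub>1 G.M x = F.M x \<cdot>\<^sub>1 tpro \<alpha> (pid D x)"
  using tpro_L[of "pid D x" x] by (simp add: F.L_pid G.L_pid)

end

locale lax_setup = D: double_category D + E: double_category E
  for D :: "('o, 'a, 'p, 'c) dbl" and E :: "('o2, 'a2, 'p2, 'c2) dbl" (structure)
begin

lemma lax_funI: "lax_functor D E F \<Longrightarrow> lax_fun D E F"
  by (simp add: lax_fun_def D.double_category_axioms E.double_category_axioms)

lemma lax_natI: "lax_trans D E \<alpha> \<Longrightarrow> lax_nat D E (tdom \<alpha>) (tcod \<alpha>) \<alpha>"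
  by (simp add: lax_nat_def lax_nat_axioms_def D.double_category_axioms E.double_category_axioms
      lax_funI lax_trans.lax_dom lax_trans.lax_cod)

lemma lax_transI:
  assumes "lax_functor D E F" "lax_functor D E G" "tdom \<alpha> = F" "tcod \<alpha> = G"
    and "restrict_laxtrans D \<alpha> = \<alpha>"
    and tob: "\<And>x. x \<in> Obj (cat0 D) \<Longrightarrow> tob \<alpha> x \<in> Arr (cat0 E)
        \<and> Dom (cat0 E) (tob \<alpha> x) = fo F x \<and> Cod (cat0 E) (tob \<alpha> x) = fo G x"
    and tpro: "\<And>m. m \<in> Obj (cat1 D) \<Longrightarrow> tpro \<alpha> m \<in> Arr (cat1 E)
        \<and> Dom (cat1 E) (tpro \<alpha> m) = fp F m \<and> Cod (cat1 E) (tpro \<alpha> m) = fp G m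
        \<and> csrc E (tpro \<alpha> m) = tob \<alpha> (psrc D m) \<and> ctgt E (tpro \<alpha> m) = tob \<alpha> (ptgt D m)"
    and tarr: "\<And>f. f \<in> Arr (cat0 D) \<Longrightarrow> tarr \<alpha> f \<in> Arr (cat1 E)
        \<and> Dom (cat1 E) (tarr \<alpha> f) = pid E (fo F (Dom (cat0 D) f))
        \<and> Cod (cat1 E) (tarr \<alpha> f) = fp G (pid D (Cod (cat0 D) f))
        \<and> csrc E (tarr \<alpha> f) = tob \<alpha> (Dom (cat0 D) f) \<cdot>\<^sub>0 fa G f
        \<and> ctgt E (tarr \<alpha> f) = fa F f \<cdot>\<^sub>0 tob \<alpha> (Cod (cat0 D) f)"
    and cell: "\<And>\<gamma> m n f g. \<gamma> \<in> Cells D m n f g \<Longrightarrow>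
        E.lcomp (lax_id_left D E G n) (tarr \<alpha> f) (fc F \<gamma> \<cdot>\<^sub>1 tpro \<alpha> n)
      = E.rcomp (lax_id_right D E G n) (tpro \<alpha> m \<cdot>\<^sub>1 fc G \<gamma>) (tarr \<alpha> g)"
    and lax: "\<And>m n. \<lbrakk>m \<in> Obj (cat1 D); n \<in> Obj (cat1 D); ptgt D m = psrc D n\<rbrakk> \<Longrightarrow>
        (tpro \<alpha> m \<odot> tpro \<alpha> n) \<cdot>\<^sub>1 lax G m n = lax F m n \<cdot>\<^sub>1 tpro \<alpha> (m \<odot>\<^sub>p\<^bsub>D\<^esub> n)"
    and un: "\<And>x. x \<in> Obj (cat0 D) \<Longrightarrow>
        un F x \<cdot>\<^sub>1 tpro \<alpha> (pid D x) = cid E (tob \<alpha> x) \<cdot>\<^sub>1 un G x"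
    and comp: "\<And>f g. \<lbrakk>f \<in> Arr (cat0 D); g \<in> Arr (cat0 D); Cod (cat0 D) f = Dom (cat0 D) g\<rbrakk> \<Longrightarrow>
        tarr \<alpha> (f \<cdot>\<^sub>0\<^bsub>D\<^esub> g) = E.lcomp (lax_id_id D E G (Cod (cat0 D) g))
          (tarr \<alpha> f \<cdot>\<^sub>1 fc G (cid D g)) (cid E (fa F f) \<cdot>\<^sub>1 tarr \<alpha> g)"
    and id: "\<And>x. x \<in> Obj (cat0 D) \<Longrightarrow> tarr \<alpha> (\<one>\<^sub>0\<^bsub>D\<^esub> x) = cid E (tob \<alpha> x) \<cdot>\<^sub>1 un G x"
  shows "lax_trans D E \<alpha>"
proof -
  interpret F: lax_fun D E F using assms(1) by (rule lax_funI)
  interpret G: lax_fun D E G using assms(2) by (rule lax_funI)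
  note [simp] = assms(3,4) tob tpro tarr
  show ?thesis
  proof (rule lax_trans.intro)
    show "lax_functor D E (tdom \<alpha>)" "lax_functor D E (tcod \<alpha>)" "restrict_laxtrans D \<alpha> = \<alpha>"
      using assms(1-5) by simp_all
  next
    fix x assume "x \<in> Obj (cat0 D)"
    then show "tob \<alpha> x \<in> Hom (cat0 E) (fo (tdom \<alpha>) x) (fo (tcod \<alpha>) x)"
      "un (tdom \<alpha>) x \<cdot>\<^sub>1 tpro \<alpha> (pid D x) = cid E (tob \<alpha> x) \<cdot>\<^sub>1 un (tcod \<alpha>) x"
      "tarr \<alpha> (\<one>\<^sub>0\<^bsub>D\<^esub> x) = cid E (tob \<alpha> x) \<cdot>\<^sub>1 un (tcod \<alpha>) x"
      by (simp_all add: Hom_def un id)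
  next
    fix m x y assume "m \<in> Pro D x y"
    then show "tpro \<alpha> m \<in> Cells E (fp (tdom \<alpha>) m) (fp (tcod \<alpha>) m) (tob \<alpha> x) (tob \<alpha> y)"
      by (auto simp: Pro_def intro!: E.CellsI)
  next
    fix f x y assume "f \<in> Hom (cat0 D) x y"
    then show "tarr \<alpha> f \<in> Cells E (pid E (fo (tdom \<alpha>) x)) (fp (tcod \<alpha>) (pid D y))
                     (tob \<alpha> x \<cdot>\<^sub>0 fa (tcod \<alpha>) f) (fa (tdom \<alpha>) f \<cdot>\<^sub>0 tob \<alpha> y)"
      by (auto simp: Hom_def intro!: E.CellsI)
  next
    fix \<gamma> m n f g assume *: "\<gamma> \<in> Cells D m n f g"
    note [simp] = D.Cells_D[OF *]
    show "inv\<^sub>1 (lunit E (fp (tdom \<alpha>) m)) \<cdot>\<^sub>1 (tarr \<alpha> f \<odot> (fc (tdom \<alpha>) \<gamma> \<cdot>\<^sub>1 tpro \<alpha> n))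
          \<cdot>\<^sub>1 lax_id_left D E (tcod \<alpha>) n
        = inv\<^sub>1 (runit E (fp (tdom \<alpha>) m)) \<cdot>\<^sub>1 ((tpro \<alpha> m \<cdot>\<^sub>1 fc (tcod \<alpha>) \<gamma>) \<odot> tarr \<alpha> g)
          \<cdot>\<^sub>1 lax_id_right D E (tcod \<alpha>) n"
      using cell[OF *] by (simp add: E.lcomp_def E.rcomp_def)
  next
    fix m n x y z assume "m \<in> Pro D x y" "n \<in> Pro D y z"
    then show "lax (tdom \<alpha>) m n \<cdot>\<^sub>1 tpro \<alpha> (m \<odot>\<^sub>p\<^bsub>D\<^esub> n) = (tpro \<alpha> m \<odot> tpro \<alpha> n) \<cdot>\<^sub>1 lax (tcod \<alpha>) m n"
      by (simp add: Pro_def lax)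
  next
    fix f g x y z assume *: "f \<in> Hom (cat0 D) x y" "g \<in> Hom (cat0 D) y z"
    then have "f \<in> Arr (cat0 D)" "Dom (cat0 D) f = x" "Cod (cat0 D) f = y"
      "g \<in> Arr (cat0 D)" "Dom (cat0 D) g = y" "Cod (cat0 D) g = z"
      by (auto simp: Hom_def)
    then show "tarr \<alpha> (f \<cdot>\<^sub>0\<^bsub>D\<^esub> g) = inv\<^sub>1 (lunit E (pid E (fo (tdom \<alpha>) x)))
            \<cdot>\<^sub>1 ((tarr \<alpha> f \<cdot>\<^sub>1 fc (tcod \<alpha>) (cid D g)) \<odot> (cid E (fa (tdom \<alpha>) f) \<cdot>\<^sub>1 tarr \<alpha> g))
            \<cdot>\<^sub>1 lax_id_id D E (tcod \<alpha>) z"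
      using comp[of f g] by (auto simp add: E.lcomp_def)
  qed
qed

lemma tob_trans_comp [simp]: "x \<in> Obj (cat0 D) \<Longrightarrow> tob (trans_comp D E \<alpha> \<beta>) x = tob \<alpha> x \<cdot>\<^sub>0 tob \<beta> x"
  and tpro_trans_comp [simp]: "m \<in> Obj (cat1 D) \<Longrightarrow> tpro (trans_comp D E \<alpha> \<beta>) m = tpro \<alpha> m \<cdot>\<^sub>1 tpro \<beta> m"
  and tdom_trans_comp [simp]: "tdom (trans_comp D E \<alpha> \<beta>) = tdom \<alpha>"
  and tcod_trans_comp [simp]: "tcod (trans_comp D E \<alpha> \<beta>) = tcod \<beta>"
  by (simp_all add: trans_comp_def restrict_laxtrans_def)

lemma tarr_trans_comp:
  assumes "lax_nat D E F G \<alpha>" "lax_nat D E G H \<beta>" "f \<in> Arr (cat0 D)"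
  shows "tarr (trans_comp D E \<alpha> \<beta>) f = E.lcomp (lax_id_id D E H (Cod (cat0 D) f))
    (cid E (tob \<alpha> (Dom (cat0 D) f)) \<cdot>\<^sub>1 tarr \<beta> f) (tarr \<alpha> f \<cdot>\<^sub>1 tpro \<beta> (pid D (Cod (cat0 D) f)))"
proof -
  interpret a: lax_nat D E F G \<alpha> by fact
  interpret b: lax_nat D E G H \<beta> by fact
  show ?thesis
    using assms(3) by (simp add: trans_comp_def restrict_laxtrans_def Let_def E.lcomp_def)
qed

lemma restrict_restrict_laxtrans [simp]:
  "restrict_laxtrans D (restrict_laxtrans D \<alpha>) = restrict_laxtrans D \<alpha>"
  by (simp add: restrict_laxtrans_def)

text \<open>An arrow component of the composite is a product of two cells out of units. Both its
  naturality axiom and its axiom for composable arrows come from rebracketing such products until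
  the axioms of \<alpha> and \<beta> apply to adjacent factors.\<close>

lemma lax_trans_comp:
  assumes "lax_trans D E \<alpha>" "lax_trans D E \<beta>" "tcod \<alpha> = tdom \<beta>"
  shows "lax_trans D E (trans_comp D E \<alpha> \<beta>)"
proof -
  define F G H where "F = tdom \<alpha>" and "G = tdom \<beta>" and "H = tcod \<beta>"
  have ab: "lax_nat D E F G \<alpha>" "lax_nat D E G H \<beta>"
    using lax_natI[OF assms(1)] lax_natI[OF assms(2)] assms(3) by (simp_all add: F_def G_def H_def)
  interpret a: lax_nat D E F G \<alpha> by fact
  interpret b: lax_nat D E G H \<beta> by fact
  let ?c = "trans_comp D E \<alpha> \<beta>"
  note [simp] = tarr_trans_comp[OF ab]
  show ?thesis
  proof (rule lax_transI[of F H])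
    show "lax_functor D E F" "lax_functor D E H" "tdom ?c = F" "tcod ?c = H"
      by (simp_all add: a.F.lax_functor_axioms b.G.lax_functor_axioms)
    show "restrict_laxtrans D ?c = ?c"
      by (simp add: trans_comp_def)
  next
    fix x assume [simp]: "x \<in> Obj (cat0 D)"
    show "tob ?c x \<in> Arr (cat0 E) \<and> Dom (cat0 E) (tob ?c x) = fo F x \<and> Cod (cat0 E) (tob ?c x) = fo H x"
      by simp
    show "un F x \<cdot>\<^sub>1 tpro ?c (pid D x) = cid E (tob ?c x) \<cdot>\<^sub>1 un H x"
      using arg_cong[OF a.tpro_un[of x], of "\<lambda>t. t \<cdot>\<^sub>1 tpro \<beta> (pid D x)"] by (simp add: b.tpro_un)
    have "tarr ?c (\<one>\<^sub>0\<^bsub>D\<^esub> x) = E.lcomp (b.G.M x)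
      (cid E (tob \<alpha> x) \<cdot>\<^sub>1 (cid E (tob \<beta> x) \<cdot>\<^sub>1 un H x)) (cid E (tob \<alpha> x) \<cdot>\<^sub>1 (un G x \<cdot>\<^sub>1 tpro \<beta> (pid D x)))"
      by (simp add: a.tarr_id b.tarr_id)
    also have "\<dots> = E.lcomp (b.G.L (pid D x))
      (cid E (tob \<alpha> x \<cdot>\<^sub>0 tob \<beta> x) \<cdot>\<^sub>1 un H x) (cid E (tob \<alpha> x \<cdot>\<^sub>0 tob \<beta> x) \<cdot>\<^sub>1 un H x)"
      by (simp add: b.tpro_un b.G.L_pid)
    also have "\<dots> = cid E (tob \<alpha> x \<cdot>\<^sub>0 tob \<beta> x) \<cdot>\<^sub>1 un H x"
      by (rule E.lcomp_unit[OF b.G.un_L]) (auto intro!: E.GlobI)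
    finally show "tarr ?c (\<one>\<^sub>0\<^bsub>D\<^esub> x) = cid E (tob ?c x) \<cdot>\<^sub>1 un H x"
      by simp
  next
    fix m assume "m \<in> Obj (cat1 D)"
    then show "tpro ?c m \<in> Arr (cat1 E) \<and> Dom (cat1 E) (tpro ?c m) = fp F m \<and>
         Cod (cat1 E) (tpro ?c m) = fp H m \<and>
         csrc E (tpro ?c m) = tob ?c (psrc D m) \<and> ctgt E (tpro ?c m) = tob ?c (ptgt D m)"
      by simp
  next
    fix f assume "f \<in> Arr (cat0 D)"
    then show "tarr ?c f \<in> Arr (cat1 E) \<and>
         Dom (cat1 E) (tarr ?c f) = pid E (fo F (Dom (cat0 D) f)) \<and>
         Cod (cat1 E) (tarr ?c f) = fp H (pid D (Cod (cat0 D) f)) \<and>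
         csrc E (tarr ?c f) = tob ?c (Dom (cat0 D) f) \<cdot>\<^sub>0 fa H f \<and>
         ctgt E (tarr ?c f) = fa F f \<cdot>\<^sub>0 tob ?c (Cod (cat0 D) f)"
      by simp
  next
    fix m n assume "m \<in> Obj (cat1 D)" "n \<in> Obj (cat1 D)" "ptgt D m = psrc D n"
    then show "(tpro ?c m \<odot> tpro ?c n) \<cdot>\<^sub>1 lax H m n = lax F m n \<cdot>\<^sub>1 tpro ?c (m \<odot>\<^sub>p\<^bsub>D\<^esub> n)"
      using arg_cong[OF a.tpro_lax[of m n], of "\<lambda>t. t \<cdot>\<^sub>1 tpro \<beta> (m \<odot>\<^sub>p\<^bsub>D\<^esub> n)"]
        b.tpro_lax[of m n] E.hcomp_vcomp'[of "tpro \<alpha> m" "tpro \<alpha> n" "tpro \<beta> m" "tpro \<beta> n" "lax H m n"]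
      by simp
  next
    fix \<gamma> m n f g assume \<gamma>: "\<gamma> \<in> Cells D m n f g"
    note [simp] = D.Cells_D[OF \<gamma>]
    define x y w z where "x = psrc D m" and "y = ptgt D m" and "w = psrc D n" and "z = ptgt D n"
    note [simp] = x_def[symmetric] y_def[symmetric] w_def[symmetric] z_def[symmetric]
    have [simp]: "x \<in> Obj (cat0 D)" "y \<in> Obj (cat0 D)" "w \<in> Obj (cat0 D)" "z \<in> Obj (cat0 D)"
      using D.source.obj_closed[of m] D.target.obj_closed[of m]
        D.source.obj_closed[of n] D.target.obj_closed[of n] by simp_all
    have "E.lcomp (b.G.L n) (tarr ?c f) (fc F \<gamma> \<cdot>\<^sub>1 tpro ?c n)
      = E.lcomp (b.G.L n)
          (E.lcomp (b.G.M w) (cid E (tob \<alpha> x) \<cdot>\<^sub>1 tarr \<beta> f) (tarr \<alpha> f \<cdot>\<^sub>1 tpro \<beta> (pid D w)))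
          (fc F \<gamma> \<cdot>\<^sub>1 (tpro \<alpha> n \<cdot>\<^sub>1 tpro \<beta> n))"
      by simp
    \<comment> \<open>The component of \<alpha> is made to act first, where it meets the naturality
      axiom of \<alpha>, transported along \<open>tpro \<beta> n\<close>.\<close>
    also have "\<dots> = E.lcomp (b.G.L n) (cid E (tob \<alpha> x) \<cdot>\<^sub>1 tarr \<beta> f)
        (E.lcomp (b.G.L n) (tarr \<alpha> f \<cdot>\<^sub>1 tpro \<beta> (pid D w)) ((fc F \<gamma> \<cdot>\<^sub>1 tpro \<alpha> n) \<cdot>\<^sub>1 tpro \<beta> n))"
      by (subst E.lcomp_lcomp[OF b.G.square_left, where x = "fo F x"]) simp_all
    also have "E.lcomp (b.G.L n) (tarr \<alpha> f \<cdot>\<^sub>1 tpro \<beta> (pid D w)) ((fc F \<gamma> \<cdot>\<^sub>1 tpro \<alpha> n) \<cdot>\<^sub>1 tpro \<beta> n)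
      = E.lcomp (a.G.L n) (tarr \<alpha> f) (fc F \<gamma> \<cdot>\<^sub>1 tpro \<alpha> n) \<cdot>\<^sub>1 tpro \<beta> n"
      by (subst E.lcomp_vcomp[OF b.tpro_L]) simp_all
    also have "\<dots> = E.rcomp (b.G.R n) ((tpro \<alpha> m \<cdot>\<^sub>1 fc G \<gamma>) \<cdot>\<^sub>1 tpro \<beta> n) (tarr \<alpha> g \<cdot>\<^sub>1 tpro \<beta> (pid D z))"
      unfolding a.cell_cond[OF \<gamma>] by (subst E.rcomp_vcomp[OF b.tpro_R]) simp_all
    \<comment> \<open>Left and right action commute; this frees the component of \<beta> to meet its
      own naturality axiom at \<gamma>.\<close>
    also have "E.lcomp (b.G.L n) (cid E (tob \<alpha> x) \<cdot>\<^sub>1 tarr \<beta> f) \<dots>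
      = E.rcomp (b.G.R n) (E.lcomp (b.G.L n) (cid E (tob \<alpha> x) \<cdot>\<^sub>1 tarr \<beta> f)
          (tpro \<alpha> m \<cdot>\<^sub>1 (fc G \<gamma> \<cdot>\<^sub>1 tpro \<beta> n))) (tarr \<alpha> g \<cdot>\<^sub>1 tpro \<beta> (pid D z))"
      by (subst E.rcomp_lcomp[OF b.G.square_mid, where x = "fo F x" and y = "fo F y"]) simp_all
    also have "E.lcomp (b.G.L n) (cid E (tob \<alpha> x) \<cdot>\<^sub>1 tarr \<beta> f) (tpro \<alpha> m \<cdot>\<^sub>1 (fc G \<gamma> \<cdot>\<^sub>1 tpro \<beta> n))
      = tpro \<alpha> m \<cdot>\<^sub>1 E.lcomp (b.G.L n) (tarr \<beta> f) (fc G \<gamma> \<cdot>\<^sub>1 tpro \<beta> n)"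
      by (subst E.vcomp_lcomp) simp_all
    also have "\<dots> = E.rcomp (b.G.R n) (tpro \<alpha> m \<cdot>\<^sub>1 (tpro \<beta> m \<cdot>\<^sub>1 fc H \<gamma>)) (cid E (tob \<alpha> y) \<cdot>\<^sub>1 tarr \<beta> g)"
      unfolding b.cell_cond[OF \<gamma>] by (subst E.vcomp_rcomp) simp_all
    also have "E.rcomp (b.G.R n) \<dots> (tarr \<alpha> g \<cdot>\<^sub>1 tpro \<beta> (pid D z))
      = E.rcomp (b.G.R n) (tpro \<alpha> m \<cdot>\<^sub>1 (tpro \<beta> m \<cdot>\<^sub>1 fc H \<gamma>))
          (E.lcomp (b.G.M z) (cid E (tob \<alpha> y) \<cdot>\<^sub>1 tarr \<beta> g) (tarr \<alpha> g \<cdot>\<^sub>1 tpro \<beta> (pid D z)))"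
      by (subst E.rcomp_rcomp[OF b.G.square_right, where x = "fo F y"]) simp_all
    finally show "E.lcomp (b.G.L n) (tarr ?c f) (fc F \<gamma> \<cdot>\<^sub>1 tpro ?c n)
      = E.rcomp (b.G.R n) (tpro ?c m \<cdot>\<^sub>1 fc H \<gamma>) (tarr ?c g)"
      by simp
  next
    fix f g assume [simp]: "f \<in> Arr (cat0 D)" "g \<in> Arr (cat0 D)" "Cod (cat0 D) f = Dom (cat0 D) g"
    define x y z where "x = Dom (cat0 D) f" and "y = Dom (cat0 D) g" and "z = Cod (cat0 D) g"
    note [simp] = x_def[symmetric] y_def[symmetric] z_def[symmetric]
    have [simp]: "x \<in> Obj (cat0 D)" "y \<in> Obj (cat0 D)" "z \<in> Obj (cat0 D)"
      using D.source.B.dom_closed[of f] D.source.B.dom_closed[of g] D.source.B.cod_closed[of g]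
      by simp_all
    have sq: "E.assoc_square (b.G.M z, b.G.M z) (b.G.M z, b.G.M z)
        (fp H (pid D z)) (fp H (pid D z)) (fp H (pid D z))"
      using b.G.square_left[of "pid D z" z] by (simp add: b.G.L_pid)
    let ?H = "fc H (cid D g)" and ?Mz = "b.G.M z" and ?Fx = "fo F x"
    let ?\<beta>f = "cid E (tob \<alpha> x) \<cdot>\<^sub>1 (tarr \<beta> f \<cdot>\<^sub>1 ?H)"
      and ?\<beta>g = "cid E (tob \<alpha> x) \<cdot>\<^sub>1 (cid E (fa G f) \<cdot>\<^sub>1 tarr \<beta> g)"
      and ?\<beta>g' = "cid E (fa F f) \<cdot>\<^sub>1 (cid E (tob \<alpha> y) \<cdot>\<^sub>1 tarr \<beta> g)"
      and ?\<alpha>f = "tarr \<alpha> f \<cdot>\<^sub>1 (fc G (cid D g) \<cdot>\<^sub>1 tpro \<beta> (pid D z))"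
      and ?\<alpha>f' = "tarr \<alpha> f \<cdot>\<^sub>1 (tpro \<beta> (pid D y) \<cdot>\<^sub>1 ?H)"
      and ?\<alpha>g = "cid E (fa F f) \<cdot>\<^sub>1 (tarr \<alpha> g \<cdot>\<^sub>1 tpro \<beta> (pid D z))"
    have g: "cid D g \<in> Cells D (pid D y) (pid D z) g g"
      by (rule D.CellsI) simp_all
    \<comment> \<open>The naturality axiom of \<beta> at the external identity on \<open>g\<close>,
      preceded by \<open>tarr \<alpha> f\<close>. Left and right product agree since both factors
      start at a unit, so the axiom exchanges two factors of a product.\<close>
    have swap: "E.lcomp ?Mz ?\<beta>g ?\<alpha>f = E.lcomp ?Mz ?\<alpha>f' ?\<beta>g'"
    proof -
      have "E.lcomp ?Mz ?\<beta>g ?\<alpha>f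
          = tarr \<alpha> f \<cdot>\<^sub>1 E.lcomp ?Mz (tarr \<beta> g) (fc G (cid D g) \<cdot>\<^sub>1 tpro \<beta> (pid D z))"
        by (subst E.vcomp_lcomp) simp_all
      also have "\<dots> = tarr \<alpha> f \<cdot>\<^sub>1 E.rcomp ?Mz (tpro \<beta> (pid D y) \<cdot>\<^sub>1 ?H) (tarr \<beta> g)"
        using b.cell_cond[OF g] by (simp add: b.G.L_pid b.G.R_pid)
      also have "\<dots> = E.rcomp ?Mz ?\<alpha>f' ?\<beta>g'"
        by (subst E.vcomp_rcomp) simp_all
      also have "\<dots> = E.lcomp ?Mz ?\<alpha>f' ?\<beta>g'"
        by (rule E.lcomp_eq_rcomp[symmetric, where x = ?Fx]) simp_all
      finally show ?thesis .
    qed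
    \<comment> \<open>Expanding the components gives a product of four cells in the order
      \<open>?\<beta>f\<close>, \<open>?\<beta>g\<close>, \<open>?\<alpha>f\<close>,
      \<open>?\<alpha>g\<close>. In the claim the two in the middle stand the other way round, which
      is what \<open>swap\<close> repairs.\<close>
    have "tarr ?c (f \<cdot>\<^sub>0\<^bsub>D\<^esub> g) = E.lcomp ?Mz
        (cid E (tob \<alpha> x) \<cdot>\<^sub>1 E.lcomp ?Mz (tarr \<beta> f \<cdot>\<^sub>1 ?H) (cid E (fa G f) \<cdot>\<^sub>1 tarr \<beta> g))
        (E.lcomp (a.G.M z) (tarr \<alpha> f \<cdot>\<^sub>1 fc G (cid D g)) (cid E (fa F f) \<cdot>\<^sub>1 tarr \<alpha> g) \<cdot>\<^sub>1 tpro \<beta> (pid D z))"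
      by (simp add: a.tarr_comp b.tarr_comp)
    also have "\<dots> = E.lcomp ?Mz (E.lcomp ?Mz ?\<beta>f ?\<beta>g) (E.lcomp ?Mz ?\<alpha>f ?\<alpha>g)"
      by (subst E.vcomp_lcomp, simp_all, subst E.lcomp_vcomp[OF b.tpro_M]) simp_all
    also have "\<dots> = E.lcomp ?Mz ?\<beta>f (E.lcomp ?Mz (E.lcomp ?Mz ?\<beta>g ?\<alpha>f) ?\<alpha>g)"
      by (simp add: E.lcomp_lcomp[OF sq, where x = ?Fx])
    also have "\<dots> = E.lcomp ?Mz (E.lcomp ?Mz ?\<beta>f ?\<alpha>f') (E.lcomp ?Mz ?\<beta>g' ?\<alpha>g)"
      unfolding swap by (simp add: E.lcomp_lcomp[OF sq, where x = ?Fx])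
    also have "E.lcomp ?Mz ?\<beta>f ?\<alpha>f' = tarr ?c f \<cdot>\<^sub>1 ?H"
      using b.G.L_nat[OF g]
      by (simp, subst E.lcomp_vcomp[where \<phi> = ?H and l' = ?Mz]) (simp_all add: b.G.L_pid)
    also have "E.lcomp ?Mz ?\<beta>g' ?\<alpha>g = cid E (fa F f) \<cdot>\<^sub>1 tarr ?c g"
      by (simp, subst E.vcomp_lcomp) simp_all
    finally show "tarr ?c (f \<cdot>\<^sub>0\<^bsub>D\<^esub> g) = E.lcomp (b.G.M (Cod (cat0 D) g))
          (tarr ?c f \<cdot>\<^sub>1 fc H (cid D g)) (cid E (fa F f) \<cdot>\<^sub>1 tarr ?c g)"
      by simp
  qed
qed

lemma tob_trans_id [simp]: "x \<in> Obj (cat0 D) \<Longrightarrow> tob (trans_id D E F) x = \<one>\<^sub>0 (fo F x)"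
  and tpro_trans_id [simp]: "m \<in> Obj (cat1 D) \<Longrightarrow> tpro (trans_id D E F) m = \<one>\<^sub>1 (fp F m)"
  and tarr_trans_id [simp]: "f \<in> Arr (cat0 D)
    \<Longrightarrow> tarr (trans_id D E F) f = cid E (fa F f) \<cdot>\<^sub>1 un F (Cod (cat0 D) f)"
  and tdom_trans_id [simp]: "tdom (trans_id D E F) = F"
  and tcod_trans_id [simp]: "tcod (trans_id D E F) = F"
  by (simp_all add: trans_id_def restrict_laxtrans_def)

lemma lax_trans_id:
  assumes "lax_functor D E F"
  shows "lax_trans D E (trans_id D E F)"
proof -
  interpret F: lax_fun D E F using assms by (rule lax_funI)
  show ?thesis
  proof (rule lax_transI[OF assms assms])
    show "restrict_laxtrans D (trans_id D E F) = trans_id D E F"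
      by (simp add: trans_id_def)
  next
    fix \<gamma> m n f g assume \<gamma>: "\<gamma> \<in> Cells D m n f g"
    note [simp] = D.Cells_D[OF \<gamma>]
    \<comment> \<open>On both sides the arrow component is a unit, so the naturality axiom collapses
      to \<open>fc F \<gamma>\<close> on each side.\<close>
    have "E.lcomp (F.L n) (cid E (fa F f) \<cdot>\<^sub>1 un F (psrc D n)) (fc F \<gamma>) = fc F \<gamma>"
      by (rule E.lcomp_unit[OF F.un_L]) (auto intro!: E.GlobI)
    moreover have "E.rcomp (F.R n) (fc F \<gamma>) (cid E (fa F g) \<cdot>\<^sub>1 un F (ptgt D n)) = fc F \<gamma>"
      by (rule E.rcomp_unit[OF F.un_R]) (auto intro!: E.GlobI)
    ultimately show "E.lcomp (F.L n) (tarr (trans_id D E F) f) (fc F \<gamma> \<cdot>\<^sub>1 tpro (trans_id D E F) n)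
      = E.rcomp (F.R n) (tpro (trans_id D E F) m \<cdot>\<^sub>1 fc F \<gamma>) (tarr (trans_id D E F) g)"
      by simp
  next
    fix f g assume [simp]: "f \<in> Arr (cat0 D)" "g \<in> Arr (cat0 D)" "Cod (cat0 D) f = Dom (cat0 D) g"
    let ?z = "Cod (cat0 D) g"
    have "E.lcomp (F.L (pid D ?z)) (cid E (fa F (f \<cdot>\<^sub>0\<^bsub>D\<^esub> g)) \<cdot>\<^sub>1 un F ?z)
        (cid E (fa F (f \<cdot>\<^sub>0\<^bsub>D\<^esub> g)) \<cdot>\<^sub>1 un F ?z) = cid E (fa F (f \<cdot>\<^sub>0\<^bsub>D\<^esub> g)) \<cdot>\<^sub>1 un F ?z"
      by (rule E.lcomp_unit[OF F.un_L]) (auto intro!: E.GlobI)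
    moreover have "un F (Dom (cat0 D) g) \<cdot>\<^sub>1 fc F (cid D g) = cid E (fa F g) \<cdot>\<^sub>1 un F ?z"
      by (simp add: F.un_nat)
    ultimately show "tarr (trans_id D E F) (f \<cdot>\<^sub>0\<^bsub>D\<^esub> g) = E.lcomp (F.M ?z)
          (tarr (trans_id D E F) f \<cdot>\<^sub>1 fc F (cid D g)) (cid E (fa F f) \<cdot>\<^sub>1 tarr (trans_id D E F) g)"
      by (simp add: F.L_pid)
  qed (simp_all add: E.hcomp_vid)
qed

lemma laxtrans_eqI:
  assumes "restrict_laxtrans D \<alpha> = \<alpha>" "restrict_laxtrans D \<beta> = \<beta>" "tdom \<alpha> = tdom \<beta>" "tcod \<alpha> = tcod \<beta>"
    "\<And>x. x \<in> Obj (cat0 D) \<Longrightarrow> tob \<alpha> x = tob \<beta> x"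
    "\<And>m. m \<in> Obj (cat1 D) \<Longrightarrow> tpro \<alpha> m = tpro \<beta> m"
    "\<And>f. f \<in> Arr (cat0 D) \<Longrightarrow> tarr \<alpha> f = tarr \<beta> f"
  shows "\<alpha> = \<beta>"
proof -
  have "restrict_laxtrans D \<alpha> = restrict_laxtrans D \<beta>"
    unfolding restrict_laxtrans_def using assms(3-) by (auto intro!: restrict_ext)
  then show ?thesis unfolding assms(1,2) .
qed

lemma restrict_trans_comp [simp]: "restrict_laxtrans D (trans_comp D E \<alpha> \<beta>) = trans_comp D E \<alpha> \<beta>"
  by (simp add: trans_comp_def)

text \<open>Object and proarrow components compose as in E, so the content lies in the arrow
  components: identities contribute units, which act trivially, and associativity is that of
  \<open>lcomp\<close>.\<close>

theorem category_Lax: "category (Lax D E)"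
proof
  fix f assume "f \<in> Arr (Lax D E)"
  then show "Dom (Lax D E) f \<in> Obj (Lax D E)" "Cod (Lax D E) f \<in> Obj (Lax D E)"
    by (simp_all add: Lax_def lax_trans.lax_dom lax_trans.lax_cod)
next
  fix x assume "x \<in> Obj (Lax D E)"
  then show "cat.Id (Lax D E) x \<in> Hom (Lax D E) x x"
    by (simp add: Lax_def Hom_def lax_trans_id)
next
  fix f g x y z assume "f \<in> Hom (Lax D E) x y" "g \<in> Hom (Lax D E) y z"
  then show "f \<cdot>\<^bsub>Lax D E\<^esub> g \<in> Hom (Lax D E) x z"
    by (simp add: Lax_def Hom_def lax_trans_comp)
next
  fix \<alpha> F G assume "\<alpha> \<in> Hom (Lax D E) F G"
  then have \<alpha>: "lax_trans D E \<alpha>" "tdom \<alpha> = F" "tcod \<alpha> = G"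
    by (auto simp: Hom_def Lax_def)
  interpret a: lax_nat D E F G \<alpha> using lax_natI[OF \<alpha>(1)] \<alpha> by simp
  have 1: "lax_nat D E F F (trans_id D E F)" "lax_nat D E G G (trans_id D E G)"
    using lax_natI[OF lax_trans_id[OF a.F.lax_functor_axioms]]
      lax_natI[OF lax_trans_id[OF a.G.lax_functor_axioms]] by simp_all
  have "trans_comp D E (trans_id D E F) \<alpha> = \<alpha>"
  proof (rule laxtrans_eqI)
    fix f assume [simp]: "f \<in> Arr (cat0 D)"
    let ?x = "Dom (cat0 D) f" and ?y = "Cod (cat0 D) f"
    have "tarr (trans_comp D E (trans_id D E F) \<alpha>) f
        = E.lcomp (a.G.M ?y) (tarr \<alpha> f) (cid E (fa F f) \<cdot>\<^sub>1 (cid E (tob \<alpha> ?y) \<cdot>\<^sub>1 un G ?y))"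
      by (simp add: tarr_trans_comp[OF 1(1) a.lax_nat_axioms] a.tpro_un)
    \<comment> \<open>Both factors start at a unit, so the left product may be read as a right
      product, for which the unit in the second factor is neutral.\<close>
    also have "\<dots> = E.rcomp (a.G.R (pid D ?y)) (tarr \<alpha> f) (cid E (fa F f \<cdot>\<^sub>0 tob \<alpha> ?y) \<cdot>\<^sub>1 un G ?y)"
      by (subst E.lcomp_eq_rcomp[where x = "fo F ?x"]) (simp_all add: a.G.R_pid)
    also have "\<dots> = tarr \<alpha> f"
      by (rule E.rcomp_unit[OF a.G.un_R]) (auto intro!: E.GlobI)
    finally show "tarr (trans_comp D E (trans_id D E F) \<alpha>) f = tarr \<alpha> f" .
  qed (simp_all add: lax_trans.extensional[OF \<alpha>(1)] \<alpha>)
  then show "cat.Id (Lax D E) F \<cdot>\<^bsub>Lax D E\<^esub> \<alpha> = \<alpha>"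
    by (simp add: Lax_def)
  have "trans_comp D E \<alpha> (trans_id D E G) = \<alpha>"
  proof (rule laxtrans_eqI)
    fix f assume [simp]: "f \<in> Arr (cat0 D)"
    let ?x = "Dom (cat0 D) f" and ?y = "Cod (cat0 D) f"
    have "tarr (trans_comp D E \<alpha> (trans_id D E G)) f
        = E.lcomp (a.G.L (pid D ?y)) (cid E (tob \<alpha> ?x \<cdot>\<^sub>0 fa G f) \<cdot>\<^sub>1 un G ?y) (tarr \<alpha> f)"
      by (simp add: tarr_trans_comp[OF a.lax_nat_axioms 1(2)] a.G.L_pid)
    also have "\<dots> = tarr \<alpha> f"
      by (rule E.lcomp_unit[OF a.G.un_L]) (auto intro!: E.GlobI)
    finally show "tarr (trans_comp D E \<alpha> (trans_id D E G)) f = tarr \<alpha> f" .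
  qed (simp_all add: lax_trans.extensional[OF \<alpha>(1)] \<alpha>)
  then show "\<alpha> \<cdot>\<^bsub>Lax D E\<^esub> cat.Id (Lax D E) G = \<alpha>"
    by (simp add: Lax_def)
next
  fix \<alpha> \<beta> \<delta> F G H K
  assume "\<alpha> \<in> Hom (Lax D E) F G" "\<beta> \<in> Hom (Lax D E) G H" "\<delta> \<in> Hom (Lax D E) H K"
  then have *: "lax_trans D E \<alpha>" "lax_trans D E \<beta>" "lax_trans D E \<delta>" "tdom \<alpha> = F" "tcod \<alpha> = G"
    "tdom \<beta> = G" "tcod \<beta> = H" "tdom \<delta> = H" "tcod \<delta> = K"
    by (auto simp: Hom_def Lax_def)
  interpret a: lax_nat D E F G \<alpha> using lax_natI[OF *(1)] * by simp
  interpret b: lax_nat D E G H \<beta> using lax_natI[OF *(2)] * by simp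
  interpret d: lax_nat D E H K \<delta> using lax_natI[OF *(3)] * by simp
  have ab: "lax_nat D E F H (trans_comp D E \<alpha> \<beta>)"
    using lax_natI[OF lax_trans_comp[OF *(1,2)]] * by simp
  have bd: "lax_nat D E G K (trans_comp D E \<beta> \<delta>)"
    using lax_natI[OF lax_trans_comp[OF *(2,3)]] * by simp
  have "trans_comp D E (trans_comp D E \<alpha> \<beta>) \<delta> = trans_comp D E \<alpha> (trans_comp D E \<beta> \<delta>)"
  proof (rule laxtrans_eqI)
    fix f assume [simp]: "f \<in> Arr (cat0 D)"
    let ?x = "Dom (cat0 D) f"
    define y where "y = Cod (cat0 D) f"
    note [simp] = y_def[symmetric]
    have [simp]: "y \<in> Obj (cat0 D)" using D.source.B.cod_closed[of f] by simp
    have sq: "E.assoc_square (d.G.M y, d.G.M y) (d.G.M y, d.G.M y)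
        (fp K (pid D y)) (fp K (pid D y)) (fp K (pid D y))"
      using d.G.square_left[of "pid D y" y] by (simp add: d.G.L_pid)
    let ?d = "cid E (tob \<alpha> ?x) \<cdot>\<^sub>1 (cid E (tob \<beta> ?x) \<cdot>\<^sub>1 tarr \<delta> f)"
      and ?b = "cid E (tob \<alpha> ?x) \<cdot>\<^sub>1 (tarr \<beta> f \<cdot>\<^sub>1 tpro \<delta> (pid D y))"
      and ?a = "tarr \<alpha> f \<cdot>\<^sub>1 (tpro \<beta> (pid D y) \<cdot>\<^sub>1 tpro \<delta> (pid D y))"
    have "tarr (trans_comp D E (trans_comp D E \<alpha> \<beta>) \<delta>) f = E.lcomp (d.G.M y) ?d
        (E.lcomp (b.G.M y) (cid E (tob \<alpha> ?x) \<cdot>\<^sub>1 tarr \<beta> f) (tarr \<alpha> f \<cdot>\<^sub>1 tpro \<beta> (pid D y))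
          \<cdot>\<^sub>1 tpro \<delta> (pid D y))"
      by (simp add: tarr_trans_comp[OF ab d.lax_nat_axioms]
          tarr_trans_comp[OF a.lax_nat_axioms b.lax_nat_axioms])
    \<comment> \<open>The component of \<delta> at the identity proarrow is multiplicative, hence
      distributes over the product of the two earlier components.\<close>
    also have "\<dots> = E.lcomp (d.G.M y) ?d (E.lcomp (d.G.M y) ?b ?a)"
      by (subst E.lcomp_vcomp[OF d.tpro_M]) simp_all
    also have "\<dots> = E.lcomp (d.G.M y) (E.lcomp (d.G.M y) ?d ?b) ?a"
      by (subst E.lcomp_lcomp[OF sq, where x = "fo F ?x"]) simp_all
    also have "E.lcomp (d.G.M y) ?d ?b = cid E (tob \<alpha> ?x) \<cdot>\<^sub>1 tarr (trans_comp D E \<beta> \<delta>) f"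
      by (simp add: tarr_trans_comp[OF b.lax_nat_axioms d.lax_nat_axioms], subst E.vcomp_lcomp) simp_all
    finally show "tarr (trans_comp D E (trans_comp D E \<alpha> \<beta>) \<delta>) f
        = tarr (trans_comp D E \<alpha> (trans_comp D E \<beta> \<delta>)) f"
      by (simp add: tarr_trans_comp[OF a.lax_nat_axioms bd])
  qed (simp_all add: *)
  then show "\<alpha> \<cdot>\<^bsub>Lax D E\<^esub> \<beta> \<cdot>\<^bsub>Lax D E\<^esub> \<delta> = \<alpha> \<cdot>\<^bsub>Lax D E\<^esub> (\<beta> \<cdot>\<^bsub>Lax D E\<^esub> \<delta>)"
    by (simp add: Lax_def)
qed

end


section \<open>Category objects, their functors, bimodules and equivariant cells\<close>

section \<open>Bimodules\<close>

context double_category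
begin

lemma
  assumes "is_catobj D X"
  shows co_ob [simp]: "co_ob X \<in> Obj (cat0 D)"
    and co_pro [simp]: "co_pro X \<in> Obj (cat1 D)"
    and psrc_co_pro [simp]: "psrc D (co_pro X) = co_ob X"
    and ptgt_co_pro [simp]: "ptgt D (co_pro X) = co_ob X"
    and co_mult_cell [simp]: "co_mult X \<in> Arr (cat1 D)"
    and dom_co_mult [simp]: "Dom (cat1 D) (co_mult X) = co_pro X \<odot>\<^sub>p co_pro X"
    and cod_co_mult [simp]: "Cod (cat1 D) (co_mult X) = co_pro X"
    and csrc_co_mult [simp]: "csrc D (co_mult X) = \<one>\<^sub>0 (co_ob X)"
    and ctgt_co_mult [simp]: "ctgt D (co_mult X) = \<one>\<^sub>0 (co_ob X)"
    and co_unit_cell [simp]: "co_unit X \<in> Arr (cat1 D)"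
    and dom_co_unit [simp]: "Dom (cat1 D) (co_unit X) = pid D (co_ob X)"
    and cod_co_unit [simp]: "Cod (cat1 D) (co_unit X) = co_pro X"
    and csrc_co_unit [simp]: "csrc D (co_unit X) = \<one>\<^sub>0 (co_ob X)"
    and ctgt_co_unit [simp]: "ctgt D (co_unit X) = \<one>\<^sub>0 (co_ob X)"
    and co_mult_square: "assoc_square (co_mult X, co_mult X) (co_mult X, co_mult X) (co_pro X) (co_pro X) (co_pro X)"
    and co_unit_left: "(co_unit X \<odot> \<one>\<^sub>1 (co_pro X)) \<cdot>\<^sub>1 co_mult X = lunit D (co_pro X)"
    and co_unit_right: "(\<one>\<^sub>1 (co_pro X) \<odot> co_unit X) \<cdot>\<^sub>1 co_mult X = runit D (co_pro X)"
proof -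
  have *: "co_ob X \<in> Obj (cat0 D)" "co_pro X \<in> Obj (cat1 D)" "psrc D (co_pro X) = co_ob X"
    "ptgt D (co_pro X) = co_ob X"
    and m: "co_mult X \<in> Glob D (co_pro X \<odot>\<^sub>p co_pro X) (co_pro X)"
    and u: "co_unit X \<in> Glob D (pid D (co_ob X)) (co_pro X)"
    and eqs: "(co_mult X \<odot> \<one>\<^sub>1 (co_pro X)) \<cdot>\<^sub>1 co_mult X
      = assoc D (co_pro X) (co_pro X) (co_pro X) \<cdot>\<^sub>1 (\<one>\<^sub>1 (co_pro X) \<odot> co_mult X) \<cdot>\<^sub>1 co_mult X"
      "(co_unit X \<odot> \<one>\<^sub>1 (co_pro X)) \<cdot>\<^sub>1 co_mult X = lunit D (co_pro X)"
      "(\<one>\<^sub>1 (co_pro X) \<odot> co_unit X) \<cdot>\<^sub>1 co_mult X = runit D (co_pro X)"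
    using assms by (simp_all add: is_catobj_def Let_def Pro_def)
  show **: "co_ob X \<in> Obj (cat0 D)" "co_pro X \<in> Obj (cat1 D)" "psrc D (co_pro X) = co_ob X"
    "ptgt D (co_pro X) = co_ob X"
    "co_mult X \<in> Arr (cat1 D)" "Dom (cat1 D) (co_mult X) = co_pro X \<odot>\<^sub>p co_pro X"
    "Cod (cat1 D) (co_mult X) = co_pro X" "csrc D (co_mult X) = \<one>\<^sub>0 (co_ob X)"
    "ctgt D (co_mult X) = \<one>\<^sub>0 (co_ob X)"
    "co_unit X \<in> Arr (cat1 D)" "Dom (cat1 D) (co_unit X) = pid D (co_ob X)"
    "Cod (cat1 D) (co_unit X) = co_pro X" "csrc D (co_unit X) = \<one>\<^sub>0 (co_ob X)"
    "ctgt D (co_unit X) = \<one>\<^sub>0 (co_ob X)"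
    using Glob_D(1-5)[OF m] Glob_D(1-5)[OF u] * by simp_all
  show "assoc_square (co_mult X, co_mult X) (co_mult X, co_mult X) (co_pro X) (co_pro X) (co_pro X)"
    using eqs(1) by (intro assoc_squareI') (simp_all add: **)
  show "(co_unit X \<odot> \<one>\<^sub>1 (co_pro X)) \<cdot>\<^sub>1 co_mult X = lunit D (co_pro X)"
    "(\<one>\<^sub>1 (co_pro X) \<odot> co_unit X) \<cdot>\<^sub>1 co_mult X = runit D (co_pro X)"
    using eqs by simp_all
qed

lemma is_catobjI:
  assumes "co_ob X \<in> Obj (cat0 D)"
    "assoc_square (co_mult X, co_mult X) (co_mult X, co_mult X) (co_pro X) (co_pro X) (co_pro X)"
    "psrc D (co_pro X) = co_ob X" "Cod (cat1 D) (co_mult X) = co_pro X"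
    "co_unit X \<in> Glob D (pid D (co_ob X)) (co_pro X)"
    "(co_unit X \<odot> \<one>\<^sub>1 (co_pro X)) \<cdot>\<^sub>1 co_mult X = lunit D (co_pro X)"
    "(\<one>\<^sub>1 (co_pro X) \<odot> co_unit X) \<cdot>\<^sub>1 co_mult X = runit D (co_pro X)"
  shows "is_catobj D X"
proof -
  note * = assoc_squareD[OF assms(2)]
  have 1: "co_mult X \<in> Glob D (co_pro X \<odot>\<^sub>p co_pro X) (co_pro X)"
    using * assms(3,4) by (intro GlobI) simp_all
  have 2: "co_pro X \<in> Pro D (co_ob X) (co_ob X)"
    using *(1,4) assms(3) by (simp add: Pro_def)
  have 3: "(co_mult X \<odot> \<one>\<^sub>1 (co_pro X)) \<cdot>\<^sub>1 co_mult X
      = assoc D (co_pro X) (co_pro X) (co_pro X) \<cdot>\<^sub>1 (\<one>\<^sub>1 (co_pro X) \<odot> co_mult X) \<cdot>\<^sub>1 co_mult X"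
    using * assms(4) assoc_square_eq[OF assms(2)] by simp
  show ?thesis
    unfolding is_catobj_def Let_def by (intro conjI assms 1 2 3)
qed

lemma
  assumes "is_cofun D \<Phi>"
  shows cf_dom [simp]: "is_catobj D (cf_dom \<Phi>)"
    and cf_cod [simp]: "is_catobj D (cf_cod \<Phi>)"
    and cf_arr [simp]: "cf_arr \<Phi> \<in> Arr (cat0 D)"
    and dom_cf_arr [simp]: "Dom (cat0 D) (cf_arr \<Phi>) = co_ob (cf_dom \<Phi>)"
    and cod_cf_arr [simp]: "Cod (cat0 D) (cf_arr \<Phi>) = co_ob (cf_cod \<Phi>)"
    and cf_cell [simp]: "cf_cell \<Phi> \<in> Arr (cat1 D)"
    and dom_cf_cell [simp]: "Dom (cat1 D) (cf_cell \<Phi>) = co_pro (cf_dom \<Phi>)"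
    and cod_cf_cell [simp]: "Cod (cat1 D) (cf_cell \<Phi>) = co_pro (cf_cod \<Phi>)"
    and csrc_cf_cell [simp]: "csrc D (cf_cell \<Phi>) = cf_arr \<Phi>"
    and ctgt_cf_cell [simp]: "ctgt D (cf_cell \<Phi>) = cf_arr \<Phi>"
    and cf_mult: "(cf_cell \<Phi> \<odot> cf_cell \<Phi>) \<cdot>\<^sub>1 co_mult (cf_cod \<Phi>) = co_mult (cf_dom \<Phi>) \<cdot>\<^sub>1 cf_cell \<Phi>"
    and cf_unit: "cid D (cf_arr \<Phi>) \<cdot>\<^sub>1 co_unit (cf_cod \<Phi>) = co_unit (cf_dom \<Phi>) \<cdot>\<^sub>1 cf_cell \<Phi>"
  using assms by (auto simp: is_cofun_def Let_def Hom_def Cells_def)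

lemma is_cofunI:
  assumes "is_catobj D (cf_dom \<Phi>)" "is_catobj D (cf_cod \<Phi>)"
    "cf_arr \<Phi> \<in> Arr (cat0 D)" "Dom (cat0 D) (cf_arr \<Phi>) = co_ob (cf_dom \<Phi>)"
    "Cod (cat0 D) (cf_arr \<Phi>) = co_ob (cf_cod \<Phi>)"
    "cf_cell \<Phi> \<in> Arr (cat1 D)" "Dom (cat1 D) (cf_cell \<Phi>) = co_pro (cf_dom \<Phi>)"
    "Cod (cat1 D) (cf_cell \<Phi>) = co_pro (cf_cod \<Phi>)"
    "csrc D (cf_cell \<Phi>) = cf_arr \<Phi>" "ctgt D (cf_cell \<Phi>) = cf_arr \<Phi>"
    "(cf_cell \<Phi> \<odot> cf_cell \<Phi>) \<cdot>\<^sub>1 co_mult (cf_cod \<Phi>) = co_mult (cf_dom \<Phi>) \<cdot>\<^sub>1 cf_cell \<Phi>"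
    "cid D (cf_arr \<Phi>) \<cdot>\<^sub>1 co_unit (cf_cod \<Phi>) = co_unit (cf_dom \<Phi>) \<cdot>\<^sub>1 cf_cell \<Phi>"
  shows "is_cofun D \<Phi>"
  unfolding is_cofun_def Let_def Hom_def Cells_def mem_Collect_eq by (intro conjI assms)

lemma
  assumes "is_bimod D M"
  shows bm_src [simp]: "is_catobj D (bm_src M)"
    and bm_tgt [simp]: "is_catobj D (bm_tgt M)"
    and bm_pro [simp]: "bm_pro M \<in> Obj (cat1 D)"
    and psrc_bm_pro [simp]: "psrc D (bm_pro M) = co_ob (bm_src M)"
    and ptgt_bm_pro [simp]: "ptgt D (bm_pro M) = co_ob (bm_tgt M)"
    and bm_lact_cell [simp]: "bm_lact M \<in> Arr (cat1 D)"
    and dom_bm_lact [simp]: "Dom (cat1 D) (bm_lact M) = co_pro (bm_src M) \<odot>\<^sub>p bm_pro M"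
    and cod_bm_lact [simp]: "Cod (cat1 D) (bm_lact M) = bm_pro M"
    and csrc_bm_lact [simp]: "csrc D (bm_lact M) = \<one>\<^sub>0 (co_ob (bm_src M))"
    and ctgt_bm_lact [simp]: "ctgt D (bm_lact M) = \<one>\<^sub>0 (co_ob (bm_tgt M))"
    and bm_ract_cell [simp]: "bm_ract M \<in> Arr (cat1 D)"
    and dom_bm_ract [simp]: "Dom (cat1 D) (bm_ract M) = bm_pro M \<odot>\<^sub>p co_pro (bm_tgt M)"
    and cod_bm_ract [simp]: "Cod (cat1 D) (bm_ract M) = bm_pro M"
    and csrc_bm_ract [simp]: "csrc D (bm_ract M) = \<one>\<^sub>0 (co_ob (bm_src M))"
    and ctgt_bm_ract [simp]: "ctgt D (bm_ract M) = \<one>\<^sub>0 (co_ob (bm_tgt M))"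
    and lact_square: "assoc_square (co_mult (bm_src M), bm_lact M) (bm_lact M, bm_lact M)
      (co_pro (bm_src M)) (co_pro (bm_src M)) (bm_pro M)"
    and ract_square: "assoc_square (bm_ract M, bm_ract M) (co_mult (bm_tgt M), bm_ract M)
      (bm_pro M) (co_pro (bm_tgt M)) (co_pro (bm_tgt M))"
    and mid_square: "assoc_square (bm_lact M, bm_ract M) (bm_ract M, bm_lact M)
      (co_pro (bm_src M)) (bm_pro M) (co_pro (bm_tgt M))"
    and lact_unit: "(co_unit (bm_src M) \<odot> \<one>\<^sub>1 (bm_pro M)) \<cdot>\<^sub>1 bm_lact M = lunit D (bm_pro M)"
    and ract_unit: "(\<one>\<^sub>1 (bm_pro M) \<odot> co_unit (bm_tgt M)) \<cdot>\<^sub>1 bm_ract M = runit D (bm_pro M)"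
proof -
  have *: "is_catobj D (bm_src M)" "is_catobj D (bm_tgt M)" "bm_pro M \<in> Obj (cat1 D)"
    "psrc D (bm_pro M) = co_ob (bm_src M)" "ptgt D (bm_pro M) = co_ob (bm_tgt M)"
    and l: "bm_lact M \<in> Glob D (co_pro (bm_src M) \<odot>\<^sub>p bm_pro M) (bm_pro M)"
    and r: "bm_ract M \<in> Glob D (bm_pro M \<odot>\<^sub>p co_pro (bm_tgt M)) (bm_pro M)"
    and eqs:
      "(co_mult (bm_src M) \<odot> \<one>\<^sub>1 (bm_pro M)) \<cdot>\<^sub>1 bm_lact M
        = assoc D (co_pro (bm_src M)) (co_pro (bm_src M)) (bm_pro M)
          \<cdot>\<^sub>1 (\<one>\<^sub>1 (co_pro (bm_src M)) \<odot> bm_lact M) \<cdot>\<^sub>1 bm_lact M"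
      "(bm_ract M \<odot> \<one>\<^sub>1 (co_pro (bm_tgt M))) \<cdot>\<^sub>1 bm_ract M
        = assoc D (bm_pro M) (co_pro (bm_tgt M)) (co_pro (bm_tgt M))
          \<cdot>\<^sub>1 (\<one>\<^sub>1 (bm_pro M) \<odot> co_mult (bm_tgt M)) \<cdot>\<^sub>1 bm_ract M"
      "(bm_lact M \<odot> \<one>\<^sub>1 (co_pro (bm_tgt M))) \<cdot>\<^sub>1 bm_ract M
        = assoc D (co_pro (bm_src M)) (bm_pro M) (co_pro (bm_tgt M))
          \<cdot>\<^sub>1 (\<one>\<^sub>1 (co_pro (bm_src M)) \<odot> bm_ract M) \<cdot>\<^sub>1 bm_lact M"
      "(co_unit (bm_src M) \<odot> \<one>\<^sub>1 (bm_pro M)) \<cdot>\<^sub>1 bm_lact M = lunit D (bm_pro M)"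
      "(\<one>\<^sub>1 (bm_pro M) \<odot> co_unit (bm_tgt M)) \<cdot>\<^sub>1 bm_ract M = runit D (bm_pro M)"
    using assms by (simp_all add: is_bimod_def Let_def Pro_def)
  show **: "is_catobj D (bm_src M)" "is_catobj D (bm_tgt M)" "bm_pro M \<in> Obj (cat1 D)"
    "psrc D (bm_pro M) = co_ob (bm_src M)" "ptgt D (bm_pro M) = co_ob (bm_tgt M)"
    "bm_lact M \<in> Arr (cat1 D)" "Dom (cat1 D) (bm_lact M) = co_pro (bm_src M) \<odot>\<^sub>p bm_pro M"
    "Cod (cat1 D) (bm_lact M) = bm_pro M" "csrc D (bm_lact M) = \<one>\<^sub>0 (co_ob (bm_src M))"
    "ctgt D (bm_lact M) = \<one>\<^sub>0 (co_ob (bm_tgt M))"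
    "bm_ract M \<in> Arr (cat1 D)" "Dom (cat1 D) (bm_ract M) = bm_pro M \<odot>\<^sub>p co_pro (bm_tgt M)"
    "Cod (cat1 D) (bm_ract M) = bm_pro M" "csrc D (bm_ract M) = \<one>\<^sub>0 (co_ob (bm_src M))"
    "ctgt D (bm_ract M) = \<one>\<^sub>0 (co_ob (bm_tgt M))"
    using Glob_D(1-5)[OF l] Glob_D(1-5)[OF r] * by simp_all
  show "assoc_square (co_mult (bm_src M), bm_lact M) (bm_lact M, bm_lact M)
      (co_pro (bm_src M)) (co_pro (bm_src M)) (bm_pro M)"
    using eqs(1) by (intro assoc_squareI') (simp_all add: **)
  show "assoc_square (bm_ract M, bm_ract M) (co_mult (bm_tgt M), bm_ract M)
      (bm_pro M) (co_pro (bm_tgt M)) (co_pro (bm_tgt M))"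
    using eqs(2) by (intro assoc_squareI') (simp_all add: **)
  show "assoc_square (bm_lact M, bm_ract M) (bm_ract M, bm_lact M)
      (co_pro (bm_src M)) (bm_pro M) (co_pro (bm_tgt M))"
    using eqs(3) by (intro assoc_squareI') (simp_all add: **)
  show "(co_unit (bm_src M) \<odot> \<one>\<^sub>1 (bm_pro M)) \<cdot>\<^sub>1 bm_lact M = lunit D (bm_pro M)"
    "(\<one>\<^sub>1 (bm_pro M) \<odot> co_unit (bm_tgt M)) \<cdot>\<^sub>1 bm_ract M = runit D (bm_pro M)"
    using eqs by simp_all
qed

text \<open>Phrased with squares because the pentagon lemmas deliver action laws in that form. The
  typing of the proarrow and of the two actions is recovered from the squares.\<close>

lemma is_bimodI:
  assumes [simp]: "is_catobj D (bm_src M)" "is_catobj D (bm_tgt M)"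
    and l: "assoc_square (co_mult (bm_src M), bm_lact M) (bm_lact M, bm_lact M)
      (co_pro (bm_src M)) (co_pro (bm_src M)) (bm_pro M)"
    and r: "assoc_square (bm_ract M, bm_ract M) (co_mult (bm_tgt M), bm_ract M)
      (bm_pro M) (co_pro (bm_tgt M)) (co_pro (bm_tgt M))"
    and m: "assoc_square (bm_lact M, bm_ract M) (bm_ract M, bm_lact M)
      (co_pro (bm_src M)) (bm_pro M) (co_pro (bm_tgt M))"
    and cod: "Cod (cat1 D) (bm_lact M) = bm_pro M" "Cod (cat1 D) (bm_ract M) = bm_pro M"
    and u: "(co_unit (bm_src M) \<odot> \<one>\<^sub>1 (bm_pro M)) \<cdot>\<^sub>1 bm_lact M = lunit D (bm_pro M)"
    "(\<one>\<^sub>1 (bm_pro M) \<odot> co_unit (bm_tgt M)) \<cdot>\<^sub>1 bm_ract M = runit D (bm_pro M)"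
  shows "is_bimod D M"
proof -
  have [simp]: "bm_pro M \<in> Obj (cat1 D)" "psrc D (bm_pro M) = co_ob (bm_src M)"
    "ptgt D (bm_pro M) = co_ob (bm_tgt M)"
    using assoc_squareD(1,4)[OF r] assoc_squareD(5)[OF l] by simp_all
  have 1: "bm_pro M \<in> Pro D (co_ob (bm_src M)) (co_ob (bm_tgt M))"
    by (simp add: Pro_def)
  have 2: "bm_lact M \<in> Glob D (co_pro (bm_src M) \<odot>\<^sub>p bm_pro M) (bm_pro M)"
    by (rule GlobI) (use assoc_squareD(12-15)[OF l] cod in simp_all)
  have 3: "bm_ract M \<in> Glob D (bm_pro M \<odot>\<^sub>p co_pro (bm_tgt M)) (bm_pro M)"
    by (rule GlobI) (use assoc_squareD(6-9)[OF r] cod in simp_all)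
  note [simp] = Glob_D(1-5)[OF 2] Glob_D(1-5)[OF 3]
  have 4: "(co_mult (bm_src M) \<odot> \<one>\<^sub>1 (bm_pro M)) \<cdot>\<^sub>1 bm_lact M
      = assoc D (co_pro (bm_src M)) (co_pro (bm_src M)) (bm_pro M)
        \<cdot>\<^sub>1 (\<one>\<^sub>1 (co_pro (bm_src M)) \<odot> bm_lact M) \<cdot>\<^sub>1 bm_lact M"
    "(bm_ract M \<odot> \<one>\<^sub>1 (co_pro (bm_tgt M))) \<cdot>\<^sub>1 bm_ract M
      = assoc D (bm_pro M) (co_pro (bm_tgt M)) (co_pro (bm_tgt M))
        \<cdot>\<^sub>1 (\<one>\<^sub>1 (bm_pro M) \<odot> co_mult (bm_tgt M)) \<cdot>\<^sub>1 bm_ract M"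
    "(bm_lact M \<odot> \<one>\<^sub>1 (co_pro (bm_tgt M))) \<cdot>\<^sub>1 bm_ract M
      = assoc D (co_pro (bm_src M)) (bm_pro M) (co_pro (bm_tgt M))
        \<cdot>\<^sub>1 (\<one>\<^sub>1 (co_pro (bm_src M)) \<odot> bm_ract M) \<cdot>\<^sub>1 bm_lact M"
    using assoc_square_eq[OF l] assoc_square_eq[OF r] assoc_square_eq[OF m] by simp_all
  show ?thesis
    unfolding is_bimod_def Let_def by (intro conjI assms 1 2 3 4)
qed

lemma
  assumes "is_bicell D A"
  shows bc_dom [simp]: "is_bimod D (bc_dom A)"
    and bc_cod [simp]: "is_bimod D (bc_cod A)"
    and bc_src [simp]: "is_cofun D (bc_src A)"
    and bc_tgt [simp]: "is_cofun D (bc_tgt A)"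
    and cf_dom_bc_src [simp]: "cf_dom (bc_src A) = bm_src (bc_dom A)"
    and cf_cod_bc_src [simp]: "cf_cod (bc_src A) = bm_src (bc_cod A)"
    and cf_dom_bc_tgt [simp]: "cf_dom (bc_tgt A) = bm_tgt (bc_dom A)"
    and cf_cod_bc_tgt [simp]: "cf_cod (bc_tgt A) = bm_tgt (bc_cod A)"
    and bc_cell [simp]: "bc_cell A \<in> Arr (cat1 D)"
    and dom_bc_cell [simp]: "Dom (cat1 D) (bc_cell A) = bm_pro (bc_dom A)"
    and cod_bc_cell [simp]: "Cod (cat1 D) (bc_cell A) = bm_pro (bc_cod A)"
    and csrc_bc_cell [simp]: "csrc D (bc_cell A) = cf_arr (bc_src A)"
    and ctgt_bc_cell [simp]: "ctgt D (bc_cell A) = cf_arr (bc_tgt A)"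
    and bc_left: "(cf_cell (bc_src A) \<odot> bc_cell A) \<cdot>\<^sub>1 bm_lact (bc_cod A) = bm_lact (bc_dom A) \<cdot>\<^sub>1 bc_cell A"
    and bc_right: "(bc_cell A \<odot> cf_cell (bc_tgt A)) \<cdot>\<^sub>1 bm_ract (bc_cod A) = bm_ract (bc_dom A) \<cdot>\<^sub>1 bc_cell A"
  using assms by (auto simp: is_bicell_def Let_def Hom_def Cells_def)

lemma is_bicellI:
  assumes "is_bimod D (bc_dom A)" "is_bimod D (bc_cod A)" "is_cofun D (bc_src A)" "is_cofun D (bc_tgt A)"
    "cf_dom (bc_src A) = bm_src (bc_dom A)" "cf_cod (bc_src A) = bm_src (bc_cod A)"
    "cf_dom (bc_tgt A) = bm_tgt (bc_dom A)" "cf_cod (bc_tgt A) = bm_tgt (bc_cod A)"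
    "bc_cell A \<in> Arr (cat1 D)" "Dom (cat1 D) (bc_cell A) = bm_pro (bc_dom A)"
    "Cod (cat1 D) (bc_cell A) = bm_pro (bc_cod A)" "csrc D (bc_cell A) = cf_arr (bc_src A)"
    "ctgt D (bc_cell A) = cf_arr (bc_tgt A)"
    "(cf_cell (bc_src A) \<odot> bc_cell A) \<cdot>\<^sub>1 bm_lact (bc_cod A) = bm_lact (bc_dom A) \<cdot>\<^sub>1 bc_cell A"
    "(bc_cell A \<odot> cf_cell (bc_tgt A)) \<cdot>\<^sub>1 bm_ract (bc_cod A) = bm_ract (bc_dom A) \<cdot>\<^sub>1 bc_cell A"
  shows "is_bicell D A"
  unfolding is_bicell_def Let_def Hom_def Cells_def mem_Collect_eq by (intro conjI assms)

lemma cofun_id_simps [simp]: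
  "cf_dom (cofun_id D X) = X" "cf_cod (cofun_id D X) = X"
  "cf_arr (cofun_id D X) = \<one>\<^sub>0 (co_ob X)" "cf_cell (cofun_id D X) = \<one>\<^sub>1 (co_pro X)"
  by (simp_all add: cofun_id_def)

lemma cofun_comp_simps [simp]:
  "cf_dom (cofun_comp D \<Phi> \<Psi>) = cf_dom \<Phi>" "cf_cod (cofun_comp D \<Phi> \<Psi>) = cf_cod \<Psi>"
  "cf_arr (cofun_comp D \<Phi> \<Psi>) = cf_arr \<Phi> \<cdot>\<^sub>0 cf_arr \<Psi>"
  "cf_cell (cofun_comp D \<Phi> \<Psi>) = cf_cell \<Phi> \<cdot>\<^sub>1 cf_cell \<Psi>"
  by (simp_all add: cofun_comp_def)

lemma glob_bicell_simps [simp]: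
  "bc_dom (glob_bicell D M N \<alpha>) = M" "bc_cod (glob_bicell D M N \<alpha>) = N"
  "bc_src (glob_bicell D M N \<alpha>) = cofun_id D (bm_src M)"
  "bc_tgt (glob_bicell D M N \<alpha>) = cofun_id D (bm_tgt M)"
  "bc_cell (glob_bicell D M N \<alpha>) = \<alpha>"
  by (simp_all add: glob_bicell_def)

lemma bicell_comp_simps [simp]:
  "bc_dom (bicell_comp D A B) = bc_dom A" "bc_cod (bicell_comp D A B) = bc_cod B"
  "bc_src (bicell_comp D A B) = cofun_comp D (bc_src A) (bc_src B)"
  "bc_tgt (bicell_comp D A B) = cofun_comp D (bc_tgt A) (bc_tgt B)"
  "bc_cell (bicell_comp D A B) = bc_cell A \<cdot>\<^sub>1 bc_cell B"
  by (simp_all add: bicell_comp_def)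

lemma unit_bimod_simps [simp]:
  "bm_src (unit_bimod X) = X" "bm_tgt (unit_bimod X) = X" "bm_pro (unit_bimod X) = co_pro X"
  "bm_lact (unit_bimod X) = co_mult X" "bm_ract (unit_bimod X) = co_mult X"
  by (simp_all add: unit_bimod_def)

lemma unit_bicell_simps [simp]:
  "bc_dom (unit_bicell \<Phi>) = unit_bimod (cf_dom \<Phi>)" "bc_cod (unit_bicell \<Phi>) = unit_bimod (cf_cod \<Phi>)"
  "bc_src (unit_bicell \<Phi>) = \<Phi>" "bc_tgt (unit_bicell \<Phi>) = \<Phi>" "bc_cell (unit_bicell \<Phi>) = cf_cell \<Phi>"
  by (simp_all add: unit_bicell_def)

lemma is_cofun_id [simp]: "is_catobj D X \<Longrightarrow> is_cofun D (cofun_id D X)"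
  by (rule is_cofunI) (simp_all add: hcomp_vid)

lemma is_cofun_comp [simp]:
  assumes [simp]: "is_cofun D \<Phi>" "is_cofun D \<Psi>" "cf_cod \<Phi> = cf_dom \<Psi>"
  shows "is_cofun D (cofun_comp D \<Phi> \<Psi>)"
proof (rule is_cofunI)
  have "((cf_cell \<Phi> \<cdot>\<^sub>1 cf_cell \<Psi>) \<odot> (cf_cell \<Phi> \<cdot>\<^sub>1 cf_cell \<Psi>)) \<cdot>\<^sub>1 co_mult (cf_cod \<Psi>)
      = (cf_cell \<Phi> \<odot> cf_cell \<Phi>) \<cdot>\<^sub>1 ((cf_cell \<Psi> \<odot> cf_cell \<Psi>) \<cdot>\<^sub>1 co_mult (cf_cod \<Psi>))"
    by (simp add: hcomp_vcomp')
  also have "\<dots> = ((cf_cell \<Phi> \<odot> cf_cell \<Phi>) \<cdot>\<^sub>1 co_mult (cf_cod \<Phi>)) \<cdot>\<^sub>1 cf_cell \<Psi>"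
    by (simp add: cf_mult)
  also have "\<dots> = (co_mult (cf_dom \<Phi>) \<cdot>\<^sub>1 cf_cell \<Phi>) \<cdot>\<^sub>1 cf_cell \<Psi>"
    by (subst cf_mult) simp_all
  finally show "(cf_cell (cofun_comp D \<Phi> \<Psi>) \<odot> cf_cell (cofun_comp D \<Phi> \<Psi>))
        \<cdot>\<^sub>1 co_mult (cf_cod (cofun_comp D \<Phi> \<Psi>))
      = co_mult (cf_dom (cofun_comp D \<Phi> \<Psi>)) \<cdot>\<^sub>1 cf_cell (cofun_comp D \<Phi> \<Psi>)"
    by simp
  have "cid D (cf_arr \<Phi>) \<cdot>\<^sub>1 (cid D (cf_arr \<Psi>) \<cdot>\<^sub>1 co_unit (cf_cod \<Psi>))
      = (cid D (cf_arr \<Phi>) \<cdot>\<^sub>1 co_unit (cf_cod \<Phi>)) \<cdot>\<^sub>1 cf_cell \<Psi>"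
    by (simp add: cf_unit)
  also have "\<dots> = (co_unit (cf_dom \<Phi>) \<cdot>\<^sub>1 cf_cell \<Phi>) \<cdot>\<^sub>1 cf_cell \<Psi>"
    by (subst cf_unit) simp_all
  finally show "cid D (cf_arr (cofun_comp D \<Phi> \<Psi>)) \<cdot>\<^sub>1 co_unit (cf_cod (cofun_comp D \<Phi> \<Psi>))
      = co_unit (cf_dom (cofun_comp D \<Phi> \<Psi>)) \<cdot>\<^sub>1 cf_cell (cofun_comp D \<Phi> \<Psi>)"
    by simp
qed simp_all

lemma is_bimod_unit [simp]: "is_catobj D X \<Longrightarrow> is_bimod D (unit_bimod X)"
  by (rule is_bimodI) (simp_all add: co_mult_square co_unit_left co_unit_right)

lemma is_bicell_unit [simp]: "is_cofun D \<Phi> \<Longrightarrow> is_bicell D (unit_bicell \<Phi>)"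
  by (rule is_bicellI) (simp_all add: cf_mult)

lemma is_bicell_comp [simp]:
  assumes [simp]: "is_bicell D A" "is_bicell D B" "bc_cod A = bc_dom B"
  shows "is_bicell D (bicell_comp D A B)"
proof (rule is_bicellI)
  have "((cf_cell (bc_src A) \<cdot>\<^sub>1 cf_cell (bc_src B)) \<odot> (bc_cell A \<cdot>\<^sub>1 bc_cell B)) \<cdot>\<^sub>1 bm_lact (bc_cod B)
      = (cf_cell (bc_src A) \<odot> bc_cell A) \<cdot>\<^sub>1 ((cf_cell (bc_src B) \<odot> bc_cell B) \<cdot>\<^sub>1 bm_lact (bc_cod B))"
    by (simp add: hcomp_vcomp')
  also have "\<dots> = ((cf_cell (bc_src A) \<odot> bc_cell A) \<cdot>\<^sub>1 bm_lact (bc_cod A)) \<cdot>\<^sub>1 bc_cell B"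
    by (simp add: bc_left)
  also have "\<dots> = (bm_lact (bc_dom A) \<cdot>\<^sub>1 bc_cell A) \<cdot>\<^sub>1 bc_cell B"
    by (subst bc_left) simp_all
  finally show "(cf_cell (bc_src (bicell_comp D A B)) \<odot> bc_cell (bicell_comp D A B))
        \<cdot>\<^sub>1 bm_lact (bc_cod (bicell_comp D A B))
      = bm_lact (bc_dom (bicell_comp D A B)) \<cdot>\<^sub>1 bc_cell (bicell_comp D A B)"
    by simp
  have "((bc_cell A \<cdot>\<^sub>1 bc_cell B) \<odot> (cf_cell (bc_tgt A) \<cdot>\<^sub>1 cf_cell (bc_tgt B))) \<cdot>\<^sub>1 bm_ract (bc_cod B)
      = (bc_cell A \<odot> cf_cell (bc_tgt A)) \<cdot>\<^sub>1 ((bc_cell B \<odot> cf_cell (bc_tgt B)) \<cdot>\<^sub>1 bm_ract (bc_cod B))"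
    by (simp add: hcomp_vcomp')
  also have "\<dots> = ((bc_cell A \<odot> cf_cell (bc_tgt A)) \<cdot>\<^sub>1 bm_ract (bc_cod A)) \<cdot>\<^sub>1 bc_cell B"
    by (simp add: bc_right)
  also have "\<dots> = (bm_ract (bc_dom A) \<cdot>\<^sub>1 bc_cell A) \<cdot>\<^sub>1 bc_cell B"
    by (subst bc_right) simp_all
  finally show "(bc_cell (bicell_comp D A B) \<odot> cf_cell (bc_tgt (bicell_comp D A B)))
        \<cdot>\<^sub>1 bm_ract (bc_cod (bicell_comp D A B))
      = bm_ract (bc_dom (bicell_comp D A B)) \<cdot>\<^sub>1 bc_cell (bicell_comp D A B)"
    by simp
qed simp_all

lemma is_bicell_globI:
  assumes "is_bimod D M" "is_bimod D N" "bm_src N = bm_src M" "bm_tgt N = bm_tgt M"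
    "\<alpha> \<in> Arr (cat1 D)" "Dom (cat1 D) \<alpha> = bm_pro M" "Cod (cat1 D) \<alpha> = bm_pro N"
    "csrc D \<alpha> = \<one>\<^sub>0 (co_ob (bm_src M))" "ctgt D \<alpha> = \<one>\<^sub>0 (co_ob (bm_tgt M))"
    "(\<one>\<^sub>1 (co_pro (bm_src M)) \<odot> \<alpha>) \<cdot>\<^sub>1 bm_lact N = bm_lact M \<cdot>\<^sub>1 \<alpha>"
    "(\<alpha> \<odot> \<one>\<^sub>1 (co_pro (bm_tgt M))) \<cdot>\<^sub>1 bm_ract N = bm_ract M \<cdot>\<^sub>1 \<alpha>"
  shows "is_bicell D (glob_bicell D M N \<alpha>)"
  by (rule is_bicellI) (simp_all add: assms)

lemma is_bicell_id [simp]: "is_bimod D M \<Longrightarrow> is_bicell D (bicell_id D M)"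
  unfolding bicell_id_def by (rule is_bicell_globI) (simp_all add: hcomp_vid)

end


section \<open>Coequalizers of globular cells tested against all cells\<close>

section \<open>Coequalizers in an equipment\<close>

lemma hom_cat_simps [simp]:
  "Dom (hom_cat D x y) = Dom (cat1 D)" "Cod (hom_cat D x y) = Cod (cat1 D)"
  "Comp (hom_cat D x y) = Comp (cat1 D)"
  by (simp_all add: hom_cat_def)

lemma cartesian_arrow_ex1:
  "\<lbrakk>cartesian_arrow A B Po Pa \<phi>; \<psi> \<in> Arr A; h \<in> Hom B (Po (Dom A \<psi>)) (Po (Dom A \<phi>));
    Cod A \<psi> = Cod A \<phi>; Pa \<psi> = h \<cdot>\<^bsub>B\<^esub> Pa \<phi>\<rbrakk>
    \<Longrightarrow> \<exists>!\<chi>. \<chi> \<in> Hom A (Dom A \<psi>) (Dom A \<phi>) \<and> Pa \<chi> = h \<and> \<chi> \<cdot>\<^bsub>A\<^esub> \<phi> = \<psi>"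
  unfolding cartesian_arrow_def by blast

context double_category
begin

text \<open>Turns the existential description of the hom-category into conditions on the boundary,
  which can be checked by rewriting.\<close>

lemma hom_cat_arr_iff:
  "\<alpha> \<in> Arr (hom_cat D x y) \<longleftrightarrow> \<alpha> \<in> Arr (cat1 D)
     \<and> csrc D \<alpha> = \<one>\<^sub>0 x \<and> ctgt D \<alpha> = \<one>\<^sub>0 y
     \<and> psrc D (Dom (cat1 D) \<alpha>) = x \<and> ptgt D (Dom (cat1 D) \<alpha>) = y"
  (is "?l \<longleftrightarrow> ?r")
proof
  assume ?l
  then obtain m n where *: "m \<in> Pro D x y" "n \<in> Pro D x y" "\<alpha> \<in> Glob D m n"
    by (auto simp: hom_cat_def)
  then show ?r
    using Glob_D[OF *(3)] by (auto simp: Pro_def)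
next
  assume r: ?r
  then have g: "\<alpha> \<in> Glob D (Dom (cat1 D) \<alpha>) (Cod (cat1 D) \<alpha>)"
    by (intro GlobI) simp_all
  have "Dom (cat1 D) \<alpha> \<in> Pro D x y"
    unfolding Pro_def using Glob_D(6)[OF g] r by simp
  moreover have "Cod (cat1 D) \<alpha> \<in> Pro D x y"
    unfolding Pro_def using Glob_D(7-9)[OF g] r by simp
  ultimately show ?l
    using g by (auto simp: hom_cat_def)
qed

lemma coequalizer_ex1:
  "\<lbrakk>coequalizer (hom_cat D x y) \<alpha> \<beta> c; h \<in> Hom (hom_cat D x y) (Cod (cat1 D) \<alpha>) d; \<alpha> \<cdot>\<^sub>1 h = \<beta> \<cdot>\<^sub>1 h\<rbrakk>
    \<Longrightarrow> \<exists>!u. u \<in> Hom (hom_cat D x y) (Cod (cat1 D) c) d \<and> c \<cdot>\<^sub>1 u = h"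
  unfolding coequalizer_def hom_cat_simps by blast

lemma coequalizerD:
  assumes "coequalizer (hom_cat D x y) \<alpha> \<beta> c"
  shows "\<alpha> \<in> Arr (cat1 D)" "\<beta> \<in> Arr (cat1 D)" "c \<in> Arr (cat1 D)"
    "Dom (cat1 D) \<beta> = Dom (cat1 D) \<alpha>" "Cod (cat1 D) \<beta> = Cod (cat1 D) \<alpha>"
    "Dom (cat1 D) c = Cod (cat1 D) \<alpha>"
    "csrc D \<alpha> = \<one>\<^sub>0 x" "ctgt D \<alpha> = \<one>\<^sub>0 y" "csrc D \<beta> = \<one>\<^sub>0 x" "ctgt D \<beta> = \<one>\<^sub>0 y"
    "csrc D c = \<one>\<^sub>0 x" "ctgt D c = \<one>\<^sub>0 y"
    "psrc D (Cod (cat1 D) \<alpha>) = x" "ptgt D (Cod (cat1 D) \<alpha>) = y"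
    "psrc D (Cod (cat1 D) c) = x" "ptgt D (Cod (cat1 D) c) = y"
    "x \<in> Obj (cat0 D)" "y \<in> Obj (cat0 D)"
    "\<alpha> \<cdot>\<^sub>1 c = \<beta> \<cdot>\<^sub>1 c"
proof -
  have *: "\<alpha> \<in> Arr (hom_cat D x y)" "\<beta> \<in> Arr (hom_cat D x y)" "c \<in> Arr (hom_cat D x y)"
    "Dom (cat1 D) \<beta> = Dom (cat1 D) \<alpha>" "Cod (cat1 D) \<beta> = Cod (cat1 D) \<alpha>"
    "Dom (cat1 D) c = Cod (cat1 D) \<alpha>" "\<alpha> \<cdot>\<^sub>1 c = \<beta> \<cdot>\<^sub>1 c"
    using assms by (auto simp: coequalizer_def parallel_pair_def Hom_def)
  show "\<alpha> \<in> Arr (cat1 D)" "\<beta> \<in> Arr (cat1 D)" "c \<in> Arr (cat1 D)"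
    "Dom (cat1 D) \<beta> = Dom (cat1 D) \<alpha>" "Cod (cat1 D) \<beta> = Cod (cat1 D) \<alpha>"
    "Dom (cat1 D) c = Cod (cat1 D) \<alpha>" "\<alpha> \<cdot>\<^sub>1 c = \<beta> \<cdot>\<^sub>1 c"
    "csrc D \<alpha> = \<one>\<^sub>0 x" "ctgt D \<alpha> = \<one>\<^sub>0 y" "csrc D \<beta> = \<one>\<^sub>0 x" "ctgt D \<beta> = \<one>\<^sub>0 y"
    "csrc D c = \<one>\<^sub>0 x" "ctgt D c = \<one>\<^sub>0 y"
    and xy: "psrc D (Cod (cat1 D) \<alpha>) = x" "ptgt D (Cod (cat1 D) \<alpha>) = y"
    using * by (auto simp: hom_cat_arr_iff)
  show "psrc D (Cod (cat1 D) c) = x" "ptgt D (Cod (cat1 D) c) = y"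
    using * psrc_cod[of c] ptgt_cod[of c] source.obj_closed target.obj_closed
    by (auto simp: hom_cat_arr_iff)
  show "x \<in> Obj (cat0 D)" "y \<in> Obj (cat0 D)"
    using * xy source.obj_closed[of "Cod (cat1 D) \<alpha>"] target.obj_closed[of "Cod (cat1 D) \<alpha>"]
    by (auto simp: hom_cat_arr_iff)
qed

end

locale mod_setup = equipment E
  for E :: "('o, 'a, 'p, 'c) dbl" (structure) +
  fixes q :: "('o, 'p, 'c) bimod \<Rightarrow> ('o, 'p, 'c) bimod \<Rightarrow> 'c"
  assumes coequalizers: "local_coequalizers E" and choice: "tensor_choice E q"
begin

text \<open>
  Restriction along \<open>(csrc h, ctgt h)\<close> turns a cell \<open>h\<close> into a globular one, so a coequalizer of
  globular cells is universal for all cells.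
\<close>

lemma restriction:
  assumes [simp]: "h \<in> Arr (cat1 E)"
  obtains \<phi> where "\<phi> \<in> Arr (cat1 E)" "Cod (cat1 E) \<phi> = Cod (cat1 E) h"
    "csrc E \<phi> = csrc E h" "ctgt E \<phi> = ctgt E h"
    "\<And>\<psi>. \<lbrakk>\<psi> \<in> Arr (cat1 E); Cod (cat1 E) \<psi> = Cod (cat1 E) h; csrc E \<psi> = csrc E h; ctgt E \<psi> = ctgt E h\<rbrakk>
      \<Longrightarrow> \<exists>!\<chi>. \<chi> \<in> Arr (cat1 E) \<and> Dom (cat1 E) \<chi> = Dom (cat1 E) \<psi> \<and> Cod (cat1 E) \<chi> = Dom (cat1 E) \<phi>
        \<and> csrc E \<chi> = \<one>\<^sub>0 (psrc E (Dom (cat1 E) h)) \<and> ctgt E \<chi> = \<one>\<^sub>0 (ptgt E (Dom (cat1 E) h))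
        \<and> \<chi> \<cdot>\<^sub>1 \<phi> = \<psi>"
proof -
  have "\<exists>\<phi>. cartesian_arrow (cat1 E) (prod_cat (cat0 E) (cat0 E)) (\<lambda>m. (psrc E m, ptgt E m))
      (\<lambda>\<alpha>. (csrc E \<alpha>, ctgt E \<alpha>)) \<phi> \<and> Cod (cat1 E) \<phi> = Cod (cat1 E) h
      \<and> (csrc E \<phi>, ctgt E \<phi>) = (csrc E h, ctgt E h)"
    by (rule cartesian_lift) (simp_all add: prod_cat_def)
  then obtain \<phi> where c: "cartesian_arrow (cat1 E) (prod_cat (cat0 E) (cat0 E))
      (\<lambda>m. (psrc E m, ptgt E m)) (\<lambda>\<alpha>. (csrc E \<alpha>, ctgt E \<alpha>)) \<phi>"
    and \<phi>: "Cod (cat1 E) \<phi> = Cod (cat1 E) h" "csrc E \<phi> = csrc E h" "ctgt E \<phi> = ctgt E h"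
    by blast
  have [simp]: "\<phi> \<in> Arr (cat1 E)"
    using c by (simp add: cartesian_arrow_def)
  have [simp]: "psrc E (Dom (cat1 E) \<phi>) = psrc E (Dom (cat1 E) h)"
    "ptgt E (Dom (cat1 E) \<phi>) = ptgt E (Dom (cat1 E) h)"
    using psrc_dom[of \<phi>] ptgt_dom'[of \<phi>] \<phi> by simp_all
  let ?x = "psrc E (Dom (cat1 E) h)" and ?y = "ptgt E (Dom (cat1 E) h)"
  show thesis
  proof (rule that)
    fix \<psi> assume \<psi>: "\<psi> \<in> Arr (cat1 E)" "Cod (cat1 E) \<psi> = Cod (cat1 E) h"
      "csrc E \<psi> = csrc E h" "ctgt E \<psi> = ctgt E h"
    have [simp]: "psrc E (Dom (cat1 E) \<psi>) = ?x" "ptgt E (Dom (cat1 E) \<psi>) = ?y"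
      using psrc_dom[of \<psi>] ptgt_dom'[of \<psi>] \<psi> by simp_all
    have xy: "?x \<in> Obj (cat0 E)" "?y \<in> Obj (cat0 E)"
      using source.obj_closed target.obj_closed by simp_all
    have "(\<one>\<^sub>0 ?x, \<one>\<^sub>0 ?y) \<in> Hom (prod_cat (cat0 E) (cat0 E)) (?x, ?y) (?x, ?y)"
      using xy by (simp add: Hom_def prod_cat_def)
    moreover have "(csrc E \<psi>, ctgt E \<psi>)
        = (\<one>\<^sub>0 ?x, \<one>\<^sub>0 ?y) \<cdot>\<^bsub>prod_cat (cat0 E) (cat0 E)\<^esub> (csrc E \<phi>, ctgt E \<phi>)"
      using \<psi> \<phi> xy by (simp add: prod_cat_def)
    ultimately have "\<exists>!\<chi>. \<chi> \<in> Hom (cat1 E) (Dom (cat1 E) \<psi>) (Dom (cat1 E) \<phi>)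
        \<and> (csrc E \<chi>, ctgt E \<chi>) = (\<one>\<^sub>0 ?x, \<one>\<^sub>0 ?y) \<and> \<chi> \<cdot>\<^sub>1 \<phi> = \<psi>"
      using cartesian_arrow_ex1[OF c \<psi>(1), of "(\<one>\<^sub>0 ?x, \<one>\<^sub>0 ?y)"] \<psi>(2) \<phi>(1) by simp
    then show "\<exists>!\<chi>. \<chi> \<in> Arr (cat1 E) \<and> Dom (cat1 E) \<chi> = Dom (cat1 E) \<psi> \<and> Cod (cat1 E) \<chi> = Dom (cat1 E) \<phi>
        \<and> csrc E \<chi> = \<one>\<^sub>0 ?x \<and> ctgt E \<chi> = \<one>\<^sub>0 ?y \<and> \<chi> \<cdot>\<^sub>1 \<phi> = \<psi>"
      by (simp add: Hom_def conj_assoc)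
  qed (use \<phi> in simp_all)
qed

text \<open>The cell \<open>h\<close> is written as a globular \<chi> followed by a cartesian lift
  \<phi> with the boundary arrows of \<open>h\<close>. The factor of \<chi> through \<open>c\<close>
  exists in the hom-category, and composing it with \<phi> gives the factor of
  \<open>h\<close>.\<close>

lemma coequalizer_factor:
  assumes c: "coequalizer (hom_cat E x y) \<alpha> \<beta> c"
    and h: "h \<in> Arr (cat1 E)" "Dom (cat1 E) h = Cod (cat1 E) \<alpha>" "\<alpha> \<cdot>\<^sub>1 h = \<beta> \<cdot>\<^sub>1 h"
  obtains u where "u \<in> Arr (cat1 E)" "Dom (cat1 E) u = Cod (cat1 E) c" "Cod (cat1 E) u = Cod (cat1 E) h"
    "csrc E u = csrc E h" "ctgt E u = ctgt E h" "c \<cdot>\<^sub>1 u = h"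
proof -
  note [simp] = coequalizerD(1-18)[OF c] h(1,2)
  obtain \<phi> where [simp]: "\<phi> \<in> Arr (cat1 E)" "Cod (cat1 E) \<phi> = Cod (cat1 E) h"
      "csrc E \<phi> = csrc E h" "ctgt E \<phi> = ctgt E h"
    and lift: "\<And>\<psi>. \<lbrakk>\<psi> \<in> Arr (cat1 E); Cod (cat1 E) \<psi> = Cod (cat1 E) h; csrc E \<psi> = csrc E h; ctgt E \<psi> = ctgt E h\<rbrakk>
      \<Longrightarrow> \<exists>!\<chi>. \<chi> \<in> Arr (cat1 E) \<and> Dom (cat1 E) \<chi> = Dom (cat1 E) \<psi> \<and> Cod (cat1 E) \<chi> = Dom (cat1 E) \<phi>
        \<and> csrc E \<chi> = \<one>\<^sub>0 x \<and> ctgt E \<chi> = \<one>\<^sub>0 y \<and> \<chi> \<cdot>\<^sub>1 \<phi> = \<psi>"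
    by (rule restriction[OF h(1)]) auto
  have hh [simp]: "Dom (cat0 E) (csrc E h) = x" "Dom (cat0 E) (ctgt E h) = y"
    by simp_all
  obtain \<chi> where \<chi>: "\<chi> \<in> Arr (cat1 E)" "Dom (cat1 E) \<chi> = Dom (cat1 E) h" "Cod (cat1 E) \<chi> = Dom (cat1 E) \<phi>"
    "csrc E \<chi> = \<one>\<^sub>0 x" "ctgt E \<chi> = \<one>\<^sub>0 y" "\<chi> \<cdot>\<^sub>1 \<phi> = h"
    using lift[of h] by auto
  \<comment> \<open>Both composites are globular and become equal after \<phi>, because
    \<open>h\<close> coequalizes the pair; uniqueness of cartesian factors makes them equal.\<close>
  have "\<alpha> \<cdot>\<^sub>1 \<chi> = \<beta> \<cdot>\<^sub>1 \<chi>"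
  proof -
    have "\<exists>!\<xi>. \<xi> \<in> Arr (cat1 E) \<and> Dom (cat1 E) \<xi> = Dom (cat1 E) (\<alpha> \<cdot>\<^sub>1 h)
        \<and> Cod (cat1 E) \<xi> = Dom (cat1 E) \<phi>
        \<and> csrc E \<xi> = \<one>\<^sub>0 x \<and> ctgt E \<xi> = \<one>\<^sub>0 y \<and> \<xi> \<cdot>\<^sub>1 \<phi> = \<alpha> \<cdot>\<^sub>1 h"
      by (rule lift) simp_all
    moreover have "\<alpha> \<cdot>\<^sub>1 \<chi> \<in> Arr (cat1 E) \<and> Dom (cat1 E) (\<alpha> \<cdot>\<^sub>1 \<chi>) = Dom (cat1 E) (\<alpha> \<cdot>\<^sub>1 h)
        \<and> Cod (cat1 E) (\<alpha> \<cdot>\<^sub>1 \<chi>) = Dom (cat1 E) \<phi>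
        \<and> csrc E (\<alpha> \<cdot>\<^sub>1 \<chi>) = \<one>\<^sub>0 x \<and> ctgt E (\<alpha> \<cdot>\<^sub>1 \<chi>) = \<one>\<^sub>0 y \<and> (\<alpha> \<cdot>\<^sub>1 \<chi>) \<cdot>\<^sub>1 \<phi> = \<alpha> \<cdot>\<^sub>1 h"
      using \<chi> by simp
    moreover have "\<beta> \<cdot>\<^sub>1 \<chi> \<in> Arr (cat1 E) \<and> Dom (cat1 E) (\<beta> \<cdot>\<^sub>1 \<chi>) = Dom (cat1 E) (\<alpha> \<cdot>\<^sub>1 h)
        \<and> Cod (cat1 E) (\<beta> \<cdot>\<^sub>1 \<chi>) = Dom (cat1 E) \<phi>
        \<and> csrc E (\<beta> \<cdot>\<^sub>1 \<chi>) = \<one>\<^sub>0 x \<and> ctgt E (\<beta> \<cdot>\<^sub>1 \<chi>) = \<one>\<^sub>0 y \<and> (\<beta> \<cdot>\<^sub>1 \<chi>) \<cdot>\<^sub>1 \<phi> = \<alpha> \<cdot>\<^sub>1 h"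
      using \<chi> h(3) by simp
    ultimately show ?thesis
      by (elim ex1E) metis
  qed
  moreover have "\<chi> \<in> Hom (hom_cat E x y) (Cod (cat1 E) \<alpha>) (Dom (cat1 E) \<phi>)"
    using \<chi> by (simp add: Hom_def hom_cat_arr_iff)
  ultimately have "\<exists>!u. u \<in> Hom (hom_cat E x y) (Cod (cat1 E) c) (Dom (cat1 E) \<phi>) \<and> c \<cdot>\<^sub>1 u = \<chi>"
    by (intro coequalizer_ex1[OF c])
  then obtain u where u: "u \<in> Arr (hom_cat E x y)" "Dom (cat1 E) u = Cod (cat1 E) c"
    "Cod (cat1 E) u = Dom (cat1 E) \<phi>" "c \<cdot>\<^sub>1 u = \<chi>"
    by (auto simp: Hom_def)
  then have u': "u \<in> Arr (cat1 E)" "csrc E u = \<one>\<^sub>0 x" "ctgt E u = \<one>\<^sub>0 y"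
    by (simp_all add: hom_cat_arr_iff)
  have "c \<cdot>\<^sub>1 (u \<cdot>\<^sub>1 \<phi>) = h"
    using u u' \<chi>(6) source.A.assoc[of c u \<phi>] by simp
  then show thesis
    using u u' by (intro that[of "u \<cdot>\<^sub>1 \<phi>"]) simp_all
qed

text \<open>The uniqueness half of the universal property against arbitrary cells, reduced to
  globular cells in two stages: cancel \<phi> by cartesianness, then cancel \<open>c\<close> in the
  hom-category.\<close>

lemma coequalizer_epi:
  assumes c: "coequalizer (hom_cat E x y) \<alpha> \<beta> c"
  shows "epi_arrow (cat1 E) c"
  unfolding epi_arrow_def
proof (intro ballI impI, elim conjE)
  fix u v assume [simp]: "u \<in> Arr (cat1 E)" "v \<in> Arr (cat1 E)"
    "Dom (cat1 E) u = Cod (cat1 E) c" "Dom (cat1 E) v = Cod (cat1 E) c" and eq: "c \<cdot>\<^sub>1 u = c \<cdot>\<^sub>1 v"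
  note [simp] = coequalizerD(1-18)[OF c]
  have d [simp]: "Dom (cat0 E) (csrc E u) = x" "Dom (cat0 E) (ctgt E u) = y"
    "Dom (cat0 E) (csrc E v) = x" "Dom (cat0 E) (ctgt E v) = y"
    by simp_all
  \<comment> \<open>Precomposition with the globular \<open>c\<close> changes neither codomain nor
    boundary arrows. Hence \<open>u\<close> and \<open>v\<close> share them and factor through the
    same lift \<phi>.\<close>
  have "Cod (cat1 E) (c \<cdot>\<^sub>1 u) = Cod (cat1 E) u" "Cod (cat1 E) (c \<cdot>\<^sub>1 v) = Cod (cat1 E) v"
    "csrc E (c \<cdot>\<^sub>1 u) = csrc E u" "csrc E (c \<cdot>\<^sub>1 v) = csrc E v"
    "ctgt E (c \<cdot>\<^sub>1 u) = ctgt E u" "ctgt E (c \<cdot>\<^sub>1 v) = ctgt E v"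
    by simp_all
  then have [simp]: "Cod (cat1 E) v = Cod (cat1 E) u" "csrc E v = csrc E u" "ctgt E v = ctgt E u"
    unfolding eq by simp_all
  obtain \<phi> where [simp]: "\<phi> \<in> Arr (cat1 E)" "Cod (cat1 E) \<phi> = Cod (cat1 E) u"
      "csrc E \<phi> = csrc E u" "ctgt E \<phi> = ctgt E u"
    and lift: "\<And>\<psi>. \<lbrakk>\<psi> \<in> Arr (cat1 E); Cod (cat1 E) \<psi> = Cod (cat1 E) u; csrc E \<psi> = csrc E u; ctgt E \<psi> = ctgt E u\<rbrakk>
      \<Longrightarrow> \<exists>!\<chi>. \<chi> \<in> Arr (cat1 E) \<and> Dom (cat1 E) \<chi> = Dom (cat1 E) \<psi> \<and> Cod (cat1 E) \<chi> = Dom (cat1 E) \<phi>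
        \<and> csrc E \<chi> = \<one>\<^sub>0 x \<and> ctgt E \<chi> = \<one>\<^sub>0 y \<and> \<chi> \<cdot>\<^sub>1 \<phi> = \<psi>"
    by (rule restriction[of u]) auto
  obtain u' where u': "u' \<in> Arr (cat1 E)" "Dom (cat1 E) u' = Cod (cat1 E) c"
    "Cod (cat1 E) u' = Dom (cat1 E) \<phi>" "csrc E u' = \<one>\<^sub>0 x" "ctgt E u' = \<one>\<^sub>0 y" "u' \<cdot>\<^sub>1 \<phi> = u"
    using lift[of u] by auto
  obtain v' where v': "v' \<in> Arr (cat1 E)" "Dom (cat1 E) v' = Cod (cat1 E) c"
    "Cod (cat1 E) v' = Dom (cat1 E) \<phi>" "csrc E v' = \<one>\<^sub>0 x" "ctgt E v' = \<one>\<^sub>0 y" "v' \<cdot>\<^sub>1 \<phi> = v"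
    using lift[of v] by auto
  have 1: "(c \<cdot>\<^sub>1 u') \<cdot>\<^sub>1 \<phi> = c \<cdot>\<^sub>1 u" "(c \<cdot>\<^sub>1 v') \<cdot>\<^sub>1 \<phi> = c \<cdot>\<^sub>1 u"
    using u' v' eq by simp_all
  have "\<exists>!\<chi>. \<chi> \<in> Arr (cat1 E) \<and> Dom (cat1 E) \<chi> = Dom (cat1 E) (c \<cdot>\<^sub>1 u)
      \<and> Cod (cat1 E) \<chi> = Dom (cat1 E) \<phi>
      \<and> csrc E \<chi> = \<one>\<^sub>0 x \<and> ctgt E \<chi> = \<one>\<^sub>0 y \<and> \<chi> \<cdot>\<^sub>1 \<phi> = c \<cdot>\<^sub>1 u"
    by (rule lift) simp_all
  moreover have "c \<cdot>\<^sub>1 u' \<in> Arr (cat1 E) \<and> Dom (cat1 E) (c \<cdot>\<^sub>1 u') = Dom (cat1 E) (c \<cdot>\<^sub>1 u)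
      \<and> Cod (cat1 E) (c \<cdot>\<^sub>1 u') = Dom (cat1 E) \<phi>
      \<and> csrc E (c \<cdot>\<^sub>1 u') = \<one>\<^sub>0 x \<and> ctgt E (c \<cdot>\<^sub>1 u') = \<one>\<^sub>0 y \<and> (c \<cdot>\<^sub>1 u') \<cdot>\<^sub>1 \<phi> = c \<cdot>\<^sub>1 u"
    using u' 1 by simp
  moreover have "c \<cdot>\<^sub>1 v' \<in> Arr (cat1 E) \<and> Dom (cat1 E) (c \<cdot>\<^sub>1 v') = Dom (cat1 E) (c \<cdot>\<^sub>1 u)
      \<and> Cod (cat1 E) (c \<cdot>\<^sub>1 v') = Dom (cat1 E) \<phi>
      \<and> csrc E (c \<cdot>\<^sub>1 v') = \<one>\<^sub>0 x \<and> ctgt E (c \<cdot>\<^sub>1 v') = \<one>\<^sub>0 y \<and> (c \<cdot>\<^sub>1 v') \<cdot>\<^sub>1 \<phi> = c \<cdot>\<^sub>1 u"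
    using v' 1(2) by simp
  ultimately have eq': "c \<cdot>\<^sub>1 u' = c \<cdot>\<^sub>1 v'"
    by (elim ex1E) metis
  have "c \<cdot>\<^sub>1 u' \<in> Hom (hom_cat E x y) (Cod (cat1 E) \<alpha>) (Dom (cat1 E) \<phi>)"
    using u' by (simp add: Hom_def hom_cat_arr_iff)
  moreover have "\<alpha> \<cdot>\<^sub>1 (c \<cdot>\<^sub>1 u') = \<beta> \<cdot>\<^sub>1 (c \<cdot>\<^sub>1 u')"
    using u' arg_cong[OF coequalizerD(19)[OF c], of "\<lambda>t. t \<cdot>\<^sub>1 u'"] by simp
  ultimately have "\<exists>!w. w \<in> Hom (hom_cat E x y) (Cod (cat1 E) c) (Dom (cat1 E) \<phi>) \<and> c \<cdot>\<^sub>1 w = c \<cdot>\<^sub>1 u'"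
    by (rule coequalizer_ex1[OF c])
  moreover have "u' \<in> Hom (hom_cat E x y) (Cod (cat1 E) c) (Dom (cat1 E) \<phi>)"
    "v' \<in> Hom (hom_cat E x y) (Cod (cat1 E) c) (Dom (cat1 E) \<phi>)"
    using u' v' by (simp_all add: Hom_def hom_cat_arr_iff)
  ultimately have "u' = v'"
    using eq' by (elim ex1E) metis
  then show "u = v"
    using u' v' by simp
qed

end


section \<open>Tensor products of bimodules and the actions they inherit\<close>

section \<open>The tensor product of bimodules\<close>

context mod_setup
begin

context
  fixes M N :: "('o, 'p, 'c) bimod"
  assumes MN: "is_bimod E M" "is_bimod E N" "bm_tgt M = bm_src N"
begin

lemma q_coequalizer:
  "coequalizer (hom_cat E (co_ob (bm_src M)) (co_ob (bm_tgt N)))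
     (bm_ract M \<odot> \<one>\<^sub>1 (bm_pro N))
     (assoc E (bm_pro M) (co_pro (bm_src N)) (bm_pro N) \<cdot>\<^sub>1 (\<one>\<^sub>1 (bm_pro M) \<odot> bm_lact N))
     (q M N)"
  using choice MN by (auto simp: tensor_choice_def)

lemma q_cell [simp]: "q M N \<in> Arr (cat1 E)"
  and dom_q [simp]: "Dom (cat1 E) (q M N) = bm_pro M \<odot>\<^sub>p bm_pro N"
  and cod_q [simp]: "Cod (cat1 E) (q M N) = tensor_pro E q M N"
  and csrc_q [simp]: "csrc E (q M N) = \<one>\<^sub>0 (co_ob (bm_src M))"
  and ctgt_q [simp]: "ctgt E (q M N) = \<one>\<^sub>0 (co_ob (bm_tgt N))"
  and tensor_pro [simp]: "tensor_pro E q M N \<in> Obj (cat1 E)"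
  and psrc_tensor_pro [simp]: "psrc E (tensor_pro E q M N) = co_ob (bm_src M)"
  and ptgt_tensor_pro [simp]: "ptgt E (tensor_pro E q M N) = co_ob (bm_tgt N)"
  using coequalizerD[OF q_coequalizer] source.A.cod_closed[of "q M N"] MN
  by (simp_all add: tensor_pro_def)

lemma q_square: "assoc_square (bm_ract M, q M N) (bm_lact N, q M N)
    (bm_pro M) (co_pro (bm_src N)) (bm_pro N)"
  using coequalizerD(19)[OF q_coequalizer] MN by (intro assoc_squareI') simp_all

lemma vid_q_coequalizer:
  assumes p: "p \<in> Obj (cat1 E)" "ptgt E p = co_ob (bm_src M)"
  shows "coequalizer (hom_cat E (psrc E p) (co_ob (bm_tgt N)))
     (\<one>\<^sub>1 p \<odot> (bm_ract M \<odot> \<one>\<^sub>1 (bm_pro N)))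
     (\<one>\<^sub>1 p \<odot> (assoc E (bm_pro M) (co_pro (bm_src N)) (bm_pro N) \<cdot>\<^sub>1 (\<one>\<^sub>1 (bm_pro M) \<odot> bm_lact N)))
     (\<one>\<^sub>1 p \<odot> q M N)"
proof -
  have "p \<in> Pro E (psrc E p) (co_ob (bm_src M))" using p by (simp add: Pro_def)
  then show ?thesis
    using coequalizers q_coequalizer unfolding local_coequalizers_def by blast
qed

lemma q_vid_coequalizer:
  assumes p: "p \<in> Obj (cat1 E)" "psrc E p = co_ob (bm_tgt N)"
  shows "coequalizer (hom_cat E (co_ob (bm_src M)) (ptgt E p))
     ((bm_ract M \<odot> \<one>\<^sub>1 (bm_pro N)) \<odot> \<one>\<^sub>1 p)
     ((assoc E (bm_pro M) (co_pro (bm_src N)) (bm_pro N) \<cdot>\<^sub>1 (\<one>\<^sub>1 (bm_pro M) \<odot> bm_lact N)) \<odot> \<one>\<^sub>1 p)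
     (q M N \<odot> \<one>\<^sub>1 p)"
proof -
  have "p \<in> Pro E (co_ob (bm_tgt N)) (ptgt E p)" using p by (simp add: Pro_def)
  then show ?thesis
    using coequalizers q_coequalizer unfolding local_coequalizers_def by blast
qed

lemma epi_q: "epi_arrow (cat1 E) (q M N)"
  by (rule coequalizer_epi[OF q_coequalizer])

lemma epi_vid_q: "\<lbrakk>p \<in> Obj (cat1 E); ptgt E p = co_ob (bm_src M)\<rbrakk>
    \<Longrightarrow> epi_arrow (cat1 E) (\<one>\<^sub>1 p \<odot> q M N)"
  by (rule coequalizer_epi[OF vid_q_coequalizer])

lemma epi_q_vid: "\<lbrakk>p \<in> Obj (cat1 E); psrc E p = co_ob (bm_tgt N)\<rbrakk>
    \<Longrightarrow> epi_arrow (cat1 E) (q M N \<odot> \<one>\<^sub>1 p)"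
  by (rule coequalizer_epi[OF q_vid_coequalizer])

text \<open>Preservation of coequalizers is applied twice, once per whiskering. This is the cell
  left over in \<open>pentagon_sq4\<close>.\<close>

lemma epi_q_vid_vid:
  assumes "p \<in> Obj (cat1 E)" "psrc E p = co_ob (bm_tgt N)" "r \<in> Obj (cat1 E)" "psrc E r = ptgt E p"
  shows "epi_arrow (cat1 E) ((q M N \<odot> \<one>\<^sub>1 p) \<odot> \<one>\<^sub>1 r)"
proof (rule coequalizer_epi)
  have "r \<in> Pro E (ptgt E p) (ptgt E r)" using assms by (simp add: Pro_def)
  then show "coequalizer (hom_cat E (co_ob (bm_src M)) (ptgt E r))
     (((bm_ract M \<odot> \<one>\<^sub>1 (bm_pro N)) \<odot> \<one>\<^sub>1 p) \<odot> \<one>\<^sub>1 r)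
     (((assoc E (bm_pro M) (co_pro (bm_src N)) (bm_pro N) \<cdot>\<^sub>1 (\<one>\<^sub>1 (bm_pro M) \<odot> bm_lact N)) \<odot> \<one>\<^sub>1 p) \<odot> \<one>\<^sub>1 r)
     ((q M N \<odot> \<one>\<^sub>1 p) \<odot> \<one>\<^sub>1 r)"
    using coequalizers q_vid_coequalizer[OF assms(1,2)] unfolding local_coequalizers_def by blast
qed

text \<open>Preservation on the left and then on the right. This is the cell left over in
  \<open>pentagon_sq3\<close>.\<close>

lemma epi_vid_q_vid:
  assumes "p \<in> Obj (cat1 E)" "ptgt E p = co_ob (bm_src M)" "r \<in> Obj (cat1 E)" "psrc E r = co_ob (bm_tgt N)"
  shows "epi_arrow (cat1 E) ((\<one>\<^sub>1 p \<odot> q M N) \<odot> \<one>\<^sub>1 r)"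
proof (rule coequalizer_epi)
  have "r \<in> Pro E (co_ob (bm_tgt N)) (ptgt E r)" using assms by (simp add: Pro_def)
  then show "coequalizer (hom_cat E (psrc E p) (ptgt E r))
     ((\<one>\<^sub>1 p \<odot> (bm_ract M \<odot> \<one>\<^sub>1 (bm_pro N))) \<odot> \<one>\<^sub>1 r)
     ((\<one>\<^sub>1 p \<odot> (assoc E (bm_pro M) (co_pro (bm_src N)) (bm_pro N) \<cdot>\<^sub>1 (\<one>\<^sub>1 (bm_pro M) \<odot> bm_lact N))) \<odot> \<one>\<^sub>1 r)
     ((\<one>\<^sub>1 p \<odot> q M N) \<odot> \<one>\<^sub>1 r)"
    using coequalizers vid_q_coequalizer[OF assms(1,2)] unfolding local_coequalizers_def by blast
qed

lemma tensor_simps [simp]: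
  "bm_src (tensor E q M N) = bm_src M" "bm_tgt (tensor E q M N) = bm_tgt N"
  "bm_pro (tensor E q M N) = tensor_pro E q M N"
  by (simp_all add: tensor_def Let_def)

text \<open>The action exists because the left action on \<open>M\<close> commutes with its right
  action, so acting on the first factor respects the relation that defines the tensor product.
  Uniqueness holds because the whiskered coequalizer cell is epic.\<close>

lemma tensor_lact_ex1:
  "\<exists>!l. l \<in> Glob E (co_pro (bm_src M) \<odot>\<^sub>p tensor_pro E q M N) (tensor_pro E q M N)
    \<and> assoc E (co_pro (bm_src M)) (bm_pro M) (bm_pro N) \<cdot>\<^sub>1 (\<one>\<^sub>1 (co_pro (bm_src M)) \<odot> q M N) \<cdot>\<^sub>1 l
      = (bm_lact M \<odot> \<one>\<^sub>1 (bm_pro N)) \<cdot>\<^sub>1 q M N"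
proof -
  note [simp] = MN
  let ?r = "co_pro (bm_src M)" and ?s = "co_pro (bm_src N)" and ?m = "bm_pro M" and ?n = "bm_pro N"
    and ?k = "tensor_pro E q M N"
  let ?h = "inv\<^sub>1 (assoc E ?r ?m ?n) \<cdot>\<^sub>1 ((bm_lact M \<odot> \<one>\<^sub>1 ?n) \<cdot>\<^sub>1 q M N)"
  \<comment> \<open>With an identity in third place the square merely records the definition of
    \<open>?h\<close>, in the form in which \<open>pentagon_sq2\<close> accepts it.\<close>
  have sq: "assoc_square (bm_lact M, q M N) (\<one>\<^sub>1 (?m \<odot>\<^sub>p ?n), ?h) ?r ?m ?n"
    by (rule assoc_squareI') (simp_all add: hcomp_vid)
  have "(\<one>\<^sub>1 ?r \<odot> ((bm_ract M \<odot> \<one>\<^sub>1 ?n) \<cdot>\<^sub>1 \<one>\<^sub>1 (?m \<odot>\<^sub>p ?n))) \<cdot>\<^sub>1 ?h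
      = (\<one>\<^sub>1 ?r \<odot> (assoc E ?m ?s ?n \<cdot>\<^sub>1 ((\<one>\<^sub>1 ?m \<odot> bm_lact N) \<cdot>\<^sub>1 \<one>\<^sub>1 (?m \<odot>\<^sub>p ?n)))) \<cdot>\<^sub>1 ?h"
    by (rule pentagon_sq2[where ab = "bm_lact M" and abc_l = "bm_ract M" and abc_r = "bm_lact M"
          and La = "q M N" and Lc = "q M N"])
      (use mid_square[of M] sq q_square in simp_all)
  then have "(\<one>\<^sub>1 ?r \<odot> (bm_ract M \<odot> \<one>\<^sub>1 ?n)) \<cdot>\<^sub>1 ?h
      = (\<one>\<^sub>1 ?r \<odot> (assoc E ?m ?s ?n \<cdot>\<^sub>1 (\<one>\<^sub>1 ?m \<odot> bm_lact N))) \<cdot>\<^sub>1 ?h"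
    by simp
  then obtain l where l: "l \<in> Arr (cat1 E)" "Dom (cat1 E) l = ?r \<odot>\<^sub>p ?k" "Cod (cat1 E) l = ?k"
    "csrc E l = \<one>\<^sub>0 (co_ob (bm_src M))" "ctgt E l = \<one>\<^sub>0 (co_ob (bm_tgt N))" "(\<one>\<^sub>1 ?r \<odot> q M N) \<cdot>\<^sub>1 l = ?h"
    by (rule coequalizer_factor[OF vid_q_coequalizer[of ?r], rotated -2]) simp_all
  show ?thesis
  proof (rule ex1I[of _ l])
    show "l \<in> Glob E (?r \<odot>\<^sub>p ?k) ?k
      \<and> assoc E ?r ?m ?n \<cdot>\<^sub>1 (\<one>\<^sub>1 ?r \<odot> q M N) \<cdot>\<^sub>1 l = (bm_lact M \<odot> \<one>\<^sub>1 ?n) \<cdot>\<^sub>1 q M N"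
      using l by (auto intro!: GlobI)
  next
    fix l' assume l': "l' \<in> Glob E (?r \<odot>\<^sub>p ?k) ?k
      \<and> assoc E ?r ?m ?n \<cdot>\<^sub>1 (\<one>\<^sub>1 ?r \<odot> q M N) \<cdot>\<^sub>1 l' = (bm_lact M \<odot> \<one>\<^sub>1 ?n) \<cdot>\<^sub>1 q M N"
    note [simp] = Glob_D(1-5)[OF conjunct1[OF l']]
    have "(\<one>\<^sub>1 ?r \<odot> q M N) \<cdot>\<^sub>1 l' = inv\<^sub>1 (assoc E ?r ?m ?n)
        \<cdot>\<^sub>1 (assoc E ?r ?m ?n \<cdot>\<^sub>1 (\<one>\<^sub>1 ?r \<odot> q M N) \<cdot>\<^sub>1 l')"
      by simp
    also have "\<dots> = ?h"
      using l' by simp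
    finally have "(\<one>\<^sub>1 ?r \<odot> q M N) \<cdot>\<^sub>1 l' = (\<one>\<^sub>1 ?r \<odot> q M N) \<cdot>\<^sub>1 l"
      using l by simp
    then show "l' = l"
      by (rule epi_arrowD[OF epi_vid_q[of ?r], rotated 2]) (simp_all add: l)
  qed
qed

text \<open>Here the compatibility of the two actions on \<open>N\<close> is used. The coequalizer
  is whiskered on the right, so \<open>pentagon_sq1\<close> supplies the coequalizing property, and
  the identity in the auxiliary square moves to first place.\<close>

lemma tensor_ract_ex1:
  "\<exists>!\<rho>. \<rho> \<in> Glob E (tensor_pro E q M N \<odot>\<^sub>p co_pro (bm_tgt N)) (tensor_pro E q M N)
    \<and> (q M N \<odot> \<one>\<^sub>1 (co_pro (bm_tgt N))) \<cdot>\<^sub>1 \<rho>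
      = assoc E (bm_pro M) (bm_pro N) (co_pro (bm_tgt N)) \<cdot>\<^sub>1 (\<one>\<^sub>1 (bm_pro M) \<odot> bm_ract N) \<cdot>\<^sub>1 q M N"
proof -
  note [simp] = MN
  let ?t = "co_pro (bm_tgt N)" and ?s = "co_pro (bm_src N)" and ?m = "bm_pro M" and ?n = "bm_pro N"
    and ?k = "tensor_pro E q M N"
  let ?h = "assoc E ?m ?n ?t \<cdot>\<^sub>1 ((\<one>\<^sub>1 ?m \<odot> bm_ract N) \<cdot>\<^sub>1 q M N)"
  have sq: "assoc_square (\<one>\<^sub>1 (?m \<odot>\<^sub>p ?n), ?h) (bm_ract N, q M N) ?m ?n ?t"
    by (rule assoc_squareI') (simp_all add: hcomp_vid)
  have "(((bm_ract M \<odot> \<one>\<^sub>1 ?n) \<cdot>\<^sub>1 \<one>\<^sub>1 (?m \<odot>\<^sub>p ?n)) \<odot> \<one>\<^sub>1 ?t) \<cdot>\<^sub>1 ?h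
      = ((assoc E ?m ?s ?n \<cdot>\<^sub>1 ((\<one>\<^sub>1 ?m \<odot> bm_lact N) \<cdot>\<^sub>1 \<one>\<^sub>1 (?m \<odot>\<^sub>p ?n))) \<odot> \<one>\<^sub>1 ?t) \<cdot>\<^sub>1 ?h"
    by (rule pentagon_sq1[where cd = "bm_ract N" and bcd_l = "bm_ract N" and bcd_r = "bm_lact N"
          and Lb = "q M N" and Lc = "q M N"])
      (use mid_square[of N] sq q_square in simp_all)
  then have "((bm_ract M \<odot> \<one>\<^sub>1 ?n) \<odot> \<one>\<^sub>1 ?t) \<cdot>\<^sub>1 ?h
      = ((assoc E ?m ?s ?n \<cdot>\<^sub>1 (\<one>\<^sub>1 ?m \<odot> bm_lact N)) \<odot> \<one>\<^sub>1 ?t) \<cdot>\<^sub>1 ?h"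
    by simp
  then obtain l where l: "l \<in> Arr (cat1 E)" "Dom (cat1 E) l = ?k \<odot>\<^sub>p ?t" "Cod (cat1 E) l = ?k"
    "csrc E l = \<one>\<^sub>0 (co_ob (bm_src M))" "ctgt E l = \<one>\<^sub>0 (co_ob (bm_tgt N))" "(q M N \<odot> \<one>\<^sub>1 ?t) \<cdot>\<^sub>1 l = ?h"
    by (rule coequalizer_factor[OF q_vid_coequalizer[of ?t], rotated -2]) simp_all
  show ?thesis
  proof (rule ex1I[of _ l])
    show "l \<in> Glob E (?k \<odot>\<^sub>p ?t) ?k
      \<and> (q M N \<odot> \<one>\<^sub>1 ?t) \<cdot>\<^sub>1 l = assoc E ?m ?n ?t \<cdot>\<^sub>1 (\<one>\<^sub>1 ?m \<odot> bm_ract N) \<cdot>\<^sub>1 q M N"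
      using l by (auto intro!: GlobI)
  next
    fix l' assume l': "l' \<in> Glob E (?k \<odot>\<^sub>p ?t) ?k
      \<and> (q M N \<odot> \<one>\<^sub>1 ?t) \<cdot>\<^sub>1 l' = assoc E ?m ?n ?t \<cdot>\<^sub>1 (\<one>\<^sub>1 ?m \<odot> bm_ract N) \<cdot>\<^sub>1 q M N"
    note [simp] = Glob_D(1-5)[OF conjunct1[OF l']]
    have "(q M N \<odot> \<one>\<^sub>1 ?t) \<cdot>\<^sub>1 l' = (q M N \<odot> \<one>\<^sub>1 ?t) \<cdot>\<^sub>1 l"
      using l l' by simp
    then show "l' = l"
      by (rule epi_arrowD[OF epi_q_vid[of ?t], rotated 2]) (simp_all add: l)
  qed
qed

lemma tensor_lact_square: "assoc_square (bm_lact M, q M N) (q M N, bm_lact (tensor E q M N))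
    (co_pro (bm_src M)) (bm_pro M) (bm_pro N)"
  and cod_tensor_lact: "Cod (cat1 E) (bm_lact (tensor E q M N)) = tensor_pro E q M N"
proof -
  note [simp] = MN
  have *: "bm_lact (tensor E q M N) \<in> Glob E (co_pro (bm_src M) \<odot>\<^sub>p tensor_pro E q M N) (tensor_pro E q M N)
    \<and> assoc E (co_pro (bm_src M)) (bm_pro M) (bm_pro N) \<cdot>\<^sub>1 (\<one>\<^sub>1 (co_pro (bm_src M)) \<odot> q M N)
        \<cdot>\<^sub>1 bm_lact (tensor E q M N) = (bm_lact M \<odot> \<one>\<^sub>1 (bm_pro N)) \<cdot>\<^sub>1 q M N"
    using theI'[OF tensor_lact_ex1] by (simp add: tensor_def Let_def)
  note [simp] = Glob_D(1-5)[OF conjunct1[OF *]]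
  show "assoc_square (bm_lact M, q M N) (q M N, bm_lact (tensor E q M N))
      (co_pro (bm_src M)) (bm_pro M) (bm_pro N)"
    using * by (intro assoc_squareI') simp_all
  show "Cod (cat1 E) (bm_lact (tensor E q M N)) = tensor_pro E q M N" by simp
qed

lemma tensor_ract_square: "assoc_square (q M N, bm_ract (tensor E q M N)) (bm_ract N, q M N)
    (bm_pro M) (bm_pro N) (co_pro (bm_tgt N))"
  and cod_tensor_ract: "Cod (cat1 E) (bm_ract (tensor E q M N)) = tensor_pro E q M N"
proof -
  note [simp] = MN
  have *: "bm_ract (tensor E q M N) \<in> Glob E (tensor_pro E q M N \<odot>\<^sub>p co_pro (bm_tgt N)) (tensor_pro E q M N)
    \<and> (q M N \<odot> \<one>\<^sub>1 (co_pro (bm_tgt N))) \<cdot>\<^sub>1 bm_ract (tensor E q M N)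
      = assoc E (bm_pro M) (bm_pro N) (co_pro (bm_tgt N)) \<cdot>\<^sub>1 (\<one>\<^sub>1 (bm_pro M) \<odot> bm_ract N) \<cdot>\<^sub>1 q M N"
    using theI'[OF tensor_ract_ex1] by (simp add: tensor_def Let_def)
  note [simp] = Glob_D(1-5)[OF conjunct1[OF *]]
  show "assoc_square (q M N, bm_ract (tensor E q M N)) (bm_ract N, q M N)
      (bm_pro M) (bm_pro N) (co_pro (bm_tgt N))"
    using * by (intro assoc_squareI') simp_all
  show "Cod (cat1 E) (bm_ract (tensor E q M N)) = tensor_pro E q M N" by simp
qed

text \<open>Each action law is the missing edge of a pentagon whose other squares are laws of
  \<open>M\<close> or \<open>N\<close> or define the induced actions; the leftover whiskered
  coequalizer cell is epic. The unit laws are checked after the same kind of cancellation.\<close>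

lemma is_bimod_tensor [simp]: "is_bimod E (tensor E q M N)"
proof -
  note [simp] = MN cod_tensor_lact cod_tensor_ract
  let ?r = "co_pro (bm_src M)" and ?t = "co_pro (bm_tgt N)" and ?m = "bm_pro M" and ?n = "bm_pro N"
    and ?k = "tensor_pro E q M N" and ?l = "bm_lact (tensor E q M N)" and ?\<rho> = "bm_ract (tensor E q M N)"
  note [simp] = assoc_squareD(23-26)[OF tensor_lact_square, simplified]
    assoc_squareD(18,19,21,22)[OF tensor_ract_square, simplified]
  \<comment> \<open>The pentagon has corners \<open>?r\<close>, \<open>?r\<close>,
    \<open>?m\<close>, \<open>?n\<close>: associativity of the action on \<open>M\<close> and three
    copies of the defining square of the induced action.\<close>
  have l: "assoc_square (co_mult (bm_src M), ?l) (?l, ?l) ?r ?r ?k"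
    using pentagon_sq5[where ab = "co_mult (bm_src M)" and bc = "bm_lact M" and cd = "q M N"
        and abc_l = "bm_lact M" and abc_r = "bm_lact M" and bcd_l = "q M N" and bcd_r = ?l
        and La = "q M N" and Lb = ?l and Lc = ?l and m = ?r and n = ?r and p = ?m and t = ?n]
      lact_square[of M] tensor_lact_square epi_vid_q[of "?r \<odot>\<^sub>p ?r"] by simp
  \<comment> \<open>The mirror image, with corners \<open>?m\<close>, \<open>?n\<close>,
    \<open>?t\<close>, \<open>?t\<close>; the coequalizer cell now sits in first place.\<close>
  have r: "assoc_square (?\<rho>, ?\<rho>) (co_mult (bm_tgt N), ?\<rho>) ?k ?t ?t"
    using pentagon_sq4[where ab = "q M N" and bc = "bm_ract N" and cd = "co_mult (bm_tgt N)"
        and abc_l = ?\<rho> and abc_r = "q M N" and bcd_l = "bm_ract N" and bcd_r = "bm_ract N"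
        and La = ?\<rho> and Lb = "q M N" and Lc = ?\<rho> and m = ?m and n = ?n and p = ?t and t = ?t]
      ract_square[of N] tensor_ract_square epi_q_vid_vid[of ?t ?t] by simp
  \<comment> \<open>Corners \<open>?r\<close>, \<open>?m\<close>, \<open>?n\<close>,
    \<open>?t\<close>: each induced action contributes its defining square twice, and the
    coequalizer cell sits in the middle.\<close>
  have m: "assoc_square (?l, ?\<rho>) (?\<rho>, ?l) ?r ?k ?t"
    using pentagon_sq3[where ab = "bm_lact M" and bc = "q M N" and cd = "bm_ract N"
        and abc_l = "q M N" and abc_r = ?l and bcd_l = ?\<rho> and bcd_r = "q M N"
        and La = ?\<rho> and Lb = ?l and Lc = "q M N" and m = ?r and n = ?m and p = ?n and t = ?t]
      tensor_lact_square tensor_ract_square epi_vid_q_vid[of ?r ?t] by simp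
  \<comment> \<open>Preceded by the whiskered \<open>q M N\<close>, this is the unit law for
    \<open>M\<close>, carried over by \<open>assoc_lunit\<close> and naturality of
    \<open>lunit\<close>.\<close>
  have ul: "(co_unit (bm_src M) \<odot> \<one>\<^sub>1 ?k) \<cdot>\<^sub>1 ?l = lunit E ?k"
  proof (rule epi_arrowD[OF epi_vid_q[of "pid E (co_ob (bm_src M))"]])
    let ?i = "pid E (co_ob (bm_src M))"
    have "assoc E ?i ?m ?n \<cdot>\<^sub>1 ((\<one>\<^sub>1 ?i \<odot> q M N) \<cdot>\<^sub>1 ((co_unit (bm_src M) \<odot> \<one>\<^sub>1 ?k) \<cdot>\<^sub>1 ?l))
        = (((co_unit (bm_src M) \<odot> \<one>\<^sub>1 ?m) \<cdot>\<^sub>1 bm_lact M) \<odot> \<one>\<^sub>1 ?n) \<cdot>\<^sub>1 q M N"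
      using assoc_square_gen[OF tensor_lact_square, of "co_unit (bm_src M)" "\<one>\<^sub>1 ?m" "\<one>\<^sub>1 ?n"]
      by (simp add: hcomp_vcomp' hcomp_vid)
    also have "\<dots> = assoc E ?i ?m ?n \<cdot>\<^sub>1 (lunit E (?m \<odot>\<^sub>p ?n) \<cdot>\<^sub>1 q M N)"
      using arg_cong[OF assoc_lunit[of ?m ?n "co_ob (bm_src M)"], of "\<lambda>t. t \<cdot>\<^sub>1 q M N"]
      by (simp add: lact_unit)
    also have "\<dots> = assoc E ?i ?m ?n \<cdot>\<^sub>1 ((\<one>\<^sub>1 ?i \<odot> q M N) \<cdot>\<^sub>1 lunit E ?k)"
      using lunit_nat[of "q M N" "\<one>\<^sub>0 (co_ob (bm_src M))" ?k] by simp
    finally show "(\<one>\<^sub>1 ?i \<odot> q M N) \<cdot>\<^sub>1 ((co_unit (bm_src M) \<odot> \<one>\<^sub>1 ?k) \<cdot>\<^sub>1 ?l)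
        = (\<one>\<^sub>1 ?i \<odot> q M N) \<cdot>\<^sub>1 lunit E ?k"
      by (rule source.A.iso_cancel[rotated -1]) simp_all
  qed simp_all
  have ur: "(\<one>\<^sub>1 ?k \<odot> co_unit (bm_tgt N)) \<cdot>\<^sub>1 ?\<rho> = runit E ?k"
  proof (rule epi_arrowD[OF epi_q_vid[of "pid E (co_ob (bm_tgt N))"]])
    let ?i = "pid E (co_ob (bm_tgt N))"
    have "(q M N \<odot> \<one>\<^sub>1 ?i) \<cdot>\<^sub>1 ((\<one>\<^sub>1 ?k \<odot> co_unit (bm_tgt N)) \<cdot>\<^sub>1 ?\<rho>)
        = assoc E ?m ?n ?i \<cdot>\<^sub>1 ((\<one>\<^sub>1 ?m \<odot> ((\<one>\<^sub>1 ?n \<odot> co_unit (bm_tgt N)) \<cdot>\<^sub>1 bm_ract N)) \<cdot>\<^sub>1 q M N)"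
      using assoc_square_gen[OF tensor_ract_square, of "\<one>\<^sub>1 ?m" "\<one>\<^sub>1 ?n" "co_unit (bm_tgt N)"]
      by (simp add: hcomp_vcomp' hcomp_vid)
    also have "\<dots> = runit E (?m \<odot>\<^sub>p ?n) \<cdot>\<^sub>1 q M N"
      using arg_cong[OF assoc_runit[of ?m ?n "co_ob (bm_tgt N)"], of "\<lambda>t. t \<cdot>\<^sub>1 q M N"]
      by (simp add: ract_unit)
    also have "\<dots> = (q M N \<odot> \<one>\<^sub>1 ?i) \<cdot>\<^sub>1 runit E ?k"
      using runit_nat[of "q M N" "\<one>\<^sub>0 (co_ob (bm_tgt N))" ?k] by simp
    finally show "(q M N \<odot> \<one>\<^sub>1 ?i) \<cdot>\<^sub>1 ((\<one>\<^sub>1 ?k \<odot> co_unit (bm_tgt N)) \<cdot>\<^sub>1 ?\<rho>)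
        = (q M N \<odot> \<one>\<^sub>1 ?i) \<cdot>\<^sub>1 runit E ?k" .
  qed simp_all
  show ?thesis
    by (rule is_bimodI) (simp_all add: l r m ul ur)
qed

end

end


section \<open>Extending cells along the unit of a category object\<close>

context double_category
begin

text \<open>By \<open>assoc_lunit\<close>, a unit inserted in front of the first factor is a unit
  inserted in front of the whole composite; the square then reassociates. It serves to prove that a
  cell of the form \<open>lcomp\<close> is equivariant on the right.\<close>

lemma hcomp_lcomp:
  assumes sq: "assoc_square (l1, l2) (l3, l4) m n p"
    and [simp]: "a \<in> Arr (cat1 D)" "b \<in> Arr (cat1 D)" "c \<in> Arr (cat1 D)"
      "Cod (cat1 D) a = m" "Cod (cat1 D) b = n" "Cod (cat1 D) c = p"
      "ctgt D a = csrc D b" "ctgt D b = csrc D c"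
      "Dom (cat1 D) a = pid D x"
    and x: "psrc D (Dom (cat1 D) b) = x"
  shows "(lcomp l1 a b \<odot> c) \<cdot>\<^sub>1 l2 = lcomp l4 a ((b \<odot> c) \<cdot>\<^sub>1 l3)"
proof -
  note [simp] = assoc_squareD[OF sq]
  note x' [simp] = x
  have [simp]: "x \<in> Obj (cat0 D)" using source.obj_closed[of "Dom (cat1 D) b"] by simp
  have [simp]: "psrc D (Dom (cat1 D) c) = ptgt D (Dom (cat1 D) b)"
    using conjunct1[OF psrc_cod_eq[OF assms(3,4,9)]] by (rule sym)
  let ?u = "Dom (cat1 D) b" and ?v = "Dom (cat1 D) c"
  have "(inv\<^sub>1 (lunit D ?u) \<odot> \<one>\<^sub>1 ?v) \<cdot>\<^sub>1 (assoc D (pid D x) ?u ?v \<cdot>\<^sub>1 lunit D (?u \<odot>\<^sub>p ?v)) = \<one>\<^sub>1 (?u \<odot>\<^sub>p ?v)"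
    by (simp add: assoc_lunit hcomp_vcomp hcomp_vid)
  then have "((inv\<^sub>1 (lunit D ?u) \<odot> \<one>\<^sub>1 ?v) \<cdot>\<^sub>1 (assoc D (pid D x) ?u ?v \<cdot>\<^sub>1 lunit D (?u \<odot>\<^sub>p ?v)))
      \<cdot>\<^sub>1 inv\<^sub>1 (lunit D (?u \<odot>\<^sub>p ?v)) = inv\<^sub>1 (lunit D (?u \<odot>\<^sub>p ?v))"
    by simp
  then have *: "(inv\<^sub>1 (lunit D ?u) \<odot> \<one>\<^sub>1 ?v) \<cdot>\<^sub>1 assoc D (pid D x) ?u ?v = inv\<^sub>1 (lunit D (?u \<odot>\<^sub>p ?v))"
    by simp
  have "(lcomp l1 a b \<odot> c) \<cdot>\<^sub>1 l2
      = (inv\<^sub>1 (lunit D ?u) \<odot> \<one>\<^sub>1 ?v) \<cdot>\<^sub>1 ((((a \<odot> b) \<cdot>\<^sub>1 l1) \<odot> c) \<cdot>\<^sub>1 l2)"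
    by (simp add: lcomp_def hcomp_vcomp')
  also have "\<dots> = ((inv\<^sub>1 (lunit D ?u) \<odot> \<one>\<^sub>1 ?v) \<cdot>\<^sub>1 assoc D (pid D x) ?u ?v)
      \<cdot>\<^sub>1 ((a \<odot> ((b \<odot> c) \<cdot>\<^sub>1 l3)) \<cdot>\<^sub>1 l4)"
    using assoc_square_gen[OF sq, of a b c] by simp
  also have "\<dots> = lcomp l4 a ((b \<odot> c) \<cdot>\<^sub>1 l3)"
    unfolding * by (simp add: lcomp_def)
  finally show ?thesis .
qed

lemma hcomp_rcomp:
  assumes sq: "assoc_square (l1, l2) (l3, l4) m n p"
    and [simp]: "a \<in> Arr (cat1 D)" "b \<in> Arr (cat1 D)" "c \<in> Arr (cat1 D)"
      "Cod (cat1 D) a = m" "Cod (cat1 D) b = n" "Cod (cat1 D) c = p"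
      "ctgt D a = csrc D b" "ctgt D b = csrc D c"
      "Dom (cat1 D) c = pid D x"
    and x: "ptgt D (Dom (cat1 D) b) = x"
  shows "(a \<odot> rcomp l3 b c) \<cdot>\<^sub>1 l4 = rcomp l2 ((a \<odot> b) \<cdot>\<^sub>1 l1) c"
proof -
  note [simp] = assoc_squareD[OF sq]
  note x' [simp] = x
  have [simp]: "x \<in> Obj (cat0 D)" using target.obj_closed[of "Dom (cat1 D) b"] by simp
  have [simp]: "ptgt D (Dom (cat1 D) a) = psrc D (Dom (cat1 D) b)"
    by (rule conjunct1[OF psrc_cod_eq[OF assms(2,3,8)]])
  let ?u = "Dom (cat1 D) a" and ?v = "Dom (cat1 D) b"
  have "inv\<^sub>1 (runit D (?u \<odot>\<^sub>p ?v)) \<cdot>\<^sub>1 (runit D (?u \<odot>\<^sub>p ?v) \<cdot>\<^sub>1 (\<one>\<^sub>1 ?u \<odot> inv\<^sub>1 (runit D ?v)))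
    = inv\<^sub>1 (runit D (?u \<odot>\<^sub>p ?v)) \<cdot>\<^sub>1
      ((assoc D ?u ?v (pid D x) \<cdot>\<^sub>1 (\<one>\<^sub>1 ?u \<odot> runit D ?v)) \<cdot>\<^sub>1 (\<one>\<^sub>1 ?u \<odot> inv\<^sub>1 (runit D ?v)))"
    by (subst assoc_runit) simp_all
  then have *: "inv\<^sub>1 (runit D (?u \<odot>\<^sub>p ?v)) \<cdot>\<^sub>1 assoc D ?u ?v (pid D x) = \<one>\<^sub>1 ?u \<odot> inv\<^sub>1 (runit D ?v)"
    by (simp add: hcomp_vcomp hcomp_vid)
  have "rcomp l2 ((a \<odot> b) \<cdot>\<^sub>1 l1) c
      = inv\<^sub>1 (runit D (?u \<odot>\<^sub>p ?v)) \<cdot>\<^sub>1 ((((a \<odot> b) \<cdot>\<^sub>1 l1) \<odot> c) \<cdot>\<^sub>1 l2)"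
    by (simp add: rcomp_def)
  also have "\<dots> = (inv\<^sub>1 (runit D (?u \<odot>\<^sub>p ?v)) \<cdot>\<^sub>1 assoc D ?u ?v (pid D x))
      \<cdot>\<^sub>1 ((a \<odot> ((b \<odot> c) \<cdot>\<^sub>1 l3)) \<cdot>\<^sub>1 l4)"
    using assoc_square_gen[OF sq, of a b c] by simp
  also have "\<dots> = (a \<odot> rcomp l3 b c) \<cdot>\<^sub>1 l4"
    unfolding * by (simp add: rcomp_def hcomp_vcomp')
  finally show ?thesis by simp
qed


subsection \<open>Cells out of unit bimodules\<close>

text \<open>Right equivariance turns the action by the restricted cell into the multiplication of
  \<open>X\<close> followed by the cell, and \<open>co_unit_left\<close> cancels the unit in
  front.\<close>

lemma cell_from_unit:
  assumes [simp]: "is_bicell D A" "bc_dom A = unit_bimod X"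
  shows "bc_cell A = lcomp (bm_ract (bc_cod A)) (co_unit X \<cdot>\<^sub>1 bc_cell A) (cf_cell (bc_tgt A))"
proof -
  have [simp]: "is_catobj D X"
    using bm_src[OF bc_dom[OF assms(1)]] by simp
  have "lcomp (bm_ract (bc_cod A)) (co_unit X \<cdot>\<^sub>1 bc_cell A) (cf_cell (bc_tgt A))
      = inv\<^sub>1 (lunit D (co_pro X)) \<cdot>\<^sub>1 ((co_unit X \<odot> \<one>\<^sub>1 (co_pro X))
        \<cdot>\<^sub>1 ((bc_cell A \<odot> cf_cell (bc_tgt A)) \<cdot>\<^sub>1 bm_ract (bc_cod A)))"
    by (simp add: lcomp_def hcomp_vcomp')
  also have "\<dots> = inv\<^sub>1 (lunit D (co_pro X)) \<cdot>\<^sub>1 (((co_unit X \<odot> \<one>\<^sub>1 (co_pro X)) \<cdot>\<^sub>1 co_mult X) \<cdot>\<^sub>1 bc_cell A)"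
    by (simp add: bc_right)
  also have "\<dots> = bc_cell A"
    by (subst co_unit_left) simp_all
  finally show ?thesis by simp
qed

lemma bicell_from_unit_eqI:
  assumes "is_bicell D A" "is_bicell D B" "bc_dom A = unit_bimod X" "bc_dom B = unit_bimod X"
    "bc_cod A = bc_cod B" "bc_src A = bc_src B" "bc_tgt A = bc_tgt B"
    "co_unit X \<cdot>\<^sub>1 bc_cell A = co_unit X \<cdot>\<^sub>1 bc_cell B"
  shows "A = B"
proof -
  have "bc_cell A = bc_cell B"
    using cell_from_unit[OF assms(1,3)] cell_from_unit[OF assms(2,4)] assms by simp
  then show ?thesis
    using assms by (intro bicell.equality) simp_all
qed

text \<open>Each formula is equivariant on one side, by associativity of the action and
  multiplicativity of the functor on that side: \<open>lcomp\<close> on the right,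
  \<open>rcomp\<close> on the left. The hypothesis \<open>balanced\<close> merges them into one cell
  with both properties.\<close>

lemma
  assumes [simp]: "is_cofun D \<Phi>" "is_cofun D \<Psi>" "cf_dom \<Phi> = X" "cf_dom \<Psi> = X"
    "is_bimod D N" "bm_src N = cf_cod \<Phi>" "bm_tgt N = cf_cod \<Psi>"
    "a \<in> Arr (cat1 D)" "Dom (cat1 D) a = pid D (co_ob X)" "Cod (cat1 D) a = bm_pro N"
    "csrc D a = cf_arr \<Phi>" "ctgt D a = cf_arr \<Psi>"
    and balanced: "lcomp (bm_ract N) a (cf_cell \<Psi>) = rcomp (bm_lact N) (cf_cell \<Phi>) a"
  shows bicell_from_unit: "is_bicell D \<lparr>bc_dom = unit_bimod X, bc_cod = N, bc_src = \<Phi>, bc_tgt = \<Psi>,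
      bc_cell = lcomp (bm_ract N) a (cf_cell \<Psi>)\<rparr>"
    and unit_comp_lcomp: "co_unit X \<cdot>\<^sub>1 lcomp (bm_ract N) a (cf_cell \<Psi>) = a"
proof -
  have [simp]: "is_catobj D X" using cf_dom[OF assms(1)] by simp
  have 1: "(lcomp (bm_ract N) a (cf_cell \<Psi>) \<odot> cf_cell \<Psi>) \<cdot>\<^sub>1 bm_ract N
      = co_mult X \<cdot>\<^sub>1 lcomp (bm_ract N) a (cf_cell \<Psi>)"
  proof -
    have "(lcomp (bm_ract N) a (cf_cell \<Psi>) \<odot> cf_cell \<Psi>) \<cdot>\<^sub>1 bm_ract N
        = lcomp (bm_ract N) a ((cf_cell \<Psi> \<odot> cf_cell \<Psi>) \<cdot>\<^sub>1 co_mult (cf_cod \<Psi>))"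
      using ract_square[of N] by (subst hcomp_lcomp[where x = "co_ob X"]) simp_all
    also have "\<dots> = co_mult X \<cdot>\<^sub>1 lcomp (bm_ract N) a (cf_cell \<Psi>)"
      by (subst vcomp_lcomp) (simp_all add: cf_mult)
    finally show ?thesis .
  qed
  have 2: "(cf_cell \<Phi> \<odot> rcomp (bm_lact N) (cf_cell \<Phi>) a) \<cdot>\<^sub>1 bm_lact N
      = co_mult X \<cdot>\<^sub>1 rcomp (bm_lact N) (cf_cell \<Phi>) a"
  proof -
    have "(cf_cell \<Phi> \<odot> rcomp (bm_lact N) (cf_cell \<Phi>) a) \<cdot>\<^sub>1 bm_lact N
        = rcomp (bm_lact N) ((cf_cell \<Phi> \<odot> cf_cell \<Phi>) \<cdot>\<^sub>1 co_mult (cf_cod \<Phi>)) a"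
      using lact_square[of N] by (subst hcomp_rcomp[where x = "co_ob X"]) simp_all
    also have "\<dots> = co_mult X \<cdot>\<^sub>1 rcomp (bm_lact N) (cf_cell \<Phi>) a"
      by (subst vcomp_rcomp) (simp_all add: cf_mult)
    finally show ?thesis .
  qed
  show "is_bicell D \<lparr>bc_dom = unit_bimod X, bc_cod = N, bc_src = \<Phi>, bc_tgt = \<Psi>,
      bc_cell = lcomp (bm_ract N) a (cf_cell \<Psi>)\<rparr>"
    by (rule is_bicellI) (use 1 2 balanced in simp_all)
  have "co_unit X \<cdot>\<^sub>1 lcomp (bm_ract N) a (cf_cell \<Psi>)
      = lcomp (bm_ract N) a (cid D (cf_arr \<Psi>) \<cdot>\<^sub>1 co_unit (cf_cod \<Psi>))"
    by (subst vcomp_lcomp) (simp_all add: cf_unit)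
  \<comment> \<open>Both factors start at a unit after restriction, so the product can be read as a
    right action, for which the unit of the target is neutral.\<close>
  also have "\<dots> = rcomp (bm_ract N) a (cid D (cf_arr \<Psi>) \<cdot>\<^sub>1 co_unit (cf_cod \<Psi>))"
    by (rule lcomp_eq_rcomp[where x = "co_ob X"]) simp_all
  also have "\<dots> = a"
    using ract_unit[of N] by (intro rcomp_unit[where n = "bm_pro N"]) (auto intro!: GlobI)
  finally show "co_unit X \<cdot>\<^sub>1 lcomp (bm_ract N) a (cf_cell \<Psi>) = a" .
qed

end

section \<open>Tensor products of equivariant cells\<close>

context mod_setup
begin

lemma tensor_cell_simps [simp]:
  "bc_dom (tensor_cell E q A B) = tensor E q (bc_dom A) (bc_dom B)"
  "bc_cod (tensor_cell E q A B) = tensor E q (bc_cod A) (bc_cod B)"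
  "bc_src (tensor_cell E q A B) = bc_src A"
  "bc_tgt (tensor_cell E q A B) = bc_tgt B"
  by (simp_all add: tensor_cell_def)

lemma bicell_match:
  assumes "is_bicell E A" "is_bicell E B" "bc_tgt A = bc_src B"
  shows "bm_tgt (bc_dom A) = bm_src (bc_dom B)" "bm_tgt (bc_cod A) = bm_src (bc_cod B)"
  using cf_dom_bc_tgt[OF assms(1)] cf_cod_bc_tgt[OF assms(1)]
    cf_dom_bc_src[OF assms(2)] cf_cod_bc_src[OF assms(2)] assms(3) by simp_all

text \<open>The functors at the boundary have arbitrary underlying arrows, so the cell to be
  factored is in general not globular: this is where the universal property of \<open>q\<close>
  against all cells enters.\<close>

lemma
  assumes AB: "is_bicell E A" "is_bicell E B" "bc_tgt A = bc_src B"
  shows q_tensor_cell: "q (bc_dom A) (bc_dom B) \<cdot>\<^sub>1 bc_cell (tensor_cell E q A B)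
      = (bc_cell A \<odot> bc_cell B) \<cdot>\<^sub>1 q (bc_cod A) (bc_cod B)"
    and is_bicell_tensor [simp]: "is_bicell E (tensor_cell E q A B)"
proof -
  note [simp] = AB bicell_match[OF AB]
  let ?M = "bc_dom A" and ?N = "bc_dom B" and ?M' = "bc_cod A" and ?N' = "bc_cod B"
  let ?\<alpha> = "bc_cell A" and ?\<beta> = "bc_cell B" and ?\<phi> = "cf_cell (bc_src A)" and ?\<psi> = "cf_cell (bc_src B)"
    and ?\<chi> = "cf_cell (bc_tgt B)"
  let ?m = "bm_pro ?M" and ?n = "bm_pro ?N" and ?r = "co_pro (bm_src ?M)" and ?s = "co_pro (bm_src ?N)"
    and ?t = "co_pro (bm_tgt ?N)"
  let ?k = "tensor_pro E q ?M ?N" and ?k' = "tensor_pro E q ?M' ?N'"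
  let ?h = "(?\<alpha> \<odot> ?\<beta>) \<cdot>\<^sub>1 q ?M' ?N'"
  \<comment> \<open>Right equivariance of \<open>A\<close> and left equivariance of \<open>B\<close>
    move the middle action past the cells, where \<open>q_square\<close> for the codomains
    identifies its two occurrences.\<close>
  have "(bm_ract ?M \<odot> \<one>\<^sub>1 ?n) \<cdot>\<^sub>1 ?h = (((?\<alpha> \<odot> ?\<psi>) \<cdot>\<^sub>1 bm_ract ?M') \<odot> ?\<beta>) \<cdot>\<^sub>1 q ?M' ?N'"
    using bc_right[of A] by (simp add: hcomp_vcomp')
  also have "\<dots> = assoc E ?m ?s ?n \<cdot>\<^sub>1 ((?\<alpha> \<odot> ((?\<psi> \<odot> ?\<beta>) \<cdot>\<^sub>1 bm_lact ?N')) \<cdot>\<^sub>1 q ?M' ?N')"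
    using assoc_square_gen[OF q_square[of ?M' ?N'], of ?\<alpha> ?\<psi> ?\<beta>] by simp
  also have "\<dots> = (assoc E ?m ?s ?n \<cdot>\<^sub>1 (\<one>\<^sub>1 ?m \<odot> bm_lact ?N)) \<cdot>\<^sub>1 ?h"
    using bc_left[of B] by (simp add: hcomp_vcomp')
  finally obtain u where u: "u \<in> Arr (cat1 E)" "Dom (cat1 E) u = ?k" "Cod (cat1 E) u = ?k'"
    "csrc E u = cf_arr (bc_src A)" "ctgt E u = cf_arr (bc_tgt B)" "q ?M ?N \<cdot>\<^sub>1 u = ?h"
    by (rule coequalizer_factor[OF q_coequalizer, rotated -2]) simp_all
  have "bc_cell (tensor_cell E q A B) = (THE \<gamma>. \<gamma> \<in> Cells E ?k ?k' (cf_arr (bc_src A)) (cf_arr (bc_tgt B))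
       \<and> q ?M ?N \<cdot>\<^sub>1 \<gamma> = ?h)"
    by (simp add: tensor_cell_def)
  also have "\<dots> = u"
  proof (rule the_equality)
    show "u \<in> Cells E ?k ?k' (cf_arr (bc_src A)) (cf_arr (bc_tgt B)) \<and> q ?M ?N \<cdot>\<^sub>1 u = ?h"
      using u by (auto intro!: CellsI)
    fix v assume v: "v \<in> Cells E ?k ?k' (cf_arr (bc_src A)) (cf_arr (bc_tgt B)) \<and> q ?M ?N \<cdot>\<^sub>1 v = ?h"
    have "q ?M ?N \<cdot>\<^sub>1 v = q ?M ?N \<cdot>\<^sub>1 u"
      using u v by simp
    then show "v = u"
      by (rule epi_arrowD[OF epi_q[of ?M ?N], rotated 3])
        (use u(1,2) Cells_D(1,2)[OF conjunct1[OF v]] in simp_all)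
  qed
  finally have eq [simp]: "bc_cell (tensor_cell E q A B) = u" .
  show *: "q ?M ?N \<cdot>\<^sub>1 bc_cell (tensor_cell E q A B) = ?h"
    using u by simp
  note [simp] = u(1-5) assoc_squareD(23-26)[OF tensor_lact_square[of ?M ?N], simplified]
    assoc_squareD(23-26)[OF tensor_lact_square[of ?M' ?N'], simplified]
    assoc_squareD(18,19,21,22)[OF tensor_ract_square[of ?M ?N], simplified]
    assoc_squareD(18,19,21,22)[OF tensor_ract_square[of ?M' ?N'], simplified]
    cod_tensor_lact cod_tensor_ract
  let ?l = "bm_lact (tensor E q ?M ?N)" and ?l' = "bm_lact (tensor E q ?M' ?N')"
    and ?\<rho> = "bm_ract (tensor E q ?M ?N)" and ?\<rho>' = "bm_ract (tensor E q ?M' ?N')"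
  \<comment> \<open>Equivariance is tested after the epic whiskering of \<open>q ?M ?N\<close>,
    where both induced actions are known from their defining squares.\<close>
  have left: "(?\<phi> \<odot> u) \<cdot>\<^sub>1 ?l' = ?l \<cdot>\<^sub>1 u"
  proof -
    have "assoc E ?r ?m ?n \<cdot>\<^sub>1 ((\<one>\<^sub>1 ?r \<odot> q ?M ?N) \<cdot>\<^sub>1 ((?\<phi> \<odot> u) \<cdot>\<^sub>1 ?l'))
        = assoc E ?r ?m ?n \<cdot>\<^sub>1 ((?\<phi> \<odot> ?h) \<cdot>\<^sub>1 ?l')"
      using u(6) by (simp add: hcomp_vcomp')
    also have "\<dots> = (((?\<phi> \<odot> ?\<alpha>) \<cdot>\<^sub>1 bm_lact ?M') \<odot> ?\<beta>) \<cdot>\<^sub>1 q ?M' ?N'"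
      using assoc_square_gen[OF tensor_lact_square[of ?M' ?N'], of ?\<phi> ?\<alpha> ?\<beta>] by simp
    also have "\<dots> = (bm_lact ?M \<odot> \<one>\<^sub>1 ?n) \<cdot>\<^sub>1 (q ?M ?N \<cdot>\<^sub>1 u)"
      using bc_left[of A] u(6) by (simp add: hcomp_vcomp')
    also have "\<dots> = ((bm_lact ?M \<odot> \<one>\<^sub>1 ?n) \<cdot>\<^sub>1 q ?M ?N) \<cdot>\<^sub>1 u"
      by simp
    also have "\<dots> = assoc E ?r ?m ?n \<cdot>\<^sub>1 ((\<one>\<^sub>1 ?r \<odot> q ?M ?N) \<cdot>\<^sub>1 (?l \<cdot>\<^sub>1 u))"
      unfolding assoc_square_eq[OF tensor_lact_square[of ?M ?N, simplified], simplified] by simp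
    finally have "(\<one>\<^sub>1 ?r \<odot> q ?M ?N) \<cdot>\<^sub>1 ((?\<phi> \<odot> u) \<cdot>\<^sub>1 ?l') = (\<one>\<^sub>1 ?r \<odot> q ?M ?N) \<cdot>\<^sub>1 (?l \<cdot>\<^sub>1 u)"
      by (rule source.A.iso_cancel[rotated -1]) simp_all
    then show ?thesis
      by (rule epi_arrowD[OF epi_vid_q[of ?M ?N ?r], rotated 5]) simp_all
  qed
  have right: "(u \<odot> ?\<chi>) \<cdot>\<^sub>1 ?\<rho>' = ?\<rho> \<cdot>\<^sub>1 u"
  proof -
    have "(q ?M ?N \<odot> \<one>\<^sub>1 ?t) \<cdot>\<^sub>1 ((u \<odot> ?\<chi>) \<cdot>\<^sub>1 ?\<rho>') = (?h \<odot> ?\<chi>) \<cdot>\<^sub>1 ?\<rho>'"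
      using u(6) by (simp add: hcomp_vcomp')
    also have "\<dots> = assoc E ?m ?n ?t \<cdot>\<^sub>1 ((?\<alpha> \<odot> ((?\<beta> \<odot> ?\<chi>) \<cdot>\<^sub>1 bm_ract ?N')) \<cdot>\<^sub>1 q ?M' ?N')"
      using assoc_square_gen[OF tensor_ract_square[of ?M' ?N'], of ?\<alpha> ?\<beta> ?\<chi>] by simp
    also have "\<dots> = (assoc E ?m ?n ?t \<cdot>\<^sub>1 ((\<one>\<^sub>1 ?m \<odot> bm_ract ?N) \<cdot>\<^sub>1 q ?M ?N)) \<cdot>\<^sub>1 u"
      using bc_right[of B] u(6) by (simp add: hcomp_vcomp')
    also have "\<dots> = (q ?M ?N \<odot> \<one>\<^sub>1 ?t) \<cdot>\<^sub>1 (?\<rho> \<cdot>\<^sub>1 u)"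
      unfolding assoc_square_eq[OF tensor_ract_square[of ?M ?N, simplified], simplified, symmetric] by simp
    finally show ?thesis
      by (rule epi_arrowD[OF epi_q_vid[of ?M ?N ?t], rotated 5]) simp_all
  qed
  show "is_bicell E (tensor_cell E q A B)"
    by (rule is_bicellI) (simp_all add: left right)
qed

end


section \<open>Associator, unit isomorphisms and underlying categories of Mod(E)\<close>

context mod_setup
begin

text \<open>Two successive factorizations: \<open>?h\<close> passes through the whiskered
  \<open>q M N\<close> because the left action on the tensor of \<open>N\<close> and
  \<open>P\<close> is induced from \<open>N\<close>, and the intermediate cell passes through the
  second coequalizer because it is balanced at the middle category object of \<open>N\<close> and
  \<open>P\<close>.\<close>

lemma tensor_assoc_cell:
  assumes [simp]: "is_bimod E M" "is_bimod E N" "is_bimod E P" "bm_tgt M = bm_src N" "bm_tgt N = bm_src P"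
  shows "bc_cell (tensor_assoc E q M N P)
      \<in> Glob E (tensor_pro E q (tensor E q M N) P) (tensor_pro E q M (tensor E q N P))"
    and "(q M N \<odot> \<one>\<^sub>1 (bm_pro P)) \<cdot>\<^sub>1 (q (tensor E q M N) P \<cdot>\<^sub>1 bc_cell (tensor_assoc E q M N P))
      = assoc E (bm_pro M) (bm_pro N) (bm_pro P)
        \<cdot>\<^sub>1 ((\<one>\<^sub>1 (bm_pro M) \<odot> q N P) \<cdot>\<^sub>1 q M (tensor E q N P))"
proof -
  let ?m = "bm_pro M" and ?n = "bm_pro N" and ?p = "bm_pro P"
    and ?s = "co_pro (bm_src N)" and ?t = "co_pro (bm_src P)"
    and ?MN = "tensor E q M N" and ?NP = "tensor E q N P"
  let ?q1 = "q M N" and ?q2 = "q N P" and ?q3 = "q M ?NP" and ?q4 = "q ?MN P"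
  let ?k = "tensor_pro E q M N" and ?z = "tensor_pro E q M ?NP" and ?y = "tensor_pro E q ?MN P"
  have sqm: "assoc_square (bm_ract M, ?q3) (bm_lact ?NP, ?q3) ?m ?s (tensor_pro E q N P)"
    using q_square[of M ?NP] by simp
  have lNP: "assoc_square (bm_lact N, ?q2) (?q2, bm_lact ?NP) ?s ?n ?p"
    using tensor_lact_square[of N P] by simp
  have rMN: "assoc_square (?q1, bm_ract ?MN) (bm_ract N, ?q1) ?m ?n ?t"
    using tensor_ract_square[of M N] by simp
  let ?h = "assoc E ?m ?n ?p \<cdot>\<^sub>1 ((\<one>\<^sub>1 ?m \<odot> ?q2) \<cdot>\<^sub>1 ?q3)"
  have sqh: "assoc_square (\<one>\<^sub>1 (?m \<odot>\<^sub>p ?n), ?h) (?q2, ?q3) ?m ?n ?p"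
    by (rule assoc_squareI') (simp_all add: hcomp_vid)
  have "(((bm_ract M \<odot> \<one>\<^sub>1 ?n) \<cdot>\<^sub>1 \<one>\<^sub>1 (?m \<odot>\<^sub>p ?n)) \<odot> \<one>\<^sub>1 ?p) \<cdot>\<^sub>1 ?h
      = ((assoc E ?m ?s ?n \<cdot>\<^sub>1 ((\<one>\<^sub>1 ?m \<odot> bm_lact N) \<cdot>\<^sub>1 \<one>\<^sub>1 (?m \<odot>\<^sub>p ?n))) \<odot> \<one>\<^sub>1 ?p) \<cdot>\<^sub>1 ?h"
    by (rule pentagon_sq1[where cd = ?q2 and bcd_l = ?q2 and bcd_r = "bm_lact ?NP"
          and Lb = ?q3 and Lc = ?q3])
      (use sqm lNP sqh in simp_all)
  then have "((bm_ract M \<odot> \<one>\<^sub>1 ?n) \<odot> \<one>\<^sub>1 ?p) \<cdot>\<^sub>1 ?h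
      = ((assoc E ?m ?s ?n \<cdot>\<^sub>1 (\<one>\<^sub>1 ?m \<odot> bm_lact N)) \<odot> \<one>\<^sub>1 ?p) \<cdot>\<^sub>1 ?h"
    by simp
  then obtain u where u: "u \<in> Arr (cat1 E)" "Dom (cat1 E) u = ?k \<odot>\<^sub>p ?p" "Cod (cat1 E) u = ?z"
    "csrc E u = \<one>\<^sub>0 (co_ob (bm_src M))" "ctgt E u = \<one>\<^sub>0 (co_ob (bm_tgt P))" "(?q1 \<odot> \<one>\<^sub>1 ?p) \<cdot>\<^sub>1 u = ?h"
    by (rule coequalizer_factor[OF q_vid_coequalizer[of M N ?p], rotated -2]) simp_all
  note [simp] = u(1-5)
  have squ: "assoc_square (?q1, u) (?q2, ?q3) ?m ?n ?p"
    by (rule assoc_squareI') (use u(6) in simp_all)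
  \<comment> \<open>Balance of the intermediate cell \<open>u\<close> is known after precomposition
    with \<open>?q1\<close>; \<open>pentagon_sq4\<close> cancels that coequalizer cell.\<close>
  have "assoc_square (bm_ract ?MN, u) (bm_lact P, u) ?k ?t ?p"
    using pentagon_sq4[where ab = ?q1 and bc = "bm_ract N" and cd = "bm_lact P"
        and abc_l = "bm_ract ?MN" and abc_r = ?q1 and bcd_l = ?q2 and bcd_r = ?q2
        and La = u and Lb = ?q3 and Lc = u and m = ?m and n = ?n and p = ?t and t = ?p]
      rMN q_square[of N P] squ epi_q_vid_vid[of M N ?t ?p] by simp
  then have "(bm_ract ?MN \<odot> \<one>\<^sub>1 ?p) \<cdot>\<^sub>1 u
      = (assoc E (bm_pro ?MN) ?t ?p \<cdot>\<^sub>1 (\<one>\<^sub>1 (bm_pro ?MN) \<odot> bm_lact P)) \<cdot>\<^sub>1 u"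
    using assoc_square_eq[of "bm_ract ?MN" u "bm_lact P" u ?k ?t ?p] by simp
  then obtain v where v: "v \<in> Arr (cat1 E)" "Dom (cat1 E) v = ?y" "Cod (cat1 E) v = ?z"
    "csrc E v = \<one>\<^sub>0 (co_ob (bm_src M))" "ctgt E v = \<one>\<^sub>0 (co_ob (bm_tgt P))" "?q4 \<cdot>\<^sub>1 v = u"
    by (rule coequalizer_factor[OF q_coequalizer[of ?MN P], rotated -2]) simp_all
  let ?P = "\<lambda>\<gamma>. \<gamma> \<in> Glob E ?y ?z \<and> (?q1 \<odot> \<one>\<^sub>1 ?p) \<cdot>\<^sub>1 ?q4 \<cdot>\<^sub>1 \<gamma>
         = assoc E ?m ?n ?p \<cdot>\<^sub>1 (\<one>\<^sub>1 ?m \<odot> ?q2) \<cdot>\<^sub>1 ?q3"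
  have "?P v"
    using v u(6) by (auto intro!: GlobI)
  moreover have "w = v" if w: "?P w" for w
  proof -
    note [simp] = Glob_D(1-5)[OF conjunct1[OF w]] v(1-5)
    have "(?q1 \<odot> \<one>\<^sub>1 ?p) \<cdot>\<^sub>1 (?q4 \<cdot>\<^sub>1 w) = (?q1 \<odot> \<one>\<^sub>1 ?p) \<cdot>\<^sub>1 (?q4 \<cdot>\<^sub>1 v)"
      using w v(6) u(6) by simp
    then have "?q4 \<cdot>\<^sub>1 w = ?q4 \<cdot>\<^sub>1 v"
      by (rule epi_arrowD[OF epi_q_vid[of M N ?p], rotated 5]) simp_all
    then show ?thesis
      by (rule epi_arrowD[OF epi_q[of ?MN P], rotated 3]) simp_all
  qed
  ultimately have ex1: "\<exists>!\<gamma>. ?P \<gamma>"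
    by blast
  have *: "bc_cell (tensor_assoc E q M N P) = (THE \<gamma>. ?P \<gamma>)"
    unfolding tensor_assoc_def by simp
  have "?P (bc_cell (tensor_assoc E q M N P))"
    unfolding * by (rule theI'[OF ex1])
  then show "bc_cell (tensor_assoc E q M N P) \<in> Glob E ?y ?z"
    and "(?q1 \<odot> \<one>\<^sub>1 ?p) \<cdot>\<^sub>1 (?q4 \<cdot>\<^sub>1 bc_cell (tensor_assoc E q M N P)) = ?h"
    using Glob_D(1-5)[of "bc_cell (tensor_assoc E q M N P)" ?y ?z] by simp_all
qed

lemma tensor_assoc_simps [simp]:
  "bc_dom (tensor_assoc E q M N P) = tensor E q (tensor E q M N) P"
  "bc_cod (tensor_assoc E q M N P) = tensor E q M (tensor E q N P)"
  "bc_src (tensor_assoc E q M N P) = cofun_id E (bm_src (tensor E q (tensor E q M N) P))"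
  "bc_tgt (tensor_assoc E q M N P) = cofun_id E (bm_tgt (tensor E q (tensor E q M N) P))"
  by (simp_all add: tensor_assoc_def)

lemma Mod_simps [simp]:
  "Obj (cat0 (Mod E q)) = {X. is_catobj E X}" "Arr (cat0 (Mod E q)) = {\<Phi>. is_cofun E \<Phi>}"
  "Dom (cat0 (Mod E q)) = cf_dom" "Cod (cat0 (Mod E q)) = cf_cod"
  "Id (cat0 (Mod E q)) = cofun_id E" "Comp (cat0 (Mod E q)) = cofun_comp E"
  "Obj (cat1 (Mod E q)) = {M. is_bimod E M}" "Arr (cat1 (Mod E q)) = {A. is_bicell E A}"
  "Dom (cat1 (Mod E q)) = bc_dom" "Cod (cat1 (Mod E q)) = bc_cod"
  "Id (cat1 (Mod E q)) = bicell_id E" "Comp (cat1 (Mod E q)) = bicell_comp E"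
  "psrc (Mod E q) = bm_src" "ptgt (Mod E q) = bm_tgt" "csrc (Mod E q) = bc_src" "ctgt (Mod E q) = bc_tgt"
  "pid (Mod E q) = unit_bimod" "cid (Mod E q) = unit_bicell"
  "pcomp (Mod E q) = tensor E q" "hcomp (Mod E q) = tensor_cell E q"
  "dbl.assoc (Mod E q) = tensor_assoc E q" "lunit (Mod E q) = tensor_lunit E q"
  "runit (Mod E q) = tensor_runit E q"
  by (simp_all add: Mod_def)

lemma bicell_id_simps [simp]:
  "bc_dom (bicell_id E M) = M" "bc_cod (bicell_id E M) = M"
  "bc_src (bicell_id E M) = cofun_id E (bm_src M)" "bc_tgt (bicell_id E M) = cofun_id E (bm_tgt M)"
  "bc_cell (bicell_id E M) = \<one>\<^sub>1 (bm_pro M)"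
  by (simp_all add: bicell_id_def)

lemma cofun_comp_id_left [simp]: "\<lbrakk>is_cofun E \<Phi>; cf_dom \<Phi> = X\<rbrakk> \<Longrightarrow> cofun_comp E (cofun_id E X) \<Phi> = \<Phi>"
  and cofun_comp_id_right [simp]: "\<lbrakk>is_cofun E \<Phi>; cf_cod \<Phi> = X\<rbrakk> \<Longrightarrow> cofun_comp E \<Phi> (cofun_id E X) = \<Phi>"
  by (auto intro!: cofun.equality)

lemma bicell_eqI:
  "\<lbrakk>bc_dom A = bc_dom B; bc_cod A = bc_cod B; bc_src A = bc_src B; bc_tgt A = bc_tgt B; bc_cell A = bc_cell B\<rbrakk>
    \<Longrightarrow> (A :: ('o, 'a, 'p, 'c) bicell) = B"
  by (rule bicell.equality) simp_all

lemma bicell_comp_id_left [simp]: "\<lbrakk>is_bicell E A; bc_dom A = M\<rbrakk> \<Longrightarrow> bicell_comp E (bicell_id E M) A = A"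
  and bicell_comp_id_right [simp]: "\<lbrakk>is_bicell E A; bc_cod A = M\<rbrakk> \<Longrightarrow> bicell_comp E A (bicell_id E M) = A"
  by (auto intro!: bicell_eqI)

lemma category_cat0_Mod: "category (cat0 (Mod E q))"
  by unfold_locales (auto simp: Hom_def intro!: cofun.equality)

lemma category_cat1_Mod: "category (cat1 (Mod E q))"
  by unfold_locales (auto simp: Hom_def intro!: bicell_eqI cofun.equality)

text \<open>The inverse inserts the unit of the source category object and then passes to the tensor
  product. An explicit formula is wanted because this inverse occurs in the axioms of
  transformations into Mod(E).\<close>

lemma
  assumes [simp]: "is_bimod E M"
  shows q_tensor_lunit: "q (unit_bimod (bm_src M)) M \<cdot>\<^sub>1 bc_cell (tensor_lunit E q M) = bm_lact M"
    and inverse_tensor_lunit: "inverse_arrows (cat1 (Mod E q)) (tensor_lunit E q M)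
      (glob_bicell E M (tensor E q (unit_bimod (bm_src M)) M)
        (inv\<^sub>1 (lunit E (bm_pro M)) \<cdot>\<^sub>1 ((co_unit (bm_src M) \<odot> \<one>\<^sub>1 (bm_pro M)) \<cdot>\<^sub>1 q (unit_bimod (bm_src M)) M)))"
proof -
  let ?X = "bm_src M"
  let ?U = "unit_bimod ?X" and ?m = "bm_pro M" and ?r = "co_pro ?X" and ?s = "co_pro (bm_tgt M)"
  let ?T = "tensor E q ?U M" and ?k = "tensor_pro E q ?U M" and ?q = "q ?U M"
  let ?d = "inv\<^sub>1 (lunit E ?m) \<cdot>\<^sub>1 ((co_unit ?X \<odot> \<one>\<^sub>1 ?m) \<cdot>\<^sub>1 ?q)"
  have "(bm_ract ?U \<odot> \<one>\<^sub>1 ?m) \<cdot>\<^sub>1 bm_lact M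
      = (assoc E (bm_pro ?U) ?r ?m \<cdot>\<^sub>1 (\<one>\<^sub>1 (bm_pro ?U) \<odot> bm_lact M)) \<cdot>\<^sub>1 bm_lact M"
    using assoc_square_eq[OF lact_square[of M]] by simp
  then obtain u where u: "u \<in> Arr (cat1 E)" "Dom (cat1 E) u = ?k" "Cod (cat1 E) u = ?m"
    "csrc E u = \<one>\<^sub>0 (co_ob ?X)" "ctgt E u = \<one>\<^sub>0 (co_ob (bm_tgt M))" "?q \<cdot>\<^sub>1 u = bm_lact M"
    by (rule coequalizer_factor[OF q_coequalizer[of ?U M], rotated -2]) simp_all
  note [simp] = u(1-5)
  have "(THE \<gamma>. \<gamma> \<in> Glob E ?k ?m \<and> ?q \<cdot>\<^sub>1 \<gamma> = bm_lact M) = u"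
  proof (rule the_equality)
    show "u \<in> Glob E ?k ?m \<and> ?q \<cdot>\<^sub>1 u = bm_lact M"
      using u(6) by (auto intro!: GlobI)
    fix v assume v: "v \<in> Glob E ?k ?m \<and> ?q \<cdot>\<^sub>1 v = bm_lact M"
    have "?q \<cdot>\<^sub>1 v = ?q \<cdot>\<^sub>1 u" using u(6) v by simp
    then show "v = u"
      by (rule epi_arrowD[OF epi_q[of ?U M], rotated 3])
        (use Glob_D(1-3)[OF conjunct1[OF v]] in simp_all)
  qed
  then have L: "tensor_lunit E q M = glob_bicell E ?T M u"
    by (simp add: tensor_lunit_def Let_def)
  show "?q \<cdot>\<^sub>1 bc_cell (tensor_lunit E q M) = bm_lact M"
    using u(6) by (simp add: L)
  note [simp] = assoc_squareD(23-26)[OF tensor_lact_square[of ?U M], simplified]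
    assoc_squareD(18,19,21,22)[OF tensor_ract_square[of ?U M], simplified]
    cod_tensor_lact[of ?U M] cod_tensor_ract[of ?U M]
  have du: "?d \<cdot>\<^sub>1 u = \<one>\<^sub>1 ?m"
    using u(6) lact_unit[of M] by simp
  have ud: "u \<cdot>\<^sub>1 ?d = \<one>\<^sub>1 ?k"
  proof (rule epi_arrowD[OF epi_q[of ?U M]])
    have "bm_lact M \<cdot>\<^sub>1 inv\<^sub>1 (lunit E ?m)
        = inv\<^sub>1 (lunit E (?r \<odot>\<^sub>p ?m)) \<cdot>\<^sub>1 ((lunit E (?r \<odot>\<^sub>p ?m) \<cdot>\<^sub>1 bm_lact M) \<cdot>\<^sub>1 inv\<^sub>1 (lunit E ?m))"
      by simp
    also have "lunit E (?r \<odot>\<^sub>p ?m) \<cdot>\<^sub>1 bm_lact M = (\<one>\<^sub>1 (pid E (co_ob ?X)) \<odot> bm_lact M) \<cdot>\<^sub>1 lunit E ?m"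
      using lunit_nat[of "bm_lact M" "\<one>\<^sub>0 (co_ob ?X)" ?m] by simp
    finally have nat: "bm_lact M \<cdot>\<^sub>1 inv\<^sub>1 (lunit E ?m)
        = inv\<^sub>1 (lunit E (?r \<odot>\<^sub>p ?m)) \<cdot>\<^sub>1 (\<one>\<^sub>1 (pid E (co_ob ?X)) \<odot> bm_lact M)"
      by simp
    \<comment> \<open>In the tensor product the action on \<open>M\<close> may be traded for
      multiplication in the unit bimodule, where the inserted unit cancels.\<close>
    have A: "assoc E (pid E (co_ob ?X)) ?r ?m \<cdot>\<^sub>1 ((co_unit ?X \<odot> bm_lact M) \<cdot>\<^sub>1 ?q)
        = assoc E (pid E (co_ob ?X)) ?r ?m \<cdot>\<^sub>1 (lunit E (?r \<odot>\<^sub>p ?m) \<cdot>\<^sub>1 ?q)"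
    proof -
      have "assoc E (pid E (co_ob ?X)) ?r ?m \<cdot>\<^sub>1 ((co_unit ?X \<odot> bm_lact M) \<cdot>\<^sub>1 ?q)
          = (((co_unit ?X \<odot> \<one>\<^sub>1 ?r) \<cdot>\<^sub>1 co_mult ?X) \<odot> \<one>\<^sub>1 ?m) \<cdot>\<^sub>1 ?q"
        using assoc_square_gen[OF q_square[of ?U M], of "co_unit ?X" "\<one>\<^sub>1 ?r" "\<one>\<^sub>1 ?m"]
        by (simp add: hcomp_vid)
      also have "\<dots> = (lunit E ?r \<odot> \<one>\<^sub>1 ?m) \<cdot>\<^sub>1 ?q"
        by (simp add: co_unit_left)
      also have "\<dots> = (assoc E (pid E (co_ob ?X)) ?r ?m \<cdot>\<^sub>1 lunit E (?r \<odot>\<^sub>p ?m)) \<cdot>\<^sub>1 ?q"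
        by (subst assoc_lunit) simp_all
      finally show ?thesis by simp
    qed
    have "(co_unit ?X \<odot> bm_lact M) \<cdot>\<^sub>1 ?q = lunit E (?r \<odot>\<^sub>p ?m) \<cdot>\<^sub>1 ?q"
      by (rule source.A.iso_cancel[OF _ _ _ _ _ A]) simp_all
    moreover have "?q \<cdot>\<^sub>1 (u \<cdot>\<^sub>1 ?d) = (bm_lact M \<cdot>\<^sub>1 inv\<^sub>1 (lunit E ?m)) \<cdot>\<^sub>1 ((co_unit ?X \<odot> \<one>\<^sub>1 ?m) \<cdot>\<^sub>1 ?q)"
      unfolding u(6)[symmetric] by simp
    ultimately show "?q \<cdot>\<^sub>1 (u \<cdot>\<^sub>1 ?d) = ?q \<cdot>\<^sub>1 \<one>\<^sub>1 ?k"
      unfolding nat by (simp add: hcomp_vcomp')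
  qed simp_all
  let ?l = "bm_lact ?T" and ?\<rho> = "bm_ract ?T"
  have left: "(\<one>\<^sub>1 ?r \<odot> u) \<cdot>\<^sub>1 bm_lact M = ?l \<cdot>\<^sub>1 u"
  proof -
    have "assoc E ?r ?r ?m \<cdot>\<^sub>1 ((\<one>\<^sub>1 ?r \<odot> ?q) \<cdot>\<^sub>1 ((\<one>\<^sub>1 ?r \<odot> u) \<cdot>\<^sub>1 bm_lact M))
        = (co_mult ?X \<odot> \<one>\<^sub>1 ?m) \<cdot>\<^sub>1 bm_lact M"
      using u(6) assoc_square_eq[OF lact_square[of M]] by (simp add: hcomp_vcomp')
    also have "\<dots> = ((co_mult ?X \<odot> \<one>\<^sub>1 ?m) \<cdot>\<^sub>1 ?q) \<cdot>\<^sub>1 u"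
      using u(6) by simp
    also have "\<dots> = assoc E ?r ?r ?m \<cdot>\<^sub>1 ((\<one>\<^sub>1 ?r \<odot> ?q) \<cdot>\<^sub>1 (?l \<cdot>\<^sub>1 u))"
      unfolding assoc_square_eq[OF tensor_lact_square[of ?U M, simplified], simplified] by simp
    finally have "(\<one>\<^sub>1 ?r \<odot> ?q) \<cdot>\<^sub>1 ((\<one>\<^sub>1 ?r \<odot> u) \<cdot>\<^sub>1 bm_lact M) = (\<one>\<^sub>1 ?r \<odot> ?q) \<cdot>\<^sub>1 (?l \<cdot>\<^sub>1 u)"
      by (rule source.A.iso_cancel[rotated -1]) simp_all
    then show ?thesis
      by (rule epi_arrowD[OF epi_vid_q[of ?U M ?r], rotated 5]) simp_all
  qed
  have right: "(u \<odot> \<one>\<^sub>1 ?s) \<cdot>\<^sub>1 bm_ract M = ?\<rho> \<cdot>\<^sub>1 u"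
  proof -
    have "(?q \<odot> \<one>\<^sub>1 ?s) \<cdot>\<^sub>1 ((u \<odot> \<one>\<^sub>1 ?s) \<cdot>\<^sub>1 bm_ract M)
        = assoc E ?r ?m ?s \<cdot>\<^sub>1 ((\<one>\<^sub>1 ?r \<odot> bm_ract M) \<cdot>\<^sub>1 (?q \<cdot>\<^sub>1 u))"
      unfolding u(6) using u(6) assoc_square_eq[OF mid_square[of M]] by (simp add: hcomp_vcomp')
    also have "\<dots> = (assoc E ?r ?m ?s \<cdot>\<^sub>1 ((\<one>\<^sub>1 ?r \<odot> bm_ract M) \<cdot>\<^sub>1 ?q)) \<cdot>\<^sub>1 u"
      by simp
    also have "\<dots> = (?q \<odot> \<one>\<^sub>1 ?s) \<cdot>\<^sub>1 (?\<rho> \<cdot>\<^sub>1 u)"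
      unfolding assoc_square_eq[OF tensor_ract_square[of ?U M, simplified], simplified, symmetric] by simp
    finally show ?thesis
      by (rule epi_arrowD[OF epi_q_vid[of ?U M ?s], rotated 5]) simp_all
  qed
  have b1: "is_bicell E (glob_bicell E ?T M u)"
    by (rule is_bicell_globI) (simp_all add: left right)
  \<comment> \<open>The inverse of an equivariant cell is equivariant: insert \<open>u\<close>
    followed by \<open>?d\<close>, use equivariance of \<open>u\<close>, and cancel.\<close>
  have b2: "is_bicell E (glob_bicell E M ?T ?d)"
  proof (rule is_bicell_globI)
    have "(\<one>\<^sub>1 ?r \<odot> ?d) \<cdot>\<^sub>1 ?l = (\<one>\<^sub>1 ?r \<odot> ?d) \<cdot>\<^sub>1 (?l \<cdot>\<^sub>1 (u \<cdot>\<^sub>1 ?d))"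
      unfolding ud by simp
    also have "\<dots> = (\<one>\<^sub>1 ?r \<odot> ?d) \<cdot>\<^sub>1 (((\<one>\<^sub>1 ?r \<odot> u) \<cdot>\<^sub>1 bm_lact M) \<cdot>\<^sub>1 ?d)"
      unfolding left by simp
    also have "\<dots> = (\<one>\<^sub>1 ?r \<odot> (?d \<cdot>\<^sub>1 u)) \<cdot>\<^sub>1 (bm_lact M \<cdot>\<^sub>1 ?d)"
      by (simp add: hcomp_vcomp')
    also have "\<dots> = bm_lact M \<cdot>\<^sub>1 ?d"
      unfolding du by (simp add: hcomp_vid)
    finally show "(\<one>\<^sub>1 ?r \<odot> ?d) \<cdot>\<^sub>1 ?l = bm_lact M \<cdot>\<^sub>1 ?d" .
    have "(?d \<odot> \<one>\<^sub>1 ?s) \<cdot>\<^sub>1 ?\<rho> = (?d \<odot> \<one>\<^sub>1 ?s) \<cdot>\<^sub>1 (?\<rho> \<cdot>\<^sub>1 (u \<cdot>\<^sub>1 ?d))"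
      unfolding ud by simp
    also have "\<dots> = (?d \<odot> \<one>\<^sub>1 ?s) \<cdot>\<^sub>1 (((u \<odot> \<one>\<^sub>1 ?s) \<cdot>\<^sub>1 bm_ract M) \<cdot>\<^sub>1 ?d)"
      unfolding right by simp
    also have "\<dots> = ((?d \<cdot>\<^sub>1 u) \<odot> \<one>\<^sub>1 ?s) \<cdot>\<^sub>1 (bm_ract M \<cdot>\<^sub>1 ?d)"
      by (simp add: hcomp_vcomp')
    also have "\<dots> = bm_ract M \<cdot>\<^sub>1 ?d"
      unfolding du by (simp add: hcomp_vid)
    finally show "(?d \<odot> \<one>\<^sub>1 ?s) \<cdot>\<^sub>1 ?\<rho> = bm_ract M \<cdot>\<^sub>1 ?d" .
  qed simp_all
  show "inverse_arrows (cat1 (Mod E q)) (tensor_lunit E q M) (glob_bicell E M ?T ?d)"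
    unfolding L inverse_arrows_def Hom_def using b1 b2 ud du
    by (auto intro!: bicell_eqI cofun.equality)
qed

text \<open>The mirror image of the left unit: the unit of the target category object is inserted on
  the right, and \<open>assoc_runit\<close> does the work of \<open>assoc_lunit\<close>.\<close>

lemma
  assumes [simp]: "is_bimod E M"
  shows q_tensor_runit: "q M (unit_bimod (bm_tgt M)) \<cdot>\<^sub>1 bc_cell (tensor_runit E q M) = bm_ract M"
    and inverse_tensor_runit: "inverse_arrows (cat1 (Mod E q)) (tensor_runit E q M)
      (glob_bicell E M (tensor E q M (unit_bimod (bm_tgt M)))
        (inv\<^sub>1 (runit E (bm_pro M)) \<cdot>\<^sub>1 ((\<one>\<^sub>1 (bm_pro M) \<odot> co_unit (bm_tgt M)) \<cdot>\<^sub>1 q M (unit_bimod (bm_tgt M)))))"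
proof -
  let ?Y = "bm_tgt M"
  let ?U = "unit_bimod ?Y" and ?m = "bm_pro M" and ?r = "co_pro (bm_src M)" and ?s = "co_pro ?Y"
  let ?T = "tensor E q M ?U" and ?k = "tensor_pro E q M ?U" and ?q = "q M ?U"
  let ?d = "inv\<^sub>1 (runit E ?m) \<cdot>\<^sub>1 ((\<one>\<^sub>1 ?m \<odot> co_unit ?Y) \<cdot>\<^sub>1 ?q)"
  have "(bm_ract M \<odot> \<one>\<^sub>1 (bm_pro ?U)) \<cdot>\<^sub>1 bm_ract M
      = (assoc E ?m (co_pro (bm_src ?U)) (bm_pro ?U) \<cdot>\<^sub>1 (\<one>\<^sub>1 ?m \<odot> bm_lact ?U)) \<cdot>\<^sub>1 bm_ract M"
    using assoc_square_eq[OF ract_square[of M]] by simp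
  then obtain u where u: "u \<in> Arr (cat1 E)" "Dom (cat1 E) u = ?k" "Cod (cat1 E) u = ?m"
    "csrc E u = \<one>\<^sub>0 (co_ob (bm_src M))" "ctgt E u = \<one>\<^sub>0 (co_ob ?Y)" "?q \<cdot>\<^sub>1 u = bm_ract M"
    by (rule coequalizer_factor[OF q_coequalizer[of M ?U], rotated -2]) simp_all
  note [simp] = u(1-5)
  have "(THE \<gamma>. \<gamma> \<in> Glob E ?k ?m \<and> ?q \<cdot>\<^sub>1 \<gamma> = bm_ract M) = u"
  proof (rule the_equality)
    show "u \<in> Glob E ?k ?m \<and> ?q \<cdot>\<^sub>1 u = bm_ract M"
      using u(6) by (auto intro!: GlobI)
    fix v assume v: "v \<in> Glob E ?k ?m \<and> ?q \<cdot>\<^sub>1 v = bm_ract M"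
    have "?q \<cdot>\<^sub>1 v = ?q \<cdot>\<^sub>1 u" using u(6) v by simp
    then show "v = u"
      by (rule epi_arrowD[OF epi_q[of M ?U], rotated 3])
        (use Glob_D(1-3)[OF conjunct1[OF v]] in simp_all)
  qed
  then have R: "tensor_runit E q M = glob_bicell E ?T M u"
    by (simp add: tensor_runit_def Let_def)
  show "?q \<cdot>\<^sub>1 bc_cell (tensor_runit E q M) = bm_ract M"
    using u(6) by (simp add: R)
  note [simp] = assoc_squareD(23-26)[OF tensor_lact_square[of M ?U], simplified]
    assoc_squareD(18,19,21,22)[OF tensor_ract_square[of M ?U], simplified]
    cod_tensor_lact[of M ?U] cod_tensor_ract[of M ?U]
  have du: "?d \<cdot>\<^sub>1 u = \<one>\<^sub>1 ?m"
    using u(6) ract_unit[of M] by simp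
  have ud: "u \<cdot>\<^sub>1 ?d = \<one>\<^sub>1 ?k"
  proof (rule epi_arrowD[OF epi_q[of M ?U]])
    have "bm_ract M \<cdot>\<^sub>1 inv\<^sub>1 (runit E ?m)
        = inv\<^sub>1 (runit E (?m \<odot>\<^sub>p ?s)) \<cdot>\<^sub>1 ((runit E (?m \<odot>\<^sub>p ?s) \<cdot>\<^sub>1 bm_ract M) \<cdot>\<^sub>1 inv\<^sub>1 (runit E ?m))"
      by simp
    also have "runit E (?m \<odot>\<^sub>p ?s) \<cdot>\<^sub>1 bm_ract M = (bm_ract M \<odot> \<one>\<^sub>1 (pid E (co_ob ?Y))) \<cdot>\<^sub>1 runit E ?m"
      using runit_nat[of "bm_ract M" "\<one>\<^sub>0 (co_ob ?Y)" ?m] by simp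
    finally have nat: "bm_ract M \<cdot>\<^sub>1 inv\<^sub>1 (runit E ?m)
        = inv\<^sub>1 (runit E (?m \<odot>\<^sub>p ?s)) \<cdot>\<^sub>1 (bm_ract M \<odot> \<one>\<^sub>1 (pid E (co_ob ?Y)))"
      by simp
    have "(bm_ract M \<odot> co_unit ?Y) \<cdot>\<^sub>1 ?q
        = assoc E ?m ?s (pid E (co_ob ?Y)) \<cdot>\<^sub>1 ((\<one>\<^sub>1 ?m \<odot> ((\<one>\<^sub>1 ?s \<odot> co_unit ?Y) \<cdot>\<^sub>1 co_mult ?Y)) \<cdot>\<^sub>1 ?q)"
      using assoc_square_gen[OF q_square[of M ?U], of "\<one>\<^sub>1 ?m" "\<one>\<^sub>1 ?s" "co_unit ?Y"]
      by (simp add: hcomp_vid)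
    also have "\<dots> = (assoc E ?m ?s (pid E (co_ob ?Y)) \<cdot>\<^sub>1 (\<one>\<^sub>1 ?m \<odot> runit E ?s)) \<cdot>\<^sub>1 ?q"
      by (simp add: co_unit_right)
    also have "\<dots> = runit E (?m \<odot>\<^sub>p ?s) \<cdot>\<^sub>1 ?q"
      by (subst assoc_runit) simp_all
    finally have "(bm_ract M \<odot> co_unit ?Y) \<cdot>\<^sub>1 ?q = runit E (?m \<odot>\<^sub>p ?s) \<cdot>\<^sub>1 ?q" .
    moreover have "?q \<cdot>\<^sub>1 (u \<cdot>\<^sub>1 ?d) = (bm_ract M \<cdot>\<^sub>1 inv\<^sub>1 (runit E ?m)) \<cdot>\<^sub>1 ((\<one>\<^sub>1 ?m \<odot> co_unit ?Y) \<cdot>\<^sub>1 ?q)"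
      unfolding u(6)[symmetric] by simp
    ultimately show "?q \<cdot>\<^sub>1 (u \<cdot>\<^sub>1 ?d) = ?q \<cdot>\<^sub>1 \<one>\<^sub>1 ?k"
      unfolding nat by (simp add: hcomp_vcomp')
  qed simp_all
  let ?l = "bm_lact ?T" and ?\<rho> = "bm_ract ?T"
  have left: "(\<one>\<^sub>1 ?r \<odot> u) \<cdot>\<^sub>1 bm_lact M = ?l \<cdot>\<^sub>1 u"
  proof -
    have "assoc E ?r ?m ?s \<cdot>\<^sub>1 ((\<one>\<^sub>1 ?r \<odot> ?q) \<cdot>\<^sub>1 ((\<one>\<^sub>1 ?r \<odot> u) \<cdot>\<^sub>1 bm_lact M))
        = (bm_lact M \<odot> \<one>\<^sub>1 ?s) \<cdot>\<^sub>1 bm_ract M"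
      using u(6) assoc_square_eq[OF mid_square[of M]] by (simp add: hcomp_vcomp')
    also have "\<dots> = ((bm_lact M \<odot> \<one>\<^sub>1 ?s) \<cdot>\<^sub>1 ?q) \<cdot>\<^sub>1 u"
      using u(6) by simp
    also have "\<dots> = assoc E ?r ?m ?s \<cdot>\<^sub>1 ((\<one>\<^sub>1 ?r \<odot> ?q) \<cdot>\<^sub>1 (?l \<cdot>\<^sub>1 u))"
      unfolding assoc_square_eq[OF tensor_lact_square[of M ?U, simplified], simplified] by simp
    finally have "(\<one>\<^sub>1 ?r \<odot> ?q) \<cdot>\<^sub>1 ((\<one>\<^sub>1 ?r \<odot> u) \<cdot>\<^sub>1 bm_lact M) = (\<one>\<^sub>1 ?r \<odot> ?q) \<cdot>\<^sub>1 (?l \<cdot>\<^sub>1 u)"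
      by (rule source.A.iso_cancel[rotated -1]) simp_all
    then show ?thesis
      by (rule epi_arrowD[OF epi_vid_q[of M ?U ?r], rotated 5]) simp_all
  qed
  have right: "(u \<odot> \<one>\<^sub>1 ?s) \<cdot>\<^sub>1 bm_ract M = ?\<rho> \<cdot>\<^sub>1 u"
  proof -
    have "(?q \<odot> \<one>\<^sub>1 ?s) \<cdot>\<^sub>1 ((u \<odot> \<one>\<^sub>1 ?s) \<cdot>\<^sub>1 bm_ract M)
        = assoc E ?m ?s ?s \<cdot>\<^sub>1 ((\<one>\<^sub>1 ?m \<odot> co_mult ?Y) \<cdot>\<^sub>1 (?q \<cdot>\<^sub>1 u))"
      unfolding u(6) using u(6) assoc_square_eq[OF ract_square[of M]] by (simp add: hcomp_vcomp')
    also have "\<dots> = (assoc E ?m ?s ?s \<cdot>\<^sub>1 ((\<one>\<^sub>1 ?m \<odot> co_mult ?Y) \<cdot>\<^sub>1 ?q)) \<cdot>\<^sub>1 u"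
      by simp
    also have "\<dots> = (?q \<odot> \<one>\<^sub>1 ?s) \<cdot>\<^sub>1 (?\<rho> \<cdot>\<^sub>1 u)"
      unfolding assoc_square_eq[OF tensor_ract_square[of M ?U, simplified], simplified, symmetric] by simp
    finally show ?thesis
      by (rule epi_arrowD[OF epi_q_vid[of M ?U ?s], rotated 5]) simp_all
  qed
  have b1: "is_bicell E (glob_bicell E ?T M u)"
    by (rule is_bicell_globI) (simp_all add: left right)
  have b2: "is_bicell E (glob_bicell E M ?T ?d)"
  proof (rule is_bicell_globI)
    have "(\<one>\<^sub>1 ?r \<odot> ?d) \<cdot>\<^sub>1 ?l = (\<one>\<^sub>1 ?r \<odot> ?d) \<cdot>\<^sub>1 (?l \<cdot>\<^sub>1 (u \<cdot>\<^sub>1 ?d))"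
      unfolding ud by simp
    also have "\<dots> = (\<one>\<^sub>1 ?r \<odot> ?d) \<cdot>\<^sub>1 (((\<one>\<^sub>1 ?r \<odot> u) \<cdot>\<^sub>1 bm_lact M) \<cdot>\<^sub>1 ?d)"
      unfolding left by simp
    also have "\<dots> = (\<one>\<^sub>1 ?r \<odot> (?d \<cdot>\<^sub>1 u)) \<cdot>\<^sub>1 (bm_lact M \<cdot>\<^sub>1 ?d)"
      by (simp add: hcomp_vcomp')
    also have "\<dots> = bm_lact M \<cdot>\<^sub>1 ?d"
      unfolding du by (simp add: hcomp_vid)
    finally show "(\<one>\<^sub>1 ?r \<odot> ?d) \<cdot>\<^sub>1 ?l = bm_lact M \<cdot>\<^sub>1 ?d" .
    have "(?d \<odot> \<one>\<^sub>1 ?s) \<cdot>\<^sub>1 ?\<rho> = (?d \<odot> \<one>\<^sub>1 ?s) \<cdot>\<^sub>1 (?\<rho> \<cdot>\<^sub>1 (u \<cdot>\<^sub>1 ?d))"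
      unfolding ud by simp
    also have "\<dots> = (?d \<odot> \<one>\<^sub>1 ?s) \<cdot>\<^sub>1 (((u \<odot> \<one>\<^sub>1 ?s) \<cdot>\<^sub>1 bm_ract M) \<cdot>\<^sub>1 ?d)"
      unfolding right by simp
    also have "\<dots> = ((?d \<cdot>\<^sub>1 u) \<odot> \<one>\<^sub>1 ?s) \<cdot>\<^sub>1 (bm_ract M \<cdot>\<^sub>1 ?d)"
      by (simp add: hcomp_vcomp')
    also have "\<dots> = bm_ract M \<cdot>\<^sub>1 ?d"
      unfolding du by (simp add: hcomp_vid)
    finally show "(?d \<odot> \<one>\<^sub>1 ?s) \<cdot>\<^sub>1 ?\<rho> = bm_ract M \<cdot>\<^sub>1 ?d" .
  qed simp_all
  show "inverse_arrows (cat1 (Mod E q)) (tensor_runit E q M) (glob_bicell E M ?T ?d)"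
    unfolding R inverse_arrows_def Hom_def using b1 b2 ud du
    by (auto intro!: bicell_eqI cofun.equality)
qed

end


section \<open>Passing from a unitary lax functor H to the lax functor \<epsilon>H\<close>

section \<open>The bijection on lax functors\<close>

lemma laxfun_eqI:
  assumes "restrict_laxfun D F = F" "restrict_laxfun D G = G"
    "\<And>x. x \<in> Obj (cat0 D) \<Longrightarrow> fo F x = fo G x"
    "\<And>f. f \<in> Arr (cat0 D) \<Longrightarrow> fa F f = fa G f"
    "\<And>m. m \<in> Obj (cat1 D) \<Longrightarrow> fp F m = fp G m"
    "\<And>\<alpha>. \<alpha> \<in> Arr (cat1 D) \<Longrightarrow> fc F \<alpha> = fc G \<alpha>"
    "\<And>m n. \<lbrakk>m \<in> Obj (cat1 D); n \<in> Obj (cat1 D); ptgt D m = psrc D n\<rbrakk> \<Longrightarrow> lax F m n = lax G m n"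
    "\<And>x. x \<in> Obj (cat0 D) \<Longrightarrow> un F x = un G x"
  shows "F = G"
proof -
  have "restrict_laxfun D F = restrict_laxfun D G"
    unfolding restrict_laxfun_def using assms(3-)
    by (auto intro!: restrict_ext ext simp: composable_def)
  then show ?thesis unfolding assms(1,2) .
qed

lemma restrict_restrict_laxfun [simp]: "restrict_laxfun D (restrict_laxfun D F) = restrict_laxfun D F"
  by (simp add: restrict_laxfun_def cong: if_cong)

lemma (in lax_setup) lax_functorI:
  assumes "restrict_laxfun D F = F"
    and fo: "\<And>x. x \<in> Obj (cat0 D) \<Longrightarrow> fo F x \<in> Obj (cat0 E)"
    and fa: "\<And>f. f \<in> Arr (cat0 D) \<Longrightarrow> fa F f \<in> Arr (cat0 E)
      \<and> Dom (cat0 E) (fa F f) = fo F (Dom (cat0 D) f) \<and> Cod (cat0 E) (fa F f) = fo F (Cod (cat0 D) f)"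
    and fa_id: "\<And>x. x \<in> Obj (cat0 D) \<Longrightarrow> fa F (\<one>\<^sub>0\<^bsub>D\<^esub> x) = \<one>\<^sub>0 (fo F x)"
    and fa_comp: "\<And>f g. \<lbrakk>f \<in> Arr (cat0 D); g \<in> Arr (cat0 D); Cod (cat0 D) f = Dom (cat0 D) g\<rbrakk>
      \<Longrightarrow> fa F (f \<cdot>\<^sub>0\<^bsub>D\<^esub> g) = fa F f \<cdot>\<^sub>0 fa F g"
    and fp: "\<And>m. m \<in> Obj (cat1 D) \<Longrightarrow> fp F m \<in> Obj (cat1 E)
      \<and> psrc E (fp F m) = fo F (psrc D m) \<and> ptgt E (fp F m) = fo F (ptgt D m)"
    and fc: "\<And>\<alpha>. \<alpha> \<in> Arr (cat1 D) \<Longrightarrow> fc F \<alpha> \<in> Arr (cat1 E)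
      \<and> Dom (cat1 E) (fc F \<alpha>) = fp F (Dom (cat1 D) \<alpha>) \<and> Cod (cat1 E) (fc F \<alpha>) = fp F (Cod (cat1 D) \<alpha>)
      \<and> csrc E (fc F \<alpha>) = fa F (csrc D \<alpha>) \<and> ctgt E (fc F \<alpha>) = fa F (ctgt D \<alpha>)"
    and fc_id: "\<And>m. m \<in> Obj (cat1 D) \<Longrightarrow> fc F (\<one>\<^sub>1\<^bsub>D\<^esub> m) = \<one>\<^sub>1 (fp F m)"
    and fc_comp: "\<And>\<alpha> \<beta>. \<lbrakk>\<alpha> \<in> Arr (cat1 D); \<beta> \<in> Arr (cat1 D); Cod (cat1 D) \<alpha> = Dom (cat1 D) \<beta>\<rbrakk>
      \<Longrightarrow> fc F (\<alpha> \<cdot>\<^sub>1\<^bsub>D\<^esub> \<beta>) = fc F \<alpha> \<cdot>\<^sub>1 fc F \<beta>"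
    and lax: "\<And>m n. \<lbrakk>m \<in> Obj (cat1 D); n \<in> Obj (cat1 D); ptgt D m = psrc D n\<rbrakk>
      \<Longrightarrow> lax F m n \<in> Arr (cat1 E) \<and> Dom (cat1 E) (lax F m n) = fp F m \<odot>\<^sub>p fp F n
        \<and> Cod (cat1 E) (lax F m n) = fp F (m \<odot>\<^sub>p\<^bsub>D\<^esub> n)
        \<and> csrc E (lax F m n) = \<one>\<^sub>0 (fo F (psrc D m)) \<and> ctgt E (lax F m n) = \<one>\<^sub>0 (fo F (ptgt D n))"
    and un: "\<And>x. x \<in> Obj (cat0 D) \<Longrightarrow> un F x \<in> Arr (cat1 E) \<and> Dom (cat1 E) (un F x) = pid E (fo F x)
        \<and> Cod (cat1 E) (un F x) = fp F (pid D x)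
        \<and> csrc E (un F x) = \<one>\<^sub>0 (fo F x) \<and> ctgt E (un F x) = \<one>\<^sub>0 (fo F x)"
    and lax_nat: "\<And>\<alpha> \<beta> m n m' n'. \<lbrakk>\<alpha> \<in> Arr (cat1 D); \<beta> \<in> Arr (cat1 D); ctgt D \<alpha> = csrc D \<beta>;
        Dom (cat1 D) \<alpha> = m; Dom (cat1 D) \<beta> = n; Cod (cat1 D) \<alpha> = m'; Cod (cat1 D) \<beta> = n'\<rbrakk>
      \<Longrightarrow> (fc F \<alpha> \<odot> fc F \<beta>) \<cdot>\<^sub>1 lax F m' n' = lax F m n \<cdot>\<^sub>1 fc F (\<alpha> \<odot>\<^bsub>D\<^esub> \<beta>)"
    and un_nat: "\<And>f x y. \<lbrakk>f \<in> Arr (cat0 D); Dom (cat0 D) f = x; Cod (cat0 D) f = y\<rbrakk>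
      \<Longrightarrow> cid E (fa F f) \<cdot>\<^sub>1 un F y = un F x \<cdot>\<^sub>1 fc F (cid D f)"
    and lax_assoc: "\<And>m n p. \<lbrakk>m \<in> Obj (cat1 D); n \<in> Obj (cat1 D); p \<in> Obj (cat1 D);
        ptgt D m = psrc D n; ptgt D n = psrc D p\<rbrakk>
      \<Longrightarrow> (lax F m n \<odot> \<one>\<^sub>1 (fp F p)) \<cdot>\<^sub>1 (lax F (m \<odot>\<^sub>p\<^bsub>D\<^esub> n) p \<cdot>\<^sub>1 fc F (assoc D m n p))
        = assoc E (fp F m) (fp F n) (fp F p) \<cdot>\<^sub>1 ((\<one>\<^sub>1 (fp F m) \<odot> lax F n p)
            \<cdot>\<^sub>1 lax F m (n \<odot>\<^sub>p\<^bsub>D\<^esub> p))"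
    and lunit: "\<And>m. m \<in> Obj (cat1 D)
      \<Longrightarrow> (un F (psrc D m) \<odot> \<one>\<^sub>1 (fp F m)) \<cdot>\<^sub>1 lax_id_left D E F m = lunit E (fp F m)"
    and runit: "\<And>m. m \<in> Obj (cat1 D)
      \<Longrightarrow> (\<one>\<^sub>1 (fp F m) \<odot> un F (ptgt D m)) \<cdot>\<^sub>1 lax_id_right D E F m = runit E (fp F m)"
  shows "lax_functor D E F"
proof -
  note [simp] = fo fa fa_id fp fc fc_id lax un
  have "cat_functor (cat0 D) (cat0 E) (fo F) (fa F)"
    by unfold_locales (auto simp: Hom_def fa_comp)
  moreover have "cat_functor (cat1 D) (cat1 E) (fp F) (fc F)"
    by unfold_locales (auto simp: Hom_def fc_comp)
  moreover have "lax_functor_axioms D E F"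
  proof
    show "restrict_laxfun D F = F" by fact
  next
    fix m x y assume "m \<in> Pro D x y"
    then have m: "m \<in> Obj (cat1 D)" "psrc D m = x" "ptgt D m = y"
      by (auto simp: Pro_def)
    note [simp] = m D.source.obj_closed[of m] D.target.obj_closed[of m]
    show "fp F m \<in> Pro E (fo F x) (fo F y)"
      using m by (simp add: Pro_def)
    have [simp]: "x \<in> Obj (cat0 D)" "y \<in> Obj (cat0 D)"
      using D.source.obj_closed[of m] D.target.obj_closed[of m] m by simp_all
    show "(un F x \<odot> \<one>\<^sub>1 (fp F m)) \<cdot>\<^sub>1 lax F (pid D x) m \<cdot>\<^sub>1 fc F (lunit D m) = lunit E (fp F m)"
      using lunit[of m] by (simp add: lax_id_left_def)
    show "(\<one>\<^sub>1 (fp F m) \<odot> un F y) \<cdot>\<^sub>1 lax F m (pid D y) \<cdot>\<^sub>1 fc F (runit D m) = runit E (fp F m)"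
      using runit[of m] by (simp add: lax_id_right_def)
  next
    fix \<alpha> m n f g assume "\<alpha> \<in> Cells D m n f g"
    then show "fc F \<alpha> \<in> Cells E (fp F m) (fp F n) (fa F f) (fa F g)"
      using D.Cells_D[of \<alpha> m n f g] by (auto intro!: E.CellsI)
  next
    fix m n x y z assume "m \<in> Pro D x y" "n \<in> Pro D y z"
    then show "lax F m n \<in> Glob E (fp F m \<odot>\<^sub>p fp F n) (fp F (m \<odot>\<^sub>p\<^bsub>D\<^esub> n))"
      by (auto simp: Pro_def intro!: E.GlobI)
  next
    fix x assume "x \<in> Obj (cat0 D)"
    then show "un F x \<in> Glob E (pid E (fo F x)) (fp F (pid D x))"
      by (auto intro!: E.GlobI)
  next
    fix \<alpha> \<beta> m m' n n' f g h assume *: "\<alpha> \<in> Cells D m m' f g" "\<beta> \<in> Cells D n n' g h"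
    show "(fc F \<alpha> \<odot> fc F \<beta>) \<cdot>\<^sub>1 lax F m' n' = lax F m n \<cdot>\<^sub>1 fc F (\<alpha> \<odot>\<^bsub>D\<^esub> \<beta>)"
      by (rule lax_nat) (use D.Cells_D[OF *(1)] D.Cells_D[OF *(2)] in simp_all)
  next
    fix f x y assume "f \<in> Hom (cat0 D) x y"
    then show "cid E (fa F f) \<cdot>\<^sub>1 un F y = un F x \<cdot>\<^sub>1 fc F (cid D f)"
      by (intro un_nat) (auto simp: Hom_def)
  next
    fix m n p w x y z assume "m \<in> Pro D w x" "n \<in> Pro D x y" "p \<in> Pro D y z"
    then show "(lax F m n \<odot> \<one>\<^sub>1 (fp F p)) \<cdot>\<^sub>1 lax F (m \<odot>\<^sub>p\<^bsub>D\<^esub> n) p \<cdot>\<^sub>1 fc F (assoc D m n p)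
        = assoc E (fp F m) (fp F n) (fp F p) \<cdot>\<^sub>1 (\<one>\<^sub>1 (fp F m) \<odot> lax F n p)
            \<cdot>\<^sub>1 lax F m (n \<odot>\<^sub>p\<^bsub>D\<^esub> p)"
      using lax_assoc[of m n p] by (simp add: Pro_def)
  qed
  ultimately show ?thesis
    by (rule lax_functor.intro)
qed

context mod_setup
begin

lemma Cells_Mod_iff: "A \<in> Cells (Mod E q) M N \<Phi> \<Psi> \<longleftrightarrow>
    is_bicell E A \<and> bc_dom A = M \<and> bc_cod A = N \<and> bc_src A = \<Phi> \<and> bc_tgt A = \<Psi>"
  by (auto simp: Cells_def Hom_def)

lemma Glob_Mod_iff: "A \<in> Glob (Mod E q) M N \<longleftrightarrow>
    is_bicell E A \<and> bc_dom A = M \<and> bc_cod A = N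
    \<and> bc_src A = cofun_id E (bm_src M) \<and> bc_tgt A = cofun_id E (bm_tgt M)"
  by (simp add: Glob_def Cells_Mod_iff)

lemma Pro_Mod_iff: "M \<in> Pro (Mod E q) X Y \<longleftrightarrow> is_bimod E M \<and> bm_src M = X \<and> bm_tgt M = Y"
  by (simp add: Pro_def)

end

locale mod_lax = D: double_category D + E: mod_setup E q
  for D :: "('o, 'a, 'p, 'c) dbl" and E :: "('o2, 'a2, 'p2, 'c2) dbl" (structure)
    and q :: "('o2, 'p2, 'c2) bimod \<Rightarrow> ('o2, 'p2, 'c2) bimod \<Rightarrow> 'c2"
begin

sublocale lax_setup D E ..

end

text \<open>Facts about \<open>H\<close> are drawn from the axioms of \<open>lax_functor\<close> one
  at a time: the locale \<open>lax_fun\<close> presupposes a double category as codomain and would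
  call for all coherence laws of \<open>Mod E q\<close>.\<close>

locale unitary_lax = mod_lax D E q
  for D :: "('o, 'a, 'p, 'c) dbl" and E :: "('o2, 'a2, 'p2, 'c2) dbl" (structure)
    and q :: "('o2, 'p2, 'c2) bimod \<Rightarrow> ('o2, 'p2, 'c2) bimod \<Rightarrow> 'c2" +
  fixes H :: "('o, 'a, 'p, 'c, ('o2, 'p2, 'c2) catobj, ('o2, 'a2, 'p2, 'c2) cofun,
       ('o2, 'p2, 'c2) bimod, ('o2, 'a2, 'p2, 'c2) bicell) laxfun"
  assumes H: "lax_functor D (Mod E q) H" and H_unitary: "unitary D (Mod E q) H"
begin

lemma fo_H [simp]: "x \<in> Obj (cat0 D) \<Longrightarrow> is_catobj E (fo H x)"
  using cat_functor.obj_closed[OF lax_functor.axioms(1)[OF H]] by simp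

lemma
  assumes "f \<in> Arr (cat0 D)"
  shows fa_H [simp]: "is_cofun E (fa H f)"
    and dom_fa_H [simp]: "cf_dom (fa H f) = fo H (Dom (cat0 D) f)"
    and cod_fa_H [simp]: "cf_cod (fa H f) = fo H (Cod (cat0 D) f)"
  using cat_functor.arr_closed[OF lax_functor.axioms(1)[OF H], of f "Dom (cat0 D) f" "Cod (cat0 D) f"] assms
  by (auto simp: Hom_def)

lemma fa_H_id [simp]: "x \<in> Obj (cat0 D) \<Longrightarrow> fa H (\<one>\<^sub>0\<^bsub>D\<^esub> x) = cofun_id E (fo H x)"
  using cat_functor.pres_id[OF lax_functor.axioms(1)[OF H]] by simp

lemma fa_H_comp [simp]: "\<lbrakk>f \<in> Arr (cat0 D); g \<in> Arr (cat0 D); Cod (cat0 D) f = Dom (cat0 D) g\<rbrakk>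
      \<Longrightarrow> fa H (f \<cdot>\<^sub>0\<^bsub>D\<^esub> g) = cofun_comp E (fa H f) (fa H g)"
  using cat_functor.pres_comp[OF lax_functor.axioms(1)[OF H], of f "Dom (cat0 D) f" "Cod (cat0 D) f" g "Cod (cat0 D) g"]
  by (simp add: Hom_def)

lemma
  assumes "m \<in> Obj (cat1 D)"
  shows fp_H [simp]: "is_bimod E (fp H m)"
    and src_fp_H [simp]: "bm_src (fp H m) = fo H (psrc D m)"
    and tgt_fp_H [simp]: "bm_tgt (fp H m) = fo H (ptgt D m)"
  using lax_functor.fp_closed[OF H, of m "psrc D m" "ptgt D m"] assms
  by (simp_all add: E.Pro_Mod_iff) (simp_all add: Pro_def)

lemma
  assumes "\<alpha> \<in> Arr (cat1 D)"
  shows fc_H [simp]: "is_bicell E (fc H \<alpha>)"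
    and dom_fc_H [simp]: "bc_dom (fc H \<alpha>) = fp H (Dom (cat1 D) \<alpha>)"
    and cod_fc_H [simp]: "bc_cod (fc H \<alpha>) = fp H (Cod (cat1 D) \<alpha>)"
    and src_fc_H [simp]: "bc_src (fc H \<alpha>) = fa H (csrc D \<alpha>)"
    and tgt_fc_H [simp]: "bc_tgt (fc H \<alpha>) = fa H (ctgt D \<alpha>)"
  using lax_functor.fc_closed[OF H D.CellsI[OF assms refl refl refl refl]]
  by (simp_all add: E.Cells_Mod_iff)

lemma fc_H_id [simp]: "m \<in> Obj (cat1 D) \<Longrightarrow> fc H (\<one>\<^sub>1\<^bsub>D\<^esub> m) = bicell_id E (fp H m)"
  using cat_functor.pres_id[OF lax_functor.axioms(2)[OF H]] by simp

lemma fc_H_comp [simp]: "\<lbrakk>\<alpha> \<in> Arr (cat1 D); \<beta> \<in> Arr (cat1 D); Cod (cat1 D) \<alpha> = Dom (cat1 D) \<beta>\<rbrakk>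
      \<Longrightarrow> fc H (\<alpha> \<cdot>\<^sub>1\<^bsub>D\<^esub> \<beta>) = bicell_comp E (fc H \<alpha>) (fc H \<beta>)"
  using cat_functor.pres_comp[OF lax_functor.axioms(2)[OF H],
      of \<alpha> "Dom (cat1 D) \<alpha>" "Cod (cat1 D) \<alpha>" \<beta> "Cod (cat1 D) \<beta>"]
  by (simp add: Hom_def)

lemma
  assumes "m \<in> Obj (cat1 D)" "n \<in> Obj (cat1 D)" "ptgt D m = psrc D n"
  shows lax_H [simp]: "is_bicell E (lax H m n)"
    and dom_lax_H [simp]: "bc_dom (lax H m n) = tensor E q (fp H m) (fp H n)"
    and cod_lax_H [simp]: "bc_cod (lax H m n) = fp H (m \<odot>\<^sub>p\<^bsub>D\<^esub> n)"
    and src_lax_H [simp]: "bc_src (lax H m n) = cofun_id E (fo H (psrc D m))"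
    and tgt_lax_H [simp]: "bc_tgt (lax H m n) = cofun_id E (fo H (ptgt D n))"
  using lax_functor.lax_closed[OF H, of m "psrc D m" "ptgt D m" n "ptgt D n"] assms
  by (simp_all add: E.Glob_Mod_iff Pro_def)

lemma
  assumes "x \<in> Obj (cat0 D)"
  shows fp_H_pid [simp]: "fp H (pid D x) = unit_bimod (fo H x)"
    and un_H [simp]: "un H x = bicell_id E (unit_bimod (fo H x))"
  using H_unitary assms by (simp_all add: unitary_def)

text \<open>Naturality of the unitors, once these are identities.\<close>

lemma fc_H_cid [simp]:
  assumes "f \<in> Arr (cat0 D)"
  shows "fc H (cid D f) = unit_bicell (fa H f)"
  using lax_functor.un_natural[OF H, of f "Dom (cat0 D) f" "Cod (cat0 D) f"] assms
  by (simp add: Hom_def)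

abbreviation "F \<equiv> eps_fun D E q H"

lemma fo_eps [simp]: "x \<in> Obj (cat0 D) \<Longrightarrow> fo F x = co_ob (fo H x)"
  and fa_eps [simp]: "f \<in> Arr (cat0 D) \<Longrightarrow> fa F f = cf_arr (fa H f)"
  and fp_eps [simp]: "m \<in> Obj (cat1 D) \<Longrightarrow> fp F m = bm_pro (fp H m)"
  and fc_eps [simp]: "\<alpha> \<in> Arr (cat1 D) \<Longrightarrow> fc F \<alpha> = bc_cell (fc H \<alpha>)"
  and lax_eps [simp]: "\<lbrakk>m \<in> Obj (cat1 D); n \<in> Obj (cat1 D); ptgt D m = psrc D n\<rbrakk>
    \<Longrightarrow> lax F m n = q (fp H m) (fp H n) \<cdot>\<^sub>1 bc_cell (lax H m n)"
  and un_eps [simp]: "x \<in> Obj (cat0 D) \<Longrightarrow> un F x = co_unit (fo H x)"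
  by (simp_all add: eps_fun_def lax_comp_def restrict_laxfun_def epsilon_def composable_def)

lemma restrict_eps [simp]: "restrict_laxfun D F = F"
  by (simp add: eps_fun_def lax_comp_def)

text \<open>The unit laws of \<open>H\<close> equate the unit isomorphism of Mod(E) with a laxator
  followed by the image of a unit isomorphism of D. Precomposition with \<open>q\<close> turns the
  former into an action, and the latter into the corresponding cell for \<epsilon>H.\<close>

lemma
  assumes [simp]: "m \<in> Obj (cat1 D)"
  shows eps_left [simp]: "lax_id_left D E F m = bm_lact (fp H m)"
    and eps_right [simp]: "lax_id_right D E F m = bm_ract (fp H m)"
proof -
  have [simp]: "psrc D m \<in> Obj (cat0 D)" "ptgt D m \<in> Obj (cat0 D)"
    using D.source.obj_closed[of m] D.target.obj_closed[of m] by simp_all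
  let ?M = "fp H m" and ?X = "fo H (psrc D m)" and ?Y = "fo H (ptgt D m)"
  let ?T = "tensor_cell E q (bicell_id E (unit_bimod ?X)) (bicell_id E ?M)"
    and ?S = "tensor_cell E q (bicell_id E ?M) (bicell_id E (unit_bimod ?Y))"
  have T: "is_bicell E ?T" "is_bicell E ?S"
    by (rule E.is_bicell_tensor; simp)+
  \<comment> \<open>The unitor of \<open>H\<close> is an identity, so its tensor with another
    identity is invisible behind the coequalizer cell.\<close>
  have q1: "q (unit_bimod ?X) ?M \<cdot>\<^sub>1 bc_cell ?T = q (unit_bimod ?X) ?M"
    using E.q_tensor_cell[of "bicell_id E (unit_bimod ?X)" "bicell_id E ?M"] by (simp add: E.hcomp_vid)
  have q2: "q ?M (unit_bimod ?Y) \<cdot>\<^sub>1 bc_cell ?S = q ?M (unit_bimod ?Y)"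
    using E.q_tensor_cell[of "bicell_id E ?M" "bicell_id E (unit_bimod ?Y)"] by (simp add: E.hcomp_vid)
  have "bicell_comp E (bicell_comp E ?T (lax H (pid D (psrc D m)) m)) (fc H (lunit D m)) = tensor_lunit E q ?M"
    using lax_functor.lax_lunit[OF H, of m "psrc D m" "ptgt D m"] by (simp add: Pro_def)
  then have "bc_cell (tensor_lunit E q ?M)
      = bc_cell ?T \<cdot>\<^sub>1 (bc_cell (lax H (pid D (psrc D m)) m) \<cdot>\<^sub>1 bc_cell (fc H (lunit D m)))"
    using T by (auto dest: arg_cong[where f = bc_cell])
  then have "bm_lact ?M = (q (unit_bimod ?X) ?M \<cdot>\<^sub>1 bc_cell ?T)
      \<cdot>\<^sub>1 (bc_cell (lax H (pid D (psrc D m)) m) \<cdot>\<^sub>1 bc_cell (fc H (lunit D m)))"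
    using E.q_tensor_lunit[of ?M] T by simp
  then show "lax_id_left D E F m = bm_lact ?M"
    unfolding q1 by (simp add: lax_id_left_def)
  have "bicell_comp E (bicell_comp E ?S (lax H m (pid D (ptgt D m)))) (fc H (runit D m)) = tensor_runit E q ?M"
    using lax_functor.lax_runit[OF H, of m "psrc D m" "ptgt D m"] by (simp add: Pro_def)
  then have "bc_cell (tensor_runit E q ?M)
      = bc_cell ?S \<cdot>\<^sub>1 (bc_cell (lax H m (pid D (ptgt D m))) \<cdot>\<^sub>1 bc_cell (fc H (runit D m)))"
    using T by (auto dest: arg_cong[where f = bc_cell])
  then have "bm_ract ?M = (q ?M (unit_bimod ?Y) \<cdot>\<^sub>1 bc_cell ?S)
      \<cdot>\<^sub>1 (bc_cell (lax H m (pid D (ptgt D m))) \<cdot>\<^sub>1 bc_cell (fc H (runit D m)))"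
    using E.q_tensor_runit[of ?M] T by simp
  then show "lax_id_right D E F m = bm_ract ?M"
    unfolding q2 by (simp add: lax_id_right_def)
qed

lemma eps_mult [simp]: "x \<in> Obj (cat0 D) \<Longrightarrow> lax_id_id D E F x = co_mult (fo H x)"
  by (simp add: lax_id_id_def)

text \<open>Each axiom is the corresponding one for \<open>H\<close>, precomposed with the
  coequalizer cells that serve as laxators of \<epsilon>; the unit laws become those of the actions
  through \<open>eps_left\<close> and \<open>eps_right\<close>.\<close>

lemma lax_functor_eps: "lax_functor D E F"
proof (rule lax_functorI)
  fix \<alpha> \<beta> m n m' n'
  assume [simp]: "\<alpha> \<in> Arr (cat1 D)" "\<beta> \<in> Arr (cat1 D)" "ctgt D \<alpha> = csrc D \<beta>"
    "Dom (cat1 D) \<alpha> = m" "Dom (cat1 D) \<beta> = n" "Cod (cat1 D) \<alpha> = m'" "Cod (cat1 D) \<beta> = n'"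
  have [simp]: "ptgt D m = psrc D n" "ptgt D m' = psrc D n'" "m \<in> Obj (cat1 D)" "n \<in> Obj (cat1 D)"
    "m' \<in> Obj (cat1 D)" "n' \<in> Obj (cat1 D)"
    using D.psrc_cod_eq[of \<alpha> \<beta>] D.source.A.dom_closed[of \<alpha>] D.source.A.dom_closed[of \<beta>]
      D.source.A.cod_closed[of \<alpha>] D.source.A.cod_closed[of \<beta>] by (auto simp del: D.ptgt_dom)
  have "bicell_comp E (tensor_cell E q (fc H \<alpha>) (fc H \<beta>)) (lax H m' n')
      = bicell_comp E (lax H m n) (fc H (\<alpha> \<odot>\<^bsub>D\<^esub> \<beta>))"
    using lax_functor.lax_natural[OF H, of \<alpha> m m' "csrc D \<alpha>" "ctgt D \<alpha>" \<beta> n n' "ctgt D \<beta>"]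
    by (simp add: D.CellsI)
  then have *: "bc_cell (tensor_cell E q (fc H \<alpha>) (fc H \<beta>)) \<cdot>\<^sub>1 bc_cell (lax H m' n')
      = bc_cell (lax H m n) \<cdot>\<^sub>1 bc_cell (fc H (\<alpha> \<odot>\<^bsub>D\<^esub> \<beta>))"
    by (auto dest: arg_cong[where f = bc_cell])
  have T: "is_bicell E (tensor_cell E q (fc H \<alpha>) (fc H \<beta>))"
    by (rule E.is_bicell_tensor) simp_all
  have "(fc F \<alpha> \<odot> fc F \<beta>) \<cdot>\<^sub>1 lax F m' n'
      = (q (fp H m) (fp H n) \<cdot>\<^sub>1 bc_cell (tensor_cell E q (fc H \<alpha>) (fc H \<beta>))) \<cdot>\<^sub>1 bc_cell (lax H m' n')"
    using E.q_tensor_cell[of "fc H \<alpha>" "fc H \<beta>"] by simp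
  also have "\<dots> = lax F m n \<cdot>\<^sub>1 fc F (\<alpha> \<odot>\<^bsub>D\<^esub> \<beta>)"
    using T by (simp add: *)
  finally show "(fc F \<alpha> \<odot> fc F \<beta>) \<cdot>\<^sub>1 lax F m' n' = lax F m n \<cdot>\<^sub>1 fc F (\<alpha> \<odot>\<^bsub>D\<^esub> \<beta>)" .
next
  fix m n p assume [simp]: "m \<in> Obj (cat1 D)" "n \<in> Obj (cat1 D)" "p \<in> Obj (cat1 D)"
    "ptgt D m = psrc D n" "ptgt D n = psrc D p"
  have [simp]: "psrc D n \<in> Obj (cat0 D)" "psrc D p \<in> Obj (cat0 D)"
    using D.source.obj_closed by simp_all
  let ?M = "fp H m" and ?N = "fp H n" and ?P = "fp H p"
  let ?T = "tensor_cell E q (lax H m n) (bicell_id E ?P)"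
    and ?S = "tensor_cell E q (bicell_id E ?M) (lax H n p)"
    and ?a = "bc_cell (tensor_assoc E q ?M ?N ?P)"
    and ?l1 = "bc_cell (lax H m n)" and ?l2 = "bc_cell (lax H (m \<odot>\<^sub>p\<^bsub>D\<^esub> n) p)"
    and ?l3 = "bc_cell (lax H n p)" and ?l4 = "bc_cell (lax H m (n \<odot>\<^sub>p\<^bsub>D\<^esub> p))"
    and ?ha = "bc_cell (fc H (assoc D m n p))"
  have T: "is_bicell E ?T" "is_bicell E ?S"
    by (rule E.is_bicell_tensor; simp)+
  have qT: "q (tensor E q ?M ?N) ?P \<cdot>\<^sub>1 bc_cell ?T = (?l1 \<odot> \<one>\<^sub>1 (bm_pro ?P)) \<cdot>\<^sub>1 q (fp H (m \<odot>\<^sub>p\<^bsub>D\<^esub> n)) ?P"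
    using E.q_tensor_cell[of "lax H m n" "bicell_id E ?P"] by simp
  have qS: "q ?M (tensor E q ?N ?P) \<cdot>\<^sub>1 bc_cell ?S = (\<one>\<^sub>1 (bm_pro ?M) \<odot> ?l3) \<cdot>\<^sub>1 q ?M (fp H (n \<odot>\<^sub>p\<^bsub>D\<^esub> p))"
    using E.q_tensor_cell[of "bicell_id E ?M" "lax H n p"] by simp
  have a: "?a \<in> Glob E (tensor_pro E q (tensor E q ?M ?N) ?P) (tensor_pro E q ?M (tensor E q ?N ?P))"
    and qa: "(q ?M ?N \<odot> \<one>\<^sub>1 (bm_pro ?P)) \<cdot>\<^sub>1 (q (tensor E q ?M ?N) ?P \<cdot>\<^sub>1 ?a)
      = assoc E (bm_pro ?M) (bm_pro ?N) (bm_pro ?P)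
        \<cdot>\<^sub>1 ((\<one>\<^sub>1 (bm_pro ?M) \<odot> q ?N ?P) \<cdot>\<^sub>1 q ?M (tensor E q ?N ?P))"
    by (rule E.tensor_assoc_cell; simp)+
  note [simp] = E.Glob_D(1-5)[OF a] T
  have "bicell_comp E (bicell_comp E ?T (lax H (m \<odot>\<^sub>p\<^bsub>D\<^esub> n) p)) (fc H (assoc D m n p))
      = bicell_comp E (bicell_comp E (tensor_assoc E q ?M ?N ?P) ?S) (lax H m (n \<odot>\<^sub>p\<^bsub>D\<^esub> p))"
    using lax_functor.lax_assoc[OF H, of m "psrc D m" "ptgt D m" n "ptgt D n" p "ptgt D p"]
    by (simp add: Pro_def)
  from arg_cong[OF this, of bc_cell]
  have *: "bc_cell ?T \<cdot>\<^sub>1 (?l2 \<cdot>\<^sub>1 ?ha) = ?a \<cdot>\<^sub>1 (bc_cell ?S \<cdot>\<^sub>1 ?l4)"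
    by simp
  \<comment> \<open>The associator of Mod(E) is known only behind two coequalizer cells. The
    laxators of \<epsilon>H contribute exactly these two, once the laxator of \<open>H\<close> has
    been moved past them as a tensor of cells.\<close>
  have "((q ?M ?N \<cdot>\<^sub>1 ?l1) \<odot> \<one>\<^sub>1 (bm_pro ?P)) \<cdot>\<^sub>1 ((q (fp H (m \<odot>\<^sub>p\<^bsub>D\<^esub> n)) ?P \<cdot>\<^sub>1 ?l2) \<cdot>\<^sub>1 ?ha)
      = (q ?M ?N \<odot> \<one>\<^sub>1 (bm_pro ?P))
        \<cdot>\<^sub>1 (((?l1 \<odot> \<one>\<^sub>1 (bm_pro ?P)) \<cdot>\<^sub>1 q (fp H (m \<odot>\<^sub>p\<^bsub>D\<^esub> n)) ?P) \<cdot>\<^sub>1 (?l2 \<cdot>\<^sub>1 ?ha))"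
    by (simp add: E.hcomp_vcomp')
  also have "\<dots> = (q ?M ?N \<odot> \<one>\<^sub>1 (bm_pro ?P)) \<cdot>\<^sub>1 (q (tensor E q ?M ?N) ?P \<cdot>\<^sub>1 (bc_cell ?T \<cdot>\<^sub>1 (?l2 \<cdot>\<^sub>1 ?ha)))"
    unfolding qT[symmetric] by simp
  also have "\<dots> = ((q ?M ?N \<odot> \<one>\<^sub>1 (bm_pro ?P)) \<cdot>\<^sub>1 (q (tensor E q ?M ?N) ?P \<cdot>\<^sub>1 ?a)) \<cdot>\<^sub>1 (bc_cell ?S \<cdot>\<^sub>1 ?l4)"
    unfolding * by simp
  also have "\<dots> = assoc E (bm_pro ?M) (bm_pro ?N) (bm_pro ?P)
        \<cdot>\<^sub>1 ((\<one>\<^sub>1 (bm_pro ?M) \<odot> q ?N ?P) \<cdot>\<^sub>1 ((q ?M (tensor E q ?N ?P) \<cdot>\<^sub>1 bc_cell ?S) \<cdot>\<^sub>1 ?l4))"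
    unfolding qa by simp
  also have "\<dots> = assoc E (bm_pro ?M) (bm_pro ?N) (bm_pro ?P)
        \<cdot>\<^sub>1 ((\<one>\<^sub>1 (bm_pro ?M) \<odot> (q ?N ?P \<cdot>\<^sub>1 ?l3)) \<cdot>\<^sub>1 (q ?M (fp H (n \<odot>\<^sub>p\<^bsub>D\<^esub> p)) \<cdot>\<^sub>1 ?l4))"
    unfolding qS by (simp add: E.hcomp_vcomp')
  finally show "(lax F m n \<odot> \<one>\<^sub>1 (fp F p)) \<cdot>\<^sub>1 (lax F (m \<odot>\<^sub>p\<^bsub>D\<^esub> n) p \<cdot>\<^sub>1 fc F (assoc D m n p))
        = assoc E (fp F m) (fp F n) (fp F p) \<cdot>\<^sub>1 ((\<one>\<^sub>1 (fp F m) \<odot> lax F n p) \<cdot>\<^sub>1 lax F m (n \<odot>\<^sub>p\<^bsub>D\<^esub> p))"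
    by simp
next
  fix m assume [simp]: "m \<in> Obj (cat1 D)"
  have [simp]: "psrc D m \<in> Obj (cat0 D)" "ptgt D m \<in> Obj (cat0 D)"
    using D.source.obj_closed[of m] D.target.obj_closed[of m] by simp_all
  show "(un F (psrc D m) \<odot> \<one>\<^sub>1 (fp F m)) \<cdot>\<^sub>1 lax_id_left D E F m = lunit E (fp F m)"
    using E.lact_unit[of "fp H m"] by simp
  show "(\<one>\<^sub>1 (fp F m) \<odot> un F (ptgt D m)) \<cdot>\<^sub>1 lax_id_right D E F m = runit E (fp F m)"
    using E.ract_unit[of "fp H m"] by simp
next
  fix f x y assume [simp]: "f \<in> Arr (cat0 D)" "Dom (cat0 D) f = x" "Cod (cat0 D) f = y"
  have [simp]: "x \<in> Obj (cat0 D)" "y \<in> Obj (cat0 D)"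
    using D.source.B.dom_closed[of f] D.source.B.cod_closed[of f] by simp_all
  show "cid E (fa F f) \<cdot>\<^sub>1 un F y = un F x \<cdot>\<^sub>1 fc F (cid D f)"
    using E.cf_unit[of "fa H f"] by simp
next
  fix m assume "m \<in> Obj (cat1 D)"
  then show "fp F m \<in> Obj (cat1 E) \<and> psrc E (fp F m) = fo F (psrc D m) \<and> ptgt E (fp F m) = fo F (ptgt D m)"
    using D.source.obj_closed[of m] D.target.obj_closed[of m] by simp
next
  fix m n assume "m \<in> Obj (cat1 D)" "n \<in> Obj (cat1 D)" "ptgt D m = psrc D n"
  then show "lax F m n \<in> Arr (cat1 E) \<and> Dom (cat1 E) (lax F m n) = fp F m \<odot>\<^sub>p fp F n
        \<and> Cod (cat1 E) (lax F m n) = fp F (m \<odot>\<^sub>p\<^bsub>D\<^esub> n)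
        \<and> csrc E (lax F m n) = \<one>\<^sub>0 (fo F (psrc D m)) \<and> ctgt E (lax F m n) = \<one>\<^sub>0 (fo F (ptgt D n))"
    using D.source.obj_closed[of m] D.target.obj_closed[of n] D.source.obj_closed[of n] by simp
qed simp_all

sublocale F: lax_fun D E F
  by (rule lax_funI[OF lax_functor_eps])

end


section \<open>The unitary lax functor Mod(F)\<eta>\<close>

locale lax_bar = mod_lax D E q + F: lax_fun D E F
  for D :: "('o, 'a, 'p, 'c) dbl" and E :: "('o2, 'a2, 'p2, 'c2) dbl" (structure)
    and q :: "('o2, 'p2, 'c2) bimod \<Rightarrow> ('o2, 'p2, 'c2) bimod \<Rightarrow> 'c2"
    and F :: "('o, 'a, 'p, 'c, 'o2, 'a2, 'p2, 'c2) laxfun"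
begin

abbreviation "ob \<equiv> bar_ob D E F"
abbreviation "arr \<equiv> bar_arr D E F"
abbreviation "pro \<equiv> bar_pro D E F"
abbreviation "cell \<equiv> bar_cell D E F"

lemma bar_ob_simps [simp]:
  "co_ob (ob x) = fo F x" "co_pro (ob x) = fp F (pid D x)" "co_mult (ob x) = lax_id_id D E F x"
  "co_unit (ob x) = un F x"
  by (simp_all add: bar_ob_def)

lemma bar_arr_simps [simp]:
  "cf_dom (arr f) = ob (Dom (cat0 D) f)" "cf_cod (arr f) = ob (Cod (cat0 D) f)"
  "cf_arr (arr f) = fa F f" "cf_cell (arr f) = fc F (cid D f)"
  by (simp_all add: bar_arr_def)

lemma bar_pro_simps [simp]:
  "bm_src (pro m) = ob (psrc D m)" "bm_tgt (pro m) = ob (ptgt D m)" "bm_pro (pro m) = fp F m"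
  "bm_lact (pro m) = lax_id_left D E F m" "bm_ract (pro m) = lax_id_right D E F m"
  by (simp_all add: bar_pro_def)

lemma bar_cell_simps [simp]:
  "bc_dom (cell \<theta>) = pro (Dom (cat1 D) \<theta>)" "bc_cod (cell \<theta>) = pro (Cod (cat1 D) \<theta>)"
  "bc_src (cell \<theta>) = arr (csrc D \<theta>)" "bc_tgt (cell \<theta>) = arr (ctgt D \<theta>)" "bc_cell (cell \<theta>) = fc F \<theta>"
  by (simp_all add: bar_cell_def)

lemma is_catobj_bar [simp]:
  assumes [simp]: "x \<in> Obj (cat0 D)"
  shows "is_catobj E (ob x)"
proof (rule E.is_catobjI)
  show "E.assoc_square (co_mult (ob x), co_mult (ob x)) (co_mult (ob x), co_mult (ob x))
      (co_pro (ob x)) (co_pro (ob x)) (co_pro (ob x))"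
    using F.square_left[of "pid D x" x] by (simp add: F.L_pid)
  show "(co_unit (ob x) \<odot> \<one>\<^sub>1 (co_pro (ob x))) \<cdot>\<^sub>1 co_mult (ob x) = lunit E (co_pro (ob x))"
    using F.un_L[of "pid D x" x] by (simp add: F.L_pid)
  show "(\<one>\<^sub>1 (co_pro (ob x)) \<odot> co_unit (ob x)) \<cdot>\<^sub>1 co_mult (ob x) = runit E (co_pro (ob x))"
    using F.un_R[of "pid D x" x] by (simp add: F.R_pid)
qed (auto intro!: E.GlobI)

lemma is_cofun_bar [simp]:
  assumes [simp]: "f \<in> Arr (cat0 D)"
  shows "is_cofun E (arr f)"
proof (rule E.is_cofunI)
  have f: "cid D f \<in> Cells D (pid D (Dom (cat0 D) f)) (pid D (Cod (cat0 D) f)) f f"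
    by (rule D.CellsI) simp_all
  show "(cf_cell (arr f) \<odot> cf_cell (arr f)) \<cdot>\<^sub>1 co_mult (cf_cod (arr f))
      = co_mult (cf_dom (arr f)) \<cdot>\<^sub>1 cf_cell (arr f)"
    using F.L_nat[OF f] by (simp add: F.L_pid)
  show "cid E (cf_arr (arr f)) \<cdot>\<^sub>1 co_unit (cf_cod (arr f)) = co_unit (cf_dom (arr f)) \<cdot>\<^sub>1 cf_cell (arr f)"
    by (simp add: F.un_nat)
qed simp_all

lemma is_bimod_bar [simp]:
  assumes [simp]: "m \<in> Obj (cat1 D)"
  shows "is_bimod E (pro m)"
proof -
  have [simp]: "psrc D m \<in> Obj (cat0 D)" "ptgt D m \<in> Obj (cat0 D)"
    using D.source.obj_closed[of m] D.target.obj_closed[of m] by simp_all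
  show ?thesis
    by (rule E.is_bimodI) (simp_all add: F.square_left F.square_right F.square_mid F.un_L F.un_R)
qed

lemma is_bicell_bar [simp]:
  assumes [simp]: "\<theta> \<in> Arr (cat1 D)"
  shows "is_bicell E (cell \<theta>)"
proof -
  have \<theta>: "\<theta> \<in> Cells D (Dom (cat1 D) \<theta>) (Cod (cat1 D) \<theta>) (csrc D \<theta>) (ctgt D \<theta>)"
    by (rule D.CellsI) simp_all
  show ?thesis
    by (rule E.is_bicellI) (simp_all add: F.L_nat[OF \<theta>] F.R_nat[OF \<theta>])
qed

text \<open>Unitarity holds on the nose: at an identity proarrow the left and the right action both
  equal the multiplication, because the two unit isomorphisms of D agree there.\<close>

lemma bar_pro_pid [simp]: "x \<in> Obj (cat0 D) \<Longrightarrow> pro (pid D x) = unit_bimod (ob x)"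
  by (rule bimod.equality) (simp_all add: F.L_pid F.R_pid)

lemma bar_cell_cid [simp]: "f \<in> Arr (cat0 D) \<Longrightarrow> cell (cid D f) = unit_bicell (arr f)"
  by (rule bicell.equality) simp_all

lemma bar_lax_simps [simp]:
  "bc_dom (bar_lax D E q F m n) = tensor E q (pro m) (pro n)"
  "bc_cod (bar_lax D E q F m n) = pro (m \<odot>\<^sub>p\<^bsub>D\<^esub> n)"
  "bc_src (bar_lax D E q F m n) = cofun_id E (bm_src (tensor E q (pro m) (pro n)))"
  "bc_tgt (bar_lax D E q F m n) = cofun_id E (bm_tgt (tensor E q (pro m) (pro n)))"
  by (simp_all add: bar_lax_def)

text \<open>The middle balance of the laxator gives the factor through the tensor product. Its
  equivariance is the equivariance of the laxator itself, read after cancelling a whiskered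
  coequalizer cell.\<close>

lemma
  assumes mn: "m \<in> Obj (cat1 D)" "n \<in> Obj (cat1 D)" "ptgt D m = psrc D n"
  shows q_bar_lax: "q (pro m) (pro n) \<cdot>\<^sub>1 bc_cell (bar_lax D E q F m n) = lax F m n"
    and is_bicell_bar_lax [simp]: "is_bicell E (bar_lax D E q F m n)"
proof -
  note [simp] = mn
  let ?M = "pro m" and ?N = "pro n" and ?z = "fp F (m \<odot>\<^sub>p\<^bsub>D\<^esub> n)"
  let ?k = "tensor_pro E q ?M ?N" and ?q = "q ?M ?N" and ?T = "tensor E q ?M ?N"
  let ?x = "psrc D m" and ?y = "psrc D n" and ?w = "ptgt D n"
  have [simp]: "?x \<in> Obj (cat0 D)" "?y \<in> Obj (cat0 D)" "?w \<in> Obj (cat0 D)"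
    using D.source.obj_closed[of m] D.source.obj_closed[of n] D.target.obj_closed[of n] by simp_all
  have "(bm_ract ?M \<odot> \<one>\<^sub>1 (bm_pro ?N)) \<cdot>\<^sub>1 lax F m n
      = (assoc E (bm_pro ?M) (co_pro (bm_src ?N)) (bm_pro ?N) \<cdot>\<^sub>1 (\<one>\<^sub>1 (bm_pro ?M) \<odot> bm_lact ?N)) \<cdot>\<^sub>1 lax F m n"
    using E.assoc_square_eq[OF F.square_balanced[OF mn(1,2) refl mn(3) refl refl]] by simp
  then obtain u where u: "u \<in> Arr (cat1 E)" "Dom (cat1 E) u = ?k" "Cod (cat1 E) u = ?z"
    "csrc E u = \<one>\<^sub>0 (fo F ?x)" "ctgt E u = \<one>\<^sub>0 (fo F ?w)" "?q \<cdot>\<^sub>1 u = lax F m n"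
    by (rule E.coequalizer_factor[OF E.q_coequalizer[of ?M ?N], rotated -2]) simp_all
  note [simp] = u(1-5)
  have "(THE \<gamma>. \<gamma> \<in> Glob E ?k ?z \<and> ?q \<cdot>\<^sub>1 \<gamma> = lax F m n) = u"
  proof (rule the_equality)
    show "u \<in> Glob E ?k ?z \<and> ?q \<cdot>\<^sub>1 u = lax F m n"
      using u(6) by (auto intro!: E.GlobI)
    fix v assume v: "v \<in> Glob E ?k ?z \<and> ?q \<cdot>\<^sub>1 v = lax F m n"
    have "?q \<cdot>\<^sub>1 v = ?q \<cdot>\<^sub>1 u" using u(6) v by simp
    then show "v = u"
      by (rule epi_arrowD[OF E.epi_q[of ?M ?N], rotated 3])
        (use E.Glob_D(1-3)[OF conjunct1[OF v]] in simp_all)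
  qed
  then have eq: "bc_cell (bar_lax D E q F m n) = u"
    by (simp add: bar_lax_def)
  show "?q \<cdot>\<^sub>1 bc_cell (bar_lax D E q F m n) = lax F m n"
    using u(6) by (simp add: eq)
  note [simp] = E.assoc_squareD(23-26)[OF E.tensor_lact_square[of ?M ?N], simplified]
    E.assoc_squareD(18,19,21,22)[OF E.tensor_ract_square[of ?M ?N], simplified]
    E.cod_tensor_lact[of ?M ?N] E.cod_tensor_ract[of ?M ?N]
  let ?l = "bm_lact ?T" and ?\<rho> = "bm_ract ?T" and ?r = "fp F (pid D ?x)" and ?t = "fp F (pid D ?w)"
  have left: "(\<one>\<^sub>1 ?r \<odot> u) \<cdot>\<^sub>1 F.L (m \<odot>\<^sub>p\<^bsub>D\<^esub> n) = ?l \<cdot>\<^sub>1 u"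
  proof -
    have "assoc E ?r (fp F m) (fp F n) \<cdot>\<^sub>1 ((\<one>\<^sub>1 ?r \<odot> ?q) \<cdot>\<^sub>1 ((\<one>\<^sub>1 ?r \<odot> u) \<cdot>\<^sub>1 F.L (m \<odot>\<^sub>p\<^bsub>D\<^esub> n)))
        = (F.L m \<odot> \<one>\<^sub>1 (fp F n)) \<cdot>\<^sub>1 lax F m n"
      using u(6) E.assoc_square_eq[OF F.square_left_lax[OF mn(1,2) refl mn(3) refl refl]]
      by (simp add: E.hcomp_vcomp')
    also have "\<dots> = ((F.L m \<odot> \<one>\<^sub>1 (fp F n)) \<cdot>\<^sub>1 ?q) \<cdot>\<^sub>1 u"
      using u(6) by simp
    also have "\<dots> = assoc E ?r (fp F m) (fp F n) \<cdot>\<^sub>1 ((\<one>\<^sub>1 ?r \<odot> ?q) \<cdot>\<^sub>1 (?l \<cdot>\<^sub>1 u))"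
      using arg_cong[OF E.assoc_square_eq[OF E.tensor_lact_square[of ?M ?N]], of "\<lambda>t. t \<cdot>\<^sub>1 u"] by simp
    finally have "(\<one>\<^sub>1 ?r \<odot> ?q) \<cdot>\<^sub>1 ((\<one>\<^sub>1 ?r \<odot> u) \<cdot>\<^sub>1 F.L (m \<odot>\<^sub>p\<^bsub>D\<^esub> n)) = (\<one>\<^sub>1 ?r \<odot> ?q) \<cdot>\<^sub>1 (?l \<cdot>\<^sub>1 u)"
      by (rule E.source.A.iso_cancel[rotated -1]) simp_all
    then show ?thesis
      by (rule epi_arrowD[OF E.epi_vid_q[of ?M ?N ?r], rotated 5]) simp_all
  qed
  have right: "(u \<odot> \<one>\<^sub>1 ?t) \<cdot>\<^sub>1 F.R (m \<odot>\<^sub>p\<^bsub>D\<^esub> n) = ?\<rho> \<cdot>\<^sub>1 u"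
  proof -
    have "(?q \<odot> \<one>\<^sub>1 ?t) \<cdot>\<^sub>1 ((u \<odot> \<one>\<^sub>1 ?t) \<cdot>\<^sub>1 F.R (m \<odot>\<^sub>p\<^bsub>D\<^esub> n))
        = (assoc E (fp F m) (fp F n) ?t \<cdot>\<^sub>1 ((\<one>\<^sub>1 (fp F m) \<odot> F.R n) \<cdot>\<^sub>1 ?q)) \<cdot>\<^sub>1 u"
      using u(6) E.assoc_square_eq[OF F.square_lax_right[OF mn(1,2) refl mn(3) refl refl]]
      by (simp add: E.hcomp_vcomp')
    also have "\<dots> = (?q \<odot> \<one>\<^sub>1 ?t) \<cdot>\<^sub>1 (?\<rho> \<cdot>\<^sub>1 u)"
      using arg_cong[OF E.assoc_square_eq[OF E.tensor_ract_square[of ?M ?N]], of "\<lambda>t. t \<cdot>\<^sub>1 u"] by simp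
    finally show ?thesis
      by (rule epi_arrowD[OF E.epi_q_vid[of ?M ?N ?t], rotated 5]) simp_all
  qed
  show "is_bicell E (bar_lax D E q F m n)"
    by (rule E.is_bicellI) (simp_all add: eq left right)
qed

abbreviation "H \<equiv> bar_fun D E q F"

lemma fo_bar [simp]: "x \<in> Obj (cat0 D) \<Longrightarrow> fo H x = ob x"
  and fa_bar [simp]: "f \<in> Arr (cat0 D) \<Longrightarrow> fa H f = arr f"
  and fp_bar [simp]: "m \<in> Obj (cat1 D) \<Longrightarrow> fp H m = pro m"
  and fc_bar [simp]: "\<theta> \<in> Arr (cat1 D) \<Longrightarrow> fc H \<theta> = cell \<theta>"
  and lax_bar [simp]: "\<lbrakk>m \<in> Obj (cat1 D); n \<in> Obj (cat1 D); ptgt D m = psrc D n\<rbrakk>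
    \<Longrightarrow> lax H m n = bar_lax D E q F m n"
  and un_bar [simp]: "x \<in> Obj (cat0 D) \<Longrightarrow> un H x = bicell_id E (unit_bimod (ob x))"
  by (simp_all add: bar_fun_def restrict_laxfun_def composable_def)

lemma restrict_bar [simp]: "restrict_laxfun D H = H"
  by (simp add: bar_fun_def)

lemma unitary_bar: "unitary D (Mod E q) H"
  by (simp add: unitary_def)

lemma cat_functor_bar: "cat_functor (cat0 D) (cat0 (Mod E q)) (fo H) (fa H)"
    "cat_functor (cat1 D) (cat1 (Mod E q)) (fp H) (fc H)"
proof -
  show "cat_functor (cat0 D) (cat0 (Mod E q)) (fo H) (fa H)"
    by (intro cat_functor.intro cat_functor_axioms.intro D.source.B.category_axioms E.category_cat0_Mod)
      (auto simp: Hom_def intro!: cofun.equality)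
  show "cat_functor (cat1 D) (cat1 (Mod E q)) (fp H) (fc H)"
    by (intro cat_functor.intro cat_functor_axioms.intro D.source.A.category_axioms E.category_cat1_Mod)
      (auto simp: Hom_def intro!: bicell.equality cofun.equality)
qed

text \<open>Behind the epic \<open>q (pro m) (pro n)\<close> this is naturality of the laxators of
  \<open>F\<close>, since \<open>q\<close> converts a tensor of cells into an external
  composite.\<close>

lemma bar_lax_natural:
  assumes \<alpha>: "\<alpha> \<in> Cells D m m' f g" and \<beta>: "\<beta> \<in> Cells D n n' g h"
  shows "bicell_comp E (tensor_cell E q (cell \<alpha>) (cell \<beta>)) (bar_lax D E q F m' n')
    = bicell_comp E (bar_lax D E q F m n) (cell (\<alpha> \<odot>\<^bsub>D\<^esub> \<beta>))"
proof -
  note [simp] = D.Cells_D[OF \<alpha>] D.Cells_D(1-9,12,13)[OF \<beta>]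
  have [simp]: "ptgt D m = psrc D n" "ptgt D m' = psrc D n'"
    using D.psrc_cod_eq[of \<alpha> \<beta>] by (auto simp del: D.ptgt_dom)
  let ?T = "tensor_cell E q (cell \<alpha>) (cell \<beta>)" and ?k = "\<lambda>m n. bc_cell (bar_lax D E q F m n)"
  have T: "is_bicell E ?T"
    by (rule E.is_bicell_tensor) simp_all
  note [simp] = E.bc_cell[OF T] E.dom_bc_cell[OF T] E.cod_bc_cell[OF T]
    E.bc_cell[OF is_bicell_bar_lax] E.dom_bc_cell[OF is_bicell_bar_lax] E.cod_bc_cell[OF is_bicell_bar_lax]
  have "q (pro m) (pro n) \<cdot>\<^sub>1 (bc_cell ?T \<cdot>\<^sub>1 ?k m' n') = (q (pro m) (pro n) \<cdot>\<^sub>1 bc_cell ?T) \<cdot>\<^sub>1 ?k m' n'"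
    by simp
  also have "\<dots> = (fc F \<alpha> \<odot> fc F \<beta>) \<cdot>\<^sub>1 (q (pro m') (pro n') \<cdot>\<^sub>1 ?k m' n')"
    using E.q_tensor_cell[of "cell \<alpha>" "cell \<beta>"] by simp
  also have "\<dots> = (q (pro m) (pro n) \<cdot>\<^sub>1 ?k m n) \<cdot>\<^sub>1 fc F (\<alpha> \<odot>\<^bsub>D\<^esub> \<beta>)"
    by (simp add: q_bar_lax F.lax_nat)
  finally have "q (pro m) (pro n) \<cdot>\<^sub>1 (bc_cell ?T \<cdot>\<^sub>1 ?k m' n')
      = q (pro m) (pro n) \<cdot>\<^sub>1 (?k m n \<cdot>\<^sub>1 fc F (\<alpha> \<odot>\<^bsub>D\<^esub> \<beta>))"
    by simp
  then have "bc_cell ?T \<cdot>\<^sub>1 ?k m' n' = ?k m n \<cdot>\<^sub>1 fc F (\<alpha> \<odot>\<^bsub>D\<^esub> \<beta>)"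
    by (rule epi_arrowD[OF E.epi_q[of "pro m" "pro n"], rotated 3]) simp_all
  then show ?thesis
    by (intro E.bicell_eqI) simp_all
qed

text \<open>Precomposed with the two coequalizer cells that determine the associator of Mod(E), both
  sides become the two sides of the associativity axiom for \<open>F\<close>; the coequalizer cells
  are then cancelled one after the other.\<close>

lemma bar_lax_assoc:
  assumes [simp]: "m \<in> Obj (cat1 D)" "n \<in> Obj (cat1 D)" "p \<in> Obj (cat1 D)"
    "ptgt D m = psrc D n" "ptgt D n = psrc D p"
  shows "bicell_comp E (bicell_comp E (tensor_cell E q (bar_lax D E q F m n) (bicell_id E (pro p)))
        (bar_lax D E q F (m \<odot>\<^sub>p\<^bsub>D\<^esub> n) p)) (cell (assoc D m n p))
    = bicell_comp E (bicell_comp E (tensor_assoc E q (pro m) (pro n) (pro p))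
        (tensor_cell E q (bicell_id E (pro m)) (bar_lax D E q F n p))) (bar_lax D E q F m (n \<odot>\<^sub>p\<^bsub>D\<^esub> p))"
    (is "bicell_comp E (bicell_comp E ?T ?L) ?c = bicell_comp E (bicell_comp E ?a ?S) ?R")
proof (rule E.bicell_eqI)
  have [simp]: "psrc D m \<in> Obj (cat0 D)" "psrc D n \<in> Obj (cat0 D)" "psrc D p \<in> Obj (cat0 D)"
    "ptgt D p \<in> Obj (cat0 D)"
    using D.source.obj_closed D.target.obj_closed by simp_all
  have T: "is_bicell E ?T" "is_bicell E ?S"
    by (rule E.is_bicell_tensor; simp)+
  let ?k = "\<lambda>m n. bc_cell (bar_lax D E q F m n)"
  let ?q2 = "q (tensor E q (pro m) (pro n)) (pro p)" and ?q3 = "q (pro m) (tensor E q (pro n) (pro p))"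
    and ?q1 = "q (pro m) (pro n) \<odot> \<one>\<^sub>1 (fp F p)"
  have qT: "?q2 \<cdot>\<^sub>1 bc_cell ?T = (?k m n \<odot> \<one>\<^sub>1 (fp F p)) \<cdot>\<^sub>1 q (pro (m \<odot>\<^sub>p\<^bsub>D\<^esub> n)) (pro p)"
    using E.q_tensor_cell[of "bar_lax D E q F m n" "bicell_id E (pro p)"] by simp
  have qS: "?q3 \<cdot>\<^sub>1 bc_cell ?S = (\<one>\<^sub>1 (fp F m) \<odot> ?k n p) \<cdot>\<^sub>1 q (pro m) (pro (n \<odot>\<^sub>p\<^bsub>D\<^esub> p))"
    using E.q_tensor_cell[of "bicell_id E (pro m)" "bar_lax D E q F n p"] by simp
  have a: "bc_cell ?a \<in> Glob E (tensor_pro E q (tensor E q (pro m) (pro n)) (pro p))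
      (tensor_pro E q (pro m) (tensor E q (pro n) (pro p)))"
    and qa: "?q1 \<cdot>\<^sub>1 (?q2 \<cdot>\<^sub>1 bc_cell ?a)
      = assoc E (fp F m) (fp F n) (fp F p) \<cdot>\<^sub>1 ((\<one>\<^sub>1 (fp F m) \<odot> q (pro n) (pro p)) \<cdot>\<^sub>1 ?q3)"
    using E.tensor_assoc_cell[of "pro m" "pro n" "pro p"] by simp_all
  note [simp] = E.Glob_D(1-5)[OF a] T
  have "?q1 \<cdot>\<^sub>1 (?q2 \<cdot>\<^sub>1 (bc_cell ?T \<cdot>\<^sub>1 (bc_cell ?L \<cdot>\<^sub>1 fc F (assoc D m n p))))
      = ?q1 \<cdot>\<^sub>1 ((?q2 \<cdot>\<^sub>1 bc_cell ?T) \<cdot>\<^sub>1 (bc_cell ?L \<cdot>\<^sub>1 fc F (assoc D m n p)))"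
    by simp
  also have "\<dots> = ((q (pro m) (pro n) \<cdot>\<^sub>1 ?k m n) \<odot> \<one>\<^sub>1 (fp F p))
      \<cdot>\<^sub>1 ((q (pro (m \<odot>\<^sub>p\<^bsub>D\<^esub> n)) (pro p) \<cdot>\<^sub>1 bc_cell ?L) \<cdot>\<^sub>1 fc F (assoc D m n p))"
    unfolding qT by (simp add: E.hcomp_vcomp')
  also have "\<dots> = (lax F m n \<odot> \<one>\<^sub>1 (fp F p)) \<cdot>\<^sub>1 lax F (m \<odot>\<^sub>p\<^bsub>D\<^esub> n) p \<cdot>\<^sub>1 fc F (assoc D m n p)"
    by (simp add: q_bar_lax)
  also have "\<dots> = assoc E (fp F m) (fp F n) (fp F p) \<cdot>\<^sub>1 (\<one>\<^sub>1 (fp F m) \<odot> lax F n p)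
            \<cdot>\<^sub>1 lax F m (n \<odot>\<^sub>p\<^bsub>D\<^esub> p)"
    by (rule F.lax_assoc[of m "psrc D m" "ptgt D m" n "ptgt D n" p "ptgt D p"]) (simp_all add: Pro_def)
  also have "\<dots> = assoc E (fp F m) (fp F n) (fp F p)
      \<cdot>\<^sub>1 ((\<one>\<^sub>1 (fp F m) \<odot> (q (pro n) (pro p) \<cdot>\<^sub>1 ?k n p)) \<cdot>\<^sub>1 (q (pro m) (pro (n \<odot>\<^sub>p\<^bsub>D\<^esub> p)) \<cdot>\<^sub>1 bc_cell ?R))"
    by (simp add: q_bar_lax)
  also have "\<dots> = assoc E (fp F m) (fp F n) (fp F p)
      \<cdot>\<^sub>1 ((\<one>\<^sub>1 (fp F m) \<odot> q (pro n) (pro p)) \<cdot>\<^sub>1 ((?q3 \<cdot>\<^sub>1 bc_cell ?S) \<cdot>\<^sub>1 bc_cell ?R))"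
    unfolding qS by (simp add: E.hcomp_vcomp')
  also have "\<dots> = (assoc E (fp F m) (fp F n) (fp F p)
      \<cdot>\<^sub>1 ((\<one>\<^sub>1 (fp F m) \<odot> q (pro n) (pro p)) \<cdot>\<^sub>1 ?q3)) \<cdot>\<^sub>1 (bc_cell ?S \<cdot>\<^sub>1 bc_cell ?R)"
    by simp
  also have "\<dots> = ?q1 \<cdot>\<^sub>1 (?q2 \<cdot>\<^sub>1 (bc_cell ?a \<cdot>\<^sub>1 (bc_cell ?S \<cdot>\<^sub>1 bc_cell ?R)))"
    unfolding qa[symmetric] by simp
  finally have "?q2 \<cdot>\<^sub>1 (bc_cell ?T \<cdot>\<^sub>1 (bc_cell ?L \<cdot>\<^sub>1 fc F (assoc D m n p)))
      = ?q2 \<cdot>\<^sub>1 (bc_cell ?a \<cdot>\<^sub>1 (bc_cell ?S \<cdot>\<^sub>1 bc_cell ?R))"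
    by (rule epi_arrowD[OF E.epi_q_vid[of "pro m" "pro n" "fp F p"], rotated 5]) simp_all
  then have "bc_cell ?T \<cdot>\<^sub>1 (bc_cell ?L \<cdot>\<^sub>1 fc F (assoc D m n p))
      = bc_cell ?a \<cdot>\<^sub>1 (bc_cell ?S \<cdot>\<^sub>1 bc_cell ?R)"
    by (rule epi_arrowD[OF E.epi_q[of "tensor E q (pro m) (pro n)" "pro p"], rotated 3]) simp_all
  then show "bc_cell (bicell_comp E (bicell_comp E ?T ?L) ?c) = bc_cell (bicell_comp E (bicell_comp E ?a ?S) ?R)"
    by simp
  show "bc_src (bicell_comp E (bicell_comp E ?T ?L) ?c) = bc_src (bicell_comp E (bicell_comp E ?a ?S) ?R)"
    "bc_tgt (bicell_comp E (bicell_comp E ?T ?L) ?c) = bc_tgt (bicell_comp E (bicell_comp E ?a ?S) ?R)"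
    by (auto intro!: cofun.equality)
qed simp_all

text \<open>Behind \<open>q\<close> the unit isomorphism of Mod(E) becomes the left action on
  \<open>pro m\<close>, which was defined as the laxator at the identity followed by the image of
  \<open>lunit D m\<close>.\<close>

lemma bar_lunit:
  assumes [simp]: "m \<in> Obj (cat1 D)" and x: "psrc D m = x"
  shows "bicell_comp E (bicell_comp E (tensor_cell E q (bicell_id E (unit_bimod (ob x))) (bicell_id E (pro m)))
      (bar_lax D E q F (pid D x) m)) (cell (lunit D m)) = tensor_lunit E q (pro m)"
    (is "bicell_comp E (bicell_comp E ?T ?L) ?c = ?R")
proof (rule E.bicell_eqI)
  note [simp] = x
  have [simp]: "x \<in> Obj (cat0 D)" "ptgt D m \<in> Obj (cat0 D)"
    using D.source.obj_closed[of m] D.target.obj_closed[of m] by simp_all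
  have T: "is_bicell E ?T"
    by (rule E.is_bicell_tensor) simp_all
  have R: "is_bicell E ?R" and Rs: "bc_dom ?R = tensor E q (unit_bimod (ob x)) (pro m)" "bc_cod ?R = pro m"
    "bc_src ?R = cofun_id E (ob x)" "bc_tgt ?R = cofun_id E (ob (ptgt D m))"
    using E.inverse_tensor_lunit[of "pro m"] by (simp_all add: inverse_arrows_def tensor_lunit_def Let_def)
  let ?q = "q (unit_bimod (ob x)) (pro m)"
  have qT: "?q \<cdot>\<^sub>1 bc_cell ?T = ?q"
    using E.q_tensor_cell[of "bicell_id E (unit_bimod (ob x))" "bicell_id E (pro m)"] by (simp add: E.hcomp_vid)
  note [simp] = T R Rs
  have "?q \<cdot>\<^sub>1 (bc_cell ?T \<cdot>\<^sub>1 (bc_cell ?L \<cdot>\<^sub>1 fc F (lunit D m)))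
      = ((?q \<cdot>\<^sub>1 bc_cell ?T) \<cdot>\<^sub>1 bc_cell ?L) \<cdot>\<^sub>1 fc F (lunit D m)"
    by simp
  also have "\<dots> = ?q \<cdot>\<^sub>1 bc_cell ?R"
    unfolding qT using q_bar_lax[of "pid D x" m] E.q_tensor_lunit[of "pro m"]
    by (simp add: lax_id_left_def)
  finally have "bc_cell ?T \<cdot>\<^sub>1 (bc_cell ?L \<cdot>\<^sub>1 fc F (lunit D m)) = bc_cell ?R"
    by (rule epi_arrowD[OF E.epi_q[of "unit_bimod (ob x)" "pro m"], rotated 3]) simp_all
  then show "bc_cell (bicell_comp E (bicell_comp E ?T ?L) ?c) = bc_cell ?R"
    by simp
  show "bc_dom (bicell_comp E (bicell_comp E ?T ?L) ?c) = bc_dom ?R"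
    "bc_cod (bicell_comp E (bicell_comp E ?T ?L) ?c) = bc_cod ?R"
    "bc_src (bicell_comp E (bicell_comp E ?T ?L) ?c) = bc_src ?R"
    "bc_tgt (bicell_comp E (bicell_comp E ?T ?L) ?c) = bc_tgt ?R"
    by (auto intro!: cofun.equality)
qed

lemma bar_runit:
  assumes [simp]: "m \<in> Obj (cat1 D)" and y: "ptgt D m = y"
  shows "bicell_comp E (bicell_comp E (tensor_cell E q (bicell_id E (pro m)) (bicell_id E (unit_bimod (ob y))))
      (bar_lax D E q F m (pid D y))) (cell (runit D m)) = tensor_runit E q (pro m)"
    (is "bicell_comp E (bicell_comp E ?T ?L) ?c = ?R")
proof (rule E.bicell_eqI)
  note [simp] = y
  have [simp]: "y \<in> Obj (cat0 D)" "psrc D m \<in> Obj (cat0 D)"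
    using D.source.obj_closed[of m] D.target.obj_closed[of m] by simp_all
  have T: "is_bicell E ?T"
    by (rule E.is_bicell_tensor) simp_all
  have R: "is_bicell E ?R" and Rs: "bc_dom ?R = tensor E q (pro m) (unit_bimod (ob y))" "bc_cod ?R = pro m"
    "bc_src ?R = cofun_id E (ob (psrc D m))" "bc_tgt ?R = cofun_id E (ob y)"
    using E.inverse_tensor_runit[of "pro m"] by (simp_all add: inverse_arrows_def tensor_runit_def Let_def)
  let ?q = "q (pro m) (unit_bimod (ob y))"
  have qT: "?q \<cdot>\<^sub>1 bc_cell ?T = ?q"
    using E.q_tensor_cell[of "bicell_id E (pro m)" "bicell_id E (unit_bimod (ob y))"] by (simp add: E.hcomp_vid)
  note [simp] = T R Rs
  have "?q \<cdot>\<^sub>1 (bc_cell ?T \<cdot>\<^sub>1 (bc_cell ?L \<cdot>\<^sub>1 fc F (runit D m)))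
      = ((?q \<cdot>\<^sub>1 bc_cell ?T) \<cdot>\<^sub>1 bc_cell ?L) \<cdot>\<^sub>1 fc F (runit D m)"
    by simp
  also have "\<dots> = ?q \<cdot>\<^sub>1 bc_cell ?R"
    unfolding qT using q_bar_lax[of m "pid D y"] E.q_tensor_runit[of "pro m"]
    by (simp add: lax_id_right_def)
  finally have "bc_cell ?T \<cdot>\<^sub>1 (bc_cell ?L \<cdot>\<^sub>1 fc F (runit D m)) = bc_cell ?R"
    by (rule epi_arrowD[OF E.epi_q[of "pro m" "unit_bimod (ob y)"], rotated 3]) simp_all
  then show "bc_cell (bicell_comp E (bicell_comp E ?T ?L) ?c) = bc_cell ?R"
    by simp
  show "bc_dom (bicell_comp E (bicell_comp E ?T ?L) ?c) = bc_dom ?R"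
    "bc_cod (bicell_comp E (bicell_comp E ?T ?L) ?c) = bc_cod ?R"
    "bc_src (bicell_comp E (bicell_comp E ?T ?L) ?c) = bc_src ?R"
    "bc_tgt (bicell_comp E (bicell_comp E ?T ?L) ?c) = bc_tgt ?R"
    by (auto intro!: cofun.equality)
qed

lemma lax_functor_bar: "lax_functor D (Mod E q) H"
proof (intro lax_functor.intro lax_functor_axioms.intro cat_functor_bar restrict_bar)
  fix m x y assume "m \<in> Pro D x y"
  then have m: "m \<in> Obj (cat1 D)" "psrc D m = x" "ptgt D m = y"
    by (auto simp: Pro_def)
  have xy: "x \<in> Obj (cat0 D)" "y \<in> Obj (cat0 D)"
    using D.source.obj_closed[of m] D.target.obj_closed[of m] m by simp_all
  show "fp H m \<in> Pro (Mod E q) (fo H x) (fo H y)"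
    using m xy by (simp add: E.Pro_Mod_iff)
  show "(un H x \<odot>\<^bsub>Mod E q\<^esub> \<one>\<^sub>1\<^bsub>Mod E q\<^esub> (fp H m)) \<cdot>\<^sub>1\<^bsub>Mod E q\<^esub> lax H (pid D x) m
      \<cdot>\<^sub>1\<^bsub>Mod E q\<^esub> fc H (lunit D m) = lunit (Mod E q) (fp H m)"
    using m xy bar_lunit[of m x] by simp
  show "(\<one>\<^sub>1\<^bsub>Mod E q\<^esub> (fp H m) \<odot>\<^bsub>Mod E q\<^esub> un H y) \<cdot>\<^sub>1\<^bsub>Mod E q\<^esub> lax H m (pid D y)
      \<cdot>\<^sub>1\<^bsub>Mod E q\<^esub> fc H (runit D m) = runit (Mod E q) (fp H m)"
    using m xy bar_runit[of m y] by simp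
next
  fix \<alpha> m n f g assume \<alpha>: "\<alpha> \<in> Cells D m n f g"
  show "fc H \<alpha> \<in> Cells (Mod E q) (fp H m) (fp H n) (fa H f) (fa H g)"
    using D.Cells_D[OF \<alpha>] by (simp add: E.Cells_Mod_iff)
next
  fix m n x y z assume "m \<in> Pro D x y" "n \<in> Pro D y z"
  then show "lax H m n \<in> Glob (Mod E q) (fp H m \<odot>\<^sub>p\<^bsub>Mod E q\<^esub> fp H n) (fp H (m \<odot>\<^sub>p\<^bsub>D\<^esub> n))"
    by (auto simp: E.Glob_Mod_iff Pro_def)
next
  fix x assume "x \<in> Obj (cat0 D)"
  then show "un H x \<in> Glob (Mod E q) (pid (Mod E q) (fo H x)) (fp H (pid D x))"
    by (simp add: E.Glob_Mod_iff)
next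
  fix \<alpha> \<beta> m m' n n' f g h assume *: "\<alpha> \<in> Cells D m m' f g" "\<beta> \<in> Cells D n n' g h"
  note [simp] = D.Cells_D[OF *(1)] D.Cells_D(1-9,12,13)[OF *(2)]
  have [simp]: "ptgt D m = psrc D n" "ptgt D m' = psrc D n'"
    using D.psrc_cod_eq[of \<alpha> \<beta>] by (auto simp del: D.ptgt_dom)
  show "(fc H \<alpha> \<odot>\<^bsub>Mod E q\<^esub> fc H \<beta>) \<cdot>\<^sub>1\<^bsub>Mod E q\<^esub> lax H m' n' = lax H m n \<cdot>\<^sub>1\<^bsub>Mod E q\<^esub> fc H (\<alpha> \<odot>\<^bsub>D\<^esub> \<beta>)"
    using bar_lax_natural[OF *] by simp
next
  fix f x y assume "f \<in> Hom (cat0 D) x y"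
  then have f: "f \<in> Arr (cat0 D)" "Dom (cat0 D) f = x" "Cod (cat0 D) f = y"
    by (auto simp: Hom_def)
  have xy: "x \<in> Obj (cat0 D)" "y \<in> Obj (cat0 D)"
    using D.source.B.dom_closed[of f] D.source.B.cod_closed[of f] f by simp_all
  show "cid (Mod E q) (fa H f) \<cdot>\<^sub>1\<^bsub>Mod E q\<^esub> un H y = un H x \<cdot>\<^sub>1\<^bsub>Mod E q\<^esub> fc H (cid D f)"
    using f xy by simp
next
  fix m n p w x y z assume *: "m \<in> Pro D w x" "n \<in> Pro D x y" "p \<in> Pro D y z"
  then show "(lax H m n \<odot>\<^bsub>Mod E q\<^esub> \<one>\<^sub>1\<^bsub>Mod E q\<^esub> (fp H p)) \<cdot>\<^sub>1\<^bsub>Mod E q\<^esub> lax H (m \<odot>\<^sub>p\<^bsub>D\<^esub> n) p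
        \<cdot>\<^sub>1\<^bsub>Mod E q\<^esub> fc H (assoc D m n p)
      = assoc (Mod E q) (fp H m) (fp H n) (fp H p)
        \<cdot>\<^sub>1\<^bsub>Mod E q\<^esub> (\<one>\<^sub>1\<^bsub>Mod E q\<^esub> (fp H m) \<odot>\<^bsub>Mod E q\<^esub> lax H n p)
        \<cdot>\<^sub>1\<^bsub>Mod E q\<^esub> lax H m (n \<odot>\<^sub>p\<^bsub>D\<^esub> p)"
    using bar_lax_assoc[of m n p] by (simp add: Pro_def)
qed

lemma unitary_lax_bar: "unitary_lax D E q H"
  by (intro unitary_lax.intro unitary_lax_axioms.intro mod_lax_axioms lax_functor_bar unitary_bar)

sublocale H: unitary_lax D E q H
  by (rule unitary_lax_bar)

lemma eps_bar: "eps_fun D E q H = F"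
proof (rule laxfun_eqI)
  show "restrict_laxfun D (eps_fun D E q H) = eps_fun D E q H" "restrict_laxfun D F = F"
    by (simp_all add: F.extensional)
qed (simp_all add: q_bar_lax)

end

section \<open>Recovering a unitary lax functor from its underlying data\<close>

context unitary_lax
begin

lemma lax_bar_eps: "lax_bar D E q F"
  by (intro lax_bar.intro mod_lax_axioms F.lax_fun_axioms)

text \<open>Unitarity identifies the image of an identity proarrow with the unit bimodule of
  \<open>fo H x\<close>, so the reconstructed category object is \<open>fo H x\<close> itself;
  \<open>eps_left\<close> and \<open>eps_right\<close> then return the original actions.\<close>

lemma bar_eps: "bar_fun D E q F = H"
proof -
  interpret B: lax_bar D E q F by (rule lax_bar_eps)
  have ob [simp]: "B.ob x = fo H x" if "x \<in> Obj (cat0 D)" for x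
    by (rule catobj.equality) (use that in simp_all)
  have arr [simp]: "B.arr f = fa H f" if "f \<in> Arr (cat0 D)" for f
    by (rule cofun.equality) (use that in simp_all)
  have pro [simp]: "B.pro m = fp H m" if "m \<in> Obj (cat1 D)" for m
    by (rule bimod.equality) (use that D.source.obj_closed[of m] D.target.obj_closed[of m] in simp_all)
  show ?thesis
  proof (rule laxfun_eqI)
    show "restrict_laxfun D (bar_fun D E q F) = bar_fun D E q F" "restrict_laxfun D H = H"
      by (simp_all add: lax_functor.extensional[OF H])
  next
    fix \<alpha> assume [simp]: "\<alpha> \<in> Arr (cat1 D)"
    have "B.cell \<alpha> = fc H \<alpha>"
      by (rule bicell.equality) simp_all
    then show "fc (bar_fun D E q F) \<alpha> = fc H \<alpha>"
      by simp
  next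
    fix m n assume mn: "m \<in> Obj (cat1 D)" "n \<in> Obj (cat1 D)" "ptgt D m = psrc D n"
    note [simp] = mn
    have [simp]: "psrc D m \<in> Obj (cat0 D)" "psrc D n \<in> Obj (cat0 D)" "ptgt D n \<in> Obj (cat0 D)"
      using D.source.obj_closed D.target.obj_closed by simp_all
    note b = B.is_bicell_bar_lax[OF mn]
    \<comment> \<open>Both laxators have the same composite with the coequalizer cell, namely the
      laxator of \<epsilon>H, and that cell is epic.\<close>
    have "q (fp H m) (fp H n) \<cdot>\<^sub>1 bc_cell (bar_lax D E q F m n) = q (fp H m) (fp H n) \<cdot>\<^sub>1 bc_cell (lax H m n)"
      using B.q_bar_lax[OF mn] by simp
    then have "bc_cell (bar_lax D E q F m n) = bc_cell (lax H m n)"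
      by (rule epi_arrowD[OF E.epi_q[of "fp H m" "fp H n"], rotated 3]) (use b in simp_all)
    then have "bar_lax D E q F m n = lax H m n"
      by (intro E.bicell_eqI) simp_all
    then show "lax (bar_fun D E q F) m n = lax H m n"
      by simp
  qed simp_all
qed

end


section \<open>Comparing the axioms of transformations in Mod(E) and in E\<close>

section \<open>The bijection on transformations\<close>

context mod_setup
begin

text \<open>Computes a left product formed in Mod(E). The inverse unit isomorphism is a unit
  insertion followed by \<open>q\<close>, and \<open>q\<close> turns the tensor into an external
  composite; what remains is a left product in E whose acting cell has been restricted along the
  unit of \<open>X\<close>.\<close>

lemma
  assumes [simp]: "is_bicell E A" "is_bicell E B" "is_bicell E L" "bc_tgt A = bc_src B"
    and X: "bc_dom A = unit_bimod X" "bm_src (bc_dom B) = X"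
    and L: "bc_dom L = tensor E q (bc_cod A) (bc_cod B)"
      "bc_src L = cofun_id E (bm_src (bc_cod A))" "bc_tgt L = cofun_id E (bm_tgt (bc_cod B))"
  defines "C \<equiv> bicell_comp E (bicell_comp E (inv_arrow (cat1 (Mod E q)) (tensor_lunit E q (bc_dom B)))
      (tensor_cell E q A B)) L"
  shows is_bicell_lcomp: "is_bicell E C"
    and dom_Mod_lcomp: "bc_dom C = bc_dom B"
    and cod_Mod_lcomp: "bc_cod C = bc_cod L"
    and src_Mod_lcomp: "bc_src C = bc_src A"
    and tgt_Mod_lcomp: "bc_tgt C = bc_tgt B"
    and cell_Mod_lcomp: "bc_cell C = lcomp (q (bc_cod A) (bc_cod B) \<cdot>\<^sub>1 bc_cell L) (co_unit X \<cdot>\<^sub>1 bc_cell A) (bc_cell B)"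
proof -
  note match [simp] = bicell_match[OF assms(1,2,4)]
  note [simp] = X L
  have [simp]: "is_catobj E X"
    using bm_src[OF bc_dom[OF assms(2)]] by simp
  let ?M = "bc_dom B" and ?T = "tensor_cell E q A B"
  let ?d = "glob_bicell E ?M (tensor E q (unit_bimod X) ?M)
        (inv\<^sub>1 (lunit E (bm_pro ?M)) \<cdot>\<^sub>1 ((co_unit X \<odot> \<one>\<^sub>1 (bm_pro ?M)) \<cdot>\<^sub>1 q (unit_bimod X) ?M))"
  have d: "inverse_arrows (cat1 (Mod E q)) (tensor_lunit E q ?M) ?d"
    using inverse_tensor_lunit[of ?M] by simp
  have inv [simp]: "inv_arrow (cat1 (Mod E q)) (tensor_lunit E q ?M) = ?d"
    by (rule category.inv_arrow_eq[OF category_cat1_Mod d])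
  have "?d \<in> Arr (cat1 (Mod E q))"
    using d unfolding inverse_arrows_def Hom_def by blast
  then have [simp]: "is_bicell E ?d"
    by simp
  have T [simp]: "is_bicell E ?T"
    by (rule is_bicell_tensor) simp_all
  have [simp]: "cf_dom (bc_src A) = X"
    using cf_dom_bc_src[OF assms(1)] by simp
  show "is_bicell E C" "bc_dom C = ?M" "bc_cod C = bc_cod L"
    by (simp_all add: C_def)
  show "bc_src C = bc_src A" "bc_tgt C = bc_tgt B"
    by (auto simp: C_def intro!: cofun.equality)
  have qT: "q (unit_bimod X) ?M \<cdot>\<^sub>1 bc_cell ?T = (bc_cell A \<odot> bc_cell B) \<cdot>\<^sub>1 q (bc_cod A) (bc_cod B)"
    using q_tensor_cell[OF assms(1,2,4)] by simp
  have "bc_cell C = inv\<^sub>1 (lunit E (bm_pro ?M)) \<cdot>\<^sub>1 ((co_unit X \<odot> \<one>\<^sub>1 (bm_pro ?M))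
      \<cdot>\<^sub>1 ((q (unit_bimod X) ?M \<cdot>\<^sub>1 bc_cell ?T) \<cdot>\<^sub>1 bc_cell L))"
    by (simp add: C_def)
  also have "\<dots> = lcomp (q (bc_cod A) (bc_cod B) \<cdot>\<^sub>1 bc_cell L) (co_unit X \<cdot>\<^sub>1 bc_cell A) (bc_cell B)"
    unfolding qT by (simp add: lcomp_def hcomp_vcomp')
  finally show "bc_cell C = lcomp (q (bc_cod A) (bc_cod B) \<cdot>\<^sub>1 bc_cell L) (co_unit X \<cdot>\<^sub>1 bc_cell A) (bc_cell B)" .
qed

lemma
  assumes [simp]: "is_bicell E A" "is_bicell E B" "is_bicell E L" "bc_tgt A = bc_src B"
    and X: "bc_dom B = unit_bimod X" "bm_tgt (bc_dom A) = X"
    and L: "bc_dom L = tensor E q (bc_cod A) (bc_cod B)"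
      "bc_src L = cofun_id E (bm_src (bc_cod A))" "bc_tgt L = cofun_id E (bm_tgt (bc_cod B))"
  defines "C \<equiv> bicell_comp E (bicell_comp E (inv_arrow (cat1 (Mod E q)) (tensor_runit E q (bc_dom A)))
      (tensor_cell E q A B)) L"
  shows dom_Mod_rcomp: "bc_dom C = bc_dom A"
    and cod_Mod_rcomp: "bc_cod C = bc_cod L"
    and src_Mod_rcomp: "bc_src C = bc_src A"
    and tgt_Mod_rcomp: "bc_tgt C = bc_tgt B"
    and cell_Mod_rcomp: "bc_cell C = rcomp (q (bc_cod A) (bc_cod B) \<cdot>\<^sub>1 bc_cell L) (bc_cell A) (co_unit X \<cdot>\<^sub>1 bc_cell B)"
proof -
  note match [simp] = bicell_match(2)[OF assms(1,2,4)]
  note [simp] = X L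
  have [simp]: "is_catobj E X"
    using bm_tgt[OF bc_dom[OF assms(1)]] by simp
  let ?M = "bc_dom A" and ?T = "tensor_cell E q A B"
  let ?d = "glob_bicell E ?M (tensor E q ?M (unit_bimod X))
        (inv\<^sub>1 (runit E (bm_pro ?M)) \<cdot>\<^sub>1 ((\<one>\<^sub>1 (bm_pro ?M) \<odot> co_unit X) \<cdot>\<^sub>1 q ?M (unit_bimod X)))"
  have d: "inverse_arrows (cat1 (Mod E q)) (tensor_runit E q ?M) ?d"
    using inverse_tensor_runit[of ?M] by simp
  have inv [simp]: "inv_arrow (cat1 (Mod E q)) (tensor_runit E q ?M) = ?d"
    by (rule category.inv_arrow_eq[OF category_cat1_Mod d])
  have "?d \<in> Arr (cat1 (Mod E q))"
    using d unfolding inverse_arrows_def Hom_def by blast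
  then have [simp]: "is_bicell E ?d"
    by simp
  have T [simp]: "is_bicell E ?T"
    by (rule is_bicell_tensor) simp_all
  have [simp]: "cf_dom (bc_tgt B) = X"
    using cf_dom_bc_tgt[OF assms(2)] by simp
  show "bc_dom C = ?M" "bc_cod C = bc_cod L"
    by (simp_all add: C_def)
  show "bc_src C = bc_src A" "bc_tgt C = bc_tgt B"
    by (auto simp: C_def intro!: cofun.equality)
  have qT: "q ?M (unit_bimod X) \<cdot>\<^sub>1 bc_cell ?T = (bc_cell A \<odot> bc_cell B) \<cdot>\<^sub>1 q (bc_cod A) (bc_cod B)"
    using q_tensor_cell[OF assms(1,2,4)] by simp
  have "bc_cell C = inv\<^sub>1 (runit E (bm_pro ?M)) \<cdot>\<^sub>1 ((\<one>\<^sub>1 (bm_pro ?M) \<odot> co_unit X)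
      \<cdot>\<^sub>1 ((q ?M (unit_bimod X) \<cdot>\<^sub>1 bc_cell ?T) \<cdot>\<^sub>1 bc_cell L))"
    by (simp add: C_def)
  also have "\<dots> = rcomp (q (bc_cod A) (bc_cod B) \<cdot>\<^sub>1 bc_cell L) (bc_cell A) (co_unit X \<cdot>\<^sub>1 bc_cell B)"
    unfolding qT by (simp add: rcomp_def hcomp_vcomp')
  finally show "bc_cell C = rcomp (q (bc_cod A) (bc_cod B) \<cdot>\<^sub>1 bc_cell L) (bc_cell A) (co_unit X \<cdot>\<^sub>1 bc_cell B)" .
qed

end

context unitary_lax
begin

text \<open>The laxator of \<open>H\<close> at an identity is accessible through its composite with
  \<open>q\<close>, which is an action; \<open>q_left_H\<close> and \<open>q_right_H\<close> are the
  facts that the computed products need.\<close>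

lemma
  assumes [simp]: "m \<in> Obj (cat1 D)"
  shows left_H [simp]: "is_bicell E (lax_id_left D (Mod E q) H m)"
    and dom_left_H [simp]: "bc_dom (lax_id_left D (Mod E q) H m) = tensor E q (unit_bimod (fo H (psrc D m))) (fp H m)"
    and cod_left_H [simp]: "bc_cod (lax_id_left D (Mod E q) H m) = fp H m"
    and src_left_H [simp]: "bc_src (lax_id_left D (Mod E q) H m) = cofun_id E (fo H (psrc D m))"
    and tgt_left_H [simp]: "bc_tgt (lax_id_left D (Mod E q) H m) = cofun_id E (fo H (ptgt D m))"
    and q_left_H [simp]: "q (unit_bimod (fo H (psrc D m))) (fp H m) \<cdot>\<^sub>1 bc_cell (lax_id_left D (Mod E q) H m)
      = bm_lact (fp H m)"
    and right_H [simp]: "is_bicell E (lax_id_right D (Mod E q) H m)"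
    and dom_right_H [simp]: "bc_dom (lax_id_right D (Mod E q) H m) = tensor E q (fp H m) (unit_bimod (fo H (ptgt D m)))"
    and cod_right_H [simp]: "bc_cod (lax_id_right D (Mod E q) H m) = fp H m"
    and src_right_H [simp]: "bc_src (lax_id_right D (Mod E q) H m) = cofun_id E (fo H (psrc D m))"
    and tgt_right_H [simp]: "bc_tgt (lax_id_right D (Mod E q) H m) = cofun_id E (fo H (ptgt D m))"
    and q_right_H [simp]: "q (fp H m) (unit_bimod (fo H (ptgt D m))) \<cdot>\<^sub>1 bc_cell (lax_id_right D (Mod E q) H m)
      = bm_ract (fp H m)"
proof -
  have [simp]: "psrc D m \<in> Obj (cat0 D)" "ptgt D m \<in> Obj (cat0 D)"
    using D.source.obj_closed[of m] D.target.obj_closed[of m] by simp_all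
  show "is_bicell E (lax_id_left D (Mod E q) H m)"
    "bc_dom (lax_id_left D (Mod E q) H m) = tensor E q (unit_bimod (fo H (psrc D m))) (fp H m)"
    "bc_cod (lax_id_left D (Mod E q) H m) = fp H m"
    "bc_src (lax_id_left D (Mod E q) H m) = cofun_id E (fo H (psrc D m))"
    "bc_tgt (lax_id_left D (Mod E q) H m) = cofun_id E (fo H (ptgt D m))"
    "is_bicell E (lax_id_right D (Mod E q) H m)"
    "bc_dom (lax_id_right D (Mod E q) H m) = tensor E q (fp H m) (unit_bimod (fo H (ptgt D m)))"
    "bc_cod (lax_id_right D (Mod E q) H m) = fp H m"
    "bc_src (lax_id_right D (Mod E q) H m) = cofun_id E (fo H (psrc D m))"
    "bc_tgt (lax_id_right D (Mod E q) H m) = cofun_id E (fo H (ptgt D m))"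
    by (simp_all add: lax_id_left_def lax_id_right_def)
  show "q (unit_bimod (fo H (psrc D m))) (fp H m) \<cdot>\<^sub>1 bc_cell (lax_id_left D (Mod E q) H m)
      = bm_lact (fp H m)"
    unfolding eps_left[OF assms, symmetric] by (simp add: lax_id_left_def del: eps_left)
  show "q (fp H m) (unit_bimod (fo H (ptgt D m))) \<cdot>\<^sub>1 bc_cell (lax_id_right D (Mod E q) H m)
      = bm_ract (fp H m)"
    unfolding eps_right[OF assms, symmetric] by (simp add: lax_id_right_def del: eps_right)
qed

lemma
  assumes [simp]: "x \<in> Obj (cat0 D)"
  shows id_id_H [simp]: "is_bicell E (lax_id_id D (Mod E q) H x)"
    and dom_id_id_H [simp]: "bc_dom (lax_id_id D (Mod E q) H x) = tensor E q (unit_bimod (fo H x)) (unit_bimod (fo H x))"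
    and cod_id_id_H [simp]: "bc_cod (lax_id_id D (Mod E q) H x) = unit_bimod (fo H x)"
    and src_id_id_H [simp]: "bc_src (lax_id_id D (Mod E q) H x) = cofun_id E (fo H x)"
    and tgt_id_id_H [simp]: "bc_tgt (lax_id_id D (Mod E q) H x) = cofun_id E (fo H x)"
    and q_id_id_H [simp]: "q (unit_bimod (fo H x)) (unit_bimod (fo H x)) \<cdot>\<^sub>1 bc_cell (lax_id_id D (Mod E q) H x)
      = co_mult (fo H x)"
  using left_H[of "pid D x"] dom_left_H[of "pid D x"] cod_left_H[of "pid D x"] src_left_H[of "pid D x"]
    tgt_left_H[of "pid D x"] q_left_H[of "pid D x"]
  by (simp_all add: lax_id_id_def del: left_H dom_left_H cod_left_H src_left_H tgt_left_H q_left_H)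

lemma bar_ob_eps [simp]: "x \<in> Obj (cat0 D) \<Longrightarrow> bar_ob D E F x = fo H x"
  and bar_arr_eps [simp]: "f \<in> Arr (cat0 D) \<Longrightarrow> bar_arr D E F f = fa H f"
  and bar_pro_eps [simp]: "m \<in> Obj (cat1 D) \<Longrightarrow> bar_pro D E F m = fp H m"
  using lax_bar.fo_bar[OF lax_bar_eps] lax_bar.fa_bar[OF lax_bar_eps] lax_bar.fp_bar[OF lax_bar_eps]
  by (simp_all add: bar_eps)

end

locale unitary_pair = mod_lax D E q + H: unitary_lax D E q H + K: unitary_lax D E q K
  for D :: "('o, 'a, 'p, 'c) dbl" and E :: "('o2, 'a2, 'p2, 'c2) dbl" (structure)
    and q :: "('o2, 'p2, 'c2) bimod \<Rightarrow> ('o2, 'p2, 'c2) bimod \<Rightarrow> 'c2"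
    and H K :: "('o, 'a, 'p, 'c, ('o2, 'p2, 'c2) catobj, ('o2, 'a2, 'p2, 'c2) cofun,
       ('o2, 'p2, 'c2) bimod, ('o2, 'a2, 'p2, 'c2) bicell) laxfun"

text \<open>Holds the typing of a candidate transformation and its value at identity proarrows,
  which is what a meaningful image in E requires. The remaining axioms are left open so that they
  can be compared with those of the image in both directions.\<close>

locale pre_nat = unitary_pair D E q H K
  for D :: "('o, 'a, 'p, 'c) dbl" and E :: "('o2, 'a2, 'p2, 'c2) dbl" (structure)
    and q :: "('o2, 'p2, 'c2) bimod \<Rightarrow> ('o2, 'p2, 'c2) bimod \<Rightarrow> 'c2"
    and H K :: "('o, 'a, 'p, 'c, ('o2, 'p2, 'c2) catobj, ('o2, 'a2, 'p2, 'c2) cofun,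
       ('o2, 'p2, 'c2) bimod, ('o2, 'a2, 'p2, 'c2) bicell) laxfun" +
  fixes \<alpha> :: "('o, 'a, 'p, 'c, ('o2, 'p2, 'c2) catobj, ('o2, 'a2, 'p2, 'c2) cofun,
       ('o2, 'p2, 'c2) bimod, ('o2, 'a2, 'p2, 'c2) bicell) laxtrans"
  assumes tdom [simp]: "tdom \<alpha> = H" and tcod [simp]: "tcod \<alpha> = K"
    and restrict: "restrict_laxtrans D \<alpha> = \<alpha>"
    and tob: "x \<in> Obj (cat0 D) \<Longrightarrow> is_cofun E (tob \<alpha> x) \<and> cf_dom (tob \<alpha> x) = fo H x \<and> cf_cod (tob \<alpha> x) = fo K x"
    and tpro: "m \<in> Obj (cat1 D) \<Longrightarrow> is_bicell E (tpro \<alpha> m) \<and> bc_dom (tpro \<alpha> m) = fp H m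
      \<and> bc_cod (tpro \<alpha> m) = fp K m \<and> bc_src (tpro \<alpha> m) = tob \<alpha> (psrc D m) \<and> bc_tgt (tpro \<alpha> m) = tob \<alpha> (ptgt D m)"
    and tarr: "f \<in> Arr (cat0 D) \<Longrightarrow> is_bicell E (tarr \<alpha> f) \<and> bc_dom (tarr \<alpha> f) = unit_bimod (fo H (Dom (cat0 D) f))
      \<and> bc_cod (tarr \<alpha> f) = unit_bimod (fo K (Cod (cat0 D) f))
      \<and> bc_src (tarr \<alpha> f) = cofun_comp E (tob \<alpha> (Dom (cat0 D) f)) (fa K f)
      \<and> bc_tgt (tarr \<alpha> f) = cofun_comp E (fa H f) (tob \<alpha> (Cod (cat0 D) f))"
    and tpro_pid [simp]: "x \<in> Obj (cat0 D) \<Longrightarrow> tpro \<alpha> (pid D x) = unit_bicell (tob \<alpha> x)"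
begin

declare tob [simp] tpro [simp] tarr [simp]

abbreviation "\<beta> \<equiv> eps_trans D E q \<alpha>"

lemma tdom_eps [simp]: "tdom \<beta> = H.F"
  and tcod_eps [simp]: "tcod \<beta> = K.F"
  and tob_eps [simp]: "x \<in> Obj (cat0 D) \<Longrightarrow> tob \<beta> x = cf_arr (tob \<alpha> x)"
  and tpro_eps [simp]: "m \<in> Obj (cat1 D) \<Longrightarrow> tpro \<beta> m = bc_cell (tpro \<alpha> m)"
  and tarr_eps [simp]: "f \<in> Arr (cat0 D) \<Longrightarrow>
    tarr \<beta> f = co_unit (fo H (Dom (cat0 D) f)) \<cdot>\<^sub>1 bc_cell (tarr \<alpha> f)"
  by (simp_all add: eps_trans_def restrict_laxtrans_def)

lemma restrict_eps_trans [simp]: "restrict_laxtrans D \<beta> = \<beta>"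
  by (simp add: eps_trans_def)

text \<open>
  On underlying cells, the conditions on \<open>\<alpha>\<close> are those on \<open>\<epsilon> * \<alpha>\<close>: precomposing the inverse unit
  isomorphism of \<open>Mod E q\<close> with the coequalizer cell inserts exactly the unit \<open>\<upsilon>\<close> that \<open>\<epsilon> * \<alpha>\<close> carries.
\<close>

abbreviation "Mod_left \<gamma> n f \<equiv> bicell_comp E (bicell_comp E
    (inv_arrow (cat1 (Mod E q)) (tensor_lunit E q (fp H (Dom (cat1 D) \<gamma>))))
    (tensor_cell E q (tarr \<alpha> f) (bicell_comp E (fc H \<gamma>) (tpro \<alpha> n)))) (lax_id_left D (Mod E q) K n)"

abbreviation "Mod_right \<gamma> m g \<equiv> bicell_comp E (bicell_comp E
    (inv_arrow (cat1 (Mod E q)) (tensor_runit E q (fp H m)))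
    (tensor_cell E q (bicell_comp E (tpro \<alpha> m) (fc K \<gamma>)) (tarr \<alpha> g)))
    (lax_id_right D (Mod E q) K (Cod (cat1 D) \<gamma>))"

text \<open>The two composites have the same boundary as cells of bimodules by typing alone, so they
  are equal exactly when their underlying cells are; these are left and right products in E.\<close>

lemma Mod_cell_condition_iff:
  assumes \<gamma>: "\<gamma> \<in> Cells D m n f g"
  shows "Mod_left \<gamma> n f = Mod_right \<gamma> m g \<longleftrightarrow>
    E.lcomp (lax_id_left D E K.F n) (tarr \<beta> f) (fc H.F \<gamma> \<cdot>\<^sub>1 tpro \<beta> n)
      = E.rcomp (lax_id_right D E K.F n) (tpro \<beta> m \<cdot>\<^sub>1 fc K.F \<gamma>) (tarr \<beta> g)"
proof -
  note [simp] = D.Cells_D[OF \<gamma>]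
  have [simp]: "psrc D m \<in> Obj (cat0 D)" "psrc D n \<in> Obj (cat0 D)" "ptgt D m \<in> Obj (cat0 D)" "ptgt D n \<in> Obj (cat0 D)"
    using D.source.obj_closed D.target.obj_closed by simp_all
  let ?A = "tarr \<alpha> f" and ?B = "bicell_comp E (fc H \<gamma>) (tpro \<alpha> n)"
    and ?L = "lax_id_left D (Mod E q) K n"
  let ?A' = "bicell_comp E (tpro \<alpha> m) (fc K \<gamma>)" and ?B' = "tarr \<alpha> g"
    and ?L' = "lax_id_right D (Mod E q) K n"
  have l: "bc_dom (Mod_left \<gamma> n f) = fp H m" "bc_cod (Mod_left \<gamma> n f) = fp K n"
    "bc_src (Mod_left \<gamma> n f) = bc_src ?A" "bc_tgt (Mod_left \<gamma> n f) = bc_tgt ?B"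
    "bc_cell (Mod_left \<gamma> n f) = E.lcomp (lax_id_left D E K.F n) (tarr \<beta> f) (fc H.F \<gamma> \<cdot>\<^sub>1 tpro \<beta> n)"
    using E.dom_Mod_lcomp[of ?A ?B ?L "fo H (psrc D m)"] E.cod_Mod_lcomp[of ?A ?B ?L "fo H (psrc D m)"]
      E.src_Mod_lcomp[of ?A ?B ?L "fo H (psrc D m)"] E.tgt_Mod_lcomp[of ?A ?B ?L "fo H (psrc D m)"]
      E.cell_Mod_lcomp[of ?A ?B ?L "fo H (psrc D m)"] by simp_all
  have r: "bc_dom (Mod_right \<gamma> m g) = fp H m" "bc_cod (Mod_right \<gamma> m g) = fp K n"
    "bc_src (Mod_right \<gamma> m g) = bc_src ?A'" "bc_tgt (Mod_right \<gamma> m g) = bc_tgt ?B'"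
    "bc_cell (Mod_right \<gamma> m g) = E.rcomp (lax_id_right D E K.F n) (tpro \<beta> m \<cdot>\<^sub>1 fc K.F \<gamma>) (tarr \<beta> g)"
    using E.dom_Mod_rcomp[of ?A' ?B' ?L' "fo H (ptgt D m)"] E.cod_Mod_rcomp[of ?A' ?B' ?L' "fo H (ptgt D m)"]
      E.src_Mod_rcomp[of ?A' ?B' ?L' "fo H (ptgt D m)"] E.tgt_Mod_rcomp[of ?A' ?B' ?L' "fo H (ptgt D m)"]
      E.cell_Mod_rcomp[of ?A' ?B' ?L' "fo H (ptgt D m)"] by simp_all
  have "bc_src ?A = bc_src ?A'" "bc_tgt ?B = bc_tgt ?B'"
    by simp_all
  then show ?thesis
    unfolding l(5)[symmetric] r(5)[symmetric] using l(1-4) r(1-4)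
    by (metis E.bicell_eqI)
qed

text \<open>Precomposition with \<open>q (fp H m) (fp H n)\<close> turns the equation in Mod(E) into
  the one in E; since this cell is epic, nothing is lost.\<close>

lemma Mod_lax_iff:
  assumes mn: "m \<in> Obj (cat1 D)" "n \<in> Obj (cat1 D)" "ptgt D m = psrc D n"
  shows "bicell_comp E (lax H m n) (tpro \<alpha> (m \<odot>\<^sub>p\<^bsub>D\<^esub> n))
      = bicell_comp E (tensor_cell E q (tpro \<alpha> m) (tpro \<alpha> n)) (lax K m n) \<longleftrightarrow>
    (tpro \<beta> m \<odot> tpro \<beta> n) \<cdot>\<^sub>1 lax K.F m n = lax H.F m n \<cdot>\<^sub>1 tpro \<beta> (m \<odot>\<^sub>p\<^bsub>D\<^esub> n)"
    (is "?A = ?B \<longleftrightarrow> ?c = ?d")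
proof -
  note [simp] = mn
  have [simp]: "psrc D m \<in> Obj (cat0 D)" "psrc D n \<in> Obj (cat0 D)" "ptgt D n \<in> Obj (cat0 D)"
    using D.source.obj_closed D.target.obj_closed by simp_all
  let ?T = "tensor_cell E q (tpro \<alpha> m) (tpro \<alpha> n)"
  have T [simp]: "is_bicell E ?T"
    by (rule E.is_bicell_tensor) simp_all
  let ?q = "q (fp H m) (fp H n)"
  have "?q \<cdot>\<^sub>1 bc_cell ?A = ?d"
    by simp
  moreover have "?q \<cdot>\<^sub>1 bc_cell ?B = ?c"
  proof -
    have "?q \<cdot>\<^sub>1 bc_cell ?B = (?q \<cdot>\<^sub>1 bc_cell ?T) \<cdot>\<^sub>1 bc_cell (lax K m n)"
      by simp
    also have "\<dots> = ?c"
      using E.q_tensor_cell[of "tpro \<alpha> m" "tpro \<alpha> n"] by simp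
    finally show ?thesis .
  qed
  moreover have "bc_cell ?A = bc_cell ?B" if "?q \<cdot>\<^sub>1 bc_cell ?A = ?q \<cdot>\<^sub>1 bc_cell ?B"
    by (rule epi_arrowD[OF E.epi_q[of "fp H m" "fp H n"], rotated 3]) (use that in simp_all)
  moreover have "?A = ?B" if "bc_cell ?A = bc_cell ?B"
    by (rule E.bicell_eqI) (use that in simp_all)
  ultimately show ?thesis by metis
qed

abbreviation "Mod_comp f g \<equiv> bicell_comp E (bicell_comp E
    (inv_arrow (cat1 (Mod E q)) (tensor_lunit E q (unit_bimod (fo H (Dom (cat0 D) f)))))
    (tensor_cell E q (bicell_comp E (tarr \<alpha> f) (fc K (cid D g)))
      (bicell_comp E (unit_bicell (fa H f)) (tarr \<alpha> g)))) (lax_id_id D (Mod E q) K (Cod (cat0 D) g))"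

text \<open>Both sides are cells out of the same unit bimodule, hence determined by their
  restrictions along its unit, and these restrictions are the two sides of the equation in
  E.\<close>

lemma Mod_comp_iff:
  assumes fg: "f \<in> Arr (cat0 D)" "g \<in> Arr (cat0 D)" "Cod (cat0 D) f = Dom (cat0 D) g"
  shows "tarr \<alpha> (f \<cdot>\<^sub>0\<^bsub>D\<^esub> g) = Mod_comp f g \<longleftrightarrow>
    tarr \<beta> (f \<cdot>\<^sub>0\<^bsub>D\<^esub> g) = E.lcomp (lax_id_id D E K.F (Cod (cat0 D) g))
          (tarr \<beta> f \<cdot>\<^sub>1 fc K.F (cid D g)) (cid E (fa H.F f) \<cdot>\<^sub>1 tarr \<beta> g)"
proof -
  note [simp] = fg
  define x y z where "x = Dom (cat0 D) f" and "y = Dom (cat0 D) g" and "z = Cod (cat0 D) g"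
  note [simp] = x_def[symmetric] y_def[symmetric] z_def[symmetric]
  have [simp]: "x \<in> Obj (cat0 D)" "y \<in> Obj (cat0 D)" "z \<in> Obj (cat0 D)"
    using D.source.B.dom_closed[of f] D.source.B.dom_closed[of g] D.source.B.cod_closed[of g] by simp_all
  let ?A = "bicell_comp E (tarr \<alpha> f) (fc K (cid D g))"
    and ?B = "bicell_comp E (unit_bicell (fa H f)) (tarr \<alpha> g)" and ?L = "lax_id_id D (Mod E q) K z"
  have AB: "bc_tgt ?A = bc_src ?B"
    by (auto intro!: cofun.equality)
  let ?X = "fo H x"
  have c: "is_bicell E (Mod_comp f g)" "bc_dom (Mod_comp f g) = unit_bimod ?X" "bc_cod (Mod_comp f g) = unit_bimod (fo K z)"
    "bc_src (Mod_comp f g) = bc_src ?A" "bc_tgt (Mod_comp f g) = bc_tgt ?B"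
    "bc_cell (Mod_comp f g) = E.lcomp (co_mult (fo K z)) (co_unit ?X \<cdot>\<^sub>1 bc_cell ?A) (bc_cell ?B)"
    using E.is_bicell_lcomp[of ?A ?B ?L ?X] E.dom_Mod_lcomp[of ?A ?B ?L ?X] E.cod_Mod_lcomp[of ?A ?B ?L ?X]
      E.src_Mod_lcomp[of ?A ?B ?L ?X] E.tgt_Mod_lcomp[of ?A ?B ?L ?X] E.cell_Mod_lcomp[of ?A ?B ?L ?X] AB
    by simp_all
  have s: "bc_src ?A = bc_src (tarr \<alpha> (f \<cdot>\<^sub>0\<^bsub>D\<^esub> g))" "bc_tgt ?B = bc_tgt (tarr \<alpha> (f \<cdot>\<^sub>0\<^bsub>D\<^esub> g))"
    by (auto intro!: cofun.equality)
  have "co_unit ?X \<cdot>\<^sub>1 bc_cell (Mod_comp f g)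
      = E.lcomp (co_mult (fo K z)) (co_unit ?X \<cdot>\<^sub>1 bc_cell ?A) (co_unit ?X \<cdot>\<^sub>1 (cf_cell (fa H f) \<cdot>\<^sub>1 bc_cell (tarr \<alpha> g)))"
    unfolding c(6) by (subst E.vcomp_lcomp) simp_all
  \<comment> \<open>The unit at the domain of \<open>f\<close> passes the functor
    \<open>fa H f\<close> and becomes the unit at its codomain, which is the one contained in
    \<open>tarr \<beta> g\<close>.\<close>
  also have "co_unit ?X \<cdot>\<^sub>1 (cf_cell (fa H f) \<cdot>\<^sub>1 bc_cell (tarr \<alpha> g))
      = (cid E (cf_arr (fa H f)) \<cdot>\<^sub>1 co_unit (fo H y)) \<cdot>\<^sub>1 bc_cell (tarr \<alpha> g)"
    using E.cf_unit[of "fa H f"] by simp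
  finally have e1: "co_unit ?X \<cdot>\<^sub>1 bc_cell (Mod_comp f g) = E.lcomp (lax_id_id D E K.F z)
          (tarr \<beta> f \<cdot>\<^sub>1 fc K.F (cid D g)) (cid E (fa H.F f) \<cdot>\<^sub>1 tarr \<beta> g)" (is "_ = ?R")
    by simp
  have e2: "tarr \<beta> (f \<cdot>\<^sub>0\<^bsub>D\<^esub> g) = co_unit ?X \<cdot>\<^sub>1 bc_cell (tarr \<alpha> (f \<cdot>\<^sub>0\<^bsub>D\<^esub> g))"
    by simp
  have "tarr \<alpha> (f \<cdot>\<^sub>0\<^bsub>D\<^esub> g) = Mod_comp f g \<longleftrightarrow> tarr \<beta> (f \<cdot>\<^sub>0\<^bsub>D\<^esub> g) = ?R"
  proof
    assume *: "tarr \<alpha> (f \<cdot>\<^sub>0\<^bsub>D\<^esub> g) = Mod_comp f g"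
    show "tarr \<beta> (f \<cdot>\<^sub>0\<^bsub>D\<^esub> g) = ?R"
      unfolding e2 e1[symmetric] * ..
  next
    assume "tarr \<beta> (f \<cdot>\<^sub>0\<^bsub>D\<^esub> g) = ?R"
    then have *: "co_unit ?X \<cdot>\<^sub>1 bc_cell (tarr \<alpha> (f \<cdot>\<^sub>0\<^bsub>D\<^esub> g)) = co_unit ?X \<cdot>\<^sub>1 bc_cell (Mod_comp f g)"
      unfolding e2 e1[symmetric] .
    show "tarr \<alpha> (f \<cdot>\<^sub>0\<^bsub>D\<^esub> g) = Mod_comp f g"
      by (rule E.bicell_from_unit_eqI[OF _ c(1) _ c(2) _ _ _ *])
        (use c(3,4,5) s in simp_all)
  qed
  then show ?thesis by simp
qed

text \<open>Again an equation between cells out of a unit bimodule; the restriction of the external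
  identity on \<open>tob \<alpha> x\<close> is computed by the unit law of that functor.\<close>

lemma tarr_id_iff:
  assumes [simp]: "x \<in> Obj (cat0 D)"
  shows "tarr \<alpha> (\<one>\<^sub>0\<^bsub>D\<^esub> x) = unit_bicell (tob \<alpha> x) \<longleftrightarrow>
    tarr \<beta> (\<one>\<^sub>0\<^bsub>D\<^esub> x) = cid E (tob \<beta> x) \<cdot>\<^sub>1 un K.F x"
proof -
  have e1: "co_unit (fo H x) \<cdot>\<^sub>1 bc_cell (unit_bicell (tob \<alpha> x)) = cid E (tob \<beta> x) \<cdot>\<^sub>1 un K.F x"
    using E.cf_unit[of "tob \<alpha> x"] by simp
  have e2: "tarr \<beta> (\<one>\<^sub>0\<^bsub>D\<^esub> x) = co_unit (fo H x) \<cdot>\<^sub>1 bc_cell (tarr \<alpha> (\<one>\<^sub>0\<^bsub>D\<^esub> x))"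
    by simp
  show ?thesis
  proof
    assume *: "tarr \<alpha> (\<one>\<^sub>0\<^bsub>D\<^esub> x) = unit_bicell (tob \<alpha> x)"
    show "tarr \<beta> (\<one>\<^sub>0\<^bsub>D\<^esub> x) = cid E (tob \<beta> x) \<cdot>\<^sub>1 un K.F x"
      unfolding e2 e1[symmetric] * ..
  next
    assume "tarr \<beta> (\<one>\<^sub>0\<^bsub>D\<^esub> x) = cid E (tob \<beta> x) \<cdot>\<^sub>1 un K.F x"
    then have *: "co_unit (fo H x) \<cdot>\<^sub>1 bc_cell (tarr \<alpha> (\<one>\<^sub>0\<^bsub>D\<^esub> x))
        = co_unit (fo H x) \<cdot>\<^sub>1 bc_cell (unit_bicell (tob \<alpha> x))"
      unfolding e2 e1[symmetric] .
    show "tarr \<alpha> (\<one>\<^sub>0\<^bsub>D\<^esub> x) = unit_bicell (tob \<alpha> x)"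
      by (rule E.bicell_from_unit_eqI[OF _ _ _ _ _ _ _ *]) (auto intro!: cofun.equality)
  qed
qed

lemma tpro_un_eps: "x \<in> Obj (cat0 D) \<Longrightarrow>
    un H.F x \<cdot>\<^sub>1 tpro \<beta> (pid D x) = cid E (tob \<beta> x) \<cdot>\<^sub>1 un K.F x"
  using E.cf_unit[of "tob \<alpha> x"] by simp

end


lemma Lax_simps [simp]:
  "Obj (Lax D E) = {F. lax_functor D E F}" "Arr (Lax D E) = {\<alpha>. lax_trans D E \<alpha>}"
  "Dom (Lax D E) = tdom" "Cod (Lax D E) = tcod" "cat.Id (Lax D E) = trans_id D E"
  "Comp (Lax D E) = trans_comp D E"
  by (simp_all add: Lax_def)

lemma Lax_unitary_simps [simp]:
  "Obj (Lax_unitary D E) = {F. lax_functor D E F \<and> unitary D E F}"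
  "Arr (Lax_unitary D E) = {\<alpha>. lax_trans D E \<alpha> \<and> unitary D E (tdom \<alpha>) \<and> unitary D E (tcod \<alpha>)}"
  "Dom (Lax_unitary D E) = tdom" "Cod (Lax_unitary D E) = tcod" "cat.Id (Lax_unitary D E) = trans_id D E"
  "Comp (Lax_unitary D E) = trans_comp D E"
  by (simp_all add: Lax_unitary_def full_subcat_def Lax_def)

section \<open>Transferring transformations along the comparison\<close>

context unitary_pair
begin

lemma lax_trans_pre_nat:
  assumes \<alpha>: "lax_trans D (Mod E q) \<alpha>" and [simp]: "tdom \<alpha> = H" "tcod \<alpha> = K"
  shows "pre_nat D E q H K \<alpha>"
proof (intro pre_nat.intro pre_nat_axioms.intro unitary_pair_axioms)
  show "tdom \<alpha> = H" "tcod \<alpha> = K" by simp_all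
  show "restrict_laxtrans D \<alpha> = \<alpha>"
    by (rule lax_trans.extensional[OF \<alpha>])
next
  fix x assume x: "x \<in> Obj (cat0 D)"
  have "tob \<alpha> x \<in> Hom (cat0 (Mod E q)) (fo H x) (fo K x)"
    using lax_trans.tob_closed[OF \<alpha> x] by simp
  then show *: "is_cofun E (tob \<alpha> x) \<and> cf_dom (tob \<alpha> x) = fo H x \<and> cf_cod (tob \<alpha> x) = fo K x"
    by (simp add: Hom_def)
  \<comment> \<open>With identity unitors, the axiom \<open>pro_id\<close> says that this component
    is the external identity on \<open>tob \<alpha> x\<close>; the typing is needed to remove the
    composites with identities.\<close>
  have "tpro \<alpha> (pid D x) \<in> Cells (Mod E q) (fp H (pid D x)) (fp K (pid D x)) (tob \<alpha> x) (tob \<alpha> x)"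
    using lax_trans.tpro_closed[OF \<alpha>, of "pid D x" x x] x by (simp add: Pro_def)
  then show "tpro \<alpha> (pid D x) = unit_bicell (tob \<alpha> x)"
    using lax_trans.pro_id[OF \<alpha> x] x * by (simp add: E.Cells_Mod_iff)
next
  fix m assume m: "m \<in> Obj (cat1 D)"
  have "tpro \<alpha> m \<in> Cells (Mod E q) (fp H m) (fp K m) (tob \<alpha> (psrc D m)) (tob \<alpha> (ptgt D m))"
    using lax_trans.tpro_closed[OF \<alpha>, of m "psrc D m" "ptgt D m"] m by (simp add: Pro_def)
  then show "is_bicell E (tpro \<alpha> m) \<and> bc_dom (tpro \<alpha> m) = fp H m
      \<and> bc_cod (tpro \<alpha> m) = fp K m \<and> bc_src (tpro \<alpha> m) = tob \<alpha> (psrc D m) \<and> bc_tgt (tpro \<alpha> m) = tob \<alpha> (ptgt D m)"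
    by (simp add: E.Cells_Mod_iff)
next
  fix f assume f: "f \<in> Arr (cat0 D)"
  let ?x = "Dom (cat0 D) f" and ?y = "Cod (cat0 D) f"
  have "tarr \<alpha> f \<in> Cells (Mod E q) (unit_bimod (fo H ?x)) (fp K (pid D ?y))
      (cofun_comp E (tob \<alpha> ?x) (fa K f)) (cofun_comp E (fa H f) (tob \<alpha> ?y))"
    using lax_trans.tarr_closed[OF \<alpha>, of f ?x ?y] f by (simp add: Hom_def)
  then show "is_bicell E (tarr \<alpha> f) \<and> bc_dom (tarr \<alpha> f) = unit_bimod (fo H ?x)
      \<and> bc_cod (tarr \<alpha> f) = unit_bimod (fo K ?y)
      \<and> bc_src (tarr \<alpha> f) = cofun_comp E (tob \<alpha> ?x) (fa K f)
      \<and> bc_tgt (tarr \<alpha> f) = cofun_comp E (fa H f) (tob \<alpha> ?y)"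
    using f by (simp add: E.Cells_Mod_iff)
qed

end

context pre_nat
begin

lemma lax_trans_eps:
  assumes \<alpha>: "lax_trans D (Mod E q) \<alpha>"
  shows "lax_trans D E \<beta>"
proof (rule lax_transI[of H.F K.F])
  show "lax_functor D E H.F" "lax_functor D E K.F"
    by (rule H.lax_functor_eps K.lax_functor_eps)+
next
  fix \<gamma> m n f g assume \<gamma>: "\<gamma> \<in> Cells D m n f g"
  show "E.lcomp (lax_id_left D E K.F n) (tarr \<beta> f) (fc H.F \<gamma> \<cdot>\<^sub>1 tpro \<beta> n)
      = E.rcomp (lax_id_right D E K.F n) (tpro \<beta> m \<cdot>\<^sub>1 fc K.F \<gamma>) (tarr \<beta> g)"
    unfolding Mod_cell_condition_iff[OF \<gamma>, symmetric]
    using lax_trans.cell_condition[OF \<alpha> \<gamma>] D.Cells_D[OF \<gamma>] by simp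
next
  fix m n assume mn: "m \<in> Obj (cat1 D)" "n \<in> Obj (cat1 D)" "ptgt D m = psrc D n"
  show "(tpro \<beta> m \<odot> tpro \<beta> n) \<cdot>\<^sub>1 lax K.F m n = lax H.F m n \<cdot>\<^sub>1 tpro \<beta> (m \<odot>\<^sub>p\<^bsub>D\<^esub> n)"
    unfolding Mod_lax_iff[OF mn, symmetric]
    using lax_trans.pro_comp[OF \<alpha>, of m "psrc D m" "ptgt D m" n "ptgt D n"] mn by (simp add: Pro_def)
next
  fix f g assume fg: "f \<in> Arr (cat0 D)" "g \<in> Arr (cat0 D)" "Cod (cat0 D) f = Dom (cat0 D) g"
  show "tarr \<beta> (f \<cdot>\<^sub>0\<^bsub>D\<^esub> g) = E.lcomp (lax_id_id D E K.F (Cod (cat0 D) g))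
          (tarr \<beta> f \<cdot>\<^sub>1 fc K.F (cid D g)) (cid E (fa H.F f) \<cdot>\<^sub>1 tarr \<beta> g)"
    unfolding Mod_comp_iff[OF fg, symmetric]
    using lax_trans.arr_comp[OF \<alpha>, of f "Dom (cat0 D) f" "Cod (cat0 D) f" g "Cod (cat0 D) g"] fg
    by (simp add: Hom_def)
next
  fix x assume x: "x \<in> Obj (cat0 D)"
  show "tarr \<beta> (\<one>\<^sub>0\<^bsub>D\<^esub> x) = cid E (tob \<beta> x) \<cdot>\<^sub>1 un K.F x"
    unfolding tarr_id_iff[OF x, symmetric] using lax_trans.arr_id[OF \<alpha> x] x by simp
  show "un H.F x \<cdot>\<^sub>1 tpro \<beta> (pid D x) = cid E (tob \<beta> x) \<cdot>\<^sub>1 un K.F x"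
    by (rule tpro_un_eps[OF x])
qed simp_all

text \<open>Typing and the axiom at identity proarrows are part of \<open>pre_nat\<close>; each
  remaining equation is reflected from E by its own equivalence.\<close>

lemma lax_trans_of_eps:
  assumes \<beta>: "lax_trans D E \<beta>"
  shows "lax_trans D (Mod E q) \<alpha>"
proof -
  interpret b: lax_nat D E H.F K.F \<beta>
    using lax_natI[OF \<beta>] by simp
  show ?thesis
  proof (rule lax_trans.intro)
    show "lax_functor D (Mod E q) (tdom \<alpha>)" "lax_functor D (Mod E q) (tcod \<alpha>)" "restrict_laxtrans D \<alpha> = \<alpha>"
      using H.H K.H restrict by simp_all
  next
    fix x assume x: "x \<in> Obj (cat0 D)"
    show "tob \<alpha> x \<in> Hom (cat0 (Mod E q)) (fo (tdom \<alpha>) x) (fo (tcod \<alpha>) x)"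
      using x by (simp add: Hom_def)
    show "un (tdom \<alpha>) x \<cdot>\<^sub>1\<^bsub>Mod E q\<^esub> tpro \<alpha> (pid D x) = cid (Mod E q) (tob \<alpha> x) \<cdot>\<^sub>1\<^bsub>Mod E q\<^esub> un (tcod \<alpha>) x"
      using x by simp
    have "tarr \<alpha> (\<one>\<^sub>0\<^bsub>D\<^esub> x) = unit_bicell (tob \<alpha> x)"
      unfolding tarr_id_iff[OF x] using b.tarr_id[OF x] .
    then show "tarr \<alpha> (\<one>\<^sub>0\<^bsub>D\<^esub> x) = cid (Mod E q) (tob \<alpha> x) \<cdot>\<^sub>1\<^bsub>Mod E q\<^esub> un (tcod \<alpha>) x"
      using x by simp
  next
    fix m x y assume "m \<in> Pro D x y"
    then show "tpro \<alpha> m \<in> Cells (Mod E q) (fp (tdom \<alpha>) m) (fp (tcod \<alpha>) m) (tob \<alpha> x) (tob \<alpha> y)"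
      by (auto simp: Pro_def E.Cells_Mod_iff)
  next
    fix f x y assume "f \<in> Hom (cat0 D) x y"
    then have "f \<in> Arr (cat0 D)" "Dom (cat0 D) f = x" "Cod (cat0 D) f = y" "y \<in> Obj (cat0 D)"
      by (auto simp: Hom_def)
    then show "tarr \<alpha> f \<in> Cells (Mod E q) (pid (Mod E q) (fo (tdom \<alpha>) x)) (fp (tcod \<alpha>) (pid D y))
        (tob \<alpha> x \<cdot>\<^sub>0\<^bsub>Mod E q\<^esub> fa (tcod \<alpha>) f) (fa (tdom \<alpha>) f \<cdot>\<^sub>0\<^bsub>Mod E q\<^esub> tob \<alpha> y)"
      by (simp add: E.Cells_Mod_iff)
  next
    fix \<gamma> m n f g assume \<gamma>: "\<gamma> \<in> Cells D m n f g"
    have "Mod_left \<gamma> n f = Mod_right \<gamma> m g"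
      unfolding Mod_cell_condition_iff[OF \<gamma>] by (rule b.cell_cond[OF \<gamma>])
    then show "inv\<^sub>1\<^bsub>Mod E q\<^esub> (lunit (Mod E q) (fp (tdom \<alpha>) m)) \<cdot>\<^sub>1\<^bsub>Mod E q\<^esub>
          (tarr \<alpha> f \<odot>\<^bsub>Mod E q\<^esub> (fc (tdom \<alpha>) \<gamma> \<cdot>\<^sub>1\<^bsub>Mod E q\<^esub> tpro \<alpha> n)) \<cdot>\<^sub>1\<^bsub>Mod E q\<^esub>
          lax_id_left D (Mod E q) (tcod \<alpha>) n
        = inv\<^sub>1\<^bsub>Mod E q\<^esub> (runit (Mod E q) (fp (tdom \<alpha>) m)) \<cdot>\<^sub>1\<^bsub>Mod E q\<^esub>
          ((tpro \<alpha> m \<cdot>\<^sub>1\<^bsub>Mod E q\<^esub> fc (tcod \<alpha>) \<gamma>) \<odot>\<^bsub>Mod E q\<^esub> tarr \<alpha> g) \<cdot>\<^sub>1\<^bsub>Mod E q\<^esub>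
          lax_id_right D (Mod E q) (tcod \<alpha>) n"
      using D.Cells_D[OF \<gamma>] by simp
  next
    fix m n x y z assume "m \<in> Pro D x y" "n \<in> Pro D y z"
    then have mn: "m \<in> Obj (cat1 D)" "n \<in> Obj (cat1 D)" "ptgt D m = psrc D n"
      by (auto simp: Pro_def)
    show "lax (tdom \<alpha>) m n \<cdot>\<^sub>1\<^bsub>Mod E q\<^esub> tpro \<alpha> (m \<odot>\<^sub>p\<^bsub>D\<^esub> n)
        = (tpro \<alpha> m \<odot>\<^bsub>Mod E q\<^esub> tpro \<alpha> n) \<cdot>\<^sub>1\<^bsub>Mod E q\<^esub> lax (tcod \<alpha>) m n"
      using b.tpro_lax[OF mn] unfolding Mod_lax_iff[OF mn, symmetric] by simp
  next
    fix f g x y z assume "f \<in> Hom (cat0 D) x y" "g \<in> Hom (cat0 D) y z"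
    then have fg: "f \<in> Arr (cat0 D)" "g \<in> Arr (cat0 D)" "Cod (cat0 D) f = Dom (cat0 D) g"
      and xz: "x = Dom (cat0 D) f" "z = Cod (cat0 D) g"
      by (auto simp: Hom_def)
    have "tarr \<alpha> (f \<cdot>\<^sub>0\<^bsub>D\<^esub> g) = Mod_comp f g"
      unfolding Mod_comp_iff[OF fg] by (rule b.tarr_comp[OF fg])
    then show "tarr \<alpha> (f \<cdot>\<^sub>0\<^bsub>D\<^esub> g)
        = inv\<^sub>1\<^bsub>Mod E q\<^esub> (lunit (Mod E q) (pid (Mod E q) (fo (tdom \<alpha>) x))) \<cdot>\<^sub>1\<^bsub>Mod E q\<^esub>
          ((tarr \<alpha> f \<cdot>\<^sub>1\<^bsub>Mod E q\<^esub> fc (tcod \<alpha>) (cid D g)) \<odot>\<^bsub>Mod E q\<^esub>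
            (cid (Mod E q) (fa (tdom \<alpha>) f) \<cdot>\<^sub>1\<^bsub>Mod E q\<^esub> tarr \<alpha> g)) \<cdot>\<^sub>1\<^bsub>Mod E q\<^esub>
          lax_id_id D (Mod E q) (tcod \<alpha>) z"
      by (simp add: xz)
  qed
qed

text \<open>At objects and proarrows the underlying cells determine everything, the functor part of
  \<open>tob \<alpha> x\<close> being read off at the identity proarrow. At arrows the component is
  reconstructed by \<open>cell_from_unit\<close>.\<close>

lemma bar_eps_trans: "bar_trans D E q \<beta> = \<alpha>"
proof -
  have tob' [simp]: "bar_tob D E \<beta> x = tob \<alpha> x" if "x \<in> Obj (cat0 D)" for x
    by (rule cofun.equality) (use that in \<open>simp_all add: bar_tob_def\<close>)
  show ?thesis
  proof (rule laxtrans_eqI)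
    show "restrict_laxtrans D (bar_trans D E q \<beta>) = bar_trans D E q \<beta>"
      by (simp add: bar_trans_def)
    show "restrict_laxtrans D \<alpha> = \<alpha>"
      by (rule restrict)
    show "tdom (bar_trans D E q \<beta>) = tdom \<alpha>" "tcod (bar_trans D E q \<beta>) = tcod \<alpha>"
      by (simp_all add: bar_trans_def restrict_laxtrans_def H.bar_eps K.bar_eps)
  next
    fix x assume "x \<in> Obj (cat0 D)"
    then show "tob (bar_trans D E q \<beta>) x = tob \<alpha> x"
      by (simp add: bar_trans_def restrict_laxtrans_def)
  next
    fix m assume m: "m \<in> Obj (cat1 D)"
    then have "bar_tpro D E \<beta> m = tpro \<alpha> m"
      using D.source.obj_closed[of m] D.target.obj_closed[of m]
      by (intro bicell.equality) (simp_all add: bar_tpro_def)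
    with m show "tpro (bar_trans D E q \<beta>) m = tpro \<alpha> m"
      by (simp add: bar_trans_def restrict_laxtrans_def)
  next
    fix f assume f: "f \<in> Arr (cat0 D)"
    let ?x = "Dom (cat0 D) f" and ?y = "Cod (cat0 D) f"
    \<comment> \<open>The reconstruction formula is literally the one defining
      \<open>bar_tarr\<close>: the restricted cell acts on the functor part of the target, which is
      the composite of \<open>fa H f\<close> with \<open>tob \<alpha> ?y\<close>.\<close>
    have "bc_cell (tarr \<alpha> f) = E.lcomp (co_mult (fo K ?y)) (co_unit (fo H ?x) \<cdot>\<^sub>1 bc_cell (tarr \<alpha> f))
        (cf_cell (fa H f) \<cdot>\<^sub>1 cf_cell (tob \<alpha> ?y))"
      using E.cell_from_unit[of "tarr \<alpha> f" "fo H ?x"] f by simp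
    then have "bar_tarr D E \<beta> f = tarr \<alpha> f"
      using f by (intro bicell.equality) (simp_all add: bar_tarr_def Let_def E.lcomp_def)
    with f show "tarr (bar_trans D E q \<beta>) f = tarr \<alpha> f"
      by (simp add: bar_trans_def restrict_laxtrans_def)
  qed
qed

end

section \<open>Images of composites and identities, and preimages of transformations\<close>

context mod_lax
begin

lemma unitary_laxI: "\<lbrakk>lax_functor D (Mod E q) H; unitary D (Mod E q) H\<rbrakk> \<Longrightarrow> unitary_lax D E q H"
  by (intro unitary_lax.intro unitary_lax_axioms.intro mod_lax_axioms)

lemma pre_natI:
  assumes "lax_trans D (Mod E q) \<alpha>" "unitary D (Mod E q) (tdom \<alpha>)" "unitary D (Mod E q) (tcod \<alpha>)"
  shows "pre_nat D E q (tdom \<alpha>) (tcod \<alpha>) \<alpha>"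
proof -
  have "unitary_pair D E q (tdom \<alpha>) (tcod \<alpha>)"
    using assms by (intro unitary_pair.intro mod_lax_axioms unitary_laxI lax_trans.lax_dom lax_trans.lax_cod)
  from unitary_pair.lax_trans_pre_nat[OF this assms(1) refl refl] show ?thesis .
qed

lemma lax_trans_eps_iff:
  "pre_nat D E q H K \<alpha> \<Longrightarrow> lax_trans D (Mod E q) \<alpha> \<longleftrightarrow> lax_trans D E (eps_trans D E q \<alpha>)"
  using pre_nat.lax_trans_eps pre_nat.lax_trans_of_eps by blast

text \<open>The components of the composite are computed in Mod(E) by \<open>is_bicell_lcomp\<close>
  and its companions. The axioms are assumed for the two images, for which
  \<open>tarr_trans_comp\<close> gives the matching formula in E.\<close>

lemma
  assumes "pre_nat D E q H K \<alpha>" "pre_nat D E q K L \<alpha>'"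
  assumes \<beta>: "lax_trans D E (eps_trans D E q \<alpha>)" and \<beta>': "lax_trans D E (eps_trans D E q \<alpha>')"
  shows pre_nat_comp: "pre_nat D E q H L (trans_comp D (Mod E q) \<alpha> \<alpha>')"
    and eps_trans_comp: "eps_trans D E q (trans_comp D (Mod E q) \<alpha> \<alpha>')
      = trans_comp D E (eps_trans D E q \<alpha>) (eps_trans D E q \<alpha>')"
proof -
  interpret a: pre_nat D E q H K \<alpha> by fact
  interpret a': pre_nat D E q K L \<alpha>' by fact
  interpret b: lax_nat D E a.H.F a.K.F "eps_trans D E q \<alpha>"
    using lax_natI[OF \<beta>] by simp
  interpret b': lax_nat D E a.K.F a'.K.F "eps_trans D E q \<alpha>'"
    using lax_natI[OF \<beta>'] by simp
  let ?c = "trans_comp D (Mod E q) \<alpha> \<alpha>'"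
  have c [simp]: "tdom ?c = H" "tcod ?c = L" "restrict_laxtrans D ?c = ?c"
    "\<And>x. x \<in> Obj (cat0 D) \<Longrightarrow> tob ?c x = cofun_comp E (tob \<alpha> x) (tob \<alpha>' x)"
    "\<And>m. m \<in> Obj (cat1 D) \<Longrightarrow> tpro ?c m = bicell_comp E (tpro \<alpha> m) (tpro \<alpha>' m)"
    by (simp_all add: trans_comp_def) (simp_all add: restrict_laxtrans_def)
  have t: "is_bicell E (tarr ?c f) \<and> bc_dom (tarr ?c f) = unit_bimod (fo H (Dom (cat0 D) f))
      \<and> bc_cod (tarr ?c f) = unit_bimod (fo L (Cod (cat0 D) f))
      \<and> bc_src (tarr ?c f) = cofun_comp E (tob ?c (Dom (cat0 D) f)) (fa L f)
      \<and> bc_tgt (tarr ?c f) = cofun_comp E (fa H f) (tob ?c (Cod (cat0 D) f))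
      \<and> bc_cell (tarr ?c f) = E.lcomp (co_mult (fo L (Cod (cat0 D) f)))
          (co_unit (fo H (Dom (cat0 D) f)) \<cdot>\<^sub>1 (cf_cell (tob \<alpha> (Dom (cat0 D) f)) \<cdot>\<^sub>1 bc_cell (tarr \<alpha>' f)))
          (bc_cell (tarr \<alpha> f) \<cdot>\<^sub>1 cf_cell (tob \<alpha>' (Cod (cat0 D) f)))"
    if f: "f \<in> Arr (cat0 D)" for f
  proof -
    let ?x = "Dom (cat0 D) f" and ?y = "Cod (cat0 D) f"
    let ?A = "bicell_comp E (unit_bicell (tob \<alpha> ?x)) (tarr \<alpha>' f)"
      and ?B = "bicell_comp E (tarr \<alpha> f) (unit_bicell (tob \<alpha>' ?y))"
      and ?L = "lax_id_id D (Mod E q) L ?y"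
    have eq: "tarr ?c f = bicell_comp E (bicell_comp E (inv_arrow (cat1 (Mod E q)) (tensor_lunit E q (bc_dom ?B)))
        (tensor_cell E q ?A ?B)) ?L"
      using f by (simp add: trans_comp_def restrict_laxtrans_def Let_def)
    have AB: "bc_tgt ?A = bc_src ?B"
      using f by (auto intro!: cofun.equality)
    have "bc_src ?A = cofun_comp E (tob ?c ?x) (fa L f)" "bc_tgt ?B = cofun_comp E (fa H f) (tob ?c ?y)"
      using f by (auto intro!: cofun.equality)
    with AB f show ?thesis
      unfolding eq
      using E.is_bicell_lcomp[of ?A ?B ?L "fo H ?x"] E.dom_Mod_lcomp[of ?A ?B ?L "fo H ?x"]
        E.cod_Mod_lcomp[of ?A ?B ?L "fo H ?x"] E.src_Mod_lcomp[of ?A ?B ?L "fo H ?x"]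
        E.tgt_Mod_lcomp[of ?A ?B ?L "fo H ?x"] E.cell_Mod_lcomp[of ?A ?B ?L "fo H ?x"]
      by (simp del: c)
  qed
  show pc: "pre_nat D E q H L ?c"
  proof (intro pre_nat.intro pre_nat_axioms.intro unitary_pair.intro mod_lax_axioms
      a.H.unitary_lax_axioms a'.K.unitary_lax_axioms)
    fix x assume "x \<in> Obj (cat0 D)"
    then show "tpro ?c (pid D x) = unit_bicell (tob ?c x)"
      by (auto intro!: bicell.equality cofun.equality)
  qed (use t D.source.obj_closed D.target.obj_closed in simp_all)
  interpret c: pre_nat D E q H L ?c by (rule pc)
  show "eps_trans D E q ?c = trans_comp D E (eps_trans D E q \<alpha>) (eps_trans D E q \<alpha>')"
  proof (rule laxtrans_eqI)
    fix f assume f [simp]: "f \<in> Arr (cat0 D)"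
    let ?x = "Dom (cat0 D) f" and ?y = "Cod (cat0 D) f"
    note [simp del] = c.tarr
    have "tarr (eps_trans D E q ?c) f = co_unit (fo H ?x) \<cdot>\<^sub>1 E.lcomp (co_mult (fo L ?y))
          (co_unit (fo H ?x) \<cdot>\<^sub>1 (cf_cell (tob \<alpha> ?x) \<cdot>\<^sub>1 bc_cell (tarr \<alpha>' f)))
          (bc_cell (tarr \<alpha> f) \<cdot>\<^sub>1 cf_cell (tob \<alpha>' ?y))"
      using t[OF f] by simp
    also have "\<dots> = E.lcomp (co_mult (fo L ?y))
          ((co_unit (fo H ?x) \<cdot>\<^sub>1 cf_cell (tob \<alpha> ?x)) \<cdot>\<^sub>1 bc_cell (tarr \<alpha>' f))
          ((co_unit (fo H ?x) \<cdot>\<^sub>1 bc_cell (tarr \<alpha> f)) \<cdot>\<^sub>1 cf_cell (tob \<alpha>' ?y))"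
      by (subst E.vcomp_lcomp) simp_all
    \<comment> \<open>The functor \<open>tob \<alpha> ?x\<close> carries the unit of
      \<open>fo H ?x\<close> to that of \<open>fo K ?x\<close>, which is the unit contained in the
      image of \<alpha>'.\<close>
    also have "co_unit (fo H ?x) \<cdot>\<^sub>1 cf_cell (tob \<alpha> ?x) = cid E (cf_arr (tob \<alpha> ?x)) \<cdot>\<^sub>1 co_unit (fo K ?x)"
      using E.cf_unit[of "tob \<alpha> ?x"] by simp
    finally show "tarr (eps_trans D E q ?c) f = tarr (trans_comp D E (eps_trans D E q \<alpha>) (eps_trans D E q \<alpha>')) f"
      using tarr_trans_comp[OF b.lax_nat_axioms b'.lax_nat_axioms f] by simp
  qed simp_all
qed

lemma
  assumes "unitary_lax D E q H"
  shows pre_nat_id: "pre_nat D E q H H (trans_id D (Mod E q) H)"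
    and eps_trans_id: "eps_trans D E q (trans_id D (Mod E q) H) = trans_id D E (eps_fun D E q H)"
proof -
  interpret H: unitary_lax D E q H by fact
  let ?i = "trans_id D (Mod E q) H"
  have i [simp]: "tdom ?i = H" "tcod ?i = H" "restrict_laxtrans D ?i = ?i"
    "\<And>x. x \<in> Obj (cat0 D) \<Longrightarrow> tob ?i x = cofun_id E (fo H x)"
    "\<And>m. m \<in> Obj (cat1 D) \<Longrightarrow> tpro ?i m = bicell_id E (fp H m)"
    "\<And>f. f \<in> Arr (cat0 D) \<Longrightarrow> tarr ?i f = unit_bicell (fa H f)"
    by (simp_all add: trans_id_def) (simp_all add: restrict_laxtrans_def)
  show p: "pre_nat D E q H H ?i"
  proof (intro pre_nat.intro pre_nat_axioms.intro unitary_pair.intro mod_lax_axioms assms)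
    fix x assume "x \<in> Obj (cat0 D)"
    then show "tpro ?i (pid D x) = unit_bicell (tob ?i x)"
      by (auto intro!: bicell.equality)
  qed (use D.source.obj_closed D.target.obj_closed in simp_all)
  interpret i: pre_nat D E q H H ?i by (rule p)
  show "eps_trans D E q ?i = trans_id D E (eps_fun D E q H)"
  proof (rule laxtrans_eqI)
    show "restrict_laxtrans D (trans_id D E (eps_fun D E q H)) = trans_id D E (eps_fun D E q H)"
      by (simp add: trans_id_def)
  next
    fix f assume f: "f \<in> Arr (cat0 D)"
    then show "tarr (eps_trans D E q ?i) f = tarr (trans_id D E (eps_fun D E q H)) f"
      using E.cf_unit[of "fa H f"] by simp
  qed simp_all
qed

text \<open>The components of \<beta> at identity proarrows become functors and those at proarrows
  become equivariant cells. The arrow components are extended by \<open>bicell_from_unit\<close>,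
  and \<open>unit_comp_lcomp\<close> restricts the extension back to \<beta>.\<close>

lemma
  assumes \<beta>: "lax_trans D E \<beta>"
  shows pre_nat_bar: "pre_nat D E q (bar_fun D E q (tdom \<beta>)) (bar_fun D E q (tcod \<beta>)) (bar_trans D E q \<beta>)"
    and eps_bar_trans: "eps_trans D E q (bar_trans D E q \<beta>) = \<beta>"
proof -
  define F G where "F = tdom \<beta>" and "G = tcod \<beta>"
  interpret b: lax_nat D E F G \<beta>
    using lax_natI[OF \<beta>] by (simp add: F_def G_def)
  interpret F: lax_bar D E q F
    by (intro lax_bar.intro mod_lax_axioms b.F.lax_fun_axioms)
  interpret G: lax_bar D E q G
    by (intro lax_bar.intro mod_lax_axioms b.G.lax_fun_axioms)
  let ?\<alpha> = "bar_trans D E q \<beta>"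
  have t [simp]: "tdom ?\<alpha> = bar_fun D E q F" "tcod ?\<alpha> = bar_fun D E q G" "restrict_laxtrans D ?\<alpha> = ?\<alpha>"
    "\<And>x. x \<in> Obj (cat0 D) \<Longrightarrow> tob ?\<alpha> x = bar_tob D E \<beta> x"
    "\<And>m. m \<in> Obj (cat1 D) \<Longrightarrow> tpro ?\<alpha> m = bar_tpro D E \<beta> m"
    "\<And>f. f \<in> Arr (cat0 D) \<Longrightarrow> tarr ?\<alpha> f = bar_tarr D E \<beta> f"
    by (simp_all add: bar_trans_def) (simp_all add: restrict_laxtrans_def)
  have tob [simp]: "cf_dom (bar_tob D E \<beta> x) = F.ob x" "cf_cod (bar_tob D E \<beta> x) = G.ob x"
    "cf_arr (bar_tob D E \<beta> x) = tob \<beta> x" "cf_cell (bar_tob D E \<beta> x) = tpro \<beta> (pid D x)" for x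
    by (simp_all add: bar_tob_def)
  have tpro [simp]: "bc_dom (bar_tpro D E \<beta> m) = F.pro m" "bc_cod (bar_tpro D E \<beta> m) = G.pro m"
    "bc_src (bar_tpro D E \<beta> m) = bar_tob D E \<beta> (psrc D m)" "bc_tgt (bar_tpro D E \<beta> m) = bar_tob D E \<beta> (ptgt D m)"
    "bc_cell (bar_tpro D E \<beta> m) = tpro \<beta> m" for m
    by (simp_all add: bar_tpro_def)
  have c1 [simp]: "is_cofun E (bar_tob D E \<beta> x)" if "x \<in> Obj (cat0 D)" for x
    by (rule E.is_cofunI) (use that b.tpro_M[of x] b.tpro_un[of x] in simp_all)
  have c2 [simp]: "is_bicell E (bar_tpro D E \<beta> m)" if "m \<in> Obj (cat1 D)" for m
  proof -
    have "psrc D m \<in> Obj (cat0 D)" "ptgt D m \<in> Obj (cat0 D)"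
      using that D.source.obj_closed[of m] D.target.obj_closed[of m] by simp_all
    then show ?thesis
      using that b.tpro_L[of m "psrc D m"] b.tpro_R[of m "ptgt D m"]
      by (intro E.is_bicellI) simp_all
  qed
  have c3: "is_bicell E (bar_tarr D E \<beta> f) \<and> bc_dom (bar_tarr D E \<beta> f) = unit_bimod (F.ob (Dom (cat0 D) f))
      \<and> bc_cod (bar_tarr D E \<beta> f) = unit_bimod (G.ob (Cod (cat0 D) f))
      \<and> bc_src (bar_tarr D E \<beta> f) = cofun_comp E (bar_tob D E \<beta> (Dom (cat0 D) f)) (G.arr f)
      \<and> bc_tgt (bar_tarr D E \<beta> f) = cofun_comp E (F.arr f) (bar_tob D E \<beta> (Cod (cat0 D) f))
      \<and> un F (Dom (cat0 D) f) \<cdot>\<^sub>1 bc_cell (bar_tarr D E \<beta> f) = tarr \<beta> f"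
    if f [simp]: "f \<in> Arr (cat0 D)" for f
  proof -
    let ?x = "Dom (cat0 D) f" and ?y = "Cod (cat0 D) f"
    let ?\<Phi> = "cofun_comp E (bar_tob D E \<beta> ?x) (G.arr f)" and ?\<Psi> = "cofun_comp E (F.arr f) (bar_tob D E \<beta> ?y)"
      and ?N = "unit_bimod (G.ob ?y)"
    have eq: "bar_tarr D E \<beta> f = \<lparr>bc_dom = unit_bimod (F.ob ?x), bc_cod = ?N, bc_src = ?\<Phi>, bc_tgt = ?\<Psi>,
      bc_cell = E.lcomp (bm_ract ?N) (tarr \<beta> f) (cf_cell ?\<Psi>)\<rparr>"
      by (simp add: bar_tarr_def Let_def E.lcomp_def)
    \<comment> \<open>At the external identity on \<open>f\<close>, the naturality axiom compares
      the two ways of combining \<open>tarr \<beta> f\<close> with components at identity proarrows;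
      this is the hypothesis \<open>balanced\<close> for the extension.\<close>
    have "cid D f \<in> Cells D (pid D ?x) (pid D ?y) f f"
      by (rule D.CellsI) simp_all
    from b.cell_cond[OF this]
    have bal: "E.lcomp (bm_ract ?N) (tarr \<beta> f) (cf_cell ?\<Psi>) = E.rcomp (bm_lact ?N) (cf_cell ?\<Phi>) (tarr \<beta> f)"
      by (simp add: b.G.L_pid b.G.R_pid)
    have "is_bicell E (bar_tarr D E \<beta> f)"
      unfolding eq by (rule E.bicell_from_unit) (use bal in simp_all)
    moreover have "co_unit (F.ob ?x) \<cdot>\<^sub>1 E.lcomp (bm_ract ?N) (tarr \<beta> f) (cf_cell ?\<Psi>) = tarr \<beta> f"
      by (rule E.unit_comp_lcomp[of ?\<Phi>]) (use bal in simp_all)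
    ultimately show ?thesis
      unfolding eq by simp
  qed
  show p: "pre_nat D E q (bar_fun D E q (tdom \<beta>)) (bar_fun D E q (tcod \<beta>)) ?\<alpha>"
    unfolding F_def[symmetric] G_def[symmetric]
  proof (intro pre_nat.intro pre_nat_axioms.intro unitary_pair.intro mod_lax_axioms
      F.unitary_lax_bar G.unitary_lax_bar)
    fix x assume "x \<in> Obj (cat0 D)"
    then show "tpro ?\<alpha> (pid D x) = unit_bicell (tob ?\<alpha> x)"
      by (auto intro!: bicell.equality)
  qed (use c3 D.source.obj_closed D.target.obj_closed in simp_all)
  interpret a: pre_nat D E q "bar_fun D E q F" "bar_fun D E q G" ?\<alpha>
    using p unfolding F_def[symmetric] G_def[symmetric] .
  show "eps_trans D E q ?\<alpha> = \<beta>"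
  proof (rule laxtrans_eqI)
    show "restrict_laxtrans D \<beta> = \<beta>"
      by (rule lax_trans.extensional[OF \<beta>])
    show "tdom (eps_trans D E q ?\<alpha>) = tdom \<beta>" "tcod (eps_trans D E q ?\<alpha>) = tcod \<beta>"
      by (simp_all add: F.eps_bar G.eps_bar)
  next
    fix f assume "f \<in> Arr (cat0 D)"
    then show "tarr (eps_trans D E q ?\<alpha>) f = tarr \<beta> f"
      using c3[of f] by simp
  qed simp_all
qed

end


section \<open>The two categories and the mutually inverse functors\<close>

context mod_lax
begin

abbreviation "U \<equiv> Lax_unitary D (Mod E q)"

lemma Hom_U_D: "\<alpha> \<in> Hom U F G \<Longrightarrow> \<alpha> \<in> Arr U \<and> tdom \<alpha> = F \<and> tcod \<alpha> = G"
  by (auto simp: Hom_def)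

lemma eps_arr:
  assumes "\<alpha> \<in> Arr U"
  shows "lax_trans D E (eps_trans D E q \<alpha>)"
    and "tdom (eps_trans D E q \<alpha>) = eps_fun D E q (tdom \<alpha>)"
    and "tcod (eps_trans D E q \<alpha>) = eps_fun D E q (tcod \<alpha>)"
    and "bar_trans D E q (eps_trans D E q \<alpha>) = \<alpha>"
    and "pre_nat D E q (tdom \<alpha>) (tcod \<alpha>) \<alpha>"
    and "tdom \<alpha> \<in> Obj U" "tcod \<alpha> \<in> Obj U"
proof -
  have \<alpha>: "lax_trans D (Mod E q) \<alpha>" "unitary D (Mod E q) (tdom \<alpha>)" "unitary D (Mod E q) (tcod \<alpha>)"
    using assms by simp_all
  show p: "pre_nat D E q (tdom \<alpha>) (tcod \<alpha>) \<alpha>"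
    by (rule pre_natI[OF \<alpha>])
  show "lax_trans D E (eps_trans D E q \<alpha>)"
    using lax_trans_eps_iff[OF p] \<alpha> by simp
  show "tdom (eps_trans D E q \<alpha>) = eps_fun D E q (tdom \<alpha>)"
    "tcod (eps_trans D E q \<alpha>) = eps_fun D E q (tcod \<alpha>)"
    by (simp_all add: eps_trans_def restrict_laxtrans_def)
  show "bar_trans D E q (eps_trans D E q \<alpha>) = \<alpha>"
    by (rule pre_nat.bar_eps_trans[OF p])
  show "tdom \<alpha> \<in> Obj U" "tcod \<alpha> \<in> Obj U"
    using \<alpha> lax_trans.lax_dom[OF \<alpha>(1)] lax_trans.lax_cod[OF \<alpha>(1)] by simp_all
qed

lemma eps_arr_inject:
  "\<lbrakk>\<alpha> \<in> Arr U; \<alpha>' \<in> Arr U; eps_trans D E q \<alpha> = eps_trans D E q \<alpha>'\<rbrakk> \<Longrightarrow> \<alpha> = \<alpha>'"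
  by (metis eps_arr(4))

lemma eps_obj:
  assumes "H \<in> Obj U"
  shows "lax_functor D E (eps_fun D E q H)" "bar_fun D E q (eps_fun D E q H) = H"
    and "trans_id D (Mod E q) H \<in> Arr U"
    and "eps_trans D E q (trans_id D (Mod E q) H) = trans_id D E (eps_fun D E q H)"
proof -
  have H: "unitary_lax D E q H"
    using assms unitary_laxI by simp
  show L: "lax_functor D E (eps_fun D E q H)" "bar_fun D E q (eps_fun D E q H) = H"
    by (rule unitary_lax.lax_functor_eps[OF H] unitary_lax.bar_eps[OF H])+
  show e: "eps_trans D E q (trans_id D (Mod E q) H) = trans_id D E (eps_fun D E q H)"
    by (rule eps_trans_id[OF H])
  \<comment> \<open>The axioms for the identity are reflected from its image, which is the identity
    on \<epsilon>H.\<close>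
  have "lax_trans D (Mod E q) (trans_id D (Mod E q) H)"
    using lax_trans_eps_iff[OF pre_nat_id[OF H]] e lax_trans_id[OF L(1)] by simp
  then show "trans_id D (Mod E q) H \<in> Arr U"
    using assms by (simp add: trans_id_def restrict_laxtrans_def)
qed

text \<open>The image of the composite is identified before the composite is known to be a
  transformation. It then inherits its axioms from that image, a composite in
  \<open>Lax D E\<close>.\<close>

lemma eps_comp:
  assumes \<alpha>: "\<alpha> \<in> Arr U" "\<alpha>' \<in> Arr U" "tcod \<alpha> = tdom \<alpha>'"
  shows "trans_comp D (Mod E q) \<alpha> \<alpha>' \<in> Arr U"
    and "eps_trans D E q (trans_comp D (Mod E q) \<alpha> \<alpha>')
      = trans_comp D E (eps_trans D E q \<alpha>) (eps_trans D E q \<alpha>')"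
proof -
  note p = eps_arr(5)[OF \<alpha>(1)] eps_arr(5)[OF \<alpha>(2), folded \<alpha>(3)] eps_arr(1)[OF \<alpha>(1)] eps_arr(1)[OF \<alpha>(2)]
  show e: "eps_trans D E q (trans_comp D (Mod E q) \<alpha> \<alpha>')
      = trans_comp D E (eps_trans D E q \<alpha>) (eps_trans D E q \<alpha>')"
    by (rule eps_trans_comp[OF p])
  have "lax_trans D E (trans_comp D E (eps_trans D E q \<alpha>) (eps_trans D E q \<alpha>'))"
    by (rule lax_trans_comp[OF p(3,4)]) (simp add: eps_arr(3)[OF \<alpha>(1)] eps_arr(2)[OF \<alpha>(2)] \<alpha>(3))
  then have "lax_trans D (Mod E q) (trans_comp D (Mod E q) \<alpha> \<alpha>')"
    using lax_trans_eps_iff[OF pre_nat_comp[OF p]] e by simp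
  then show "trans_comp D (Mod E q) \<alpha> \<alpha>' \<in> Arr U"
    using \<alpha> by (simp add: trans_comp_def restrict_laxtrans_def)
qed

text \<open>
  Composites of transformations into \<open>Mod E q\<close> are reflected by the injective, composition-preserving
  map to \<open>Lax D E\<close>, so the coherence axioms of the double category \<open>Mod E q\<close> are never needed.
\<close>

lemma category_Lax_unitary: "category U"
proof -
  interpret C: category "Lax D E" by (rule category_Lax)
  have eps: "eps_trans D E q \<alpha> \<in> Hom (Lax D E) (eps_fun D E q F) (eps_fun D E q G)"
    if "\<alpha> \<in> Hom U F G" for \<alpha> F G
  proof -
    have "\<alpha> \<in> Arr U" "tdom \<alpha> = F" "tcod \<alpha> = G" using Hom_U_D[OF that] by blast+
    then show ?thesis using eps_arr(1-3)[of \<alpha>] by (simp add: Hom_def)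
  qed
  have dom: "\<alpha> \<in> Arr U" "tdom \<alpha> = F" "tcod \<alpha> = G" if "\<alpha> \<in> Hom U F G" for \<alpha> F G
    using Hom_U_D[OF that] by blast+
  have comp: "trans_comp D (Mod E q) \<alpha> \<beta> \<in> Hom U F H" if "\<alpha> \<in> Hom U F G" "\<beta> \<in> Hom U G H" for \<alpha> \<beta> F G H
    using eps_comp(1)[of \<alpha> \<beta>] dom[OF that(1)] dom[OF that(2)]
    by (simp add: Hom_def) (simp add: trans_comp_def restrict_laxtrans_def)
  have comp': "eps_trans D E q (trans_comp D (Mod E q) \<alpha> \<beta>)
      = trans_comp D E (eps_trans D E q \<alpha>) (eps_trans D E q \<beta>)"
    if "\<alpha> \<in> Hom U F G" "\<beta> \<in> Hom U G H" for \<alpha> \<beta> F G H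
    by (rule eps_comp(2)) (use dom[OF that(1)] dom[OF that(2)] in simp_all)
  have id: "trans_id D (Mod E q) F \<in> Hom U F F" if "F \<in> Obj U" for F
    using eps_obj(3)[OF that] by (simp add: Hom_def) (simp add: trans_id_def restrict_laxtrans_def)
  have obj: "F \<in> Obj U" "G \<in> Obj U" if "\<alpha> \<in> Hom U F G" for \<alpha> F G
    using eps_arr(6,7)[OF dom(1)[OF that]] dom[OF that] by simp_all
  show ?thesis
  proof
    fix \<alpha> assume "\<alpha> \<in> Arr U"
    then show "Dom U \<alpha> \<in> Obj U" "Cod U \<alpha> \<in> Obj U"
      using eps_arr(6,7)[of \<alpha>] by simp_all
  next
    fix F assume "F \<in> Obj U"
    then show "cat.Id U F \<in> Hom U F F" using id by simp
  next
    fix \<alpha> \<beta> F G H assume "\<alpha> \<in> Hom U F G" "\<beta> \<in> Hom U G H"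
    then show "\<alpha> \<cdot>\<^bsub>U\<^esub> \<beta> \<in> Hom U F H" using comp by simp
  next
    fix \<alpha> F G assume \<alpha>: "\<alpha> \<in> Hom U F G"
    note F = obj(1)[OF \<alpha>] and G = obj(2)[OF \<alpha>]
    have "trans_comp D (Mod E q) (trans_id D (Mod E q) F) \<alpha> = \<alpha>"
      using C.id_left[OF eps[OF \<alpha>]] comp'[OF id[OF F] \<alpha>] eps_obj(4)[OF F]
      by (intro eps_arr_inject dom(1)[OF comp[OF id[OF F] \<alpha>]] dom(1)[OF \<alpha>]) simp
    then show "cat.Id U F \<cdot>\<^bsub>U\<^esub> \<alpha> = \<alpha>" by simp
    have "trans_comp D (Mod E q) \<alpha> (trans_id D (Mod E q) G) = \<alpha>"
      using C.id_right[OF eps[OF \<alpha>]] comp'[OF \<alpha> id[OF G]] eps_obj(4)[OF G]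
      by (intro eps_arr_inject dom(1)[OF comp[OF \<alpha> id[OF G]]] dom(1)[OF \<alpha>]) simp
    then show "\<alpha> \<cdot>\<^bsub>U\<^esub> cat.Id U G = \<alpha>" by simp
  next
    fix \<alpha> \<beta> \<gamma> F G H K assume h: "\<alpha> \<in> Hom U F G" "\<beta> \<in> Hom U G H" "\<gamma> \<in> Hom U H K"
    note ab = comp[OF h(1,2)] and bc = comp[OF h(2,3)]
    have "trans_comp D (Mod E q) (trans_comp D (Mod E q) \<alpha> \<beta>) \<gamma>
        = trans_comp D (Mod E q) \<alpha> (trans_comp D (Mod E q) \<beta> \<gamma>)"
      using C.comp_assoc[OF eps[OF h(1)] eps[OF h(2)] eps[OF h(3)]]
        comp'[OF h(1,2)] comp'[OF h(2,3)] comp'[OF ab h(3)] comp'[OF h(1) bc]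
      by (intro eps_arr_inject dom(1)[OF comp[OF ab h(3)]] dom(1)[OF comp[OF h(1) bc]]) simp
    then show "\<alpha> \<cdot>\<^bsub>U\<^esub> \<beta> \<cdot>\<^bsub>U\<^esub> \<gamma> = \<alpha> \<cdot>\<^bsub>U\<^esub> (\<beta> \<cdot>\<^bsub>U\<^esub> \<gamma>)" by simp
  qed
qed

lemma bar_obj:
  assumes "lax_functor D E F"
  shows "bar_fun D E q F \<in> Obj U" "eps_fun D E q (bar_fun D E q F) = F"
proof -
  have F: "lax_bar D E q F"
    using lax_funI[OF assms] by (intro lax_bar.intro mod_lax_axioms)
  show "bar_fun D E q F \<in> Obj U" "eps_fun D E q (bar_fun D E q F) = F"
    using lax_bar.lax_functor_bar[OF F] lax_bar.unitary_bar[OF F] lax_bar.eps_bar[OF F] by simp_all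
qed

lemma bar_arr:
  assumes \<beta>: "lax_trans D E \<beta>"
  shows "bar_trans D E q \<beta> \<in> Hom U (bar_fun D E q (tdom \<beta>)) (bar_fun D E q (tcod \<beta>))"
proof -
  have "lax_trans D (Mod E q) (bar_trans D E q \<beta>)"
    using lax_trans_eps_iff[OF pre_nat_bar[OF \<beta>]] eps_bar_trans[OF \<beta>] \<beta> by simp
  moreover have "tdom (bar_trans D E q \<beta>) = bar_fun D E q (tdom \<beta>)"
    "tcod (bar_trans D E q \<beta>) = bar_fun D E q (tcod \<beta>)"
    by (simp_all add: bar_trans_def restrict_laxtrans_def)
  moreover have "bar_fun D E q (tdom \<beta>) \<in> Obj U" "bar_fun D E q (tcod \<beta>) \<in> Obj U"
    by (rule bar_obj(1)[OF lax_trans.lax_dom[OF \<beta>]] bar_obj(1)[OF lax_trans.lax_cod[OF \<beta>]])+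
  ultimately show ?thesis
    by (simp add: Hom_def)
qed

text \<open>Functoriality of the inverse is inherited: the bar of an identity or a composite and the
  expected arrow have the same image in \<open>Lax D E\<close>, and \<open>eps_arr_inject\<close>
  makes them equal.\<close>

lemma inverse_functors_eps_bar:
  "inverse_functors U (Lax D E) (eps_fun D E q) (eps_trans D E q) (bar_fun D E q) (bar_trans D E q)"
proof -
  have 1: "cat_functor U (Lax D E) (eps_fun D E q) (eps_trans D E q)"
  proof (intro cat_functor.intro cat_functor_axioms.intro category_Lax_unitary category_Lax)
    fix H assume H: "H \<in> Obj U"
    then show "eps_fun D E q H \<in> Obj (Lax D E)"
      using eps_obj(1)[OF H] by simp
    show "eps_trans D E q (cat.Id U H) = cat.Id (Lax D E) (eps_fun D E q H)"
      using eps_obj(4)[OF H] by simp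
  next
    fix \<alpha> H K assume "\<alpha> \<in> Hom U H K"
    then have "\<alpha> \<in> Arr U" "tdom \<alpha> = H" "tcod \<alpha> = K" using Hom_U_D by blast+
    then show "eps_trans D E q \<alpha> \<in> Hom (Lax D E) (eps_fun D E q H) (eps_fun D E q K)"
      using eps_arr(1-3)[of \<alpha>] by (simp add: Hom_def)
  next
    fix \<alpha> \<beta> F G H assume "\<alpha> \<in> Hom U F G" "\<beta> \<in> Hom U G H"
    then have "\<alpha> \<in> Arr U" "\<beta> \<in> Arr U" "tcod \<alpha> = tdom \<beta>" using Hom_U_D by blast+
    then show "eps_trans D E q (\<alpha> \<cdot>\<^bsub>U\<^esub> \<beta>) = eps_trans D E q \<alpha> \<cdot>\<^bsub>Lax D E\<^esub> eps_trans D E q \<beta>"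
      using eps_comp(2)[of \<alpha> \<beta>] by simp
  qed
  interpret e: cat_functor U "Lax D E" "eps_fun D E q" "eps_trans D E q" by (rule 1)
  have 2: "cat_functor (Lax D E) U (bar_fun D E q) (bar_trans D E q)"
  proof (intro cat_functor.intro cat_functor_axioms.intro category_Lax_unitary category_Lax)
    fix F assume "F \<in> Obj (Lax D E)"
    then have F: "lax_functor D E F" by simp
    note B = bar_obj[OF F]
    show "bar_fun D E q F \<in> Obj U" by (rule B)
    have i: "lax_trans D E (trans_id D E F)"
      by (rule lax_trans_id[OF F])
    have "bar_trans D E q (trans_id D E F) \<in> Arr U"
      using Hom_U_D[OF bar_arr[OF i]] by blast
    moreover have "eps_trans D E q (bar_trans D E q (trans_id D E F)) = trans_id D E F"
      by (rule eps_bar_trans[OF i])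
    \<comment> \<open>Both arrows have the identity on \<open>F\<close> as image, because \<epsilon>
      of the bar of \<open>F\<close> is \<open>F\<close> again.\<close>
    ultimately have "bar_trans D E q (trans_id D E F) = trans_id D (Mod E q) (bar_fun D E q F)"
      using eps_obj(3,4)[OF B(1)] B(2) by (intro eps_arr_inject) simp_all
    then show "bar_trans D E q (cat.Id (Lax D E) F) = cat.Id U (bar_fun D E q F)"
      by simp
  next
    fix \<beta> F G assume "\<beta> \<in> Hom (Lax D E) F G"
    then show "bar_trans D E q \<beta> \<in> Hom U (bar_fun D E q F) (bar_fun D E q G)"
      using bar_arr[of \<beta>] by (auto simp: Hom_def)
  next
    fix \<beta> \<gamma> F G H assume "\<beta> \<in> Hom (Lax D E) F G" "\<gamma> \<in> Hom (Lax D E) G H"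
    then have bg: "lax_trans D E \<beta>" "lax_trans D E \<gamma>" "tcod \<beta> = tdom \<gamma>"
      by (simp_all add: Hom_def)
    note c = lax_trans_comp[OF bg]
    have h: "bar_trans D E q \<beta> \<in> Arr U" "bar_trans D E q \<gamma> \<in> Arr U"
      "tcod (bar_trans D E q \<beta>) = tdom (bar_trans D E q \<gamma>)"
      using Hom_U_D[OF bar_arr[OF bg(1)]] Hom_U_D[OF bar_arr[OF bg(2)]] bg(3) by metis+
    have "bar_trans D E q (trans_comp D E \<beta> \<gamma>) \<in> Arr U"
      using Hom_U_D[OF bar_arr[OF c]] by blast
    then have "bar_trans D E q (trans_comp D E \<beta> \<gamma>)
        = trans_comp D (Mod E q) (bar_trans D E q \<beta>) (bar_trans D E q \<gamma>)"
      by (rule eps_arr_inject[OF _ eps_comp(1)[OF h]])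
        (simp add: eps_bar_trans[OF c] eps_comp(2)[OF h] eps_bar_trans[OF bg(1)] eps_bar_trans[OF bg(2)])
    then show "bar_trans D E q (\<beta> \<cdot>\<^bsub>Lax D E\<^esub> \<gamma>) = bar_trans D E q \<beta> \<cdot>\<^bsub>U\<^esub> bar_trans D E q \<gamma>"
      by simp
  qed
  show ?thesis
  proof (intro inverse_functors.intro inverse_functors_axioms.intro 1 2)
    show "bar_fun D E q (eps_fun D E q H) = H" if "H \<in> Obj U" for H
      by (rule eps_obj(2)[OF that])
    show "bar_trans D E q (eps_trans D E q \<alpha>) = \<alpha>" if "\<alpha> \<in> Arr U" for \<alpha>
      by (rule eps_arr(4)[OF that])
    show "eps_fun D E q (bar_fun D E q F) = F" if "F \<in> Obj (Lax D E)" for F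
      using bar_obj(2)[of F] that by simp
    show "eps_trans D E q (bar_trans D E q \<beta>) = \<beta>" if "\<beta> \<in> Arr (Lax D E)" for \<beta>
      using eps_bar_trans[of \<beta>] that by simp
  qed
qed

end

theorem proposition7p8:
  fixes D :: "('o, 'a, 'p, 'c) dbl"
    and E :: "('o2, 'a2, 'p2, 'c2) dbl"
    and q :: "('o2, 'p2, 'c2) bimod \<Rightarrow> ('o2, 'p2, 'c2) bimod \<Rightarrow> 'c2"
  assumes "double_category D"
    and "equipment E"
    and "local_coequalizers E"
    and "tensor_choice E q"
  shows "inverse_functors (Lax_unitary D (Mod E q)) (Lax D E)
           (eps_fun D E q) (eps_trans D E q) (bar_fun D E q) (bar_trans D E q)
       \<and> iso_of_categories (Lax_unitary D (Mod E q)) (Lax D E) (eps_fun D E q) (eps_trans D E q)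
       \<and> bij_betw (eps_fun D E q)
           {H. lax_functor D (Mod E q) H \<and> unitary D (Mod E q) H} {F. lax_functor D E F}
       \<and> bij_betw (bar_fun D E q)
           {F. lax_functor D E F} {H. lax_functor D (Mod E q) H \<and> unitary D (Mod E q) H}"
proof -
  interpret mod_lax D E q
    using assms by (simp add: mod_lax_def mod_setup_def mod_setup_axioms_def)
  have inv: "inverse_functors U (Lax D E) (eps_fun D E q) (eps_trans D E q) (bar_fun D E q) (bar_trans D E q)"
    by (rule inverse_functors_eps_bar)
  moreover have "iso_of_categories U (Lax D E) (eps_fun D E q) (eps_trans D E q)"
    unfolding iso_of_categories_def using inv by blast
  moreover have "bij_betw (eps_fun D E q) (Obj U) (Obj (Lax D E))"
    by (rule bij_betw_byWitness[where f' = "bar_fun D E q"])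
      (use eps_obj(1,2) bar_obj in auto)
  moreover have "bij_betw (bar_fun D E q) (Obj (Lax D E)) (Obj U)"
    by (rule bij_betw_byWitness[where f' = "eps_fun D E q"])
      (use eps_obj(1,2) bar_obj in auto)
  ultimately show ?thesis by simp
qed

end
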